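(* Let $n\in\{2,3\}$ and $b\in\mathbb{C}$ with $\operatorname{Im} b>0$. Let $\Omega,\Omega_r\subset\mathbb{R}^n$ be bounded domains with boundaries $\partial\Omega,\partial\Omega_r$ of class $C^2$, and let $\Gamma$ be a smooth closed hypersurface lying within both $\Omega$ and $\Omega_r$. Let $f$ be a continuous function defined on $\Omega\cup\Omega_r$. Assume there exists a transformation from $\Omega$ to $\Omega_r$ of the form $\tau_r(x)=x+r(x)$, and assume that $\tau_r$ is a bijection with $r\in C^2$. For $O=\Omega$ and $O=\Omega_r$ let $u_O$ be the solution of $$\Delta u+b^2u=f|_O\ \text{ in } O\setminus\Gamma,\qquad u|_{\partial O}=0,\qquad [u]|_\Gamma=0,\qquad \Big[\frac{\partial u}{\partial\mathbf n}\Big]\Big|_\Gamma=0,$$ and let $\hat u_O$ be its extension by zero to a cube $[s,t]^n$ containing $\Omega$ and $\Omega_r$. Then for any $\varepsilon>0$ there exists $\delta>0$ such that if $\|r\|_{C^2}<\delta$, then $$\|\hat u_{\Omega}-\hat u_{\Omega_r}\|_{2}<\varepsilon .$$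
   Context: $\mathbf n$ is the unit normal on $\Gamma$ pointing from the inside to the outside of $\Gamma$, and $[v]|_\Gamma$ is the jump of $v$ across $\Gamma$. $\|\cdot\|_2$ is the $L^2$ norm on $[s,t]^n$. The only data that change between the two problems are the domain and the restriction of $f$ to it. The boundary data and both interface jump data are zero in both problems, and $b$ and $\Gamma$ are the same. The statement expresses continuity of the solution operator (domain, interface, data) $\mapsto\hat u$ with respect to the domain.
   Formalization: The function f is additionally assumed square integrable on the cube [s,t]^n (automatic if f is bounded); for merely continuous f, unbounded near a boundary point of Ω, no single δ need work for all Ω_r. *)

theory Defs
  imports "HOL-Analysis.Analysis"
begin

section \<open>Functions of class C^k on open sets\<close>

definition partial_deriv ::
  "'a::euclidean_space \<Rightarrow> ('a \<Rightarrow> 'b::real_normed_vector) \<Rightarrow> 'a \<Rightarrow> 'b" where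
  "partial_deriv i f x = frechet_derivative f (at x) i"

text \<open>Derivatives are taken in the full space, so this is only meant for open \<open>S\<close>.\<close>

fun Ck_on :: "nat \<Rightarrow> 'a::euclidean_space set \<Rightarrow> ('a \<Rightarrow> 'b::real_normed_vector) \<Rightarrow> bool" where
  "Ck_on 0 S f \<longleftrightarrow> continuous_on S f"
| "Ck_on (Suc k) S f \<longleftrightarrow>
     (\<forall>x\<in>S. f differentiable (at x)) \<and> (\<forall>i\<in>Basis. Ck_on k S (partial_deriv i f))"

definition smooth_on :: "'a::euclidean_space set \<Rightarrow> ('a \<Rightarrow> 'b::real_normed_vector) \<Rightarrow> bool" where
  "smooth_on S f \<longleftrightarrow> (\<forall>k. Ck_on k S f)"

text \<open>The norm takes values in \<open>[0,\<infinity>]\<close>, so that unbounded derivatives are not assigned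
  an arbitrary real supremum.\<close>

definition C2_norm :: "'a::euclidean_space set \<Rightarrow> ('a \<Rightarrow> 'b::real_normed_vector) \<Rightarrow> ennreal" where
  "C2_norm S r =
     (SUP x\<in>S. ennreal (norm (r x)))
     + (\<Sum>i\<in>Basis. SUP x\<in>S. ennreal (norm (partial_deriv i r x)))
     + (\<Sum>i\<in>Basis. \<Sum>j\<in>Basis. SUP x\<in>S. ennreal (norm (partial_deriv j (partial_deriv i r) x)))"

definition laplacian :: "('a::euclidean_space \<Rightarrow> 'b::real_normed_vector) \<Rightarrow> 'a \<Rightarrow> 'b" where
  "laplacian f x = (\<Sum>i\<in>Basis. partial_deriv i (partial_deriv i f) x)"


section \<open>Domains and hypersurfaces\<close>

definition regular_on :: "'a::euclidean_space set \<Rightarrow> ('a \<Rightarrow> real) \<Rightarrow> bool" where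
  "regular_on U \<rho> \<longleftrightarrow> (\<forall>x\<in>U. \<exists>v. frechet_derivative \<rho> (at x) v \<noteq> 0)"

text \<open>The open set \<open>D\<close> has boundary of class \<open>C\<^sup>2\<close>: near each boundary point it lies on one
  side of a regular level set of a \<open>C\<^sup>2\<close> function.\<close>

definition C2_boundary :: "'a::euclidean_space set \<Rightarrow> bool" where
  "C2_boundary D \<longleftrightarrow>
     (\<forall>p\<in>frontier D. \<exists>U \<rho>. open U \<and> p \<in> U \<and> Ck_on 2 U \<rho> \<and> regular_on U \<rho> \<and>
        D \<inter> U = {x\<in>U. \<rho> x < 0})"

definition bounded_C2_domain :: "'a::euclidean_space set \<Rightarrow> bool" where
  "bounded_C2_domain D \<longleftrightarrow>
     open D \<and> connected D \<and> D \<noteq> {} \<and> bounded D \<and> C2_boundary D"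

definition defining_function ::
  "'a::euclidean_space set \<Rightarrow> 'a \<Rightarrow> 'a set \<Rightarrow> ('a \<Rightarrow> real) \<Rightarrow> bool" where
  "defining_function \<Gamma> p U \<rho> \<longleftrightarrow>
     open U \<and> p \<in> U \<and> smooth_on U \<rho> \<and> regular_on U \<rho> \<and> \<Gamma> \<inter> U = {x\<in>U. \<rho> x = 0}"

text \<open>``Closed'' as for closed manifolds: compact and without boundary.\<close>

definition smooth_closed_hypersurface :: "'a::euclidean_space set \<Rightarrow> bool" where
  "smooth_closed_hypersurface \<Gamma> \<longleftrightarrow>
     compact \<Gamma> \<and> (\<forall>p\<in>\<Gamma>. \<exists>U \<rho>. defining_function \<Gamma> p U \<rho>)"

text \<open>The tangent space at \<open>p\<close> is the kernel of the derivative of a defining function.\<close>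

definition outward_unit_normal :: "'a::euclidean_space set \<Rightarrow> 'a \<Rightarrow> 'a \<Rightarrow> bool" where
  "outward_unit_normal \<Gamma> p \<nu> \<longleftrightarrow>
     norm \<nu> = 1 \<and>
     (\<exists>U \<rho>. defining_function \<Gamma> p U \<rho> \<and>
        (\<forall>v. frechet_derivative \<rho> (at p) v = 0 \<longrightarrow> \<nu> \<bullet> v = 0)) \<and>
     (\<forall>\<^sub>F h in at_right (0::real). p - h *\<^sub>R \<nu> \<in> inside \<Gamma> \<and> p + h *\<^sub>R \<nu> \<in> outside \<Gamma>)"


section \<open>The interface problem\<close>

definition has_traces ::
  "'a::euclidean_space set \<Rightarrow> ('a \<Rightarrow> 'b::real_normed_vector) \<Rightarrow> bool" where
  "has_traces \<Gamma> v \<longleftrightarrow>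
     (\<forall>p\<in>\<Gamma>. (\<exists>l. (v \<longlongrightarrow> l) (at p within inside \<Gamma>)) \<and>
             (\<exists>l. (v \<longlongrightarrow> l) (at p within outside \<Gamma>)))"

definition jump ::
  "'a::euclidean_space set \<Rightarrow> ('a \<Rightarrow> 'b::real_normed_vector) \<Rightarrow> 'a \<Rightarrow> 'b" where
  "jump \<Gamma> v p = Lim (at p within outside \<Gamma>) v - Lim (at p within inside \<Gamma>) v"

definition test_function :: "'a::euclidean_space set \<Rightarrow> ('a \<Rightarrow> complex) \<Rightarrow> bool" where
  "test_function S \<phi> \<longleftrightarrow>
     smooth_on UNIV \<phi> \<and> compact (closure {x. \<phi> x \<noteq> 0}) \<and> closure {x. \<phi> x \<noteq> 0} \<subseteq> S"

text \<open>\<open>\<Delta>u + b\<^sup>2 u = f\<close> on the open set \<open>S\<close> in the sense of distributions. For merely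
  continuous \<open>f\<close> a twice differentiable solution need not exist; a \<open>C\<^sup>2\<close> function
  solving the equation pointwise is a solution in this sense.\<close>

definition helmholtz_on ::
  "complex \<Rightarrow> 'a::euclidean_space set \<Rightarrow> ('a \<Rightarrow> complex) \<Rightarrow> ('a \<Rightarrow> complex) \<Rightarrow> bool" where
  "helmholtz_on b S f u \<longleftrightarrow>
     (\<forall>\<phi>. test_function S \<phi> \<longrightarrow>
        (LINT x:S|lebesgue. u x * (laplacian \<phi> x + b\<^sup>2 * \<phi> x)) = (LINT x:S|lebesgue. f x * \<phi> x))"

text \<open>Solutions are \<open>C\<^sup>1\<close> up to \<open>\<Gamma>\<close> from either side and continuous up to the
  boundary of \<open>D\<close>. The values of \<open>u\<close> on \<open>\<Gamma>\<close> and outside \<open>D\<close> are irrelevant.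
  Jumps are formed from one-sided limits, \<open>\<nu>\<close> being a unit normal field on \<open>\<Gamma>\<close>.\<close>

definition interface_solution ::
  "complex \<Rightarrow> 'a::euclidean_space set \<Rightarrow> ('a \<Rightarrow> 'a) \<Rightarrow> ('a \<Rightarrow> complex) \<Rightarrow> 'a set \<Rightarrow>
   ('a \<Rightarrow> complex) \<Rightarrow> bool" where
  "interface_solution b \<Gamma> \<nu> f D u \<longleftrightarrow>
     Ck_on 1 (D - \<Gamma>) u \<and>
     has_traces \<Gamma> u \<and> (\<forall>i\<in>Basis. has_traces \<Gamma> (partial_deriv i u)) \<and>
     helmholtz_on b (D - \<Gamma>) f u \<and>
     (\<forall>p\<in>frontier D. (u \<longlongrightarrow> 0) (at p within D)) \<and>
     (\<forall>p\<in>\<Gamma>. jump \<Gamma> u p = 0) \<and>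
     (\<forall>p\<in>\<Gamma>. jump \<Gamma> (\<lambda>x. frechet_derivative u (at x) (\<nu> p)) p = 0)"

definition zero_extension :: "'a set \<Rightarrow> ('a \<Rightarrow> complex) \<Rightarrow> 'a \<Rightarrow> complex" where
  "zero_extension D u x = (if x \<in> D then u x else 0)"


section \<open>Square integrable functions\<close>

definition square_integrable_on :: "'a::euclidean_space set \<Rightarrow> ('a \<Rightarrow> complex) \<Rightarrow> bool" where
  "square_integrable_on S v \<longleftrightarrow>
     set_borel_measurable lebesgue S v \<and> set_integrable lebesgue S (\<lambda>x. (cmod (v x))\<^sup>2)"

definition L2_norm_on :: "'a::euclidean_space set \<Rightarrow> ('a \<Rightarrow> complex) \<Rightarrow> real" where
  "L2_norm_on S v = sqrt (LINT x:S|lebesgue. (cmod (v x))\<^sup>2)"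

end

theory Submission
  imports Defs
begin

text \<open>Since the jumps of \<open>u\<close> and of its normal derivative vanish, \<open>u\<close> extends to a \<open>C\<^sup>1\<close> function
  across \<open>\<Gamma>\<close> that satisfies the weak form of the Helmholtz equation on the whole domain: the
  interface disappears. Truncating near the zero set of \<open>u\<close> yields \<open>C\<^sup>1\<close> functions \<open>\<phi>\<close>, compactly
  supported in the domain, that are close to \<open>u\<close> in \<open>L\<^sup>2\<close> and solve the weak equation up to a small
  error with respect to the \<open>H\<^sup>1\<close> norm of the test function; this replaces the space \<open>H\<^sup>1\<^sub>0\<close>.
  As \<open>Im b > 0\<close>, the form \<open>\<integral> \<nabla>\<phi> \<cdot> \<nabla>\<psi> - b\<^sup>2 \<phi> \<psi>\<close> is coercive, so two such functions with
  close right-hand sides are close in \<open>H\<^sup>1\<close>. An approximate solution on \<open>\<Omega>r\<close>, pulled back by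
  \<open>x \<mapsto> x + r x\<close>, solves the equation on \<open>\<Omega>\<close> up to an error of the order of the
  \<open>C\<^sup>1\<close> size of \<open>r\<close> and of the \<open>L\<^sup>2\<close> distance between \<open>f\<close> and its pull-back. To keep \<open>\<delta>\<close> independent
  of the solution on \<open>\<Omega>r\<close>, the error is measured against one approximation \<open>\<phi>\<close> on \<open>\<Omega>\<close> that is
  fixed beforehand.\<close>

text \<open>The data \<open>f\<close> is merely continuous on the domains and square integrable on
  the cube, so neither second derivatives of the solution nor control of its gradient at the
  boundary is available; every comparison is between weak forms, with errors measured by the H^1
  norm of the test function. The quantifiers shape the argument: \<open>\<delta>\<close> precedes
  \<open>\<Omega>r\<close>, \<open>r\<close> and both solutions. The H^1 norm and the modulus of
  continuity of the fixed approximation may influence \<open>\<delta>\<close>, but the H^1 norm of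
  the pulled-back one may not; it is at most that of the difference plus that of the fixed one, and
  the former is absorbed by coercivity. Coercivity holds for every sign of Re b^2: the form of a
  function and its conjugate is A - b^2 B with A, B \<ge> 0, and b^2 lies off the half-line of
  nonnegative reals. As \<open>f\<close> may be unbounded near the boundary, its displacement is
  controlled by uniform continuity near a large compact subset and by the tail of |f|^2 over the
  cube, which is the same for all \<open>\<Omega>r\<close>.\<close>

section \<open>Calculus of C^k functions\<close>

lemma partial_deriv_eq:
  "(f has_derivative f') (at x) \<Longrightarrow> partial_deriv i f x = f' i"
  unfolding partial_deriv_def using frechet_derivative_at by metis

lemma frechet_derivative_eq:
  "(f has_derivative f') (at x) \<Longrightarrow> frechet_derivative f (at x) = f'"
  using frechet_derivative_at by metis

lemma has_derivative_frechet:
  "f differentiable (at x) \<Longrightarrow> (f has_derivative frechet_derivative f (at x)) (at x)"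
  by (simp add: frechet_derivative_works)

lemma linear_sum_Basis:
  fixes D :: "'a::euclidean_space \<Rightarrow> 'b::real_normed_vector"
  assumes "linear D"
  shows "D v = (\<Sum>i\<in>Basis. (v \<bullet> i) *\<^sub>R D i)"
proof -
  have "D v = D (\<Sum>i\<in>Basis. (v \<bullet> i) *\<^sub>R i)" by (simp add: euclidean_representation)
  also have "\<dots> = (\<Sum>i\<in>Basis. (v \<bullet> i) *\<^sub>R D i)"
    using assms by (simp add: linear_sum linear_scale)
  finally show ?thesis .
qed

text \<open>Reduces the derivative in any direction to the partial derivatives, the only objects
  that \<open>Ck_on\<close> speaks of.\<close>

lemma frechet_derivative_sum_partial:
  fixes f :: "'a::euclidean_space \<Rightarrow> 'b::real_normed_vector"
  assumes "f differentiable (at x)"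
  shows "frechet_derivative f (at x) v = (\<Sum>i\<in>Basis. (v \<bullet> i) *\<^sub>R partial_deriv i f x)"
  unfolding partial_deriv_def by (rule linear_sum_Basis[OF linear_frechet_derivative[OF assms]])

lemma Ck_on_1:
  "Ck_on 1 S f \<longleftrightarrow> (\<forall>x\<in>S. f differentiable (at x)) \<and> (\<forall>i\<in>Basis. continuous_on S (partial_deriv i f))"
  by simp

lemma Ck_on_1I:
  fixes f :: "'a::euclidean_space \<Rightarrow> 'b::real_normed_vector"
  assumes "\<And>x. x \<in> S \<Longrightarrow> (f has_derivative D x) (at x)"
    and "\<And>i. i \<in> Basis \<Longrightarrow> continuous_on S (\<lambda>x. D x i)"
  shows "Ck_on 1 S f"
  unfolding Ck_on_1
proof (intro conjI ballI)
  fix i :: 'a assume "i \<in> Basis"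
  have "continuous_on S (partial_deriv i f) = continuous_on S (\<lambda>x. D x i)"
    by (rule continuous_on_cong) (auto simp: partial_deriv_eq[OF assms(1)])
  with assms(2) \<open>i \<in> Basis\<close> show "continuous_on S (partial_deriv i f)" by simp
qed (use assms(1) in \<open>auto simp: differentiable_def\<close>)

lemma Ck_on_1_continuous: "Ck_on 1 S f \<Longrightarrow> continuous_on S f"
  unfolding Ck_on_1 by (simp add: continuous_at_imp_continuous_on differentiable_imp_continuous_within)

lemma Ck_on_1_continuous_frechet:
  assumes "Ck_on 1 S f"
  shows "continuous_on S (\<lambda>x. frechet_derivative f (at x) v)"
proof -
  have "continuous_on S (\<lambda>x. \<Sum>i\<in>Basis. (v \<bullet> i) *\<^sub>R partial_deriv i f x)"
    using assms unfolding Ck_on_1 by (intro continuous_intros) auto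
  then show ?thesis
  proof (rule continuous_on_eq)
    fix x assume "x \<in> S"
    then have "f differentiable (at x)" using assms unfolding Ck_on_1 by blast
    then show "(\<Sum>i\<in>Basis. (v \<bullet> i) *\<^sub>R partial_deriv i f x) = frechet_derivative f (at x) v"
      by (simp only: frechet_derivative_sum_partial)
  qed
qed

lemma Ck_on_Suc: "Ck_on (Suc k) S f \<Longrightarrow> Ck_on k S f"
proof (induction k arbitrary: f)
  case 0
  then show ?case using Ck_on_1_continuous by auto
qed auto

lemma Ck_on_le: "Ck_on m S f \<Longrightarrow> k \<le> m \<Longrightarrow> Ck_on k S f"
proof (induction m)
  case (Suc m)
  then show ?case using Ck_on_Suc by (metis le_Suc_eq)
qed auto

lemma Ck_on_subset: "Ck_on k S f \<Longrightarrow> T \<subseteq> S \<Longrightarrow> Ck_on k T f"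
proof (induction k arbitrary: f)
  case 0
  then show ?case using continuous_on_subset by (metis Ck_on.simps(1))
next
  case (Suc k)
  then show ?case by (simp add: subset_iff)
qed

lemma has_derivative_cong_open:
  assumes "open S" "x \<in> S" "\<And>y. y \<in> S \<Longrightarrow> f y = g y"
  shows "(f has_derivative D) (at x) \<longleftrightarrow> (g has_derivative D) (at x)"
  using has_derivative_transform_within_open[of f D x UNIV S g]
    has_derivative_transform_within_open[of g D x UNIV S f] assms by auto

lemma partial_deriv_cong_open:
  assumes "open S" "x \<in> S" "\<And>y. y \<in> S \<Longrightarrow> f y = g y"
  shows "partial_deriv i f x = partial_deriv i g x"
  unfolding partial_deriv_def frechet_derivative_def
  using has_derivative_cong_open[OF assms] by simp

lemma differentiable_cong_open:
  assumes "open S" "x \<in> S" "\<And>y. y \<in> S \<Longrightarrow> f y = g y"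
  shows "f differentiable (at x) \<longleftrightarrow> g differentiable (at x)"
  unfolding differentiable_def using has_derivative_cong_open[OF assms] by simp

text \<open>On an open set derivatives are determined by the values in the set, so a function
  redefined elsewhere keeps its class.\<close>

lemma Ck_on_cong_open:
  assumes "open S" "\<And>y. y \<in> S \<Longrightarrow> f y = g y"
  shows "Ck_on k S f \<longleftrightarrow> Ck_on k S g"
  using assms
proof (induction k arbitrary: f g)
  case 0
  then show ?case using continuous_on_cong by (metis Ck_on.simps(1))
next
  case (Suc k)
  have "Ck_on k S (partial_deriv i f) \<longleftrightarrow> Ck_on k S (partial_deriv i g)" for i
    by (rule Suc.IH) (use Suc.prems partial_deriv_cong_open in blast)+
  moreover have "f differentiable (at x) \<longleftrightarrow> g differentiable (at x)" if "x \<in> S" for x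
    by (rule differentiable_cong_open[OF Suc.prems(1) that Suc.prems(2)])
  ultimately show ?case by auto
qed

lemma Ck_on_1_Un:
  assumes "open S" "open T" "Ck_on 1 S f" "Ck_on 1 T f"
  shows "Ck_on 1 (S \<union> T) f"
  using assms unfolding Ck_on_1 by (auto intro!: continuous_on_open_Un)

lemma Ck_on_const: "Ck_on k S (\<lambda>x. c)"
proof (induction k arbitrary: c)
  case (Suc k)
  have "partial_deriv i (\<lambda>x::'a. c) = (\<lambda>x. 0)" for i
    by (rule ext, rule partial_deriv_eq) (auto intro!: derivative_eq_intros)
  then show ?case using Suc by auto
qed auto

lemma Ck_on_bounded_linear:
  assumes "bounded_linear L"
  shows "Ck_on k S L"
proof (cases k)
  case 0
  then show ?thesis using assms by (simp add: linear_continuous_on)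
next
  case (Suc m)
  have d: "(L has_derivative L) (at x)" for x using bounded_linear_imp_has_derivative[OF assms] .
  have "partial_deriv i L = (\<lambda>x. L i)" for i
    by (rule ext, rule partial_deriv_eq) (rule d)
  moreover have "L differentiable (at x)" for x using d differentiableI by blast
  ultimately show ?thesis using Suc Ck_on_const by auto
qed

lemma Ck_on_add:
  assumes "open S" "Ck_on k S f" "Ck_on k S g"
  shows "Ck_on k S (\<lambda>x. f x + g x)"
  using assms(2,3)
proof (induction k arbitrary: f g)
  case 0
  then show ?case by (auto intro!: continuous_intros)
next
  case (Suc k)
  have p: "partial_deriv i (\<lambda>x. f x + g x) x = partial_deriv i f x + partial_deriv i g x" if "x \<in> S" for i x
    unfolding partial_deriv_def[of i f] partial_deriv_def[of i g]
    by (rule partial_deriv_eq) (use Suc.prems that in \<open>auto intro!: derivative_intros has_derivative_frechet\<close>)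
  have "Ck_on k S (partial_deriv i (\<lambda>x. f x + g x))" if "i \<in> Basis" for i
    using Ck_on_cong_open[OF assms(1) p] Suc that by auto
  then show ?case using Suc.prems by (auto intro!: derivative_intros)
qed

lemma partial_deriv_mult:
  fixes f g :: "'a::euclidean_space \<Rightarrow> 'b::real_normed_algebra"
  assumes "f differentiable (at x)" "g differentiable (at x)"
  shows "partial_deriv i (\<lambda>x. f x * g x) x = f x * partial_deriv i g x + partial_deriv i f x * g x"
  unfolding partial_deriv_def[of i f] partial_deriv_def[of i g]
  by (rule partial_deriv_eq) (use assms in \<open>auto intro!: has_derivative_mult has_derivative_frechet\<close>)

lemma Ck_on_mult:
  fixes f g :: "'a::euclidean_space \<Rightarrow> 'b::real_normed_algebra"
  assumes "open S" "Ck_on k S f" "Ck_on k S g"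
  shows "Ck_on k S (\<lambda>x. f x * g x)"
  using assms(2,3)
proof (induction k arbitrary: f g)
  case 0
  then show ?case by (auto intro!: continuous_intros)
next
  case (Suc k)
  have p: "partial_deriv i (\<lambda>x. f x * g x) x = f x * partial_deriv i g x + partial_deriv i f x * g x" if "x \<in> S" for i x
    by (rule partial_deriv_mult) (use Suc.prems that in auto)
  have "Ck_on k S (partial_deriv i (\<lambda>x. f x * g x))" if "i \<in> Basis" for i
    using Ck_on_cong_open[OF assms(1) p] Suc Ck_on_Suc[OF Suc.prems(1)] Ck_on_Suc[OF Suc.prems(2)] that
    by (auto intro!: Ck_on_add[OF assms(1)] Suc.IH)
  then show ?case using Suc.prems by (auto intro!: derivative_intros)
qed

lemma Ck_on_sum:
  assumes "open S" "\<And>i. i \<in> I \<Longrightarrow> Ck_on k S (f i)"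
  shows "Ck_on k S (\<lambda>x. \<Sum>i\<in>I. f i x)"
  using assms(2)
  by (induction I rule: infinite_finite_induct) (auto intro!: Ck_on_const Ck_on_add[OF assms(1)])

lemma Ck_on_bounded_linear_comp:
  assumes L: "bounded_linear L" and "open S" "Ck_on k S f"
  shows "Ck_on k S (\<lambda>x. L (f x))"
  using assms(3)
proof (induction k arbitrary: f)
  case 0
  then show ?case using L by (auto intro: bounded_linear.continuous_on)
next
  case (Suc k)
  have d: "((\<lambda>x. L (f x)) has_derivative (\<lambda>v. L (frechet_derivative f (at x) v))) (at x)" if "x \<in> S" for x
    by (rule bounded_linear.has_derivative[OF L]) (use Suc.prems that in \<open>auto intro!: has_derivative_frechet\<close>)
  have p: "partial_deriv i (\<lambda>x. L (f x)) x = L (partial_deriv i f x)" if "x \<in> S" for i x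
    unfolding partial_deriv_def[of i f] by (rule partial_deriv_eq[OF d[OF that]])
  have "Ck_on k S (partial_deriv i (\<lambda>x. L (f x)))" if "i \<in> Basis" for i
    using Ck_on_cong_open[OF assms(2) p] Suc that by auto
  then show ?case using d by (auto simp: differentiable_def)
qed

text \<open>Differentiating \<open>h (q x)\<close> produces \<open>h'\<close> composed with
  \<open>q\<close>, so an induction for a single \<open>h\<close> does not close; it runs over all
  members of a family \<open>H\<close> closed under differentiation. It serves the functions
  \<open>flat_exp p\<close>, with \<open>p\<close> ranging over the polynomials.\<close>

lemma Ck_on_compose_closed:
  fixes q :: "'a::euclidean_space \<Rightarrow> real"
  assumes H: "\<And>h. h \<in> H \<Longrightarrow> \<exists>h'\<in>H. \<forall>t. (h has_real_derivative h' t) (at t)"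
    and "open S" "Ck_on k S q" "h \<in> H"
  shows "Ck_on k S (\<lambda>x. h (q x))"
  using assms(3,4)
proof (induction k arbitrary: h)
  case 0
  then obtain h' where "\<forall>t. (h has_real_derivative h' t) (at t)" using H by blast
  then have "continuous_on UNIV h" by (meson DERIV_isCont continuous_at_imp_continuous_on)
  then show ?case using 0 by (auto intro: continuous_on_compose2)
next
  case (Suc k)
  then obtain h' where h': "h' \<in> H" "\<And>t. (h has_real_derivative h' t) (at t)" using H by blast
  have d: "((\<lambda>x. h (q x)) has_derivative (\<lambda>v. frechet_derivative q (at x) v * h' (q x))) (at x)" if "x \<in> S" for x
  proof -
    have "(q has_derivative frechet_derivative q (at x)) (at x)"
      using Suc.prems that by (auto intro!: has_derivative_frechet)
    from has_derivative_compose[OF this h'(2)[THEN has_field_derivative_imp_has_derivative]]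
    show ?thesis by (simp add: mult.commute)
  qed
  have p: "partial_deriv i (\<lambda>x. h (q x)) x = partial_deriv i q x * h' (q x)" if "x \<in> S" for i x
    unfolding partial_deriv_def[of i q] by (rule partial_deriv_eq[OF d[OF that]])
  have "Ck_on k S (partial_deriv i (\<lambda>x. h (q x)))" if "i \<in> Basis" for i
    using Ck_on_cong_open[OF assms(2) p] Suc.prems Suc.IH[OF _ h'(1)] Ck_on_Suc[OF Suc.prems(1)] that
    by (auto intro!: Ck_on_mult[OF assms(2)])
  then show ?case using d by (auto simp: differentiable_def)
qed

section \<open>Compactly supported C^1 functions\<close>

text \<open>Being C^1 is asked on the whole space, so the extension by zero is part of the notion
  and integrals over \<open>S\<close> become integrals over the whole space. The compact set is
  existential: any compact superset of the support inside \<open>S\<close> may be used.\<close>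

definition C1c :: "'a::euclidean_space set \<Rightarrow> ('a \<Rightarrow> 'b::real_normed_vector) \<Rightarrow> bool" where
  "C1c S \<phi> \<longleftrightarrow> Ck_on 1 UNIV \<phi> \<and> (\<exists>K. compact K \<and> K \<subseteq> S \<and> (\<forall>x. x \<notin> K \<longrightarrow> \<phi> x = 0))"

text \<open>\<open>S\<close> and the complement of \<open>K\<close> are open and cover the space; on
  the second set the function is zero.\<close>

lemma C1cI:
  assumes "open S" "compact K" "K \<subseteq> S" "Ck_on 1 S \<phi>" "\<And>x. x \<notin> K \<Longrightarrow> \<phi> x = 0"
  shows "C1c S \<phi>"
proof -
  have "open (- K)" using assms(2) by (simp add: compact_imp_closed open_Compl)
  moreover have "Ck_on 1 (- K) \<phi>"
    using Ck_on_cong_open[OF \<open>open (- K)\<close>, of \<phi> "\<lambda>x. 0"] Ck_on_const assms(5) by blast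
  ultimately have "Ck_on 1 (S \<union> - K) \<phi>" using Ck_on_1_Un[OF assms(1)] assms(4) by blast
  moreover have "S \<union> - K = UNIV" using assms(3) by auto
  ultimately show ?thesis using assms unfolding C1c_def by metis
qed

lemma C1cE:
  assumes "C1c S \<phi>"
  obtains K where "compact K" "K \<subseteq> S" "\<And>x. x \<notin> K \<Longrightarrow> \<phi> x = 0"
    "\<And>x. x \<notin> K \<Longrightarrow> frechet_derivative \<phi> (at x) = (\<lambda>v. 0)"
proof -
  obtain K where K: "compact K" "K \<subseteq> S" "\<And>x. x \<notin> K \<Longrightarrow> \<phi> x = 0"
    using assms unfolding C1c_def by blast
  have "(\<phi> has_derivative (\<lambda>v. 0)) (at x)" if "x \<notin> K" for x
  proof (rule has_derivative_transform_within_open[of "\<lambda>x. 0" _ _ _ "- K"])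
    show "open (- K)" using K(1) by (simp add: compact_imp_closed open_Compl)
  qed (use K that in auto)
  from that[OF K frechet_derivative_eq[OF this]] show ?thesis .
qed

lemma C1c_Ck: "C1c S \<phi> \<Longrightarrow> Ck_on 1 UNIV \<phi>"
  by (simp add: C1c_def)

lemma C1c_differentiable: "C1c S \<phi> \<Longrightarrow> \<phi> differentiable (at x)"
  by (simp add: C1c_def)

lemma C1c_mono: "C1c S \<phi> \<Longrightarrow> S \<subseteq> T \<Longrightarrow> C1c T \<phi>"
  unfolding C1c_def by (meson order_trans)

lemma C1c_continuous: "C1c S \<phi> \<Longrightarrow> continuous_on T \<phi>"
  using C1c_Ck Ck_on_1_continuous continuous_on_subset by (metis subset_UNIV)

lemma C1c_continuous_frechet: "C1c S \<phi> \<Longrightarrow> continuous_on T (\<lambda>x. frechet_derivative \<phi> (at x) v)"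
  using Ck_on_1_continuous_frechet[OF C1c_Ck] continuous_on_subset by (metis subset_UNIV)

lemma C1c_continuous_partial: "C1c S \<phi> \<Longrightarrow> continuous_on T (partial_deriv i \<phi>)"
  unfolding partial_deriv_def[abs_def] by (rule C1c_continuous_frechet)

lemma C1c_mult:
  fixes \<phi> h :: "'a::euclidean_space \<Rightarrow> 'b::real_normed_algebra"
  assumes "C1c S \<phi>" "open S" "Ck_on 1 S h"
  shows "C1c S (\<lambda>x. \<phi> x * h x)"
proof -
  obtain K where "compact K" "K \<subseteq> S" "\<And>x. x \<notin> K \<Longrightarrow> \<phi> x = 0"
    using assms unfolding C1c_def by blast
  then show ?thesis
    using assms Ck_on_mult[OF assms(2) Ck_on_subset[OF C1c_Ck[OF assms(1)]] assms(3)]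
    by (auto intro!: C1cI[of S K])
qed

lemma C1c_add:
  assumes "C1c S \<phi>" "C1c S \<psi>"
  shows "C1c S (\<lambda>x. \<phi> x + \<psi> x)"
proof -
  obtain K where K: "compact K" "K \<subseteq> S" "\<And>x. x \<notin> K \<Longrightarrow> \<phi> x = 0"
    using assms(1) unfolding C1c_def by blast
  obtain L where L: "compact L" "L \<subseteq> S" "\<And>x. x \<notin> L \<Longrightarrow> \<psi> x = 0"
    using assms(2) unfolding C1c_def by blast
  show ?thesis unfolding C1c_def
    using Ck_on_add[OF open_UNIV C1c_Ck[OF assms(1)] C1c_Ck[OF assms(2)]] K L
    by (intro conjI exI[of _ "K \<union> L"]) auto
qed

lemma C1c_bounded_linear:
  assumes "C1c S \<phi>" "bounded_linear L"
  shows "C1c S (\<lambda>x. L (\<phi> x))"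
  using assms Ck_on_bounded_linear_comp[OF assms(2) open_UNIV C1c_Ck[OF assms(1)]]
  unfolding C1c_def by (metis linear_simps(3))

lemma C1c_diff:
  assumes "C1c S \<phi>" "C1c S \<psi>"
  shows "C1c S (\<lambda>x. \<phi> x - \<psi> x)"
  using C1c_add[OF assms(1) C1c_bounded_linear[OF assms(2), of uminus]]
  by (simp add: bounded_linear_minus bounded_linear_ident)

lemma C1c_zero: "C1c S (\<lambda>x. 0)"
  unfolding C1c_def using Ck_on_const compact_empty by blast

lemma C1c_sum:
  assumes "\<And>i. i \<in> I \<Longrightarrow> C1c S (f i)"
  shows "C1c S (\<lambda>x. \<Sum>i\<in>I. f i x)"
  using assms by (induction I rule: infinite_finite_induct) (auto intro!: C1c_zero C1c_add)

section \<open>Integration of compactly supported functions\<close>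

lemma integrable_compact_support:
  fixes f :: "'a::euclidean_space \<Rightarrow> 'b::{banach, second_countable_topology}"
  assumes "compact K" "continuous_on K f" "\<And>x. x \<notin> K \<Longrightarrow> f x = 0"
  shows "integrable lborel f" "integrable lebesgue f"
proof -
  have "integrable lborel (\<lambda>x. indicator K x *\<^sub>R f x)"
    by (rule borel_integrable_compact) (use assms in auto)
  moreover have "(\<lambda>x. indicator K x *\<^sub>R f x) = f"
    using assms(3) by (auto simp: fun_eq_iff indicator_def)
  ultimately show i: "integrable lborel f" by simp
  then have "f \<in> borel_measurable lborel" by auto
  with i show "integrable lebesgue f" by (simp add: integrable_completion)
qed

lemma integral_lebesgue_lborel:
  fixes f :: "'a::euclidean_space \<Rightarrow> 'b::{banach, second_countable_topology}"
  assumes "integrable lborel f"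
  shows "integral\<^sup>L lebesgue f = integral\<^sup>L lborel f"
  using assms by (intro integral_completion) auto

lemma C1c_bounded_derivative:
  fixes \<phi> :: "'a::euclidean_space \<Rightarrow> 'b::real_normed_vector"
  assumes "C1c S \<phi>"
  obtains B where "B \<ge> 0" "\<And>x v. norm (frechet_derivative \<phi> (at x) v) \<le> B * norm v"
proof -
  obtain K where K: "compact K" "\<And>x. x \<notin> K \<Longrightarrow> frechet_derivative \<phi> (at x) = (\<lambda>v. 0)"
    using C1cE[OF assms] by metis
  have "\<exists>B\<ge>0. \<forall>x. norm (partial_deriv i \<phi> x) \<le> B" for i
  proof -
    have "bounded (partial_deriv i \<phi> ` K)"
      using C1c_continuous_partial[OF assms] K(1) compact_continuous_image compact_imp_bounded by blast
    then obtain B where B: "B > 0" "\<And>x. x \<in> K \<Longrightarrow> norm (partial_deriv i \<phi> x) \<le> B"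
      unfolding bounded_pos by auto
    then have "norm (partial_deriv i \<phi> x) \<le> B" for x
      by (cases "x \<in> K") (auto simp: partial_deriv_def K(2))
    then show ?thesis using B(1) by (intro exI[of _ B]) auto
  qed
  then obtain B where B: "\<And>i. B i \<ge> 0" "\<And>i x. norm (partial_deriv i \<phi> x) \<le> B i" by metis
  show ?thesis
  proof (rule that)
    show "(\<Sum>i\<in>Basis. B i) \<ge> 0" by (simp add: B sum_nonneg)
    fix x v
    have "norm (frechet_derivative \<phi> (at x) v) \<le> (\<Sum>i\<in>Basis. norm ((v \<bullet> i) *\<^sub>R partial_deriv i \<phi> x))"
      unfolding frechet_derivative_sum_partial[OF C1c_differentiable[OF assms]] by (rule norm_sum)
    also have "\<dots> \<le> (\<Sum>i\<in>Basis. B i * norm v)"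
    proof (rule sum_mono)
      fix i :: 'a assume i: "i \<in> Basis"
      have "norm (v \<bullet> i) * norm (partial_deriv i \<phi> x) \<le> norm v * B i"
        by (rule mult_mono) (use B Basis_le_norm[OF i] in auto)
      then show "norm ((v \<bullet> i) *\<^sub>R partial_deriv i \<phi> x) \<le> B i * norm v" by (simp add: mult.commute)
    qed
    finally show "norm (frechet_derivative \<phi> (at x) v) \<le> (\<Sum>i\<in>Basis. B i) * norm v"
      by (simp add: sum_distrib_right)
  qed
qed

lemma C1c_lipschitz:
  fixes \<phi> :: "'a::euclidean_space \<Rightarrow> 'b::real_normed_vector"
  assumes "C1c S \<phi>"
  obtains B where "B \<ge> 0" "\<And>x y. norm (\<phi> x - \<phi> y) \<le> B * norm (x - y)"
proof -
  obtain B where B: "B \<ge> 0" "\<And>x v. norm (frechet_derivative \<phi> (at x) v) \<le> B * norm v"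
    using C1c_bounded_derivative[OF assms] by blast
  have "norm (\<phi> x - \<phi> y) \<le> B * norm (x - y)" for x y
  proof (rule differentiable_bound[of UNIV])
    show "(\<phi> has_derivative frechet_derivative \<phi> (at x)) (at x within UNIV)" for x
      using has_derivative_frechet[OF C1c_differentiable[OF assms]] by simp
    show "onorm (frechet_derivative \<phi> (at x)) \<le> B" for x
      using B by (intro onorm_bound) auto
  qed auto
  with B(1) that show ?thesis by blast
qed

lemma integral_shift:
  fixes f :: "'a::euclidean_space \<Rightarrow> 'b::{banach, second_countable_topology}"
  assumes "f \<in> borel_measurable borel"
  shows "integral\<^sup>L lborel (\<lambda>x. f (c + x)) = integral\<^sup>L lborel f"
proof -
  have "integral\<^sup>L lborel f = integral\<^sup>L (distr lborel borel ((+) c)) f" by (simp add: lborel_distr_plus)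
  also have "\<dots> = integral\<^sup>L lborel (\<lambda>x. f (c + x))"
    by (rule integral_distr) (use assms in auto)
  finally show ?thesis by simp
qed

lemma difference_quotient_tendsto:
  fixes f :: "real \<Rightarrow> 'b::real_normed_vector"
  assumes "(f has_vector_derivative D) (at 0)"
  shows "((\<lambda>t. (f t - f 0) /\<^sub>R t) \<longlongrightarrow> D) (at 0)"
proof -
  have "((\<lambda>h. norm (f h - f 0 - h *\<^sub>R D) / norm h) \<longlongrightarrow> 0) (at 0)"
    using assms unfolding has_vector_derivative_def has_derivative_at by simp
  moreover have "norm (f h - f 0 - h *\<^sub>R D) / norm h = norm ((f h - f 0) /\<^sub>R h - D)" if "h \<noteq> 0" for h :: real
  proof -
    have "(f h - f 0) /\<^sub>R h - D = (f h - f 0 - h *\<^sub>R D) /\<^sub>R h"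
      using that by (simp add: scaleR_diff_right)
    then show ?thesis by (simp add: divide_inverse mult.commute)
  qed
  ultimately have "((\<lambda>h. norm ((f h - f 0) /\<^sub>R h - D)) \<longlongrightarrow> 0) (at 0)"
    by (subst (asm) tendsto_cong[OF eventually_mono[OF eventually_neq_at_within[of 0]]]) auto
  then show ?thesis by (simp add: tendsto_norm_zero_iff LIM_zero_iff)
qed

text \<open>Translation invariance makes the integral of every difference quotient zero, and
  dominated convergence passes to the derivative, in any direction and without iterated
  integrals.\<close>

lemma integral_frechet_C1c_zero:
  fixes \<phi> :: "'a::euclidean_space \<Rightarrow> 'b::{banach, second_countable_topology}"
  assumes "C1c S \<phi>"
  shows "(LINT x|lebesgue. frechet_derivative \<phi> (at x) v) = 0"
proof -
  obtain K where K: "compact K" "\<And>x. x \<notin> K \<Longrightarrow> \<phi> x = 0"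
     "\<And>x. x \<notin> K \<Longrightarrow> frechet_derivative \<phi> (at x) = (\<lambda>v. 0)"
    using C1cE[OF assms] by metis
  obtain B where B: "B \<ge> 0" "\<And>x y. norm (\<phi> x - \<phi> y) \<le> B * norm (x - y)"
    using C1c_lipschitz[OF assms] by blast
  obtain R where "\<And>x. x \<in> K \<Longrightarrow> norm x \<le> R"
    using compact_imp_bounded[OF K(1)] unfolding bounded_iff by blast
  then have R: "K \<subseteq> cball 0 R" by auto
  \<comment> \<open>Difference quotients along the steps 1/(n+1). These are at most 1, so all
    quotients vanish off the ball of radius \<open>R + norm v\<close>, on which the Lipschitz
    constant gives the dominating function.\<close>
  define q where "q n x = real (Suc n) *\<^sub>R (\<phi> (inverse (real (Suc n)) *\<^sub>R v + x) - \<phi> x)" for n x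
  have cont: "continuous_on T \<phi>" for T by (rule C1c_continuous[OF assms])
  then have meas: "\<phi> \<in> borel_measurable borel" by (rule borel_measurable_continuous_onI)
  have int: "integrable lborel \<phi>" by (rule integrable_compact_support) (use K cont in auto)
  have intD: "integrable lborel (\<lambda>x. frechet_derivative \<phi> (at x) v)"
    by (rule integrable_compact_support[OF K(1)]) (use K C1c_continuous_frechet[OF assms] in auto)
  have shift: "integrable lborel (\<lambda>x. \<phi> (c + x))" for c
  proof -
    have "integrable (distr lborel borel ((+) c)) \<phi>" using int by (simp only: lborel_distr_plus)
    then show ?thesis by (rule integrable_distr[rotated]) simp
  qed
  have q0: "integral\<^sup>L lborel (q n) = 0" for n
    unfolding q_def using int shift integral_shift[OF meas] by simp
  have "(\<lambda>n. integral\<^sup>L lborel (q n)) \<longlonglongrightarrow> integral\<^sup>L lborel (\<lambda>x. frechet_derivative \<phi> (at x) v)"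
  proof (rule integral_dominated_convergence)
    show "integrable lborel (\<lambda>x. indicat_real (cball 0 (R + norm v)) x *\<^sub>R (B * norm v))"
      by (rule borel_integrable_compact) auto
    show "AE x in lborel. (\<lambda>n. q n x) \<longlonglongrightarrow> frechet_derivative \<phi> (at x) v"
    proof (rule AE_I2)
      fix x
      have d: "((\<lambda>t. \<phi> (t *\<^sub>R v + x)) has_vector_derivative frechet_derivative \<phi> (at x) v) (at 0)"
      proof -
        have "(\<phi> has_derivative frechet_derivative \<phi> (at x)) (at (0 *\<^sub>R v + x))"
          using has_derivative_frechet[OF C1c_differentiable[OF assms]] by simp
        then have "((\<lambda>t. \<phi> (t *\<^sub>R v + x)) has_derivative (\<lambda>t. frechet_derivative \<phi> (at x) (t *\<^sub>R v))) (at 0)"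
          by (rule has_derivative_compose[rotated]) (auto intro!: derivative_eq_intros)
        then show ?thesis unfolding has_vector_derivative_def
          using linear_frechet_derivative[OF C1c_differentiable[OF assms]] by (simp add: linear_scale)
      qed
      have "((\<lambda>t. (\<phi> (t *\<^sub>R v + x) - \<phi> x) /\<^sub>R t) \<longlongrightarrow> frechet_derivative \<phi> (at x) v) (at 0)"
        using difference_quotient_tendsto[OF d] by simp
      moreover have "filterlim (\<lambda>n. inverse (real (Suc n))) (at 0) sequentially"
        using LIMSEQ_inverse_real_of_nat unfolding filterlim_at by auto
      ultimately have "((\<lambda>n. (\<phi> (inverse (real (Suc n)) *\<^sub>R v + x) - \<phi> x) /\<^sub>R inverse (real (Suc n))) \<longlonglongrightarrow> frechet_derivative \<phi> (at x) v)"
        by (rule filterlim_compose)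
      then show "(\<lambda>n. q n x) \<longlonglongrightarrow> frechet_derivative \<phi> (at x) v" by (simp add: q_def)
    qed
    show "AE x in lborel. norm (q n x) \<le> indicat_real (cball 0 (R + norm v)) x *\<^sub>R (B * norm v)" for n
    proof (rule AE_I2)
      fix x
      show "norm (q n x) \<le> indicat_real (cball 0 (R + norm v)) x *\<^sub>R (B * norm v)"
      proof (cases "x \<in> cball 0 (R + norm v)")
        case True
        have "norm (\<phi> (inverse (real (Suc n)) *\<^sub>R v + x) - \<phi> x) \<le> B * norm (inverse (real (Suc n)) *\<^sub>R v)"
          using B(2)[of "inverse (real (Suc n)) *\<^sub>R v + x" x] by simp
        then have "norm (q n x) \<le> real (Suc n) * (B * norm (inverse (real (Suc n)) *\<^sub>R v))"
          unfolding q_def norm_scaleR by (intro mult_mono) auto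
        also have "\<dots> = B * norm v" by simp
        finally show ?thesis using True by simp
      next
        case False
        have "norm (inverse (real (Suc n)) *\<^sub>R v) \<le> norm v"
          using mult_left_mono[of 1 "1 + real n" "norm v"] by (simp add: field_simps)
        moreover have "norm x \<le> norm (inverse (real (Suc n)) *\<^sub>R v + x) + norm (inverse (real (Suc n)) *\<^sub>R v)"
          using norm_triangle_ineq4[of "inverse (real (Suc n)) *\<^sub>R v + x" "inverse (real (Suc n)) *\<^sub>R v"] by simp
        moreover have "norm x > R + norm v" using False by simp
        moreover have "0 \<le> norm v" by simp
        ultimately have "norm (inverse (real (Suc n)) *\<^sub>R v + x) > R" "norm x > R"
          by linarith+
        then have "inverse (real (Suc n)) *\<^sub>R v + x \<notin> K" "x \<notin> K"
          using R by (meson leD mem_cball_0 subsetD)+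
        then show ?thesis using False K by (simp add: q_def)
      qed
    qed
    show "(\<lambda>x. frechet_derivative \<phi> (at x) v) \<in> borel_measurable lborel"
      using intD by (rule borel_measurable_integrable)
    have "continuous_on UNIV (\<lambda>x. \<phi> (c + x))" for c
      by (rule continuous_on_compose2[OF cont[of UNIV]]) (auto intro!: continuous_intros)
    then have "continuous_on UNIV (q n)" for n
      unfolding q_def using cont by (intro continuous_intros) auto
    then show "q n \<in> borel_measurable lborel" for n
      by (simp add: borel_measurable_continuous_onI)
  qed
  then have "integral\<^sup>L lborel (\<lambda>x. frechet_derivative \<phi> (at x) v) = 0"
    by (simp add: q0 LIMSEQ_const_iff)
  then show ?thesis using integral_lebesgue_lborel[OF intD] by simp
qed

section \<open>Smooth bumps and mollification\<close>

text \<open>With \<open>p = 1\<close> this is the classical smooth function exp(-1/t) continued by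
  0. The polynomial factor makes the family closed under differentiation.\<close>

definition flat_exp :: "real poly \<Rightarrow> real \<Rightarrow> real" where
  "flat_exp p t = (if t > 0 then poly p (inverse t) * exp (- inverse t) else 0)"

lemma poly_div_exp_tendsto_0: "((\<lambda>x. poly p x * exp (- x)) \<longlongrightarrow> (0::real)) at_top"
proof -
  have "((\<lambda>x. \<Sum>i\<le>degree p. coeff p i * (x ^ i / exp x)) \<longlongrightarrow> (\<Sum>i\<le>degree p. coeff p i * 0)) at_top"
    by (intro tendsto_intros tendsto_power_div_exp_0)
  then show ?thesis
    by (simp add: poly_altdef sum_distrib_right exp_minus divide_inverse mult.assoc)
qed

text \<open>For t > 0 the derivative of p(1/t) exp(-1/t) is (p - p')(1/t) t^(-2) exp(-1/t), which
  explains the factor \<open>[:0, 0, 1:]\<close>. At 0 the one-sided difference quotient is (1/h)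
  p(1/h) exp(-1/h), again a polynomial in 1/h times the exponential, and tends to 0.\<close>

lemma flat_exp_has_derivative:
  "(flat_exp p has_real_derivative flat_exp ([:0, 0, 1:] * (p - pderiv p)) t) (at t)"
proof -
  consider "t > 0" | "t < 0" | "t = 0" by linarith
  then show ?thesis
  proof cases
    case 1
    have "((\<lambda>t. poly p (inverse t) * exp (- inverse t)) has_real_derivative
        flat_exp ([:0, 0, 1:] * (p - pderiv p)) t) (at t)"
      using 1 by (auto intro!: derivative_eq_intros simp: flat_exp_def algebra_simps power2_eq_square)
    then show ?thesis
      by (rule has_field_derivative_transform_within_open[where S="{0<..}"])
         (use 1 in \<open>auto simp: flat_exp_def\<close>)
  next
    case 2
    have "((\<lambda>t. 0) has_real_derivative 0) (at t)" by simp
    then show ?thesis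
      using has_field_derivative_transform_within_open[of "\<lambda>t. 0" 0 t "{..<0}" "flat_exp p"] 2
      by (auto simp: flat_exp_def)
  next
    case 3
    have "((\<lambda>h. poly (pCons 0 p) (inverse h) * exp (- inverse h)) \<longlongrightarrow> 0) (at_right 0)"
      by (rule filterlim_compose[OF poly_div_exp_tendsto_0 filterlim_inverse_at_top_right])
    moreover have "\<forall>\<^sub>F h in at_right 0. poly (pCons 0 p) (inverse h) * exp (- inverse h) = flat_exp p h / h"
      by (auto simp: eventually_at_right_field flat_exp_def divide_inverse intro!: exI[of _ 1])
    ultimately have "((\<lambda>h. flat_exp p h / h) \<longlongrightarrow> 0) (at_right 0)"
      by (rule Lim_transform_eventually)
    moreover have "((\<lambda>h. flat_exp p h / h) \<longlongrightarrow> 0) (at_left 0)"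
    proof -
      have "\<forall>\<^sub>F h in at_left 0. 0 = flat_exp p h / h"
        by (auto simp: eventually_at_left_field flat_exp_def intro!: exI[of _ "-1"])
      with tendsto_const show ?thesis by (rule Lim_transform_eventually)
    qed
    ultimately have "((\<lambda>h. flat_exp p h / h) \<longlongrightarrow> 0) (at 0)" by (rule filterlim_split_at[rotated])
    then show ?thesis using 3 by (simp add: has_field_derivative_iff flat_exp_def)
  qed
qed

definition bump :: "real \<Rightarrow> 'a::euclidean_space \<Rightarrow> real" where
  "bump r x = flat_exp 1 (r\<^sup>2 - x \<bullet> x)"

lemma bump_nonneg: "bump r x \<ge> 0"
  by (simp add: bump_def flat_exp_def)

lemma bump_pos: "norm x < r \<Longrightarrow> bump r x > 0"
proof -
  assume "norm x < r"
  then have "(norm x)\<^sup>2 < r\<^sup>2" by (intro power_strict_mono) auto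
  then show ?thesis by (simp add: bump_def flat_exp_def power2_norm_eq_inner)
qed

lemma bump_zero: "r \<ge> 0 \<Longrightarrow> norm x \<ge> r \<Longrightarrow> bump r x = 0"
proof -
  assume "r \<ge> 0" "norm x \<ge> r"
  then have "(norm x)\<^sup>2 \<ge> r\<^sup>2" by (intro power_mono) auto
  then show ?thesis by (simp add: bump_def flat_exp_def power2_norm_eq_inner)
qed

text \<open>The inner product of x with itself is a sum of products of linear functions; working
  with the square avoids the singularity of the norm at 0.\<close>

lemma smooth_bump: "Ck_on k UNIV (bump r :: 'a::euclidean_space \<Rightarrow> real)"
proof -
  have "Ck_on k UNIV (\<lambda>x::'a. \<Sum>i\<in>Basis. (x \<bullet> i) * (x \<bullet> i))"
    by (intro Ck_on_sum Ck_on_mult open_UNIV Ck_on_bounded_linear bounded_linear_inner_left)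
  then have "Ck_on k UNIV (\<lambda>x::'a. x \<bullet> x)" by (simp add: euclidean_inner[symmetric])
  then have "Ck_on k UNIV (\<lambda>x::'a. r\<^sup>2 + (- (x \<bullet> x)))"
    by (intro Ck_on_add Ck_on_const Ck_on_bounded_linear_comp[of uminus] open_UNIV
        bounded_linear_minus bounded_linear_ident)
  then have "Ck_on k UNIV (\<lambda>x::'a. flat_exp 1 (r\<^sup>2 + (- (x \<bullet> x))))"
    by (rule Ck_on_compose_closed[of "range flat_exp", rotated 2])
       (use flat_exp_has_derivative in blast)+
  then show ?thesis by (simp add: bump_def[abs_def])
qed

lemma continuous_bump: "continuous_on S (bump r)"
  using smooth_bump[of 0 r] continuous_on_subset by auto

definition mollifier :: "real \<Rightarrow> 'a::euclidean_space \<Rightarrow> complex" where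
  "mollifier r x = of_real (bump r x / (LBINT y. bump r (y::'a)))"

lemma bump_integral_pos:
  assumes "r > 0"
  shows "(LBINT y. bump r (y::'a::euclidean_space)) > 0"
proof -
  have int: "integrable lborel (bump r :: 'a \<Rightarrow> real)"
    by (rule integrable_compact_support[of "cball 0 r"])
       (use assms in \<open>auto intro!: continuous_bump bump_zero\<close>)
  have "(LBINT y. bump r (y::'a)) \<noteq> 0"
  proof
    assume "(LBINT y. bump r (y::'a)) = 0"
    then have "AE y in lborel. bump r (y::'a) = 0"
      using integral_nonneg_eq_0_iff_AE[OF int] bump_nonneg by auto
    then have "AE y in lborel. (y::'a) \<notin> ball 0 r"
      by (rule AE_mp) (use bump_pos[of _ r] in \<open>force intro!: AE_I2\<close>)
    then have "ball (0::'a) r \<in> null_sets lborel"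
      by (subst (asm) AE_iff_null_sets[symmetric]) auto
    then have "negligible (ball (0::'a) r)"
      using negligible_iff_null_sets null_sets_completionI by blast
    then show False using open_not_negligible[of "ball (0::'a) r"] assms by simp
  qed
  moreover have "(LBINT y. bump r (y::'a)) \<ge> 0" by (simp add: bump_nonneg)
  ultimately show ?thesis by simp
qed

lemma smooth_mollifier: "Ck_on k UNIV (mollifier r :: 'a::euclidean_space \<Rightarrow> complex)"
proof -
  have "Ck_on k UNIV (\<lambda>x::'a. bump r x * inverse (LBINT y. bump r (y::'a)))"
    by (intro Ck_on_mult smooth_bump Ck_on_const open_UNIV)
  from Ck_on_bounded_linear_comp[OF bounded_linear_of_real open_UNIV this]
  show ?thesis unfolding mollifier_def[abs_def] divide_inverse .
qed

lemma mollifier_zero: "r \<ge> 0 \<Longrightarrow> norm x \<ge> r \<Longrightarrow> mollifier r x = 0"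
  by (simp add: mollifier_def bump_zero)

lemma integral_norm_mollifier:
  assumes "r > 0"
  shows "integrable lborel (\<lambda>x::'a::euclidean_space. cmod (mollifier r x))"
    and "(LBINT x. cmod (mollifier r (x::'a))) = 1"
    and "(LBINT x. mollifier r (x::'a)) = 1"
proof -
  have cm: "cmod (mollifier r x) = bump r x / (LBINT y. bump r (y::'a))" for x :: 'a
    using bump_nonneg[of r x] bump_integral_pos[OF assms, where 'a='a] by (simp add: mollifier_def norm_divide)
  have int: "integrable lborel (bump r :: 'a \<Rightarrow> real)"
    by (rule integrable_compact_support[of "cball 0 r"])
       (use assms in \<open>auto intro!: continuous_bump bump_zero\<close>)
  then show "integrable lborel (\<lambda>x::'a. cmod (mollifier r x))" by (simp add: cm)
  show one: "(LBINT x. cmod (mollifier r (x::'a))) = 1"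
    using bump_integral_pos[OF assms, where 'a='a] by (simp add: cm)
  have "mollifier r x = of_real (cmod (mollifier r x))" for x :: 'a by (simp only: cm) (simp only: mollifier_def)
  then have "(LBINT x. mollifier r (x::'a)) = (LBINT x. complex_of_real (cmod (mollifier r (x::'a))))"
    by metis
  also have "\<dots> = 1" using one by simp
  finally show "(LBINT x. mollifier r (x::'a)) = 1" .
qed

section \<open>Convolution\<close>

definition conv :: "('a::euclidean_space \<Rightarrow> complex) \<Rightarrow> ('a \<Rightarrow> complex) \<Rightarrow> 'a \<Rightarrow> complex" where
  "conv \<psi> \<kappa> x = (LBINT y. \<psi> y * \<kappa> (x - y))"

text \<open>The derivative rule below differentiates the second factor; exchanging the factors makes
  it available for the first. The substitution y \<mapsto> x - y preserves Lebesgue measure.\<close>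

lemma conv_commute:
  fixes \<psi> \<kappa> :: "'a::euclidean_space \<Rightarrow> complex"
  assumes "continuous_on UNIV \<psi>" "continuous_on UNIV \<kappa>"
  shows "conv \<psi> \<kappa> = conv \<kappa> \<psi>"
proof
  fix x
  have m: "(\<lambda>y. \<psi> y * \<kappa> (x - y)) \<in> borel_measurable borel"
    by (intro borel_measurable_continuous_onI continuous_intros assms
        continuous_on_compose2[OF assms(2)]) auto
  \<comment> \<open>Affine substitution with factor -1, whose density |-1|^n is 1.\<close>
  have "(lborel :: 'a measure) = density (distr lborel borel (\<lambda>y. x + (-1) *\<^sub>R y)) (\<lambda>_. \<bar>-1::real\<bar>^DIM('a))"
    by (rule lborel_affine) simp
  then have eq: "distr lborel borel (\<lambda>y. x - y) = (lborel :: 'a measure)"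
    by (simp add: density_1)
  have "conv \<psi> \<kappa> x = integral\<^sup>L (distr lborel borel (\<lambda>y. x - y)) (\<lambda>y. \<psi> y * \<kappa> (x - y))"
    unfolding eq conv_def by simp
  also have "\<dots> = integral\<^sup>L lborel (\<lambda>y. \<psi> (x - y) * \<kappa> (x - (x - y)))"
    by (rule integral_distr) (use m in auto)
  also have "\<dots> = conv \<kappa> \<psi> x" unfolding conv_def by (simp add: mult.commute)
  finally show "conv \<psi> \<kappa> x = conv \<kappa> \<psi> x" .
qed

lemma conv_integrable:
  fixes \<psi> \<kappa> :: "'a::euclidean_space \<Rightarrow> complex"
  assumes "continuous_on UNIV \<psi>" "continuous_on UNIV \<kappa>" "compact K" "\<And>x. x \<notin> K \<Longrightarrow> \<psi> x = 0"
  shows "integrable lborel (\<lambda>y. \<psi> y * \<kappa> (x - y))"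
  by (rule integrable_compact_support[OF assms(3)])
     (use assms(4) in \<open>auto intro!: continuous_intros continuous_on_compose2[OF assms(2)]
        continuous_on_subset[OF assms(1)]\<close>)

text \<open>Differentiation under the integral sign, carried out over a box that contains the
  support of \<open>\<psi>\<close>. The derivative of the integrand is a \<open>Blinfun\<close>
  valued function whose continuity is checked on basis vectors.\<close>

lemma conv_has_derivative:
  fixes \<psi> \<kappa> :: "'a::euclidean_space \<Rightarrow> complex"
  assumes \<psi>: "continuous_on UNIV \<psi>" and K: "compact K" "\<And>x. x \<notin> K \<Longrightarrow> \<psi> x = 0"
    and \<kappa>: "Ck_on 1 UNIV \<kappa>"
  obtains D where "(conv \<psi> \<kappa> has_derivative D) (at x)"
    "\<And>i. i \<in> Basis \<Longrightarrow> D i = conv \<psi> (partial_deriv i \<kappa>) x"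
proof -
  obtain a b where ab: "K \<subseteq> cbox a b"
    using bounded_subset_cbox_symmetric[OF compact_imp_bounded[OF K(1)]] by blast
  define fx where "fx x y = Blinfun (\<lambda>v. \<psi> y * frechet_derivative \<kappa> (at (x - y)) v)" for x y
  have \<kappa>d: "\<kappa> differentiable (at z)" for z using \<kappa> by simp
  have app: "blinfun_apply (fx x y) = (\<lambda>v. \<psi> y * frechet_derivative \<kappa> (at (x - y)) v)" for x y
  proof -
    have "bounded_linear (frechet_derivative \<kappa> (at (x - y)))"
      using has_derivative_frechet[OF \<kappa>d] has_derivative_bounded_linear by blast
    then show ?thesis unfolding fx_def by (intro bounded_linear_Blinfun_apply bounded_linear_const_mult)
  qed
  have conv_cbox: "conv \<psi> \<kappa>' x = integral (cbox a b) (\<lambda>y. \<psi> y * \<kappa>' (x - y))"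
    if "continuous_on UNIV \<kappa>'" for \<kappa>' x
  proof -
    have "conv \<psi> \<kappa>' x = integral UNIV (\<lambda>y. \<psi> y * \<kappa>' (x - y))"
      unfolding conv_def using integral_lborel[OF conv_integrable[OF \<psi> that K]] by simp
    also have "\<dots> = integral UNIV (\<lambda>y. if y \<in> cbox a b then \<psi> y * \<kappa>' (x - y) else 0)"
      by (rule integral_cong) (use ab K(2) in auto)
    finally show ?thesis by (simp only: integral_restrict_UNIV)
  qed
  have \<kappa>c: "continuous_on UNIV \<kappa>" using \<kappa> by (rule Ck_on_1_continuous)
  have contfx: "continuous_on (UNIV \<times> cbox a b) (\<lambda>(x, y). fx x y)"
  proof (rule continuous_on_blinfun_componentwise)
    fix i :: 'a assume "i \<in> Basis"
    have "continuous_on (UNIV \<times> cbox a b) (\<lambda>p. \<psi> (snd p) * frechet_derivative \<kappa> (at (fst p - snd p)) i)"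
      by (intro continuous_intros continuous_on_compose2[OF \<psi>]
          continuous_on_compose2[OF Ck_on_1_continuous_frechet[OF \<kappa>]]) auto
    then show "continuous_on (UNIV \<times> cbox a b) (\<lambda>p. blinfun_apply (case p of (x, y) \<Rightarrow> fx x y) i)"
      by (simp add: case_prod_beta app)
  qed
  have "((\<lambda>x. integral (cbox a b) (\<lambda>y. \<psi> y * \<kappa> (x - y))) has_derivative
      blinfun_apply (integral (cbox a b) (fx x))) (at x within UNIV)"
  proof (rule leibniz_rule[OF _ _ contfx])
    show "((\<lambda>x. \<psi> y * \<kappa> (x - y)) has_derivative blinfun_apply (fx x y)) (at x within UNIV)" for x y
    proof -
      have "((\<lambda>x. \<kappa> (x - y)) has_derivative frechet_derivative \<kappa> (at (x - y))) (at x)"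
        by (rule has_derivative_compose[of "\<lambda>x. x - y" "\<lambda>v. v" _ _ \<kappa>])
           (auto intro!: derivative_eq_intros has_derivative_frechet \<kappa>d)
      then show ?thesis unfolding app by (simp add: has_derivative_mult_right)
    qed
    show "(\<lambda>y. \<psi> y * \<kappa> (x - y)) integrable_on cbox a b" for x
      by (intro integrable_continuous continuous_intros continuous_on_compose2[OF \<kappa>c]
          continuous_on_subset[OF \<psi>]) auto
  qed auto
  then have d: "(conv \<psi> \<kappa> has_derivative blinfun_apply (integral (cbox a b) (fx x))) (at x)"
    by (simp add: conv_cbox[OF \<kappa>c, abs_def])
  have fi: "fx x integrable_on cbox a b"
  proof (rule integrable_continuous)
    show "continuous_on (cbox a b) (fx x)"
      using continuous_on_compose2[OF contfx, of "cbox a b" "\<lambda>y. (x, y)"]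
      by (simp add: continuous_on_Pair continuous_on_const continuous_on_id image_subset_iff)
  qed
  have "blinfun_apply (integral (cbox a b) (fx x)) i = conv \<psi> (partial_deriv i \<kappa>) x" if "i \<in> Basis" for i
  proof -
    have "blinfun_apply (integral (cbox a b) (fx x)) i = integral (cbox a b) (\<lambda>y. blinfun_apply (fx x y) i)"
      using blinfun_apply_integral[OF fi] by simp
    also have "\<dots> = integral (cbox a b) (\<lambda>y. \<psi> y * partial_deriv i \<kappa> (x - y))"
      by (simp add: app partial_deriv_def)
    also have "\<dots> = conv \<psi> (partial_deriv i \<kappa>) x"
      using conv_cbox[of "partial_deriv i \<kappa>"] \<kappa> that by simp
    finally show ?thesis .
  qed
  with d that show ?thesis by blast
qed

lemma partial_deriv_conv:
  fixes \<psi> \<kappa> :: "'a::euclidean_space \<Rightarrow> complex"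
  assumes "continuous_on UNIV \<psi>" "compact K" "\<And>x. x \<notin> K \<Longrightarrow> \<psi> x = 0" "Ck_on 1 UNIV \<kappa>"
    and "i \<in> Basis"
  shows "partial_deriv i (conv \<psi> \<kappa>) = conv \<psi> (partial_deriv i \<kappa>)"
proof
  fix x
  show "partial_deriv i (conv \<psi> \<kappa>) x = conv \<psi> (partial_deriv i \<kappa>) x"
    using conv_has_derivative[OF assms(1-4), of x] assms(5) partial_deriv_eq by metis
qed

lemma conv_continuous:
  fixes \<psi> \<kappa> :: "'a::euclidean_space \<Rightarrow> complex"
  assumes "continuous_on UNIV \<psi>" "compact K" "\<And>x. x \<notin> K \<Longrightarrow> \<psi> x = 0" "continuous_on UNIV \<kappa>"
  shows "continuous_on UNIV (conv \<psi> \<kappa>)"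
proof -
  obtain a b where ab: "K \<subseteq> cbox a b"
    using bounded_subset_cbox_symmetric[OF compact_imp_bounded[OF assms(2)]] by blast
  have eq: "conv \<psi> \<kappa> x = integral (cbox a b) (\<lambda>y. \<psi> y * \<kappa> (x - y))" for x
  proof -
    have "conv \<psi> \<kappa> x = integral UNIV (\<lambda>y. \<psi> y * \<kappa> (x - y))"
      unfolding conv_def using integral_lborel[OF conv_integrable[OF assms(1,4,2,3)]] by simp
    also have "\<dots> = integral UNIV (\<lambda>y. if y \<in> cbox a b then \<psi> y * \<kappa> (x - y) else 0)"
      by (rule integral_cong) (use ab assms(3) in auto)
    finally show ?thesis by (simp only: integral_restrict_UNIV)
  qed
  have "continuous_on UNIV (\<lambda>x. integral (cbox a b) (\<lambda>y. \<psi> y * \<kappa> (x - y)))"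
  proof (rule integral_continuous_on_param)
    show "continuous_on (UNIV \<times> cbox a b) (\<lambda>(x, y). \<psi> y * \<kappa> (x - y))"
      unfolding case_prod_beta
      by (intro continuous_intros continuous_on_compose2[OF assms(1)]
          continuous_on_compose2[OF assms(4)]) auto
  qed
  then show ?thesis by (simp add: eq[abs_def])
qed

lemma smooth_conv:
  fixes \<psi> \<kappa> :: "'a::euclidean_space \<Rightarrow> complex"
  assumes "continuous_on UNIV \<psi>" "compact K" "\<And>x. x \<notin> K \<Longrightarrow> \<psi> x = 0" "Ck_on k UNIV \<kappa>"
  shows "Ck_on k UNIV (conv \<psi> \<kappa>)"
  using assms(4)
proof (induction k arbitrary: \<kappa>)
  case 0
  then show ?case using conv_continuous[OF assms(1-3)] by simp
next
  case (Suc k)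
  have \<kappa>: "Ck_on 1 UNIV \<kappa>" using Suc.prems Ck_on_le[of "Suc k" UNIV \<kappa> 1] by simp
  have "conv \<psi> \<kappa> differentiable (at x)" for x
    using conv_has_derivative[OF assms(1-3) \<kappa>, of x] differentiableI by metis
  moreover have "Ck_on k UNIV (partial_deriv i (conv \<psi> \<kappa>))" if "i \<in> Basis" for i
    using Suc that by (simp add: partial_deriv_conv[OF assms(1-3) \<kappa> that])
  ultimately show ?case by simp
qed

text \<open>Compactness is used on the closed 1-neighbourhood \<open>L\<close> of \<open>K\<close>:
  two points closer than 1 either both lie in \<open>L\<close> or both lie off \<open>K\<close>,
  where the function is zero.\<close>

lemma uniformly_continuous_compact_support:
  fixes f :: "'a::euclidean_space \<Rightarrow> 'b::real_normed_vector"
  assumes "continuous_on UNIV f" "compact K" "\<And>x. x \<notin> K \<Longrightarrow> f x = 0"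
  shows "uniformly_continuous_on UNIV f"
  unfolding uniformly_continuous_on_def
proof (intro allI impI)
  fix e :: real assume "e > 0"
  define L where "L = {x + y |x y. x \<in> K \<and> y \<in> cball 0 1}"
  have "compact L" unfolding L_def by (intro compact_sums assms(2) compact_cball)
  then have "uniformly_continuous_on L f"
    using compact_uniformly_continuous continuous_on_subset[OF assms(1)] by blast
  then obtain d where d: "d > 0" "\<And>x y. x \<in> L \<Longrightarrow> y \<in> L \<Longrightarrow> dist y x < d \<Longrightarrow> dist (f y) (f x) < e"
    unfolding uniformly_continuous_on_def using \<open>e > 0\<close> by metis
  have near: "y \<in> L" if "x \<in> K" "dist y x < 1" for x y :: 'a
  proof -
    have "y = x + (y - x)" "y - x \<in> cball 0 1" using that by (auto simp: dist_norm norm_minus_commute)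
    with \<open>x \<in> K\<close> show ?thesis unfolding L_def by blast
  qed
  show "\<exists>d>0. \<forall>x\<in>UNIV. \<forall>x'\<in>UNIV. dist x' x < d \<longrightarrow> dist (f x') (f x) < e"
  proof (intro exI conjI ballI impI)
    show "min d 1 > 0" using d by simp
    fix x y :: 'a assume xy: "dist y x < min d 1"
    show "dist (f y) (f x) < e"
    proof (cases "x \<in> K \<or> y \<in> K")
      case True
      then have "x \<in> L \<and> y \<in> L" using near[of x y] near[of y x] near[of x x] near[of y y] xy
        by (auto simp: dist_commute)
      then show ?thesis using d xy by auto
    next
      case False
      then show ?thesis using assms(3) \<open>e > 0\<close> by simp
    qed
  qed
qed

text \<open>After the factors are exchanged, the difference is the average of \<psi>(x - y) -
  \<psi>(x) against a probability density that vanishes for |y| \<ge> r, so uniform continuity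
  bounds it independently of x.\<close>

lemma conv_mollifier_close:
  fixes \<psi> :: "'a::euclidean_space \<Rightarrow> complex"
  assumes \<psi>: "continuous_on UNIV \<psi>" "compact K" "\<And>x. x \<notin> K \<Longrightarrow> \<psi> x = 0" and "e > 0"
  shows "\<exists>\<delta>>0. \<forall>r. 0 < r \<and> r < \<delta> \<longrightarrow> (\<forall>x. cmod (conv \<psi> (mollifier r) x - \<psi> x) \<le> e)"
proof -
  have "uniformly_continuous_on UNIV \<psi>" by (rule uniformly_continuous_compact_support[OF \<psi>])
  then obtain d where d: "d > 0" "\<And>x y. dist y x < d \<Longrightarrow> dist (\<psi> y) (\<psi> x) < e"
    unfolding uniformly_continuous_on_def using \<open>e > 0\<close> by (metis UNIV_I)
  have "cmod (conv \<psi> (mollifier r) x - \<psi> x) \<le> e" if r: "0 < r" "r < d" for r x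
  proof -
    let ?m = "mollifier r :: 'a \<Rightarrow> complex"
    have cm: "continuous_on UNIV ?m" using smooth_mollifier[of 0] by simp
    have z: "?m y = 0" if "y \<notin> cball 0 r" for y by (rule mollifier_zero) (use that r in auto)
    have int1: "integrable lborel (\<lambda>y. ?m y * \<psi> (x - y))"
      by (rule conv_integrable[OF cm \<psi>(1) compact_cball z])
    have int2: "integrable lborel (\<lambda>y. ?m y * \<psi> x)"
      using integral_norm_mollifier(3)[OF r(1), where 'a='a] not_integrable_integral_eq by fastforce
    have "conv \<psi> ?m x - \<psi> x = (LBINT y. ?m y * \<psi> (x - y)) - (LBINT y. ?m y * \<psi> x)"
      using integral_norm_mollifier(3)[OF r(1), where 'a='a]
      by (simp add: conv_commute[OF \<psi>(1) cm]) (simp add: conv_def)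
    also have "\<dots> = (LBINT y. ?m y * (\<psi> (x - y) - \<psi> x))"
      by (subst Bochner_Integration.integral_diff[symmetric, OF int1 int2]) (simp add: algebra_simps)
    finally have eq: "conv \<psi> ?m x - \<psi> x = (LBINT y. ?m y * (\<psi> (x - y) - \<psi> x))" .
    have "cmod (LBINT y. ?m y * (\<psi> (x - y) - \<psi> x)) \<le> (LBINT y. cmod (?m y) * e)"
    proof (rule Bochner_Integration.integral_norm_bound_integral)
      show "integrable lborel (\<lambda>y. ?m y * (\<psi> (x - y) - \<psi> x))"
        using Bochner_Integration.integrable_diff[OF int1 int2] by (simp add: algebra_simps)
      show "integrable lborel (\<lambda>y. cmod (?m y) * e)"
        using integral_norm_mollifier(1)[OF r(1), where 'a='a] by simp
      fix y
      show "cmod (?m y * (\<psi> (x - y) - \<psi> x)) \<le> cmod (?m y) * e"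
      proof (cases "norm y < r")
        case True
        then have "cmod (\<psi> (x - y) - \<psi> x) \<le> e" using d(2)[of "x - y" x] r by (simp add: dist_norm)
        then show ?thesis by (simp add: norm_mult mult_left_mono)
      qed (use mollifier_zero[of r y] r in auto)
    qed
    also have "\<dots> = e" using integral_norm_mollifier(2)[OF r(1), where 'a='a] by simp
    finally show ?thesis using eq by simp
  qed
  with d(1) show ?thesis by blast
qed

lemma conv_mollifier_support:
  fixes \<psi> :: "'a::euclidean_space \<Rightarrow> complex"
  assumes "\<And>x. x \<notin> K \<Longrightarrow> \<psi> x = 0" "0 \<le> r" "r \<le> d" "x \<notin> {x + y |x y. x \<in> K \<and> y \<in> cball 0 d}"
  shows "conv \<psi> (mollifier r) x = 0"
proof -
  have "\<psi> y * mollifier r (x - y) = 0" for y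
  proof (cases "y \<in> K")
    case True
    have "norm (x - y) \<ge> r"
    proof (rule ccontr)
      assume "\<not> norm (x - y) \<ge> r"
      then have "x = y + (x - y)" "x - y \<in> cball 0 d" using assms(3) by auto
      then show False using assms(4) True by blast
    qed
    then show ?thesis by (simp add: mollifier_zero assms(2))
  qed (use assms(1) in auto)
  then show ?thesis unfolding conv_def by (simp only: Bochner_Integration.integral_zero)
qed

text \<open>The compact set \<open>L\<close> is chosen before the accuracy \<open>e\<close>, so that
  one integrable bound of the coefficients near \<open>L\<close> controls the error for every
  \<open>e\<close>.\<close>

lemma mollify_C1c:
  fixes \<psi> :: "'a::euclidean_space \<Rightarrow> complex"
  assumes "C1c S \<psi>" "open S"
  obtains L where "compact L" "L \<subseteq> S"
    "\<And>e. e > 0 \<Longrightarrow> \<exists>\<Psi>. (\<forall>k. Ck_on k UNIV \<Psi>) \<and> (\<forall>x. x \<notin> L \<longrightarrow> \<Psi> x = 0) \<and>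
        (\<forall>x. cmod (\<Psi> x - \<psi> x) \<le> e) \<and>
        (\<forall>i\<in>Basis. \<forall>x. cmod (partial_deriv i \<Psi> x - partial_deriv i \<psi> x) \<le> e)"
proof -
  obtain K where K: "compact K" "K \<subseteq> S" "\<And>x. x \<notin> K \<Longrightarrow> \<psi> x = 0"
     "\<And>x. x \<notin> K \<Longrightarrow> frechet_derivative \<psi> (at x) = (\<lambda>v. 0)"
    using C1cE[OF assms(1)] by metis
  obtain d where d: "d > 0" "(\<Union>x\<in>K. ball x d) \<subseteq> S"
    using compact_subset_open_imp_ball_epsilon_subset[OF K(1) assms(2) K(2)] by blast
  define L where "L = {x + y |x y. x \<in> K \<and> y \<in> cball 0 (d/2)}"
  have "compact L" unfolding L_def by (intro compact_sums K compact_cball)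
  moreover have "L \<subseteq> S"
  proof
    fix z assume "z \<in> L"
    then obtain x y where "z = x + y" "x \<in> K" "norm y \<le> d/2" unfolding L_def by auto
    then have "z \<in> ball x d" using d(1) by (simp add: dist_norm)
    with \<open>x \<in> K\<close> d(2) show "z \<in> S" by blast
  qed
  moreover have "\<exists>\<Psi>. (\<forall>k. Ck_on k UNIV \<Psi>) \<and> (\<forall>x. x \<notin> L \<longrightarrow> \<Psi> x = 0) \<and>
        (\<forall>x. cmod (\<Psi> x - \<psi> x) \<le> e) \<and>
        (\<forall>i\<in>Basis. \<forall>x. cmod (partial_deriv i \<Psi> x - partial_deriv i \<psi> x) \<le> e)" if "e > 0" for e
  proof -
    have c0: "continuous_on UNIV \<psi>" by (rule C1c_continuous[OF assms(1)])
    have ci: "continuous_on UNIV (partial_deriv i \<psi>)" for i by (rule C1c_continuous_partial[OF assms(1)])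
    have zi: "partial_deriv i \<psi> x = 0" if "x \<notin> K" for x i using K(4)[OF that] by (simp add: partial_deriv_def)
    obtain d0 where d0: "d0 > 0" "\<And>r x. 0 < r \<Longrightarrow> r < d0 \<Longrightarrow> cmod (conv \<psi> (mollifier r) x - \<psi> x) \<le> e"
      using conv_mollifier_close[OF c0 K(1,3) \<open>e > 0\<close>] by blast
    have "\<exists>\<delta>>0. \<forall>r. 0 < r \<and> r < \<delta> \<longrightarrow> (\<forall>x. cmod (conv (partial_deriv i \<psi>) (mollifier r) x - partial_deriv i \<psi> x) \<le> e)" for i
      by (rule conv_mollifier_close[OF ci K(1) zi \<open>e > 0\<close>])
    then obtain di where di: "\<And>i. di i > 0"
      "\<And>i r x. 0 < r \<Longrightarrow> r < di i \<Longrightarrow> cmod (conv (partial_deriv i \<psi>) (mollifier r) x - partial_deriv i \<psi> x) \<le> e"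
      by metis
    \<comment> \<open>Halved to lie strictly below each of finitely many thresholds:
      \<open>d/2\<close> for the support, \<open>d0\<close> for the function and \<open>di i\<close>
      for its partial derivatives.\<close>
    define r where "r = min (d/2) (min d0 (Min (di ` Basis))) / 2"
    have "Min (di ` Basis) > 0" using di(1) by auto
    then have r: "0 < r" "r < d0" "r \<le> d/2" using d d0 unfolding r_def by auto
    have ri: "r < di i" if "i \<in> Basis" for i
    proof -
      have "Min (di ` Basis) \<le> di i" using that by simp
      moreover have "r \<le> Min (di ` Basis) / 2" unfolding r_def by (simp add: min.coboundedI2)
      ultimately show ?thesis using \<open>Min (di ` Basis) > 0\<close> by linarith
    qed
    let ?m = "mollifier r :: 'a \<Rightarrow> complex"
    have cm: "continuous_on UNIV ?m" using smooth_mollifier[of 0] by simp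
    have zm: "?m y = 0" if "y \<notin> cball 0 r" for y by (rule mollifier_zero) (use that r in auto)
    \<comment> \<open>The derivative rule acts on the second factor, which is \<open>\<psi>\<close>
      once the factors are exchanged; a second exchange restores the form.\<close>
    have pd: "partial_deriv i (conv \<psi> ?m) = conv (partial_deriv i \<psi>) ?m" if "i \<in> Basis" for i
    proof -
      have "partial_deriv i (conv \<psi> ?m) = partial_deriv i (conv ?m \<psi>)"
        by (simp add: conv_commute[OF c0 cm])
      also have "\<dots> = conv ?m (partial_deriv i \<psi>)"
        by (rule partial_deriv_conv[OF cm compact_cball zm C1c_Ck[OF assms(1)] that])
      also have "\<dots> = conv (partial_deriv i \<psi>) ?m" by (rule conv_commute[OF cm ci])
      finally show ?thesis .
    qed
    show ?thesis
    proof (intro exI[of _ "conv \<psi> ?m"] conjI allI ballI impI)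
      show "Ck_on k UNIV (conv \<psi> ?m)" for k
        by (rule smooth_conv[OF c0 K(1,3) smooth_mollifier])
      show "conv \<psi> ?m x = 0" if "x \<notin> L" for x
        by (rule conv_mollifier_support[OF K(3)]) (use r that L_def in auto)
      show "cmod (conv \<psi> ?m x - \<psi> x) \<le> e" for x using d0 r by simp
      show "cmod (partial_deriv i (conv \<psi> ?m) x - partial_deriv i \<psi> x) \<le> e" if "i \<in> Basis" for i x
        using di(2)[OF r(1) ri[OF that]] by (simp add: pd[OF that])
    qed
  qed
  ultimately show ?thesis using that by blast
qed

text \<open>Counterpart for functions that are only continuous: the derivatives of the
  approximations may blow up as \<open>e\<close> tends to 0. It turns a continuous coefficient into
  an admissible factor for integration by parts.\<close>

lemma mollify_continuous:
  fixes \<psi> :: "'a::euclidean_space \<Rightarrow> complex"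
  assumes "continuous_on UNIV \<psi>" "compact K" "K \<subseteq> S" "\<And>x. x \<notin> K \<Longrightarrow> \<psi> x = 0" "open S"
  obtains L where "compact L" "L \<subseteq> S" "K \<subseteq> L"
    "\<And>e. e > 0 \<Longrightarrow> \<exists>\<Psi>. C1c S \<Psi> \<and> (\<forall>x. x \<notin> L \<longrightarrow> \<Psi> x = 0) \<and> (\<forall>x. cmod (\<Psi> x - \<psi> x) \<le> e)"
proof -
  obtain d where d: "d > 0" "(\<Union>x\<in>K. ball x d) \<subseteq> S"
    using compact_subset_open_imp_ball_epsilon_subset[OF assms(2,5,3)] by blast
  define L where "L = {x + y |x y. x \<in> K \<and> y \<in> cball 0 (d/2)}"
  have L1: "compact L" unfolding L_def by (intro compact_sums assms compact_cball)
  moreover have L2: "L \<subseteq> S"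
  proof
    fix z assume "z \<in> L"
    then obtain x y where "z = x + y" "x \<in> K" "norm y \<le> d/2" unfolding L_def by auto
    then have "z \<in> ball x d" using d(1) by (simp add: dist_norm)
    with \<open>x \<in> K\<close> d(2) show "z \<in> S" by blast
  qed
  moreover have "K \<subseteq> L" unfolding L_def using d(1) by force
  moreover have "\<exists>\<Psi>. C1c S \<Psi> \<and> (\<forall>x. x \<notin> L \<longrightarrow> \<Psi> x = 0) \<and> (\<forall>x. cmod (\<Psi> x - \<psi> x) \<le> e)" if "e > 0" for e
  proof -
    obtain d0 where d0: "d0 > 0" "\<And>r x. 0 < r \<Longrightarrow> r < d0 \<Longrightarrow> cmod (conv \<psi> (mollifier r) x - \<psi> x) \<le> e"
      using conv_mollifier_close[OF assms(1,2,4) \<open>e > 0\<close>] by blast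
    define r where "r = min (d/2) d0 / 2"
    have r: "0 < r" "r < d0" "r \<le> d/2" using d d0 unfolding r_def by auto
    have z: "conv \<psi> (mollifier r) x = 0" if "x \<notin> L" for x
      by (rule conv_mollifier_support[OF assms(4)]) (use r that L_def in auto)
    show ?thesis
      using smooth_conv[OF assms(1,2,4) smooth_mollifier[of 1]] d0 r z L1 L2 unfolding C1c_def by blast
  qed
  ultimately show ?thesis using that by blast
qed

section \<open>Regular level sets\<close>

text \<open>Strict differentiability at \<open>p\<close>: both points of the increment vary. It
  follows from the mean value inequality for \<open>g\<close> minus its linearisation, whose
  derivative is small near \<open>p\<close>.\<close>

lemma Ck_on_1_strict_diff:
  fixes g :: "'a::euclidean_space \<Rightarrow> 'b::real_normed_vector"
  assumes "open U" "p \<in> U" "Ck_on 1 U g" "\<kappa> > 0"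
  obtains R where "R > 0" "ball p R \<subseteq> U"
    "\<And>y z. y \<in> ball p R \<Longrightarrow> z \<in> ball p R \<Longrightarrow>
       norm (g y - g z - frechet_derivative g (at p) (y - z)) \<le> \<kappa> * norm (y - z)"
proof -
  have gd: "g differentiable (at x)" if "x \<in> U" for x using assms(3) that unfolding Ck_on_1 by blast
  define S where "S x = (\<Sum>i\<in>Basis. norm (partial_deriv i g x - partial_deriv i g p))" for x
  have "continuous_on U S"
    unfolding S_def using assms(3) by (intro continuous_intros) (auto simp: Ck_on_1)
  then have "isCont S p" using assms(1,2) continuous_on_eq_continuous_at by blast
  moreover have "S p = 0" by (simp add: S_def)
  ultimately have "(S \<longlongrightarrow> 0) (at p)" unfolding isCont_def by metis
  then obtain R1 where R1: "R1 > 0" "\<And>x. x \<noteq> p \<Longrightarrow> dist x p < R1 \<Longrightarrow> dist (S x) 0 < \<kappa>"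
    using assms(4) unfolding Lim_at by (metis zero_less_dist_iff)
  then have S: "S x \<le> \<kappa>" if "dist x p < R1" for x
    using that assms(4) \<open>S p = 0\<close> by (cases "x = p") (force simp: dist_real_def)+
  obtain R2 where R2: "R2 > 0" "ball p R2 \<subseteq> U" using assms(1,2) open_contains_ball by blast
  define R where "R = min R1 R2"
  have R: "R > 0" "ball p R \<subseteq> U" using R1 R2 by (auto simp: R_def)
  let ?A = "frechet_derivative g (at p)"
  have blA: "bounded_linear ?A"
    using has_derivative_frechet[OF gd[OF assms(2)]] has_derivative_bounded_linear by blast
  show ?thesis
  proof (rule that[OF R])
    fix y z assume yz: "y \<in> ball p R" "z \<in> ball p R"
    have "norm ((g y - ?A y) - (g z - ?A z)) \<le> \<kappa> * norm (y - z)"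
    proof (rule differentiable_bound[of "ball p R"])
      fix x assume x: "x \<in> ball p R"
      then have xU: "x \<in> U" using R by auto
      show "((\<lambda>y. g y - ?A y) has_derivative (\<lambda>v. frechet_derivative g (at x) v - ?A v)) (at x within ball p R)"
        by (rule has_derivative_at_withinI[OF has_derivative_diff[OF has_derivative_frechet[OF gd[OF xU]]
              bounded_linear_imp_has_derivative[OF blA]]])
      show "onorm (\<lambda>v. frechet_derivative g (at x) v - ?A v) \<le> \<kappa>"
      proof (rule onorm_bound)
        fix v
        have "frechet_derivative g (at x) v - ?A v =
            (\<Sum>i\<in>Basis. (v \<bullet> i) *\<^sub>R (partial_deriv i g x - partial_deriv i g p))"
          unfolding frechet_derivative_sum_partial[OF gd[OF xU]] frechet_derivative_sum_partial[OF gd[OF assms(2)]]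
          by (simp add: sum_subtractf scaleR_diff_right)
        also have "norm \<dots> \<le> (\<Sum>i\<in>Basis. norm ((v \<bullet> i) *\<^sub>R (partial_deriv i g x - partial_deriv i g p)))"
          by (rule norm_sum)
        also have "\<dots> \<le> (\<Sum>i\<in>Basis. norm v * norm (partial_deriv i g x - partial_deriv i g p))"
          by (intro sum_mono) (simp add: Basis_le_norm mult_right_mono)
        also have "\<dots> = norm v * S x" by (simp add: S_def sum_distrib_left)
        also have "\<dots> \<le> norm v * \<kappa>"
          using S[of x] x by (intro mult_left_mono) (auto simp: R_def dist_commute)
        finally show "norm (frechet_derivative g (at x) v - ?A v) \<le> \<kappa> * norm v" by (simp add: mult.commute)
      qed (use assms in simp)
    qed (use yz in auto)
    then show "norm (g y - g z - ?A (y - z)) \<le> \<kappa> * norm (y - z)"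
      by (simp add: linear_diff[OF bounded_linear.linear[OF blA]] algebra_simps)
  qed
qed

text \<open>Near \<open>p\<close> the level set meets each ray from \<open>p - v\<close> at most
  once, since such rays have directions close to \<open>v\<close>, along which \<open>\<rho>\<close>
  is strictly monotone. A closed set with this starlike property is negligible.\<close>

lemma negligible_regular_level_aux:
  fixes \<rho> :: "'a::euclidean_space \<Rightarrow> real"
  assumes "open U" "p \<in> U" "Ck_on 1 U \<rho>" "frechet_derivative \<rho> (at p) v > 0"
  obtains r where "r > 0" "negligible {x \<in> ball p r. \<rho> x = 0}"
proof -
  let ?A = "frechet_derivative \<rho> (at p)"
  define c where "c = ?A v"
  have c: "c > 0" using assms(4) by (simp add: c_def)
  have dp: "\<rho> differentiable (at p)" using assms unfolding Ck_on_1 by blast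
  have blA: "bounded_linear ?A"
    using has_derivative_frechet[OF dp] has_derivative_bounded_linear by blast
  obtain L where L: "L > 0" "\<And>w. norm (?A w) \<le> norm w * L"
    using bounded_linear.pos_bounded[OF blA] by blast
  \<comment> \<open>Direction vectors have norm at most \<open>norm v + 1\<close>; the linearisation
    error is then at most c/4, against a directional derivative of at least 3c/4.\<close>
  define \<kappa> where "\<kappa> = c / (4 * (norm v + 1))"
  have nv: "norm v + 1 > 0" by (smt (verit) norm_ge_zero)
  then have \<kappa>: "\<kappa> > 0" "\<kappa> * (norm v + 1) = c / 4" using c by (auto simp: \<kappa>_def field_simps)
  obtain R where R: "R > 0" "ball p R \<subseteq> U"
    "\<And>y z. y \<in> ball p R \<Longrightarrow> z \<in> ball p R \<Longrightarrow> norm (\<rho> y - \<rho> z - ?A (y - z)) \<le> \<kappa> * norm (y - z)"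
    using Ck_on_1_strict_diff[OF assms(1-3) \<kappa>(1)] by blast
  define r where "r = min (R/2) (min 1 (c / (4 * L)))"
  have r: "r > 0" "r \<le> R/2" "r \<le> 1" "r * L \<le> c / 4"
  proof -
    show "r > 0" "r \<le> R/2" "r \<le> 1" unfolding r_def using R(1) c L(1) by auto
    have "r \<le> c / (4 * L)" unfolding r_def by simp
    then show "r * L \<le> c / 4" using L(1) by (simp add: field_simps)
  qed
  define S where "S = {x \<in> cball p r. \<rho> x = 0}"
  have sub: "cball p r \<subseteq> ball p R" using r R(1) by auto
  have "continuous_on (cball p r) \<rho>"
    using Ck_on_1_continuous[OF assms(3)] continuous_on_subset sub R(2) by blast
  then have "closed S" unfolding S_def
    using continuous_closed_preimage_constant[of "cball p r" \<rho> 0] by simp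
  then have "negligible S"
  proof (rule starlike_negligible[where a = "p - v"])
    fix t x assume h: "p - v + t *\<^sub>R x \<in> S" "0 \<le> t" "p - v + x \<in> S"
    let ?y = "p - v + x" and ?z = "p - v + t *\<^sub>R x"
    have yz: "?y \<in> ball p R" "?z \<in> ball p R" using h sub unfolding S_def by blast+
    have d: "?y - ?z = (1 - t) *\<^sub>R x" by (simp add: algebra_simps)
    define e where "e = x - v"
    have "norm e \<le> r" using h(3) unfolding S_def e_def by (simp add: dist_norm norm_minus_commute algebra_simps)
    then have xv: "x = v + e" "norm e \<le> r" by (auto simp: e_def)
    have "norm (?A ((1 - t) *\<^sub>R x)) \<le> \<kappa> * norm ((1 - t) *\<^sub>R x)"
      using R(3)[OF yz] h unfolding S_def d by simp
    then have 1: "\<bar>1 - t\<bar> * \<bar>?A x\<bar> \<le> \<kappa> * (\<bar>1 - t\<bar> * norm x)"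
      using linear_scale[OF bounded_linear.linear[OF blA]] by (simp add: abs_mult)
    have "\<bar>?A e\<bar> \<le> norm e * L" using L(2)[of e] by simp
    also have "\<dots> \<le> r * L" using xv(2) L(1) by (simp add: mult_right_mono)
    finally have "\<bar>?A e\<bar> \<le> c / 4" using r(4) by linarith
    moreover have "?A x = c + ?A e"
      unfolding xv(1) c_def using linear_add[OF bounded_linear.linear[OF blA]] by simp
    ultimately have 2: "\<bar>?A x\<bar> \<ge> 3 * c / 4" by linarith
    have "norm x \<le> norm v + 1" using xv r(3) norm_triangle_ineq[of v e] by simp
    then have "\<kappa> * norm x \<le> c / 4" using \<kappa> by (metis less_eq_real_def mult_left_mono)
    then have "\<bar>1 - t\<bar> * (\<kappa> * norm x) \<le> \<bar>1 - t\<bar> * (c / 4)" by (rule mult_left_mono) simp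
    moreover have "\<bar>1 - t\<bar> * (3 * c / 4) \<le> \<bar>1 - t\<bar> * \<bar>?A x\<bar>" using 2 by (rule mult_left_mono) simp
    ultimately have "\<bar>1 - t\<bar> * (3 * c / 4) \<le> \<bar>1 - t\<bar> * (c / 4)" using 1 by (simp add: algebra_simps)
    then have "\<bar>1 - t\<bar> * c \<le> 0" by (simp add: algebra_simps)
    then have "\<bar>1 - t\<bar> \<le> 0" using c by (simp add: mult_le_0_iff)
    then show "t = 1" by simp
  qed
  moreover have "{x \<in> ball p r. \<rho> x = 0} \<subseteq> S" unfolding S_def by auto
  ultimately have "negligible {x \<in> ball p r. \<rho> x = 0}" using negligible_subset by blast
  with r(1) that show ?thesis by blast
qed

text \<open>Negligibility is a local property. Regularity is asked of the points and not of
  \<open>U\<close>, so that the real and imaginary parts of an arbitrary C^1 function are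
  covered.\<close>

lemma negligible_regular_level:
  fixes \<rho> :: "'a::euclidean_space \<Rightarrow> real"
  assumes "open U" "Ck_on 1 U \<rho>"
  shows "negligible {x \<in> U. \<rho> x = 0 \<and> (\<exists>v. frechet_derivative \<rho> (at x) v \<noteq> 0)}" (is "negligible ?S")
proof (subst locally_negligible_alt, rule ballI)
  fix p assume p: "p \<in> ?S"
  then obtain v0 where v0: "frechet_derivative \<rho> (at p) v0 \<noteq> 0" by blast
  have pU: "p \<in> U" using p by blast
  then have "\<rho> differentiable (at p)" using assms unfolding Ck_on_1 by simp
  then have "linear (frechet_derivative \<rho> (at p))" by (rule linear_frechet_derivative)
  then have neg: "frechet_derivative \<rho> (at p) (- v0) = - frechet_derivative \<rho> (at p) v0" by (rule linear_neg)
  define v where "v = (if frechet_derivative \<rho> (at p) v0 > 0 then v0 else - v0)"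
  have "frechet_derivative \<rho> (at p) v > 0" using v0 neg by (auto simp: v_def)
  from negligible_regular_level_aux[OF assms(1) pU assms(2) this]
  obtain r where r: "r > 0" "negligible {x \<in> ball p r. \<rho> x = 0}" by auto
  have "?S \<inter> ball p r \<subseteq> {x \<in> ball p r. \<rho> x = 0}" by blast
  then have "negligible (?S \<inter> ball p r)" using r(2) negligible_subset by blast
  moreover have "openin (top_of_set ?S) (?S \<inter> ball p r)" by (simp add: openin_open_Int)
  moreover have "p \<in> ?S \<inter> ball p r" using p r by simp
  ultimately show "\<exists>W. openin (top_of_set ?S) W \<and> p \<in> W \<and> negligible W" by blast
qed

section \<open>Regularity across the interface\<close>

text \<open>The derivative is evaluated on the open segment and in its direction, so the endpoints
  may lie on the interface, where \<open>g\<close> is merely known to be continuous.\<close>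

lemma segment_bound:
  fixes g :: "'a::real_normed_vector \<Rightarrow> 'b::real_normed_vector"
  assumes "continuous_on (closed_segment a b) g"
    and "\<And>x. x \<in> open_segment a b \<Longrightarrow> (g has_derivative G x) (at x)"
    and "\<And>x. x \<in> open_segment a b \<Longrightarrow> norm (G x (b - a)) \<le> e * norm (b - a)"
  shows "norm (g b - g a) \<le> e * norm (b - a)"
proof (cases "a = b")
  case False
  let ?\<phi> = "\<lambda>t. a + t *\<^sub>R (b - a)"
  have op: "?\<phi> t \<in> open_segment a b" if "0 < t" "t < 1" for t
    using that False unfolding in_segment by (auto intro!: exI[of _ t] simp: algebra_simps)
  have "norm ((g \<circ> ?\<phi>) 1 - (g \<circ> ?\<phi>) 0) \<le> 1 * (e * norm (b - a)) - 0 * (e * norm (b - a))"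
  proof (rule differentiable_bound_general)
    show "continuous_on {0..1} (g \<circ> ?\<phi>)"
    proof (rule continuous_on_compose)
      have "?\<phi> ` {0..1} \<subseteq> closed_segment a b"
      proof (clarsimp)
        fix t :: real assume "0 \<le> t" "t \<le> 1"
        moreover have "a + t *\<^sub>R (b - a) = (1 - t) *\<^sub>R a + t *\<^sub>R b" by (simp add: algebra_simps)
        ultimately show "a + t *\<^sub>R (b - a) \<in> closed_segment a b" unfolding in_segment by blast
      qed
      then show "continuous_on (?\<phi> ` {0..1}) g" using assms(1) continuous_on_subset by blast
    qed (auto intro!: continuous_intros)
    show "((g \<circ> ?\<phi>) has_vector_derivative G (?\<phi> t) (b - a)) (at t)" if "0 < t" "t < 1" for t
    proof -
      have d: "(g has_derivative G (?\<phi> t)) (at (?\<phi> t))" using assms(2)[OF op[OF that]] .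
      have "((\<lambda>t. g (?\<phi> t)) has_derivative (\<lambda>s. G (?\<phi> t) (s *\<^sub>R (b - a)))) (at t)"
        by (rule has_derivative_compose[of "?\<phi>" _ _ _ g]) (use d in \<open>auto intro!: derivative_eq_intros\<close>)
      then show ?thesis unfolding has_vector_derivative_def o_def
        by (simp add: linear_scale[OF has_derivative_linear[OF d]])
    qed
    show "norm (G (?\<phi> t) (b - a)) \<le> e * norm (b - a)" if "0 < t" "t < 1" for t
      using assms(3)[OF op[OF that]] .
  qed (auto intro!: continuous_intros derivative_eq_intros simp: has_vector_derivative_def)
  then show ?thesis by simp
qed simp

text \<open>One-sided first order expansion at a boundary point \<open>p\<close> of
  \<open>X\<close>. The straight segment from \<open>p\<close> to \<open>x\<close> may leave
  \<open>X\<close>; a detour goes from \<open>p\<close> by \<open>M * dist x p\<close> along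
  \<open>v\<close>, then across, then back down to \<open>x\<close>. On each leg the derivative of
  \<open>g\<close> minus \<Lambda> is small, and the total length is
  \<open>(2 * M + 1) * dist x p\<close>.\<close>

lemma one_sided_diff:
  fixes g :: "'a::euclidean_space \<Rightarrow> 'b::real_normed_vector"
  assumes cont: "continuous_on (ball p R) g" and R: "R > 0"
    and v: "norm v = 1" and M: "M \<ge> 0"
    and der: "\<And>x. x \<in> X \<Longrightarrow> x \<in> ball p R \<Longrightarrow> (g has_derivative D x) (at x)"
    and bl: "bounded_linear \<Lambda>"
    and lim: "\<And>e. e > 0 \<Longrightarrow> \<exists>r>0. \<forall>x\<in>X. dist x p < r \<longrightarrow> (\<forall>w. norm (D x w - \<Lambda> w) \<le> e * norm w)"
    and cone: "\<And>x t. x \<in> Y \<Longrightarrow> dist x p < R \<Longrightarrow> 0 < t \<Longrightarrow> t \<le> M * dist x p \<Longrightarrow> p + t *\<^sub>R v \<in> X \<and> x + t *\<^sub>R v \<in> X"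
    and top: "\<And>x. x \<in> Y \<Longrightarrow> dist x p < R \<Longrightarrow> x \<noteq> p \<Longrightarrow>
       closed_segment (p + (M * dist x p) *\<^sub>R v) (x + (M * dist x p) *\<^sub>R v) \<subseteq> X"
    and "e > 0"
  shows "\<exists>r>0. \<forall>x\<in>Y. dist x p < r \<longrightarrow> norm (g x - g p - \<Lambda> (x - p)) \<le> e * norm (x - p)"
proof -
  define e' where "e' = e / (2 * M + 1)"
  have e': "e' > 0" "e' * (2 * M + 1) = e" using M \<open>e > 0\<close> by (auto simp: e'_def)
  obtain r0 where r0: "r0 > 0" "\<And>x w. x \<in> X \<Longrightarrow> dist x p < r0 \<Longrightarrow> norm (D x w - \<Lambda> w) \<le> e' * norm w"
    using lim[OF e'(1)] by blast
  define s where "s = min r0 R"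
  have s: "s > 0" "s \<le> r0" "s \<le> R" using r0 R by (auto simp: s_def)
  define h where "h = (\<lambda>x. g x - \<Lambda> x)"
  have seg: "norm (h b - h a) \<le> e' * norm (b - a)"
    if "a \<in> ball p s" "b \<in> ball p s" "open_segment a b \<subseteq> X" for a b
  proof (rule segment_bound)
    have sub: "closed_segment a b \<subseteq> ball p s" using that(1,2) convex_ball closed_segment_subset by blast
    have "closed_segment a b \<subseteq> ball p R" using sub s(3) subset_ball by blast
    then show "continuous_on (closed_segment a b) h" unfolding h_def
      by (rule continuous_on_diff[OF continuous_on_subset[OF cont] linear_continuous_on[OF bl]])
    fix x assume "x \<in> open_segment a b"
    then have x: "x \<in> X" "x \<in> ball p s" using that(3) sub segment_open_subset_closed by blast+
    then have "x \<in> ball p R" using s(3) by auto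
    then show "(h has_derivative (\<lambda>w. D x w - \<Lambda> w)) (at x)" unfolding h_def
      using x by (intro has_derivative_diff[OF der bounded_linear_imp_has_derivative[OF bl]])
    show "norm (D x (b - a) - \<Lambda> (b - a)) \<le> e' * norm (b - a)"
      using r0(2)[OF x(1)] x(2) s(2) by (simp add: dist_commute)
  qed
  \<comment> \<open>Points of the detour are within \<open>(M + 1) * dist x p\<close> of
    \<open>p\<close>; the divisor \<open>M + 2\<close> keeps them strictly inside
    \<open>ball p s\<close>.\<close>
  define r where "r = s / (M + 2)"
  have r: "r > 0" "(M + 1) * r < s" using s(1) M by (auto simp: r_def field_simps)
  show ?thesis
  proof (intro exI[of _ r] conjI ballI impI r(1))
    fix x assume x: "x \<in> Y" "dist x p < r"
    define d where "d = dist x p"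
    show "norm (g x - g p - \<Lambda> (x - p)) \<le> e * norm (x - p)"
    proof (cases "x = p")
      case False
      then have d: "d > 0" "d < r" "norm (x - p) = d" using x by (auto simp: d_def dist_norm)
      have "r \<le> s" using r M by (smt (verit) mult_right_mono mult_cancel_right1)
      then have xR: "dist x p < R" using s(3) d by (simp add: d_def)
      have "(M + 1) * d \<le> (M + 1) * r" using M d by (intro mult_left_mono) auto
      then have Ms: "M * d + d < s" using r(2) by (simp add: algebra_simps)
      let ?a = "p + (M * d) *\<^sub>R v" and ?b = "x + (M * d) *\<^sub>R v"
      have "dist p x < s" using \<open>r \<le> s\<close> x(2) by (simp add: dist_commute)
      then have in1: "p \<in> ball p s" "x \<in> ball p s" using s(1) by simp_all
      have "norm ((M * d) *\<^sub>R v) = M * d" using M d v by simp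
      then have in2: "?a \<in> ball p s" using Ms d by (simp add: dist_norm)
      have "dist p ?b \<le> norm (x - p) + norm ((M * d) *\<^sub>R v)"
        by (metis add_diff_eq dist_norm norm_minus_commute norm_triangle_ineq add_diff_cancel_left' diff_add_eq)
      then have in3: "?b \<in> ball p s" using Ms d \<open>norm ((M * d) *\<^sub>R v) = M * d\<close> by simp
      have os: "open_segment q (q + (M * d) *\<^sub>R v) \<subseteq> {q + t *\<^sub>R v |t. 0 < t \<and> t \<le> M * d}" for q
      proof
        fix z assume "z \<in> open_segment q (q + (M * d) *\<^sub>R v)"
        then obtain u where u: "0 < u" "u < 1" "z = (1 - u) *\<^sub>R q + u *\<^sub>R (q + (M * d) *\<^sub>R v)" "q \<noteq> q + (M * d) *\<^sub>R v"
          unfolding in_segment by blast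
        then have "M * d \<noteq> 0" by auto
        then have Md: "M * d > 0" using M d by (simp add: mult_nonneg_nonneg order_less_le)
        have "z = q + (u * (M * d)) *\<^sub>R v" using u(3) by (simp add: algebra_simps)
        moreover have "0 < u * (M * d)" "u * (M * d) \<le> M * d" using u Md by (auto simp: mult_left_le_one_le)
        ultimately show "z \<in> {q + t *\<^sub>R v |t. 0 < t \<and> t \<le> M * d}" by blast
      qed
      have cone': "p + t *\<^sub>R v \<in> X" "x + t *\<^sub>R v \<in> X" if "0 < t" "t \<le> M * d" for t
        using cone[OF x(1) xR, of t] that by (simp_all add: d_def)
      have o1: "open_segment p ?a \<subseteq> X" using os[of p] cone'(1) by blast
      have o2: "open_segment x ?b \<subseteq> X" using os[of x] cone'(2) by blast
      have "closed_segment ?a ?b \<subseteq> X" using top[OF x(1) xR False] by (simp add: d_def)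
      then have o3: "open_segment ?a ?b \<subseteq> X" using segment_open_subset_closed by blast
      have "norm (h ?a - h p) \<le> e' * (M * d)" using seg[OF in1(1) in2 o1] M d v by simp
      moreover have "norm (h ?b - h x) \<le> e' * (M * d)" using seg[OF in1(2) in3 o2] M d v by simp
      moreover have "norm (h ?b - h ?a) \<le> e' * d" using seg[OF in2 in3 o3] d by simp
      moreover have "norm (h x - h p) \<le> norm (h ?a - h p) + norm (h ?b - h x) + norm (h ?b - h ?a)"
      proof -
        have "h x - h p = (h ?a - h p) - (h ?b - h x) + (h ?b - h ?a)" by simp
        then show ?thesis by (smt (verit) norm_triangle_ineq norm_triangle_ineq4)
      qed
      ultimately have "norm (h x - h p) \<le> e' * (2 * M + 1) * d" by (simp add: algebra_simps)
      then have "norm (h x - h p) \<le> e * norm (x - p)" using e'(2) d by simp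
      moreover have "h x - h p = g x - g p - \<Lambda> (x - p)"
        unfolding h_def by (simp add: linear_diff[OF bounded_linear.linear[OF bl]])
      ultimately show ?thesis by simp
    qed (use linear_0[OF bounded_linear.linear[OF bl]] in simp)
  qed
qed

text \<open>Supplies the detour of the preceding lemma. Moving along \<open>v\<close> increases
  \<open>\<rho>\<close> at rate at least c/2, and lifting by \<open>M * dist x p\<close> outweighs
  the loss of at most \<open>L * dist x p\<close> on the way across: with
  \<open>M = 2 * L / c + 2\<close> the surplus c M/2 - L - c/2 equals c/2.\<close>

lemma cone_positive:
  fixes \<rho> :: "'a::euclidean_space \<Rightarrow> real"
  assumes strict: "\<And>y z. y \<in> ball p R \<Longrightarrow> z \<in> ball p R \<Longrightarrow> \<bar>\<rho> y - \<rho> z - A (y - z)\<bar> \<le> c / 2 * norm (y - z)"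
    and A: "linear A" "\<And>w. \<bar>A w\<bar> \<le> L * norm w" and c: "A v = c" "c > 0" and v: "norm v = 1" and L: "L \<ge> 0"
    and \<rho>p: "\<rho> p = 0" and x: "\<rho> x \<ge> 0" and M: "M = 2 * L / c + 2" and xR: "(M + 1) * dist x p < R"
  shows "\<And>t. 0 < t \<Longrightarrow> t \<le> M * dist x p \<Longrightarrow> p + t *\<^sub>R v \<in> ball p R \<and> \<rho> (p + t *\<^sub>R v) > 0"
    and "\<And>t. 0 < t \<Longrightarrow> t \<le> M * dist x p \<Longrightarrow> x + t *\<^sub>R v \<in> ball p R \<and> \<rho> (x + t *\<^sub>R v) > 0"
    and "x \<noteq> p \<Longrightarrow> y \<in> closed_segment (p + (M * dist x p) *\<^sub>R v) (x + (M * dist x p) *\<^sub>R v) \<Longrightarrow>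
           y \<in> ball p R \<and> \<rho> y > 0"
proof -
  define d where "d = dist x p"
  have d0: "d \<ge> 0" "norm (x - p) = d" by (auto simp: d_def dist_norm)
  have M0: "M \<ge> 2" using M L c(2) by simp
  have Md: "M * d + d < R" using xR by (simp add: d_def algebra_simps)
  have MdR: "d < R" "M * d < R" using Md d0 M0 by (smt (verit) mult_nonneg_nonneg)+
  have R: "R > 0" using MdR d0 by linarith
  have pR: "p \<in> ball p R" "x \<in> ball p R" using R MdR by (auto simp: d_def dist_commute)
  have bd: "dist p (q + t *\<^sub>R v) \<le> dist p q + t" if "t \<ge> 0" for q t
    using dist_triangle[of p "q + t *\<^sub>R v" q] that v by (simp add: dist_norm)
  have Atv: "A (t *\<^sub>R v) = t * c" for t using linear_scale[OF A(1)] c by simp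
  have grow: "\<rho> (q + t *\<^sub>R v) > 0" if "q \<in> ball p R" "q + t *\<^sub>R v \<in> ball p R" "0 < t" "\<rho> q \<ge> 0" for q t
  proof -
    have "\<bar>\<rho> (q + t *\<^sub>R v) - \<rho> q - t * c\<bar> \<le> c / 2 * t"
      using strict[OF that(2,1)] that(3) v by (simp add: Atv)
    moreover have "t * c > 0" using c that by simp
    moreover have "c / 2 * t = t * c / 2" by simp
    ultimately show ?thesis using that(4) by linarith
  qed
  show "p + t *\<^sub>R v \<in> ball p R \<and> \<rho> (p + t *\<^sub>R v) > 0" if "0 < t" "t \<le> M * dist x p" for t
  proof -
    have "p + t *\<^sub>R v \<in> ball p R" using bd[of t p] that MdR by (simp add: d_def)
    then show ?thesis using grow[OF pR(1)] that \<rho>p by simp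
  qed
  show "x + t *\<^sub>R v \<in> ball p R \<and> \<rho> (x + t *\<^sub>R v) > 0" if "0 < t" "t \<le> M * dist x p" for t
  proof -
    have "x + t *\<^sub>R v \<in> ball p R" using bd[of t x] that Md by (simp add: d_def dist_commute)
    then show ?thesis using grow[OF pR(2)] that x by simp
  qed
  show "y \<in> ball p R \<and> \<rho> y > 0" if xy: "x \<noteq> p" "y \<in> closed_segment (p + (M * dist x p) *\<^sub>R v) (x + (M * dist x p) *\<^sub>R v)"
  proof -
    have d: "d > 0" using xy by (simp add: d_def)
    obtain s where s: "0 \<le> s" "s \<le> 1" "y = (1 - s) *\<^sub>R (p + (M * d) *\<^sub>R v) + s *\<^sub>R (x + (M * d) *\<^sub>R v)"
      using xy(2) unfolding in_segment d_def by blast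
    have yp: "y - p = (M * d) *\<^sub>R v + s *\<^sub>R (x - p)" using s(3) by (simp add: algebra_simps)
    have sd: "s * d \<le> d" using s d by (simp add: mult_left_le_one_le)
    have "norm (y - p) \<le> M * d + s * d"
      unfolding yp using norm_triangle_ineq[of "(M * d) *\<^sub>R v" "s *\<^sub>R (x - p)"] v s d0 M0 by simp
    then have n: "norm (y - p) \<le> M * d + d" using sd by linarith
    then have yR: "y \<in> ball p R" using Md by (simp add: dist_norm norm_minus_commute)
    have "\<bar>A (s *\<^sub>R (x - p))\<bar> \<le> L * (s * d)" using A(2)[of "s *\<^sub>R (x - p)"] s d0 by simp
    also have "\<dots> \<le> L * d" using sd L by (rule mult_left_mono)
    finally have "A (y - p) \<ge> M * d * c - L * d"
      unfolding yp linear_add[OF A(1)] Atv by linarith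
    moreover have "\<bar>\<rho> y - A (y - p)\<bar> \<le> c / 2 * (M * d + d)"
      using strict[OF yR pR(1)] \<rho>p n c(2) by (smt (verit) mult_left_mono half_gt_zero)
    ultimately have "\<rho> y \<ge> M * d * c - L * d - c / 2 * (M * d + d)" by linarith
    also have "M * d * c - L * d - c / 2 * (M * d + d) = d * (c * M / 2 - L - c / 2)" by (simp add: field_simps)
    also have "c * M / 2 - L - c / 2 = c / 2" using c(2) by (simp add: M field_simps)
    finally have "\<rho> y \<ge> d * (c / 2)" .
    moreover have "d * (c / 2) > 0" using d c(2) by simp
    ultimately show ?thesis using yR by linarith
  qed
qed

text \<open>\<open>N\<close> vanishes on \<open>v\<close>, so it depends only on the component
  \<tau> in the kernel of \<open>A\<close>. The level set contains points p + h \<tau> + s v with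
  |s| \<le> e h, and there N applied to the displacement is h N \<tau>; smallness of
  \<open>N\<close> along the level set forces N \<tau> = 0.\<close>

lemma tangent_agree:
  fixes N :: "'a::euclidean_space \<Rightarrow> 'b::real_normed_vector" and \<rho> :: "'a \<Rightarrow> real"
  assumes N: "bounded_linear N" "N v = 0"
    and \<rho>: "(\<rho> has_derivative A) (at p)" "\<rho> p = 0" "A v > 0" "norm v = 1"
    and cont: "continuous_on (ball p R) \<rho>" "R > 0"
    and small: "\<And>e. e > 0 \<Longrightarrow> \<exists>r>0. \<forall>x. dist x p < r \<longrightarrow> \<rho> x = 0 \<longrightarrow> norm (N (x - p)) \<le> e * norm (x - p)"
  shows "N w = 0"
proof -
  have linA: "linear A" using \<rho>(1) has_derivative_linear by blast
  have linN: "linear N" using N(1) by (rule bounded_linear.linear)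
  \<comment> \<open>Projection to the kernel of \<open>A\<close> along \<open>v\<close>; it need not
    be the orthogonal one.\<close>
  define \<tau> where "\<tau> = w - (A w / A v) *\<^sub>R v"
  have A\<tau>: "A \<tau> = 0" unfolding \<tau>_def using \<rho>(3) linear_diff[OF linA] linear_scale[OF linA] by simp
  have N\<tau>: "N \<tau> = N w" unfolding \<tau>_def using N(2) linear_diff[OF linN] linear_scale[OF linN] by simp
  define c where "c = A v"
  have c: "c > 0" using \<rho>(3) c_def by simp
  have bound: "norm (N \<tau>) \<le> e * (norm \<tau> + 1)" if e: "0 < e" "e \<le> 1" for e
  proof -
    have nt: "norm \<tau> + 1 > 0" by (smt (verit) norm_ge_zero)
    define \<kappa> where "\<kappa> = e * c / (2 * (norm \<tau> + 1))"
    have \<kappa>: "\<kappa> > 0" "\<kappa> * (norm \<tau> + 1) = e * c / 2" using c e nt by (auto simp: \<kappa>_def field_simps)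
    obtain r1 where r1: "r1 > 0" "\<And>y. norm (y - p) < r1 \<Longrightarrow> norm (\<rho> y - \<rho> p - A (y - p)) \<le> \<kappa> * norm (y - p)"
      using \<rho>(1) \<kappa>(1) unfolding has_derivative_at_alt by blast
    obtain r2 where r2: "r2 > 0" "\<And>x. dist x p < r2 \<Longrightarrow> \<rho> x = 0 \<Longrightarrow> norm (N (x - p)) \<le> e * norm (x - p)"
      using small[OF e(1)] by blast
    define m where "m = min R (min r1 r2)"
    have m: "m > 0" using r1 r2 cont by (simp add: m_def)
    define h where "h = m / (2 * (norm \<tau> + 1))"
    have "h > 0" using m nt by (simp add: h_def)
    moreover have "h * (norm \<tau> + 1) = m / 2" unfolding h_def using nt
      by (metis nonzero_mult_divide_mult_cancel_right less_irrefl times_divide_eq_left)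
    ultimately have h: "h > 0" "h * (norm \<tau> + 1) = m / 2" by auto
    then have h: "h > 0" "h * (norm \<tau> + 1) < m" using m by auto
    have nb: "norm (h *\<^sub>R \<tau> + s *\<^sub>R v) \<le> h * (norm \<tau> + 1)" if "\<bar>s\<bar> \<le> e * h" for s
    proof -
      have "norm (h *\<^sub>R \<tau> + s *\<^sub>R v) \<le> h * norm \<tau> + \<bar>s\<bar>"
        using norm_triangle_ineq[of "h *\<^sub>R \<tau>" "s *\<^sub>R v"] h \<rho>(4) by simp
      moreover have "e * h \<le> h" using e h by (simp add: mult_left_le_one_le)
      ultimately show ?thesis using that by (simp add: algebra_simps)
    qed
    have est: "\<bar>\<rho> (p + (h *\<^sub>R \<tau> + s *\<^sub>R v)) - s * c\<bar> \<le> e * c / 2 * h" if s: "\<bar>s\<bar> \<le> e * h" for s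
    proof -
      let ?z = "h *\<^sub>R \<tau> + s *\<^sub>R v"
      have "norm (\<rho> (p + ?z) - \<rho> p - A (p + ?z - p)) \<le> \<kappa> * norm (p + ?z - p)"
        using nb[OF s] h m by (intro r1(2)) (simp add: m_def)
      moreover have "A ?z = s * c"
        by (simp add: linear_add[OF linA] linear_scale[OF linA] A\<tau> c_def)
      moreover have "\<kappa> * norm ?z \<le> \<kappa> * (h * (norm \<tau> + 1))" using nb[OF s] \<kappa>(1) by (intro mult_left_mono) auto
      moreover have "\<kappa> * (h * (norm \<tau> + 1)) = e * c / 2 * h"
        using \<kappa>(2) by (metis mult.assoc mult.commute)
      ultimately show ?thesis using \<rho>(2) by simp
    qed
    have ehc: "e * h * c > 0" using e h c by simp
    \<comment> \<open>Intermediate value theorem: at s = -e h and s = e h the linear part s c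
      dominates the error \<open>e * c / 2 * h\<close>, so \<open>\<rho>\<close> changes
      sign.\<close>
    have "\<exists>s\<ge>- (e * h). s \<le> e * h \<and> \<rho> (p + (h *\<^sub>R \<tau> + s *\<^sub>R v)) = 0"
    proof (rule IVT')
      show "\<rho> (p + (h *\<^sub>R \<tau> + (- (e * h)) *\<^sub>R v)) \<le> 0"
      proof -
        have "\<bar>\<rho> (p + (h *\<^sub>R \<tau> + (- (e * h)) *\<^sub>R v)) - (- (e * h)) * c\<bar> \<le> e * c / 2 * h"
          using e h by (intro est) simp
        moreover have "e * c / 2 * h = e * h * c / 2" "(- (e * h)) * c = - (e * h * c)" by simp_all
        ultimately show ?thesis using ehc by linarith
      qed
      show "0 \<le> \<rho> (p + (h *\<^sub>R \<tau> + (e * h) *\<^sub>R v))"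
      proof -
        have "\<bar>\<rho> (p + (h *\<^sub>R \<tau> + (e * h) *\<^sub>R v)) - (e * h) * c\<bar> \<le> e * c / 2 * h"
          using e h by (intro est) simp
        moreover have "e * c / 2 * h = e * h * c / 2" by simp
        ultimately show ?thesis using ehc by linarith
      qed
      show "- (e * h) \<le> e * h" using e h by simp
      show "continuous_on {- (e * h)..e * h} (\<lambda>s. \<rho> (p + (h *\<^sub>R \<tau> + s *\<^sub>R v)))"
      proof (rule continuous_on_compose2[OF cont(1)])
        show "(\<lambda>s. p + (h *\<^sub>R \<tau> + s *\<^sub>R v)) ` {- (e * h)..e * h} \<subseteq> ball p R"
        proof (clarsimp)
          fix s assume "- (e * h) \<le> s" "s \<le> e * h"
          then have "norm (h *\<^sub>R \<tau> + s *\<^sub>R v) < m" using nb[of s] h by (simp add: abs_le_iff)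
          moreover have "dist p (p + (h *\<^sub>R \<tau> + s *\<^sub>R v)) = norm (h *\<^sub>R \<tau> + s *\<^sub>R v)"
            by (metis add_diff_cancel_left' dist_commute dist_norm)
          ultimately show "dist p (p + (h *\<^sub>R \<tau> + s *\<^sub>R v)) < R" by (simp add: m_def)
        qed
      qed (auto intro!: continuous_intros)
    qed
    then obtain s where s: "\<bar>s\<bar> \<le> e * h" "\<rho> (p + (h *\<^sub>R \<tau> + s *\<^sub>R v)) = 0"
      by (metis abs_le_iff minus_le_iff)
    let ?z = "h *\<^sub>R \<tau> + s *\<^sub>R v"
    have "dist (p + ?z) p < r2" using nb[OF s(1)] h by (simp add: dist_norm m_def)
    then have "norm (N (p + ?z - p)) \<le> e * norm (p + ?z - p)" by (rule r2(2)) (rule s(2))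
    then have "norm (N ?z) \<le> e * norm ?z" by simp
    moreover have "N ?z = h *\<^sub>R N \<tau>" using N(2) by (simp add: linear_add[OF linN] linear_scale[OF linN])
    moreover have "e * norm ?z \<le> e * (h * (norm \<tau> + 1))" using nb[OF s(1)] e by (intro mult_left_mono) auto
    ultimately have "h * norm (N \<tau>) \<le> h * (e * (norm \<tau> + 1))" using h(1) by (simp add: algebra_simps)
    then show ?thesis using h(1) by simp
  qed
  have "norm (N \<tau>) \<le> 0"
  proof (rule field_le_epsilon)
    fix e :: real assume e: "e > 0"
    have nt: "norm \<tau> + 1 > 0" by (smt (verit) norm_ge_zero)
    define e1 where "e1 = min 1 (e / (norm \<tau> + 1))"
    have "e1 > 0" "e1 \<le> 1" using e nt by (auto simp: e1_def)
    then have "norm (N \<tau>) \<le> e1 * (norm \<tau> + 1)" by (rule bound)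
    also have "\<dots> \<le> e / (norm \<tau> + 1) * (norm \<tau> + 1)" using nt by (intro mult_right_mono) (auto simp: e1_def)
    also have "\<dots> = 0 + e" using nt by simp
    finally show "norm (N \<tau>) \<le> 0 + e" .
  qed
  then show ?thesis using N\<tau> by simp
qed

text \<open>The kernel condition with v = \<nu> shows that the derivative along the normal is
  nonzero, as \<nu> has length 1; its sign is arranged by passing to -\<rho>.\<close>

lemma outward_unit_normalE:
  assumes "outward_unit_normal \<Gamma> p \<nu>"
  obtains U and \<rho> :: "'a::euclidean_space \<Rightarrow> real" where "open U" "p \<in> U" "Ck_on 1 U \<rho>"
    "\<Gamma> \<inter> U = {x \<in> U. \<rho> x = 0}" "frechet_derivative \<rho> (at p) \<nu> > 0"
proof -
  obtain U \<rho> where d: "defining_function \<Gamma> p U \<rho>"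
    and k: "\<And>v. frechet_derivative \<rho> (at p) v = 0 \<Longrightarrow> \<nu> \<bullet> v = 0" and n: "norm \<nu> = 1"
    using assms unfolding outward_unit_normal_def by blast
  have U: "open U" "p \<in> U" "Ck_on 1 U \<rho>" "\<Gamma> \<inter> U = {x \<in> U. \<rho> x = 0}"
    using d unfolding defining_function_def smooth_on_def by blast+
  have \<rho>d: "\<rho> differentiable (at x)" if "x \<in> U" for x using U(3) that unfolding Ck_on_1 by blast
  have "\<nu> \<bullet> \<nu> \<noteq> 0" using n by auto
  then have ne: "frechet_derivative \<rho> (at p) \<nu> \<noteq> 0" using k by blast
  show ?thesis
  proof (cases "frechet_derivative \<rho> (at p) \<nu> > 0")
    case True
    show ?thesis by (rule that[OF U True])
  next
    case False
    have "frechet_derivative (\<lambda>x. - \<rho> x) (at p) = (\<lambda>v. - frechet_derivative \<rho> (at p) v)"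
      by (intro frechet_derivative_eq has_derivative_minus has_derivative_frechet \<rho>d U)
    then have "frechet_derivative (\<lambda>x. - \<rho> x) (at p) \<nu> > 0" using False ne by simp
    moreover have "Ck_on 1 U (\<lambda>x. - \<rho> x)"
      using Ck_on_bounded_linear_comp[OF bounded_linear_minus[OF bounded_linear_ident] U(1,3)] by simp
    moreover have "\<Gamma> \<inter> U = {x \<in> U. - \<rho> x = 0}" using U(4) by simp
    ultimately show ?thesis using that[OF U(1,2)] by simp
  qed
qed

text \<open>Makes the filters of the two one-sided limits nontrivial, so that the \<open>Lim\<close>
  in \<open>jump\<close> is the limit whose existence \<open>has_traces\<close> asserts.\<close>

lemma islimpt_sides:
  assumes "outward_unit_normal \<Gamma> p \<nu>"
  shows "p islimpt outside \<Gamma>" "p islimpt inside \<Gamma>"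
proof -
  have n: "norm \<nu> = 1" using assms unfolding outward_unit_normal_def by blast
  obtain h0 where h0: "h0 > 0" "\<And>h. 0 < h \<Longrightarrow> h < h0 \<Longrightarrow> p - h *\<^sub>R \<nu> \<in> inside \<Gamma> \<and> p + h *\<^sub>R \<nu> \<in> outside \<Gamma>"
    using assms unfolding outward_unit_normal_def eventually_at_right_field by auto
  have h: "p - (min e h0 / 2) *\<^sub>R \<nu> \<in> inside \<Gamma> \<and> p + (min e h0 / 2) *\<^sub>R \<nu> \<in> outside \<Gamma>" if "e > 0" for e
    using h0(1) that by (intro h0(2)) (auto simp: min_def)
  have d: "dist (p + (min e h0 / 2) *\<^sub>R \<nu>) p < e" "dist (p - (min e h0 / 2) *\<^sub>R \<nu>) p < e"
    "p + (min e h0 / 2) *\<^sub>R \<nu> \<noteq> p" "p - (min e h0 / 2) *\<^sub>R \<nu> \<noteq> p" if "e > 0" for e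
    using that h0(1) n by (auto simp: dist_norm min_def)
  show "p islimpt outside \<Gamma>" unfolding islimpt_approachable using h d by metis
  show "p islimpt inside \<Gamma>" unfolding islimpt_approachable using h d by metis
qed

text \<open>Convergence of the finitely many partial derivatives is convergence in operator norm,
  uniform in \<open>w\<close>. Since \<open>p\<close> is not in \<open>S\<close>, the exclusion of
  \<open>p\<close> in the limit loses nothing.\<close>

lemma linear_close_of_partial_limits:
  fixes u :: "'a::euclidean_space \<Rightarrow> 'b::real_normed_vector"
  assumes "\<And>i. i \<in> Basis \<Longrightarrow> (partial_deriv i u \<longlongrightarrow> l i) (at p within S)"
    and "\<And>x. x \<in> S \<Longrightarrow> dist x p < r0 \<Longrightarrow> u differentiable (at x)" "r0 > 0" "p \<notin> S" "e > 0"
  shows "\<exists>r>0. \<forall>x\<in>S. dist x p < r \<longrightarrow>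
     (\<forall>w. norm (frechet_derivative u (at x) w - (\<Sum>i\<in>Basis. (w \<bullet> i) *\<^sub>R l i)) \<le> e * norm w)"
proof -
  have "((\<lambda>x. \<Sum>i\<in>Basis. norm (partial_deriv i u x - l i)) \<longlongrightarrow> (\<Sum>i\<in>(Basis::'a set). norm (l i - l i))) (at p within S)"
    using assms(1) by (intro tendsto_intros) auto
  then have "((\<lambda>x. \<Sum>i\<in>Basis. norm (partial_deriv i u x - l i)) \<longlongrightarrow> 0) (at p within S)" by simp
  then obtain r1 where r1: "r1 > 0"
    "\<And>x. x \<in> S \<Longrightarrow> 0 < dist x p \<Longrightarrow> dist x p < r1 \<Longrightarrow> dist (\<Sum>i\<in>Basis. norm (partial_deriv i u x - l i)) 0 < e"
    using assms(5) unfolding Lim_within by blast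
  show ?thesis
  proof (intro exI[of _ "min r0 r1"] conjI ballI impI allI)
    fix x w assume x: "x \<in> S" "dist x p < min r0 r1"
    then have "0 < dist x p" using assms(4) by auto
    then have s: "(\<Sum>i\<in>Basis. norm (partial_deriv i u x - l i)) \<le> e"
      using r1(2)[OF x(1)] x(2) by (simp add: dist_real_def abs_less_iff)
    have ud: "u differentiable (at x)" using assms(2) x by simp
    have "norm (frechet_derivative u (at x) w - (\<Sum>i\<in>Basis. (w \<bullet> i) *\<^sub>R l i))
        = norm (\<Sum>i\<in>Basis. (w \<bullet> i) *\<^sub>R (partial_deriv i u x - l i))"
      unfolding frechet_derivative_sum_partial[OF ud] by (simp add: sum_subtractf scaleR_diff_right)
    also have "\<dots> \<le> (\<Sum>i\<in>Basis. norm ((w \<bullet> i) *\<^sub>R (partial_deriv i u x - l i)))" by (rule norm_sum)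
    also have "\<dots> \<le> (\<Sum>i\<in>Basis. norm w * norm (partial_deriv i u x - l i))"
      by (intro sum_mono) (simp add: Basis_le_norm mult_right_mono)
    also have "\<dots> \<le> norm w * e" using s by (simp add: sum_distrib_left[symmetric] mult_left_mono)
    finally show "norm (frechet_derivative u (at x) w - (\<Sum>i\<in>Basis. (w \<bullet> i) *\<^sub>R l i)) \<le> e * norm w"
      by (simp add: mult.commute)
  qed (use assms(3) r1(1) in simp)
qed

lemma bounded_linear_sum_Basis: "bounded_linear (\<lambda>w::'a::euclidean_space. \<Sum>i\<in>Basis. (w \<bullet> i) *\<^sub>R (l i :: 'b::real_normed_vector))"
  by (intro bounded_linear_sum bounded_linear_scaleR_const bounded_linear_inner_left)

text \<open>Both one-sided derivatives at a point of the interface agree on tangent vectors because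
  the function is continuous across it, and on the normal because the normal jump vanishes.\<close>

lemma interface_point:
  fixes u g :: "'a::euclidean_space \<Rightarrow> complex"
  assumes \<Gamma>: "closed \<Gamma>" "p \<in> \<Gamma>" "outward_unit_normal \<Gamma> p \<nu>"
    and \<Omega>: "open \<Omega>" "p \<in> \<Omega>"
    and u: "Ck_on 1 (\<Omega> - \<Gamma>) u" and g: "\<And>x. x \<notin> \<Gamma> \<Longrightarrow> g x = u x" "continuous_on \<Omega> g"
    and lo: "\<And>i. i \<in> Basis \<Longrightarrow> (partial_deriv i u \<longlongrightarrow> lo i) (at p within outside \<Gamma>)"
    and li: "\<And>i. i \<in> Basis \<Longrightarrow> (partial_deriv i u \<longlongrightarrow> li i) (at p within inside \<Gamma>)"
    and normal: "(\<Sum>i\<in>Basis. (\<nu> \<bullet> i) *\<^sub>R lo i) = (\<Sum>i\<in>Basis. (\<nu> \<bullet> i) *\<^sub>R li i)"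
  shows "(g has_derivative (\<lambda>w. \<Sum>i\<in>Basis. (w \<bullet> i) *\<^sub>R lo i)) (at p)"
    and "\<And>i. i \<in> Basis \<Longrightarrow> lo i = li i"
proof -
  obtain U and \<rho> :: "'a \<Rightarrow> real" where U: "open U" "p \<in> U" "Ck_on 1 U \<rho>"
    "\<Gamma> \<inter> U = {x \<in> U. \<rho> x = 0}" "frechet_derivative \<rho> (at p) \<nu> > 0"
    by (rule outward_unit_normalE[OF \<Gamma>(3)])
  have n: "norm \<nu> = 1" using \<Gamma>(3) unfolding outward_unit_normal_def by blast
  obtain h0 where h0: "h0 > 0" "\<And>h. 0 < h \<Longrightarrow> h < h0 \<Longrightarrow> p - h *\<^sub>R \<nu> \<in> inside \<Gamma> \<and> p + h *\<^sub>R \<nu> \<in> outside \<Gamma>"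
    using \<Gamma>(3) unfolding outward_unit_normal_def eventually_at_right_field by auto
  let ?A = "frechet_derivative \<rho> (at p)"
  define c where "c = ?A \<nu>"
  have c: "c > 0" using U(5) c_def by simp
  have \<rho>p: "\<rho> p = 0" using U(2,4) \<Gamma>(2) by blast
  have dp: "(\<rho> has_derivative ?A) (at p)"
    using U unfolding Ck_on_1 by (auto intro!: has_derivative_frechet)
  then have blA: "bounded_linear ?A" by (rule has_derivative_bounded_linear)
  have linA: "linear ?A" using blA by (rule bounded_linear.linear)
  obtain L where L: "L > 0" "\<And>w. norm (?A w) \<le> norm w * L"
    using bounded_linear.pos_bounded[OF blA] by blast
  have L': "\<bar>?A w\<bar> \<le> L * norm w" for w using L(2)[of w] by (simp add: mult.commute)
  have UO: "open (U \<inter> \<Omega>)" "p \<in> U \<inter> \<Omega>" using U \<Omega> by auto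
  have "Ck_on 1 (U \<inter> \<Omega>) \<rho>" by (rule Ck_on_subset[OF U(3)]) simp
  note UO = UO this
  obtain R where R: "R > 0" "ball p R \<subseteq> U \<inter> \<Omega>"
    "\<And>y z. y \<in> ball p R \<Longrightarrow> z \<in> ball p R \<Longrightarrow> norm (\<rho> y - \<rho> z - ?A (y - z)) \<le> c / 2 * norm (y - z)"
    using Ck_on_1_strict_diff[OF UO, of "c/2"] c by auto
  define M where "M = 2 * L / c + 2"
  have M: "M \<ge> 2" using L c by (simp add: M_def)
  \<comment> \<open>Points within \<open>R1\<close> of \<open>p\<close> have their whole detour
    inside \<open>ball p R\<close>, where strict differentiability holds.\<close>
  define R1 where "R1 = R / (M + 2)"
  have R1: "R1 > 0" "R1 \<le> R" using R M by (auto simp: R1_def field_simps mult_le_cancel_left1)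
  have xR1: "(M + 1) * dist x p < R" if "dist x p < R1" for x
  proof -
    have "(M + 1) * dist x p \<le> (M + 1) * R1" using that M by (intro mult_left_mono) auto
    also have "\<dots> < (M + 2) * R1" using R1 by (simp add: algebra_simps)
    also have "\<dots> = R" using M by (simp add: R1_def)
    finally show ?thesis .
  qed
  have cone1: "\<bar>\<rho> y - \<rho> z - ?A (y - z)\<bar> \<le> c / 2 * norm (y - z)" if "y \<in> ball p R" "z \<in> ball p R" for y z
    using R(3)[OF that] by simp
  have cone2: "\<bar>- \<rho> y - - \<rho> z - - ?A (y - z)\<bar> \<le> c / 2 * norm (y - z)" if "y \<in> ball p R" "z \<in> ball p R" for y z
    using R(3)[OF that] unfolding real_norm_def by linarith
  have linA': "linear (\<lambda>w. - ?A w)" using linA by (simp add: linear_compose_neg)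
  have A\<nu>: "- ?A (- \<nu>) = c" using linear_neg[OF linA] by (simp add: c_def)
  have n': "norm (- \<nu>) = 1" using n by simp
  have L'': "\<bar>- ?A w\<bar> \<le> L * norm w" for w using L'[of w] by simp
  \<comment> \<open>\<open>X\<close> and \<open>X'\<close> are the open sides of the level set,
    \<open>Y\<close> and \<open>Y'\<close> the closed ones near \<open>p\<close>. The level set
    belongs to both \<open>Y\<close> and \<open>Y'\<close>, which allows the two one-sided
    expansions to be compared on it.\<close>
  define X where "X = {x \<in> ball p R. \<rho> x > 0}"
  define X' where "X' = {x \<in> ball p R. \<rho> x < 0}"
  define Y where "Y = {x. dist x p < R1 \<and> \<rho> x \<ge> 0}"
  define Y' where "Y' = {x. dist x p < R1 \<and> \<rho> x \<le> 0}"
  have "\<rho> x = 0" if "x \<in> \<Gamma>" "x \<in> ball p R" for x using R(2) U(4) that by blast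
  then have X\<Gamma>: "X \<subseteq> - \<Gamma>" "X' \<subseteq> - \<Gamma>" by (force simp: X_def X'_def)+
  have L0: "L \<ge> 0" using L(1) by simp
  have A\<nu>': "?A \<nu> = c" by (simp add: c_def)
  have \<rho>p': "- \<rho> p = 0" using \<rho>p by simp
  have up1: "p + t *\<^sub>R \<nu> \<in> X \<and> x + t *\<^sub>R \<nu> \<in> X" if "x \<in> Y" "0 < t" "t \<le> M * dist x p" for x t
  proof -
    have xx: "\<rho> x \<ge> 0" "dist x p < R1" using that(1) by (auto simp: Y_def)
    have "p + t *\<^sub>R \<nu> \<in> ball p R \<and> \<rho> (p + t *\<^sub>R \<nu>) > 0"
      by (rule cone_positive(1)[where R=R and A="?A" and c=c and L=L and M=M and x=x])
         (rule cone1 linA L' A\<nu>' c n L0 \<rho>p xx(1) M_def xR1[OF xx(2)] that(2,3) | assumption)+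
    moreover have "x + t *\<^sub>R \<nu> \<in> ball p R \<and> \<rho> (x + t *\<^sub>R \<nu>) > 0"
      by (rule cone_positive(2)[where R=R and A="?A" and c=c and L=L and M=M and x=x and p=p])
         (rule cone1 linA L' A\<nu>' c n L0 \<rho>p xx(1) M_def xR1[OF xx(2)] that(2,3) | assumption)+
    ultimately show ?thesis by (simp add: X_def)
  qed
  have up2: "closed_segment (p + (M * dist x p) *\<^sub>R \<nu>) (x + (M * dist x p) *\<^sub>R \<nu>) \<subseteq> X" if "x \<in> Y" "x \<noteq> p" for x
  proof
    fix y assume y: "y \<in> closed_segment (p + (M * dist x p) *\<^sub>R \<nu>) (x + (M * dist x p) *\<^sub>R \<nu>)"
    have xx: "\<rho> x \<ge> 0" "dist x p < R1" using that(1) by (auto simp: Y_def)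
    have "y \<in> ball p R \<and> \<rho> y > 0"
      by (rule cone_positive(3)[where R=R and A="?A" and c=c and L=L and M=M and x=x and p=p and v=\<nu>])
         (rule cone1 linA L' A\<nu>' c n L0 \<rho>p xx(1) M_def xR1[OF xx(2)] that(2) y | assumption)+
    then show "y \<in> X" by (simp add: X_def)
  qed
  have dn1: "p + t *\<^sub>R (- \<nu>) \<in> X' \<and> x + t *\<^sub>R (- \<nu>) \<in> X'" if "x \<in> Y'" "0 < t" "t \<le> M * dist x p" for x t
  proof -
    have xx: "- \<rho> x \<ge> 0" "dist x p < R1" using that(1) by (auto simp: Y'_def)
    have "p + t *\<^sub>R (- \<nu>) \<in> ball p R \<and> - \<rho> (p + t *\<^sub>R (- \<nu>)) > 0"
      by (rule cone_positive(1)[where \<rho>="\<lambda>x. - \<rho> x" and R=R and A="\<lambda>w. - ?A w" and c=c and L=L and M=M and x=x])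
         (rule cone2 linA' L'' A\<nu> c n' L0 \<rho>p' xx(1) M_def xR1[OF xx(2)] that(2,3) | assumption)+
    moreover have "x + t *\<^sub>R (- \<nu>) \<in> ball p R \<and> - \<rho> (x + t *\<^sub>R (- \<nu>)) > 0"
      by (rule cone_positive(2)[where \<rho>="\<lambda>x. - \<rho> x" and R=R and A="\<lambda>w. - ?A w" and c=c and L=L and M=M and x=x and p=p])
         (rule cone2 linA' L'' A\<nu> c n' L0 \<rho>p' xx(1) M_def xR1[OF xx(2)] that(2,3) | assumption)+
    ultimately show ?thesis by (simp add: X'_def)
  qed
  have dn2: "closed_segment (p + (M * dist x p) *\<^sub>R (- \<nu>)) (x + (M * dist x p) *\<^sub>R (- \<nu>)) \<subseteq> X'" if "x \<in> Y'" "x \<noteq> p" for x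
  proof
    fix y assume y: "y \<in> closed_segment (p + (M * dist x p) *\<^sub>R (- \<nu>)) (x + (M * dist x p) *\<^sub>R (- \<nu>))"
    have xx: "- \<rho> x \<ge> 0" "dist x p < R1" using that(1) by (auto simp: Y'_def)
    have "y \<in> ball p R \<and> - \<rho> y > 0"
      by (rule cone_positive(3)[where \<rho>="\<lambda>x. - \<rho> x" and R=R and A="\<lambda>w. - ?A w" and c=c and L=L and M=M and x=x and p=p and v="- \<nu>"])
         (rule cone2 linA' L'' A\<nu> c n' L0 \<rho>p' xx(1) M_def xR1[OF xx(2)] that(2) y | assumption)+
    then show "y \<in> X'" by (simp add: X'_def)
  qed
  \<comment> \<open>The detour of the cone condition, read as a path in the complement of
    \<open>\<Gamma>\<close>.\<close>
  have conn: "connected_component (- \<Gamma>) (p + t *\<^sub>R v) x"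
    if tl: "0 < t" "t \<le> M * d" "0 < d" and Z: "\<And>s. 0 < s \<Longrightarrow> s \<le> M * d \<Longrightarrow> p + s *\<^sub>R v \<in> Z"
      "\<And>s. 0 < s \<Longrightarrow> s \<le> M * d \<Longrightarrow> x + s *\<^sub>R v \<in> Z" "x \<in> Z"
      "closed_segment (p + (M * d) *\<^sub>R v) (x + (M * d) *\<^sub>R v) \<subseteq> Z" "Z \<subseteq> - \<Gamma>" for t d v x Z
  proof -
    have seg: "connected_component (- \<Gamma>) a b" if "closed_segment a b \<subseteq> Z" for a b
      using that Z(5) unfolding connected_component_def by (intro exI[of _ "closed_segment a b"]) auto
    have sv: "closed_segment (q + s1 *\<^sub>R v) (q + s2 *\<^sub>R v) \<subseteq> {q + s *\<^sub>R v |s. s1 \<le> s \<and> s \<le> s2}" if "s1 \<le> s2" for q s1 s2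
    proof
      fix z assume "z \<in> closed_segment (q + s1 *\<^sub>R v) (q + s2 *\<^sub>R v)"
      then obtain a where a: "0 \<le> a" "a \<le> 1" "z = (1 - a) *\<^sub>R (q + s1 *\<^sub>R v) + a *\<^sub>R (q + s2 *\<^sub>R v)"
        unfolding in_segment by blast
      then have "z = q + (s1 + a * (s2 - s1)) *\<^sub>R v" by (simp add: algebra_simps)
      moreover have "s1 \<le> s1 + a * (s2 - s1)" using a that by simp
      moreover have "s1 + a * (s2 - s1) \<le> s2" using a that mult_left_le_one_le[of "s2 - s1" a] by simp
      ultimately show "z \<in> {q + s *\<^sub>R v |s. s1 \<le> s \<and> s \<le> s2}" by blast
    qed
    have "closed_segment (p + t *\<^sub>R v) (p + (M * d) *\<^sub>R v) \<subseteq> Z"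
    proof
      fix z assume "z \<in> closed_segment (p + t *\<^sub>R v) (p + (M * d) *\<^sub>R v)"
      then have "\<exists>s. z = p + s *\<^sub>R v \<and> t \<le> s \<and> s \<le> M * d" using sv[OF tl(2)] by blast
      then show "z \<in> Z" using Z(1) tl(1) by force
    qed
    moreover have "closed_segment (x + 0 *\<^sub>R v) (x + (M * d) *\<^sub>R v) \<subseteq> Z"
    proof
      fix z assume "z \<in> closed_segment (x + 0 *\<^sub>R v) (x + (M * d) *\<^sub>R v)"
      moreover have "0 \<le> M * d" using tl by linarith
      ultimately obtain s where s: "z = x + s *\<^sub>R v" "0 \<le> s" "s \<le> M * d" using sv by blast
      then show "z \<in> Z" using Z(2)[of s] Z(3) by (cases "s = 0") auto
    qed
    ultimately have "connected_component (- \<Gamma>) (p + t *\<^sub>R v) (p + (M * d) *\<^sub>R v)"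
      "connected_component (- \<Gamma>) x (x + (M * d) *\<^sub>R v)" using seg by force+
    moreover have "connected_component (- \<Gamma>) (p + (M * d) *\<^sub>R v) (x + (M * d) *\<^sub>R v)"
      using seg Z(4) by blast
    ultimately show ?thesis using connected_component_trans connected_component_sym by metis
  qed
  have Xp: "p \<notin> X" "p \<notin> X'" using \<rho>p by (auto simp: X_def X'_def)
  \<comment> \<open>The sign of \<open>\<rho>\<close> tells the sides apart: \<open>x\<close> is
    joined off \<open>\<Gamma>\<close> to a point p + t \<nu> with t < h0, which the definition of
    the outward normal puts outside.\<close>
  have Xout: "x \<in> outside \<Gamma>" if "x \<in> X" "dist x p < R1" for x
  proof -
    have xY: "x \<in> Y" using that by (auto simp: X_def Y_def)
    have d: "dist x p > 0" using that(1) Xp by auto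
    define t where "t = min (h0 / 2) (M * dist x p)"
    have t: "0 < t" "t < h0" "t \<le> M * dist x p" using h0(1) M d by (auto simp: t_def)
    have "connected_component (- \<Gamma>) (p + t *\<^sub>R \<nu>) x"
    proof (rule conn[OF t(1,3) d, of _ X])
      show "p + s *\<^sub>R \<nu> \<in> X" "x + s *\<^sub>R \<nu> \<in> X" if "0 < s" "s \<le> M * dist x p" for s
        using up1[OF xY that] by blast+
      show "closed_segment (p + (M * dist x p) *\<^sub>R \<nu>) (x + (M * dist x p) *\<^sub>R \<nu>) \<subseteq> X"
        using up2[OF xY] d by simp
    qed (use that(1) X\<Gamma> in simp_all)
    then show ?thesis using outside_same_component h0(2)[OF t(1,2)] by blast
  qed
  have X'in: "x \<in> inside \<Gamma>" if "x \<in> X'" "dist x p < R1" for x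
  proof -
    have xY: "x \<in> Y'" using that by (auto simp: X'_def Y'_def)
    have d: "dist x p > 0" using that(1) Xp by auto
    define t where "t = min (h0 / 2) (M * dist x p)"
    have t: "0 < t" "t < h0" "t \<le> M * dist x p" using h0(1) M d by (auto simp: t_def)
    have "connected_component (- \<Gamma>) (p + t *\<^sub>R (- \<nu>)) x"
    proof (rule conn[OF t(1,3) d, of _ X'])
      show "p + s *\<^sub>R (- \<nu>) \<in> X'" "x + s *\<^sub>R (- \<nu>) \<in> X'" if "0 < s" "s \<le> M * dist x p" for s
        using dn1[OF xY that] by blast+
      show "closed_segment (p + (M * dist x p) *\<^sub>R (- \<nu>)) (x + (M * dist x p) *\<^sub>R (- \<nu>)) \<subseteq> X'"
        using dn2[OF xY] d by simp
    qed (use that(1) X\<Gamma> in simp_all)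
    moreover have "p + t *\<^sub>R (- \<nu>) \<in> inside \<Gamma>" using h0(2)[OF t(1,2)] by simp
    ultimately show ?thesis by (rule inside_same_component)
  qed
  define \<Lambda>o where "\<Lambda>o w = (\<Sum>i\<in>Basis. (w \<bullet> i) *\<^sub>R lo i)" for w
  define \<Lambda>i where "\<Lambda>i w = (\<Sum>i\<in>Basis. (w \<bullet> i) *\<^sub>R li i)" for w
  have bl: "bounded_linear \<Lambda>o" "bounded_linear \<Lambda>i"
    unfolding \<Lambda>o_def[abs_def] \<Lambda>i_def[abs_def] by (rule bounded_linear_sum_Basis)+
  have ud: "u differentiable (at x)" if "x \<in> ball p R" "x \<notin> \<Gamma>" for x
    using u R(2) that unfolding Ck_on_1 by blast
  have \<Omega>\<Gamma>: "open (\<Omega> - \<Gamma>)" using \<Omega>(1) \<Gamma>(1) by (rule open_Diff)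
  have gder: "(g has_derivative frechet_derivative u (at x)) (at x)" if "x \<in> ball p R" "x \<notin> \<Gamma>" for x
  proof -
    have "x \<in> \<Omega> - \<Gamma>" using that R(2) by blast
    then show ?thesis
      by (subst has_derivative_cong_open[OF \<Omega>\<Gamma>, of x g u])
         (use g(1) ud that in \<open>auto intro!: has_derivative_frechet\<close>)
  qed
  have bR: "ball p R1 \<subseteq> ball p R" using R1(2) by (rule subset_ball)
  then have "ball p R1 \<subseteq> \<Omega>" using R(2) by blast
  then have contg: "continuous_on (ball p R1) g" by (rule continuous_on_subset[OF g(2)])
  have limo: "\<exists>r>0. \<forall>x\<in>X. dist x p < r \<longrightarrow> (\<forall>w. norm (frechet_derivative u (at x) w - \<Lambda>o w) \<le> e * norm w)" if "e > 0" for e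
  proof -
    have po: "p \<notin> outside \<Gamma>" using \<Gamma>(2) by (simp add: outside_def)
    have "u differentiable (at x)" if "x \<in> outside \<Gamma>" "dist x p < R" for x
      using ud[of x] that by (simp add: dist_commute outside_def)
    from linear_close_of_partial_limits[OF lo this R(1) po \<open>e > 0\<close>]
    obtain r where r: "r > 0" "\<And>x w. x \<in> outside \<Gamma> \<Longrightarrow> dist x p < r \<Longrightarrow>
       norm (frechet_derivative u (at x) w - (\<Sum>i\<in>Basis. (w \<bullet> i) *\<^sub>R lo i)) \<le> e * norm w" by auto
    show ?thesis using r R1 Xout unfolding \<Lambda>o_def by (intro exI[of _ "min r R1"]) simp
  qed
  have limi: "\<exists>r>0. \<forall>x\<in>X'. dist x p < r \<longrightarrow> (\<forall>w. norm (frechet_derivative u (at x) w - \<Lambda>i w) \<le> e * norm w)" if "e > 0" for e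
  proof -
    have po: "p \<notin> inside \<Gamma>" using \<Gamma>(2) by (simp add: inside_def)
    have "u differentiable (at x)" if "x \<in> inside \<Gamma>" "dist x p < R" for x
      using ud[of x] that by (simp add: dist_commute inside_def)
    from linear_close_of_partial_limits[OF li this R(1) po \<open>e > 0\<close>]
    obtain r where r: "r > 0" "\<And>x w. x \<in> inside \<Gamma> \<Longrightarrow> dist x p < r \<Longrightarrow>
       norm (frechet_derivative u (at x) w - (\<Sum>i\<in>Basis. (w \<bullet> i) *\<^sub>R li i)) \<le> e * norm w" by auto
    show ?thesis using r R1 X'in unfolding \<Lambda>i_def by (intro exI[of _ "min r R1"]) simp
  qed
  have M0: "M \<ge> 0" using M by simp
  have expo: "\<exists>r>0. \<forall>x\<in>Y. dist x p < r \<longrightarrow> norm (g x - g p - \<Lambda>o (x - p)) \<le> e * norm (x - p)" if "e > 0" for e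
  proof (rule one_sided_diff[OF contg R1(1) n M0 _ bl(1) _ _ _ that, where X=X and D="\<lambda>x. frechet_derivative u (at x)"])
    show "(g has_derivative frechet_derivative u (at x)) (at x)" if "x \<in> X" "x \<in> ball p R1" for x
      using gder[of x] that X\<Gamma>(1) bR by blast
  qed (use up1 up2 limo in simp_all)
  have expi: "\<exists>r>0. \<forall>x\<in>Y'. dist x p < r \<longrightarrow> norm (g x - g p - \<Lambda>i (x - p)) \<le> e * norm (x - p)" if "e > 0" for e
  proof (rule one_sided_diff[OF contg R1(1) n' M0 _ bl(2) _ _ _ that, where X=X' and D="\<lambda>x. frechet_derivative u (at x)"])
    show "(g has_derivative frechet_derivative u (at x)) (at x)" if "x \<in> X'" "x \<in> ball p R1" for x
      using gder[of x] that X\<Gamma>(2) bR by blast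
  qed (use dn1 dn2 limi in simp_all)
  \<comment> \<open>At points of the level set both expansions concern the same value of
    \<open>g\<close>, so subtracting them bounds the difference of the linear parts; along \<nu>
    this difference is zero by the condition \<open>normal\<close>.\<close>
  have agree: "\<Lambda>o w - \<Lambda>i w = 0" for w
  proof (rule tangent_agree[where N="\<lambda>w. \<Lambda>o w - \<Lambda>i w", OF _ _ dp \<rho>p U(5) n _ R1(1)])
    show "bounded_linear (\<lambda>w. \<Lambda>o w - \<Lambda>i w)" by (intro bounded_linear_sub bl)
    show "\<Lambda>o \<nu> - \<Lambda>i \<nu> = 0" using normal by (simp add: \<Lambda>o_def \<Lambda>i_def)
    have "ball p R1 \<subseteq> U" using R(2) bR by blast
    then show "continuous_on (ball p R1) \<rho>" using Ck_on_1_continuous[OF U(3)] continuous_on_subset by blast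
    fix e :: real assume e: "e > 0"
    obtain r1 where r1: "r1 > 0" "\<And>x. x \<in> Y \<Longrightarrow> dist x p < r1 \<Longrightarrow> norm (g x - g p - \<Lambda>o (x - p)) \<le> e/2 * norm (x - p)"
      using expo[of "e/2"] e by (metis half_gt_zero)
    obtain r2 where r2: "r2 > 0" "\<And>x. x \<in> Y' \<Longrightarrow> dist x p < r2 \<Longrightarrow> norm (g x - g p - \<Lambda>i (x - p)) \<le> e/2 * norm (x - p)"
      using expi[of "e/2"] e by (metis half_gt_zero)
    show "\<exists>r>0. \<forall>x. dist x p < r \<longrightarrow> \<rho> x = 0 \<longrightarrow> norm (\<Lambda>o (x - p) - \<Lambda>i (x - p)) \<le> e * norm (x - p)"
    proof (intro exI[of _ "min R1 (min r1 r2)"] conjI allI impI)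
      fix x assume x: "dist x p < min R1 (min r1 r2)" "\<rho> x = 0"
      then have "x \<in> Y" "x \<in> Y'" by (auto simp: Y_def Y'_def)
      then have a: "norm (g x - g p - \<Lambda>o (x - p)) \<le> e/2 * norm (x - p)"
         "norm (g x - g p - \<Lambda>i (x - p)) \<le> e/2 * norm (x - p)" using r1 r2 x by auto
      have "\<Lambda>o (x - p) - \<Lambda>i (x - p) = (g x - g p - \<Lambda>i (x - p)) - (g x - g p - \<Lambda>o (x - p))" by simp
      then have "norm (\<Lambda>o (x - p) - \<Lambda>i (x - p)) \<le> norm (g x - g p - \<Lambda>i (x - p)) + norm (g x - g p - \<Lambda>o (x - p))"
        by (metis norm_triangle_ineq4)
      also have "\<dots> \<le> e * norm (x - p)" using a by (simp add: field_simps)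
      finally show "norm (\<Lambda>o (x - p) - \<Lambda>i (x - p)) \<le> e * norm (x - p)" .
    qed (use R1 r1 r2 in auto)
  qed
  then have eqL: "\<Lambda>i = \<Lambda>o" by (simp add: fun_eq_iff)
  show "(g has_derivative (\<lambda>w. \<Sum>i\<in>Basis. (w \<bullet> i) *\<^sub>R lo i)) (at p)"
    unfolding \<Lambda>o_def[symmetric] has_derivative_at_alt
  proof (intro conjI bl(1) allI impI)
    fix e :: real assume e: "e > 0"
    obtain r1 where r1: "r1 > 0" "\<And>x. x \<in> Y \<Longrightarrow> dist x p < r1 \<Longrightarrow> norm (g x - g p - \<Lambda>o (x - p)) \<le> e * norm (x - p)"
      using expo[OF e] by blast
    obtain r2 where r2: "r2 > 0" "\<And>x. x \<in> Y' \<Longrightarrow> dist x p < r2 \<Longrightarrow> norm (g x - g p - \<Lambda>o (x - p)) \<le> e * norm (x - p)"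
      using expi[OF e] unfolding eqL by blast
    show "\<exists>d>0. \<forall>y. norm (y - p) < d \<longrightarrow> norm (g y - g p - \<Lambda>o (y - p)) \<le> e * norm (y - p)"
    proof (intro exI[of _ "min R1 (min r1 r2)"] conjI allI impI)
      fix x assume x: "norm (x - p) < min R1 (min r1 r2)"
      then have "x \<in> Y \<or> x \<in> Y'" by (auto simp: Y_def Y'_def dist_norm)
      then show "norm (g x - g p - \<Lambda>o (x - p)) \<le> e * norm (x - p)"
        using r1(2)[of x] r2(2)[of x] x by (auto simp: dist_norm)
    qed (use R1 r1 r2 in auto)
  qed
  show "lo i = li i" if "i \<in> Basis" for i
  proof -
    have "\<Lambda>o i = lo i" "\<Lambda>i i = li i" unfolding \<Lambda>o_def \<Lambda>i_def using that
      by (simp_all add: inner_Basis if_distrib[of "\<lambda>a. a *\<^sub>R _"] cong: if_cong)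
    then show ?thesis using eqL by metis
  qed
qed

section \<open>Gluing the two sides\<close>

text \<open>Values of \<open>h\<close> on \<open>\<Gamma>\<close> are limits of values off
  \<open>\<Gamma>\<close>, so an estimate that holds off \<open>\<Gamma>\<close> near
  \<open>p\<close> passes to the points of \<open>\<Gamma>\<close> near \<open>p\<close>. This needs
  points of the complement arbitrarily close to every point of \<open>\<Gamma>\<close>.\<close>

lemma continuous_on_limit_extension:
  fixes g h :: "'a::metric_space \<Rightarrow> 'b::real_normed_vector"
  assumes "open \<Omega>" "closed \<Gamma>" "continuous_on (\<Omega> - \<Gamma>) g" "\<And>x. x \<in> \<Omega> - \<Gamma> \<Longrightarrow> h x = g x"
    and lim: "\<And>p. p \<in> \<Gamma> \<inter> \<Omega> \<Longrightarrow> (g \<longlongrightarrow> h p) (at p within - \<Gamma>)"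
    and nt: "\<And>p. p \<in> \<Gamma> \<Longrightarrow> p islimpt - \<Gamma>"
  shows "continuous_on \<Omega> h"
  unfolding continuous_on_eq_continuous_at[OF assms(1)]
proof
  fix p assume p: "p \<in> \<Omega>"
  show "isCont h p"
  proof (cases "p \<in> \<Gamma>")
    case False
    have "open (\<Omega> - \<Gamma>)" using assms(1,2) by (rule open_Diff)
    moreover have "continuous_on (\<Omega> - \<Gamma>) h" using assms(3,4) continuous_on_eq by metis
    ultimately show ?thesis using continuous_on_eq_continuous_at False p by blast
  next
    case True
    show ?thesis unfolding continuous_at_eps_delta
    proof (intro allI impI)
      fix e :: real assume e: "e > 0"
      obtain r1 where r1: "r1 > 0" "\<And>x. x \<in> - \<Gamma> \<Longrightarrow> 0 < dist x p \<Longrightarrow> dist x p < r1 \<Longrightarrow> dist (g x) (h p) < e/2"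
        using lim[of p] True p half_gt_zero[OF e] unfolding Lim_within by blast
      obtain r2 where r2: "r2 > 0" "ball p r2 \<subseteq> \<Omega>" using assms(1) p open_contains_ball by blast
      define r where "r = min r1 r2"
      have "dist (h x) (h p) < e" if x: "dist x p < r" for x
      proof (cases "x \<in> \<Gamma>")
        case False
        then have "x \<in> \<Omega> - \<Gamma>" "x \<noteq> p" using x r2 True by (auto simp: r_def dist_commute)
        then show ?thesis using r1(2)[of x] x e assms(4)[of x] by (simp add: r_def)
      next
        case xG: True
        have x\<Omega>: "x \<in> \<Omega>" using x r2 by (auto simp: r_def dist_commute)
        have l: "((\<lambda>y. g y - h p) \<longlongrightarrow> h x - h p) (at x within - \<Gamma>)"
          using lim[of x] xG x\<Omega> by (intro tendsto_intros) auto
        have "norm (h x - h p) \<le> e/2"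
        proof (rule Lim_norm_ubound[OF _ l])
          show "at x within - \<Gamma> \<noteq> bot" using nt[OF xG] by (simp add: trivial_limit_within)
          have "\<forall>\<^sub>F y in at x within - \<Gamma>. y \<in> ball p r \<and> y \<in> - \<Gamma>"
            using x by (intro eventually_conj eventually_at_topological[THEN iffD2] exI[of _ "ball p r"])
              (auto simp: dist_commute eventually_at_filter)
          then show "\<forall>\<^sub>F y in at x within - \<Gamma>. norm (g y - h p) \<le> e/2"
          proof (rule eventually_mono)
            fix y assume y: "y \<in> ball p r \<and> y \<in> - \<Gamma>"
            then have "y \<noteq> p" using True by blast
            then show "norm (g y - h p) \<le> e/2"
              using r1(2)[of y] y by (auto simp: r_def dist_commute dist_norm[symmetric])
          qed
        qed
        then show ?thesis using e by (simp add: dist_norm)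
      qed
      then show "\<exists>d>0. \<forall>x'. dist x' p < d \<longrightarrow> dist (h x') (h p) < e"
        using r1 r2 by (intro exI[of _ r]) (auto simp: r_def)
    qed
  qed
qed

lemma interface_C1:
  fixes u :: "'a::euclidean_space \<Rightarrow> complex"
  assumes \<Omega>: "open \<Omega>" and \<Gamma>: "compact \<Gamma>" "\<Gamma> \<subseteq> \<Omega>" "\<forall>p\<in>\<Gamma>. outward_unit_normal \<Gamma> p (\<nu> p)"
    and sol: "interface_solution b \<Gamma> \<nu> f \<Omega> u"
  obtains g where "Ck_on 1 \<Omega> g" "\<And>x. x \<notin> \<Gamma> \<Longrightarrow> g x = u x"
proof -
  have cl: "closed \<Gamma>" using \<Gamma>(1) by (rule compact_imp_closed)
  have op: "open (\<Omega> - \<Gamma>)" using \<Omega> cl by (rule open_Diff)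
  have u: "Ck_on 1 (\<Omega> - \<Gamma>) u" and tr: "has_traces \<Gamma> u" "\<And>i. i \<in> Basis \<Longrightarrow> has_traces \<Gamma> (partial_deriv i u)"
    and j: "\<And>p. p \<in> \<Gamma> \<Longrightarrow> jump \<Gamma> u p = 0"
     "\<And>p. p \<in> \<Gamma> \<Longrightarrow> jump \<Gamma> (\<lambda>x. frechet_derivative u (at x) (\<nu> p)) p = 0"
    using sol unfolding interface_solution_def by auto
  have ud: "u differentiable (at x)" if "x \<in> \<Omega> - \<Gamma>" for x using u that unfolding Ck_on_1 by blast
  have ntr: "at p within outside \<Gamma> \<noteq> bot" "at p within inside \<Gamma> \<noteq> bot" if "p \<in> \<Gamma>" for p
    using islimpt_sides \<Gamma>(3) that trivial_limit_within by metis+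
  \<comment> \<open>The values of \<open>u\<close> on \<open>\<Gamma>\<close> are arbitrary and are
    replaced by the outer trace; \<open>G\<close> does the same for the partial derivatives. The
    vanishing jumps, together with the agreement of tangential derivatives, make these traces
    two-sided limits.\<close>
  define g where "g x = (if x \<in> \<Gamma> then Lim (at x within outside \<Gamma>) u else u x)" for x
  define G where "G i x = (if x \<in> \<Gamma> then Lim (at x within outside \<Gamma>) (partial_deriv i u) else partial_deriv i u x)" for i x
  have lim: "(u \<longlongrightarrow> g p) (at p within - \<Gamma>)" if p: "p \<in> \<Gamma>" for p
  proof -
    obtain lo li where l: "(u \<longlongrightarrow> li) (at p within inside \<Gamma>)" "(u \<longlongrightarrow> lo) (at p within outside \<Gamma>)"
      using tr(1) p unfolding has_traces_def by blast
    then have "lo = li" "g p = lo" using j(1)[OF p] p ntr[OF p] by (auto simp: jump_def g_def tendsto_Lim)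
    then show ?thesis using l Lim_Un[of u "g p" p "inside \<Gamma>" "outside \<Gamma>"] by simp
  qed
  have nl: "p islimpt - \<Gamma>" if "p \<in> \<Gamma>" for p
    using islimpt_sides(1) \<Gamma>(3) that islimpt_subset by (metis Un_upper2 inside_Un_outside)
  have contg: "continuous_on \<Omega> g"
    by (rule continuous_on_limit_extension[OF \<Omega> cl Ck_on_1_continuous[OF u]])
       (use lim nl in \<open>auto simp: g_def\<close>)
  have near: "\<forall>\<^sub>F x in at p within S. x \<in> \<Omega> - \<Gamma>" if "p \<in> \<Gamma>" "S \<subseteq> - \<Gamma>" for p S
    unfolding eventually_at_topological using \<Gamma>(2) \<Omega> that by (intro exI[of _ \<Omega>]) auto
  have pt: "(g has_derivative (\<lambda>w. \<Sum>i\<in>Basis. (w \<bullet> i) *\<^sub>R G i p)) (at p) \<and>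
      (\<forall>i\<in>Basis. (partial_deriv i u \<longlongrightarrow> G i p) (at p within - \<Gamma>))" if p: "p \<in> \<Gamma>" for p
  proof -
    have "\<forall>i\<in>Basis. \<exists>lo li. (partial_deriv i u \<longlongrightarrow> li) (at p within inside \<Gamma>) \<and> (partial_deriv i u \<longlongrightarrow> lo) (at p within outside \<Gamma>)"
      using tr(2) p unfolding has_traces_def by blast
    then obtain lo li where l: "\<And>i. i \<in> Basis \<Longrightarrow> (partial_deriv i u \<longlongrightarrow> li i) (at p within inside \<Gamma>)"
      "\<And>i. i \<in> Basis \<Longrightarrow> (partial_deriv i u \<longlongrightarrow> lo i) (at p within outside \<Gamma>)" by metis
    \<comment> \<open>The direction \<open>\<nu> p\<close> is frozen at \<open>p\<close>, as in the
      jump condition, so the normal trace is a fixed linear combination of the traces of the partial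
      derivatives.\<close>
    have fr: "((\<lambda>x. frechet_derivative u (at x) (\<nu> p)) \<longlongrightarrow> (\<Sum>i\<in>Basis. (\<nu> p \<bullet> i) *\<^sub>R l' i)) (at p within S)"
      if "\<And>i. i \<in> Basis \<Longrightarrow> (partial_deriv i u \<longlongrightarrow> l' i) (at p within S)" "S \<subseteq> - \<Gamma>" for S l'
    proof (rule Lim_transform_eventually)
      show "((\<lambda>x. \<Sum>i\<in>Basis. (\<nu> p \<bullet> i) *\<^sub>R partial_deriv i u x) \<longlongrightarrow> (\<Sum>i\<in>Basis. (\<nu> p \<bullet> i) *\<^sub>R l' i)) (at p within S)"
        using that(1) by (intro tendsto_intros) auto
      show "\<forall>\<^sub>F x in at p within S. (\<Sum>i\<in>Basis. (\<nu> p \<bullet> i) *\<^sub>R partial_deriv i u x) = frechet_derivative u (at x) (\<nu> p)"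
        using near[OF p that(2)] by (rule eventually_mono) (simp add: frechet_derivative_sum_partial[OF ud])
    qed
    have io: "inside \<Gamma> \<subseteq> - \<Gamma>" "outside \<Gamma> \<subseteq> - \<Gamma>" using inside_Un_outside by blast+
    have nm: "(\<Sum>i\<in>Basis. (\<nu> p \<bullet> i) *\<^sub>R lo i) = (\<Sum>i\<in>Basis. (\<nu> p \<bullet> i) *\<^sub>R li i)"
      using j(2)[OF p] tendsto_Lim[OF ntr(1)[OF p] fr[OF l(2) io(2)]] tendsto_Lim[OF ntr(2)[OF p] fr[OF l(1) io(1)]]
      by (simp add: jump_def)
    have p\<Omega>: "p \<in> \<Omega>" using p \<Gamma>(2) by blast
    have gu: "g x = u x" if "x \<notin> \<Gamma>" for x using that by (simp add: g_def)
    have nu: "outward_unit_normal \<Gamma> p (\<nu> p)" using \<Gamma>(3) p by blast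
    have ip: "(g has_derivative (\<lambda>w. \<Sum>i\<in>Basis. (w \<bullet> i) *\<^sub>R lo i)) (at p)"
      by (rule interface_point(1)[where \<Gamma>=\<Gamma> and p=p and \<nu>="\<nu> p" and \<Omega>=\<Omega> and u=u and g=g and lo=lo and li=li])
         (rule cl p nu \<Omega> p\<Omega> u gu contg l nm | assumption)+
    have ip2: "lo i = li i" if "i \<in> Basis" for i
      by (rule interface_point(2)[where \<Gamma>=\<Gamma> and p=p and \<nu>="\<nu> p" and \<Omega>=\<Omega> and u=u and g=g and lo=lo and li=li])
         (rule cl p nu \<Omega> p\<Omega> u gu contg l nm that | assumption)+
    have Gl: "G i p = lo i" if "i \<in> Basis" for i
      using tendsto_Lim[OF ntr(1)[OF p] l(2)[OF that]] p by (simp add: G_def)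
    have "(g has_derivative (\<lambda>w. \<Sum>i\<in>Basis. (w \<bullet> i) *\<^sub>R G i p)) (at p)"
      using ip by (simp add: Gl)
    moreover have "(partial_deriv i u \<longlongrightarrow> G i p) (at p within - \<Gamma>)" if "i \<in> Basis" for i
      using Lim_Un[of "partial_deriv i u" "G i p" p "inside \<Gamma>" "outside \<Gamma>"] l[OF that] ip2[OF that] Gl[OF that]
      by simp
    ultimately show ?thesis by blast
  qed
  have "Ck_on 1 \<Omega> g"
  proof (rule Ck_on_1I)
    fix x assume x: "x \<in> \<Omega>"
    show "(g has_derivative (\<lambda>w. \<Sum>i\<in>Basis. (w \<bullet> i) *\<^sub>R G i x)) (at x)"
    proof (cases "x \<in> \<Gamma>")
      case False
      then have x': "x \<in> \<Omega> - \<Gamma>" using x by blast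
      have "(g has_derivative frechet_derivative u (at x)) (at x)"
        by (subst has_derivative_cong_open[OF op x', of g u])
           (use ud x' in \<open>auto simp: g_def intro!: has_derivative_frechet\<close>)
      moreover have "frechet_derivative u (at x) = (\<lambda>w. \<Sum>i\<in>Basis. (w \<bullet> i) *\<^sub>R G i x)"
        using False frechet_derivative_sum_partial[OF ud[OF x']] by (simp add: G_def fun_eq_iff)
      ultimately show ?thesis by simp
    qed (use pt in blast)
  next
    fix i :: 'a assume i: "i \<in> Basis"
    have "continuous_on \<Omega> (G i)"
    proof (rule continuous_on_limit_extension[OF \<Omega> cl])
      show "continuous_on (\<Omega> - \<Gamma>) (partial_deriv i u)" using u i unfolding Ck_on_1 by blast
    qed (use pt i nl in \<open>auto simp: G_def\<close>)
    moreover have "(\<Sum>j\<in>Basis. (i \<bullet> j) *\<^sub>R G j x) = G i x" for x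
      using i by (simp add: inner_Basis if_distrib[of "\<lambda>a. a *\<^sub>R _"] cong: if_cong)
    ultimately show "continuous_on \<Omega> (\<lambda>x. \<Sum>j\<in>Basis. (i \<bullet> j) *\<^sub>R G j x)" by simp
  qed
  then show ?thesis using that by (simp add: g_def)
qed

text \<open>Locally \<open>\<Gamma>\<close> is a regular level set. Changing \<open>u\<close> on
  \<open>\<Gamma>\<close> is therefore invisible to integrals.\<close>

lemma negligible_interface:
  fixes \<Gamma> :: "'a::euclidean_space set"
  assumes "\<forall>p\<in>\<Gamma>. outward_unit_normal \<Gamma> p (\<nu> p)"
  shows "negligible \<Gamma>"
proof (subst locally_negligible_alt, rule ballI)
  fix p assume p: "p \<in> \<Gamma>"
  then have nu: "outward_unit_normal \<Gamma> p (\<nu> p)" using assms by blast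
  obtain U and \<rho> :: "'a \<Rightarrow> real" where U: "open U" "p \<in> U" "Ck_on 1 U \<rho>"
    "\<Gamma> \<inter> U = {x \<in> U. \<rho> x = 0}" "frechet_derivative \<rho> (at p) (\<nu> p) > 0"
    by (rule outward_unit_normalE[OF nu])
  obtain r where r: "r > 0" "negligible {x \<in> ball p r. \<rho> x = 0}"
    using negligible_regular_level_aux[OF U(1-3,5)] by blast
  have "\<Gamma> \<inter> (U \<inter> ball p r) \<subseteq> {x \<in> ball p r. \<rho> x = 0}" using U(4) by blast
  then have "negligible (\<Gamma> \<inter> (U \<inter> ball p r))" using r(2) negligible_subset by blast
  moreover have "openin (top_of_set \<Gamma>) (\<Gamma> \<inter> (U \<inter> ball p r))" using U(1) by (intro openin_open_Int) auto
  ultimately show "\<exists>W. openin (top_of_set \<Gamma>) W \<and> p \<in> W \<and> negligible W"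
    using p U(2) r(1) by (intro exI[of _ "\<Gamma> \<inter> (U \<inter> ball p r)"]) auto
qed

section \<open>The weak formulation\<close>

lemma frechet_derivative_mult:
  fixes f g :: "'a::euclidean_space \<Rightarrow> 'b::real_normed_algebra"
  assumes "f differentiable (at x)" "g differentiable (at x)"
  shows "frechet_derivative (\<lambda>x. f x * g x) (at x) v =
     f x * frechet_derivative g (at x) v + frechet_derivative f (at x) v * g x"
  using partial_deriv_mult[OF assms, of v] by (simp add: partial_deriv_def)

text \<open>The product with a compactly supported factor is again \<open>C1c\<close>, and the
  integral of its derivative is zero. Off \<open>S\<close> the function \<open>s\<close> may be
  arbitrary, since \<open>\<phi>\<close> and its derivative vanish there.\<close>

lemma integration_by_parts:
  fixes \<phi> s :: "'a::euclidean_space \<Rightarrow> 'b::{real_normed_algebra, banach, second_countable_topology}"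
  assumes "C1c S \<phi>" "open S" "Ck_on 1 S s"
  shows "integrable lebesgue (\<lambda>x. \<phi> x * frechet_derivative s (at x) v)"
    and "integrable lebesgue (\<lambda>x. frechet_derivative \<phi> (at x) v * s x)"
    and "(LINT x|lebesgue. \<phi> x * frechet_derivative s (at x) v) =
         - (LINT x|lebesgue. frechet_derivative \<phi> (at x) v * s x)"
proof -
  obtain K where K: "compact K" "K \<subseteq> S" "\<And>x. x \<notin> K \<Longrightarrow> \<phi> x = 0"
    "\<And>x. x \<notin> K \<Longrightarrow> frechet_derivative \<phi> (at x) = (\<lambda>v. 0)"
    using C1cE[OF assms(1)] by metis
  show i1: "integrable lebesgue (\<lambda>x. \<phi> x * frechet_derivative s (at x) v)"
    by (rule integrable_compact_support[OF K(1)])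
       (use K C1c_continuous[OF assms(1)] continuous_on_subset[OF Ck_on_1_continuous_frechet[OF assms(3)]] in
         \<open>auto intro!: continuous_on_mult\<close>)
  show i2: "integrable lebesgue (\<lambda>x. frechet_derivative \<phi> (at x) v * s x)"
    by (rule integrable_compact_support[OF K(1)])
       (use K C1c_continuous_frechet[OF assms(1)] continuous_on_subset[OF Ck_on_1_continuous[OF assms(3)]] in
         \<open>auto intro!: continuous_on_mult\<close>)
  have p: "C1c S (\<lambda>x. \<phi> x * s x)" by (rule C1c_mult[OF assms])
  have "frechet_derivative (\<lambda>x. \<phi> x * s x) (at x) v =
     \<phi> x * frechet_derivative s (at x) v + frechet_derivative \<phi> (at x) v * s x" for x
  proof (cases "x \<in> S")
    case True
    then show ?thesis
      using frechet_derivative_mult[OF C1c_differentiable[OF assms(1)]] assms(3) unfolding Ck_on_1 by blast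
  next
    case False
    then have x: "x \<notin> K" using K(2) by blast
    have "frechet_derivative (\<lambda>x. \<phi> x * s x) (at x) = (\<lambda>v. 0)"
    proof (rule frechet_derivative_eq, rule has_derivative_transform_within_open[of "\<lambda>x. 0" _ _ _ "- K"])
      show "open (- K)" using K(1) by (simp add: compact_imp_closed open_Compl)
    qed (use x K(3) in auto)
    then show ?thesis using K x by simp
  qed
  then have "(LINT x|lebesgue. \<phi> x * frechet_derivative s (at x) v + frechet_derivative \<phi> (at x) v * s x) = 0"
    using integral_frechet_C1c_zero[OF p, of v] by simp
  then show "(LINT x|lebesgue. \<phi> x * frechet_derivative s (at x) v) =
         - (LINT x|lebesgue. frechet_derivative \<phi> (at x) v * s x)"
    using i1 i2 by (simp add: eq_neg_iff_add_eq_0)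
qed

text \<open>The pairing is bilinear, without conjugation, and \<open>h\<close> collects the terms of
  order zero: Green's formula turns \<Delta>g + b^2 g = f into the vanishing of this expression for
  h = b^2 g - f.\<close>

definition weak_form :: "('a::euclidean_space \<Rightarrow> complex) \<Rightarrow> ('a \<Rightarrow> complex) \<Rightarrow> ('a \<Rightarrow> complex) \<Rightarrow> complex" where
  "weak_form g h \<psi> = (LINT x|lebesgue. (\<Sum>i\<in>Basis. partial_deriv i g x * partial_deriv i \<psi> x) - h x * \<psi> x)"

lemma weak_form_integrable:
  fixes g h \<psi> :: "'a::euclidean_space \<Rightarrow> complex"
  assumes "Ck_on 1 S g" "continuous_on S h" "C1c S \<psi>"
  shows "integrable lebesgue (\<lambda>x. (\<Sum>i\<in>Basis. partial_deriv i g x * partial_deriv i \<psi> x) - h x * \<psi> x)"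
proof -
  obtain K where K: "compact K" "K \<subseteq> S" "\<And>x. x \<notin> K \<Longrightarrow> \<psi> x = 0"
    "\<And>x. x \<notin> K \<Longrightarrow> frechet_derivative \<psi> (at x) = (\<lambda>v. 0)"
    using C1cE[OF assms(3)] by metis
  show ?thesis
  proof (rule integrable_compact_support[OF K(1)])
    have "continuous_on K (partial_deriv i g)" if "i \<in> Basis" for i
      using assms(1) K(2) continuous_on_subset that unfolding Ck_on_1 by blast
    moreover have "continuous_on K h" using assms(2) K(2) continuous_on_subset by blast
    ultimately show "continuous_on K (\<lambda>x. (\<Sum>i\<in>Basis. partial_deriv i g x * partial_deriv i \<psi> x) - h x * \<psi> x)"
      using C1c_continuous[OF assms(3)] C1c_continuous_partial[OF assms(3)]
      by (intro continuous_intros) auto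
  qed (use K in \<open>auto simp: partial_deriv_def\<close>)
qed

lemma partial_deriv_add:
  assumes "f differentiable (at x)" "g differentiable (at x)"
  shows "partial_deriv i (\<lambda>x. f x + g x) x = partial_deriv i f x + partial_deriv i g x"
  unfolding partial_deriv_def[of i f] partial_deriv_def[of i g]
  by (rule partial_deriv_eq) (use assms in \<open>auto intro!: has_derivative_add has_derivative_frechet\<close>)

lemma weak_form_sum:
  fixes g h :: "'a::euclidean_space \<Rightarrow> complex"
  assumes "Ck_on 1 S g" "continuous_on S h" "finite I" "\<And>j. j \<in> I \<Longrightarrow> C1c S (\<psi> j)"
  shows "weak_form g h (\<lambda>x. \<Sum>j\<in>I. \<psi> j x) = (\<Sum>j\<in>I. weak_form g h (\<psi> j))"
  using assms(3,4)
proof (induction I)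
  case empty
  have "partial_deriv i (\<lambda>x::'a. 0::complex) = (\<lambda>x. 0)" for i
    by (rule ext, rule partial_deriv_eq) (auto intro!: derivative_eq_intros)
  then show ?case by (simp add: weak_form_def)
next
  case (insert j I)
  have c: "C1c S (\<psi> j)" "C1c S (\<lambda>x. \<Sum>j\<in>I. \<psi> j x)" using insert by (auto intro: C1c_sum)
  have p: "partial_deriv i (\<lambda>x. \<psi> j x + (\<Sum>j\<in>I. \<psi> j x)) x =
     partial_deriv i (\<psi> j) x + partial_deriv i (\<lambda>x. \<Sum>j\<in>I. \<psi> j x) x" for i x
    by (rule partial_deriv_add) (use c C1c_differentiable in blast)+
  have "weak_form g h (\<lambda>x. \<psi> j x + (\<Sum>j\<in>I. \<psi> j x)) =
     weak_form g h (\<psi> j) + weak_form g h (\<lambda>x. \<Sum>j\<in>I. \<psi> j x)"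
    unfolding weak_form_def
    by (subst Bochner_Integration.integral_add[symmetric, OF weak_form_integrable[OF assms(1,2) c(1)]
          weak_form_integrable[OF assms(1,2) c(2)]])
       (simp add: p algebra_simps sum.distrib)
  then show ?case using insert by simp
qed

lemma set_lebesgue_integral_support:
  assumes "\<And>x. x \<notin> S \<Longrightarrow> F x = 0"
  shows "set_lebesgue_integral M S F = integral\<^sup>L M F"
  unfolding set_lebesgue_integral_def using assms
  by (intro arg_cong[of _ _ "integral\<^sup>L M"]) (auto simp: fun_eq_iff indicator_def)

text \<open>One integration by parts in the distributional equation, in which the first partial
  derivatives of \<open>\<phi>\<close> are the compactly supported factors and \<open>u\<close> is
  the other one.\<close>

lemma weak_form_smooth:
  fixes u f :: "'a::euclidean_space \<Rightarrow> complex"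
  assumes "open S" "helmholtz_on b S f u" "Ck_on 1 S u" "continuous_on S f"
    and \<phi>: "\<And>k. Ck_on k UNIV \<phi>" "compact L" "L \<subseteq> S" "\<And>x. x \<notin> L \<Longrightarrow> \<phi> x = 0"
  shows "weak_form u (\<lambda>x. b\<^sup>2 * u x - f x) \<phi> = 0"
proof -
  have cl: "closed L" using \<phi>(2) by (rule compact_imp_closed)
  have "{x. \<phi> x \<noteq> 0} \<subseteq> L" using \<phi>(4) by auto
  then have cL: "closure {x. \<phi> x \<noteq> 0} \<subseteq> L" using cl by (rule closure_minimal)
  then have "compact (closure {x. \<phi> x \<noteq> 0})"
    using \<phi>(2) closed_subset compact_Int_closed[of L "closure {x. \<phi> x \<noteq> 0}"] by (simp add: Int_absorb1)
  then have tf: "test_function S \<phi>" unfolding test_function_def smooth_on_def using \<phi>(1,3) cL by blast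
  have C: "C1c S \<phi>" using \<phi> unfolding C1c_def by blast
  have z: "partial_deriv i F x = 0" if "x \<notin> L" "\<And>x. x \<notin> L \<Longrightarrow> F x = (0::complex)" for i F x
  proof -
    have "partial_deriv i F x = partial_deriv i (\<lambda>x. 0) x"
      by (rule partial_deriv_cong_open[of "- L"]) (use that cl in auto)
    also have "\<dots> = 0" by (rule partial_deriv_eq) simp
    finally show ?thesis .
  qed
  have z1: "partial_deriv i \<phi> x = 0" if "x \<notin> L" for i x by (rule z[OF that \<phi>(4)])
  have z2: "partial_deriv j (partial_deriv i \<phi>) x = 0" if "x \<notin> L" for i j x by (rule z[OF that z1])
  have Ci: "C1c S (partial_deriv i \<phi>)" if "i \<in> Basis" for i
    using \<phi>(1)[of "Suc 1"] that \<phi>(2,3) z1 unfolding C1c_def Ck_on.simps(2)[of 1] by blast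
  have "(LINT x:S|lebesgue. u x * (laplacian \<phi> x + b\<^sup>2 * \<phi> x)) = (LINT x:S|lebesgue. f x * \<phi> x)"
    using assms(2) tf unfolding helmholtz_on_def by blast
  moreover have "(LINT x:S|lebesgue. f x * \<phi> x) = (LINT x|lebesgue. f x * \<phi> x)"
    by (rule set_lebesgue_integral_support) (use \<phi> in auto)
  moreover have "(LINT x:S|lebesgue. u x * (laplacian \<phi> x + b\<^sup>2 * \<phi> x)) =
      (LINT x|lebesgue. u x * (laplacian \<phi> x + b\<^sup>2 * \<phi> x))"
  proof (rule set_lebesgue_integral_support)
    fix x assume "x \<notin> S"
    then have "x \<notin> L" using \<phi>(3) by blast
    then show "u x * (laplacian \<phi> x + b\<^sup>2 * \<phi> x) = 0" using z2 \<phi>(4) by (simp add: laplacian_def)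
  qed
  ultimately have eq: "(LINT x|lebesgue. u x * (laplacian \<phi> x + b\<^sup>2 * \<phi> x)) = (LINT x|lebesgue. f x * \<phi> x)" by simp
  have cu: "continuous_on L u" using Ck_on_1_continuous[OF assms(3)] \<phi>(3) continuous_on_subset by blast
  have cf: "continuous_on L f" using assms(4) \<phi>(3) continuous_on_subset by blast
  have c\<phi>: "continuous_on L \<phi>" using C1c_continuous[OF C] .
  have int_f: "integrable lebesgue (\<lambda>x. f x * \<phi> x)" "integrable lebesgue (\<lambda>x. u x * (b\<^sup>2 * \<phi> x))"
    by (rule integrable_compact_support[OF \<phi>(2)]; use cf cu c\<phi> \<phi>(4) in \<open>auto intro!: continuous_intros\<close>)+
  have ibp: "integrable lebesgue (\<lambda>x. partial_deriv i \<phi> x * partial_deriv i u x)"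
    "integrable lebesgue (\<lambda>x. partial_deriv i (partial_deriv i \<phi>) x * u x)"
    "(LINT x|lebesgue. partial_deriv i \<phi> x * partial_deriv i u x) =
     - (LINT x|lebesgue. partial_deriv i (partial_deriv i \<phi>) x * u x)" if "i \<in> Basis" for i
    using integration_by_parts[OF Ci[OF that] assms(1,3), of i] by (simp_all add: partial_deriv_def)
  have "(LINT x|lebesgue. u x * (laplacian \<phi> x + b\<^sup>2 * \<phi> x)) =
     (LINT x|lebesgue. (\<Sum>i\<in>Basis. partial_deriv i (partial_deriv i \<phi>) x * u x) + u x * (b\<^sup>2 * \<phi> x))"
    by (simp add: laplacian_def algebra_simps sum_distrib_left)
  also have "\<dots> = (\<Sum>i\<in>Basis. LINT x|lebesgue. partial_deriv i (partial_deriv i \<phi>) x * u x) + (LINT x|lebesgue. u x * (b\<^sup>2 * \<phi> x))"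
    using ibp int_f by (subst Bochner_Integration.integral_add) auto
  also have "(\<Sum>i\<in>Basis. LINT x|lebesgue. partial_deriv i (partial_deriv i \<phi>) x * u x) =
     - (\<Sum>i\<in>Basis. LINT x|lebesgue. partial_deriv i \<phi> x * partial_deriv i u x)"
    by (simp add: ibp(3) sum_negf)
  finally have e2: "(\<Sum>i\<in>Basis. LINT x|lebesgue. partial_deriv i \<phi> x * partial_deriv i u x)
     = (LINT x|lebesgue. u x * (b\<^sup>2 * \<phi> x)) - (LINT x|lebesgue. f x * \<phi> x)"
    using eq by (simp add: algebra_simps)
  have "weak_form u (\<lambda>x. b\<^sup>2 * u x - f x) \<phi> =
    (LINT x|lebesgue. (\<Sum>i\<in>Basis. partial_deriv i \<phi> x * partial_deriv i u x) - (u x * (b\<^sup>2 * \<phi> x) - f x * \<phi> x))"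
    unfolding weak_form_def by (simp add: algebra_simps)
  also have "\<dots> = (\<Sum>i\<in>Basis. LINT x|lebesgue. partial_deriv i \<phi> x * partial_deriv i u x)
     - ((LINT x|lebesgue. u x * (b\<^sup>2 * \<phi> x)) - (LINT x|lebesgue. f x * \<phi> x))"
    using ibp int_f by (subst Bochner_Integration.integral_diff) auto
  finally show ?thesis using e2 by simp
qed

text \<open>Density of smooth test functions with respect to uniform convergence of values and first
  derivatives. All approximations are supported in one compact set, over which the coefficients are
  integrable.\<close>

lemma weak_form_C1c_of_smooth:
  fixes g h :: "'a::euclidean_space \<Rightarrow> complex"
  assumes "open S" "Ck_on 1 S g" "continuous_on S h"
    and smooth: "\<And>\<phi> L. (\<And>k. Ck_on k UNIV \<phi>) \<Longrightarrow> compact L \<Longrightarrow> L \<subseteq> S \<Longrightarrow> (\<And>x. x \<notin> L \<Longrightarrow> \<phi> x = 0) \<Longrightarrow>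
       weak_form g h \<phi> = 0"
    and \<psi>: "C1c S \<psi>"
  shows "weak_form g h \<psi> = 0"
proof -
  obtain L where L: "compact L" "L \<subseteq> S"
    and app: "\<And>e. e > 0 \<Longrightarrow> \<exists>\<Psi>. (\<forall>k. Ck_on k UNIV \<Psi>) \<and> (\<forall>x. x \<notin> L \<longrightarrow> \<Psi> x = 0) \<and>
        (\<forall>x. cmod (\<Psi> x - \<psi> x) \<le> e) \<and>
        (\<forall>i\<in>Basis. \<forall>x. cmod (partial_deriv i \<Psi> x - partial_deriv i \<psi> x) \<le> e)"
    using mollify_C1c[OF \<psi> assms(1)] by metis
  obtain K where K: "compact K" "K \<subseteq> S" "\<And>x. x \<notin> K \<Longrightarrow> \<psi> x = 0"
    "\<And>x. x \<notin> K \<Longrightarrow> frechet_derivative \<psi> (at x) = (\<lambda>v. 0)"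
    using C1cE[OF \<psi>] by metis
  define M where "M = K \<union> L"
  have M: "compact M" "M \<subseteq> S" using K L by (auto simp: M_def)
  \<comment> \<open>Pointwise bound of the integrand per unit of error in the test function; outside
    \<open>M\<close> both test functions vanish.\<close>
  define B where "B x = (if x \<in> M then (\<Sum>i\<in>(Basis::'a set). cmod (partial_deriv i g x)) + cmod (h x) else 0)" for x
  have intB: "integrable lebesgue B"
  proof (rule integrable_compact_support[OF M(1)])
    have "continuous_on M (\<lambda>x. (\<Sum>i\<in>(Basis::'a set). cmod (partial_deriv i g x)) + cmod (h x))"
      using assms(2,3) M(2) continuous_on_subset unfolding Ck_on_1 by (intro continuous_intros) blast+
    then show "continuous_on M B" by (rule continuous_on_eq) (simp add: B_def)
  qed (simp add: B_def)
  define C where "C = integral\<^sup>L lebesgue B"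
  have bound: "cmod (weak_form g h \<psi>) \<le> e * C" if e: "e > 0" for e
  proof -
    obtain \<Psi> where \<Psi>: "\<And>k. Ck_on k UNIV \<Psi>" "\<And>x. x \<notin> L \<Longrightarrow> \<Psi> x = 0"
        "\<And>x. cmod (\<Psi> x - \<psi> x) \<le> e"
        "\<And>i x. i\<in>Basis \<Longrightarrow> cmod (partial_deriv i \<Psi> x - partial_deriv i \<psi> x) \<le> e"
      using app[OF e] by blast
    have C1: "C1c S \<Psi>" using \<Psi> L unfolding C1c_def by blast
    obtain K' where K': "\<And>x. x \<notin> L \<Longrightarrow> partial_deriv i \<Psi> x = 0" for i
    proof -
      have "partial_deriv i \<Psi> x = 0" if "x \<notin> L" for i x
      proof -
        have "partial_deriv i \<Psi> x = partial_deriv i (\<lambda>x. 0) x"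
          by (rule partial_deriv_cong_open[of "- L"]) (use that \<Psi>(2) L(1) in \<open>auto simp: compact_imp_closed open_Compl\<close>)
        also have "\<dots> = 0" by (rule partial_deriv_eq) simp
        finally show ?thesis .
      qed
      then show ?thesis using that by blast
    qed
    let ?W = "\<lambda>\<psi> x. (\<Sum>i\<in>Basis. partial_deriv i g x * partial_deriv i \<psi> x) - h x * \<psi> x"
    note i1 = weak_form_integrable[OF assms(2,3) \<psi>] and i2 = weak_form_integrable[OF assms(2,3) C1]
    have "weak_form g h \<psi> = weak_form g h \<psi> - weak_form g h \<Psi>"
      using smooth[OF \<Psi>(1) L \<Psi>(2)] by simp
    also have "\<dots> = (LINT x|lebesgue. ?W \<psi> x - ?W \<Psi> x)"
      unfolding weak_form_def by (rule Bochner_Integration.integral_diff[symmetric, OF i1 i2])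
    also have "cmod \<dots> \<le> (LINT x|lebesgue. e * B x)"
    proof (rule Bochner_Integration.integral_norm_bound_integral)
      show "integrable lebesgue (\<lambda>x. ?W \<psi> x - ?W \<Psi> x)" using i1 i2 by simp
      show "integrable lebesgue (\<lambda>x. e * B x)" using intB by simp
      fix x
      have "?W \<psi> x - ?W \<Psi> x = (\<Sum>i\<in>Basis. partial_deriv i g x * (partial_deriv i \<psi> x - partial_deriv i \<Psi> x)) - h x * (\<psi> x - \<Psi> x)"
        by (simp add: sum_subtractf algebra_simps)
      also have "cmod \<dots> \<le> cmod (\<Sum>i\<in>Basis. partial_deriv i g x * (partial_deriv i \<psi> x - partial_deriv i \<Psi> x)) + cmod (h x * (\<psi> x - \<Psi> x))"
        by (rule norm_triangle_ineq4)
      also have "\<dots> \<le> (\<Sum>i\<in>Basis. cmod (partial_deriv i g x) * cmod (partial_deriv i \<psi> x - partial_deriv i \<Psi> x)) + cmod (h x) * cmod (\<psi> x - \<Psi> x)"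
        by (intro add_mono order_trans[OF norm_sum]) (simp_all add: norm_mult)
      also have "\<dots> \<le> e * B x"
      proof (cases "x \<in> M")
        case True
        have "(\<Sum>i\<in>Basis. cmod (partial_deriv i g x) * cmod (partial_deriv i \<psi> x - partial_deriv i \<Psi> x)) + cmod (h x) * cmod (\<psi> x - \<Psi> x)
          \<le> (\<Sum>i\<in>(Basis::'a set). cmod (partial_deriv i g x) * e) + cmod (h x) * e"
          using \<Psi>(3,4) by (intro add_mono sum_mono mult_left_mono) (auto simp: norm_minus_commute)
        also have "\<dots> = e * B x" using True by (simp add: B_def sum_distrib_left algebra_simps)
        finally show ?thesis .
      next
        case False
        then show ?thesis using K(3,4) \<Psi>(2) K' by (auto simp: M_def B_def partial_deriv_def)
      qed
      finally show "cmod (?W \<psi> x - ?W \<Psi> x) \<le> e * B x" .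
    qed
    also have "\<dots> = e * C" by (simp add: C_def)
    finally show ?thesis .
  qed
  have "cmod (weak_form g h \<psi>) \<le> 0"
  proof (rule field_le_epsilon)
    fix e :: real assume "e > 0"
    have C0: "C \<ge> 0" unfolding C_def by (rule Bochner_Integration.integral_nonneg) (auto simp: B_def sum_nonneg)
    then have "cmod (weak_form g h \<psi>) \<le> e / (C + 1) * C" using \<open>e > 0\<close> by (intro bound) simp
    also have "\<dots> \<le> 0 + e" using C0 \<open>e > 0\<close> by (simp add: field_simps)
    finally show "cmod (weak_form g h \<psi>) \<le> 0 + e" .
  qed
  then show ?thesis by simp
qed

subsection \<open>A C1 step function\<close>

text \<open>A nondecreasing cutoff that is 0 for t \<le> 0 and tends to 1. It is C^1, as are the
  test functions that it multiplies, and being rational it allows explicit bounds on the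
  derivative.\<close>

definition step :: "real \<Rightarrow> real" where
  "step t = (max 0 t)\<^sup>2 / (1 + (max 0 t)\<^sup>2)"

definition step' :: "real \<Rightarrow> real" where
  "step' t = 2 * max 0 t / (1 + (max 0 t)\<^sup>2)\<^sup>2"

lemma one_plus_square_pos: "1 + (x::real)\<^sup>2 > 0"
  by (smt (verit) zero_le_power2)

lemma step_has_derivative: "(step has_real_derivative step' t) (at t)"
proof -
  have sq: "((\<lambda>t. (max 0 t)\<^sup>2) has_real_derivative 2 * max 0 t) (at t)" for t :: real
  proof -
    consider "t > 0" | "t < 0" | "t = 0" by linarith
    then show ?thesis
    proof cases
      case 1
      have "((\<lambda>t. t\<^sup>2) has_real_derivative 2 * max 0 t) (at t)"
        using 1 by (auto intro!: derivative_eq_intros)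
      then show ?thesis
        by (rule has_field_derivative_transform_within_open[where S="{0<..}"]) (use 1 in auto)
    next
      case 2
      have "((\<lambda>t. 0) has_real_derivative 2 * max 0 t) (at t)" using 2 by simp
      then show ?thesis
        by (rule has_field_derivative_transform_within_open[where S="{..<0}"]) (use 2 in auto)
    next
      case 3
      have "((\<lambda>h::real. (max 0 h)\<^sup>2 / h) \<longlongrightarrow> 0) (at 0)"
      proof (rule Lim_null_comparison)
        show "\<forall>\<^sub>F h in at (0::real). norm ((max 0 h)\<^sup>2 / h) \<le> \<bar>h\<bar>"
          by (rule always_eventually) (auto simp: max_def power2_eq_square)
        show "((\<lambda>h::real. \<bar>h\<bar>) \<longlongrightarrow> 0) (at 0)" using tendsto_rabs_zero tendsto_ident_at by blast
      qed
      then show ?thesis using 3 by (simp add: has_field_derivative_iff)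
    qed
  qed
  have "((\<lambda>t. (max 0 t)\<^sup>2 / (1 + (max 0 t)\<^sup>2)) has_real_derivative
     ((2 * max 0 t) * (1 + (max 0 t)\<^sup>2) - (max 0 t)\<^sup>2 * (0 + 2 * max 0 t)) / ((1 + (max 0 t)\<^sup>2) * (1 + (max 0 t)\<^sup>2))) (at t)"
    by (rule DERIV_divide[OF sq DERIV_add[OF DERIV_const sq]])
       (use one_plus_square_pos[of "max 0 t"] in linarith)
  moreover have "((2 * max 0 t) * (1 + (max 0 t)\<^sup>2) - (max 0 t)\<^sup>2 * (0 + 2 * max 0 t)) / ((1 + (max 0 t)\<^sup>2) * (1 + (max 0 t)\<^sup>2)) = step' t"
    unfolding step'_def by (simp add: power2_eq_square algebra_simps)
  ultimately show ?thesis unfolding step_def[abs_def] by simp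
qed

lemma step_bounds: "0 \<le> step t" "step t \<le> 1" "0 \<le> step' t"
  unfolding step_def step'_def by (auto simp: divide_simps one_plus_square_pos add_pos_nonneg)

lemma step_zero: "t \<le> 0 \<Longrightarrow> step t = 0" "t \<le> 0 \<Longrightarrow> step' t = 0"
  by (auto simp: step_def step'_def)

text \<open>For t > 0 the inequality behind this is 3(1 + t^2) - 2t(t + 1) = (t - 1)^2 + 2 > 0. At t
  = n s - 1 the factor t + 1 is n s, so the bound controls n s \<open>step'\<close> uniformly in n
  and forces it to 0 as n grows.\<close>

lemma step'_bound: "(t + 1) * step' t \<le> 3 / (1 + (max 0 t)\<^sup>2)"
proof (cases "t \<le> 0")
  case True
  then show ?thesis by (simp add: step_zero)
next
  case False
  then have "(t + 1) * (2 * t) \<le> 3 * (1 + t\<^sup>2)"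
    using zero_le_power2[of "t - 1"] by (simp add: power2_eq_square algebra_simps)
  then have "(t + 1) * (2 * t) / (1 + t\<^sup>2)\<^sup>2 \<le> 3 * (1 + t\<^sup>2) / (1 + t\<^sup>2)\<^sup>2"
    by (rule divide_right_mono) simp
  also have "\<dots> = 3 / (1 + t\<^sup>2)"
    unfolding power2_eq_square[of "1 + t\<^sup>2"]
    by (rule nonzero_mult_divide_mult_cancel_right) (use one_plus_square_pos[of t] in linarith)
  finally show ?thesis using False by (simp add: step'_def)
qed

lemma continuous_step': "continuous_on S step'"
proof -
  have "1 + (max 0 t)\<^sup>2 \<noteq> (0::real)" for t using one_plus_square_pos[of "max 0 t"] by linarith
  then show ?thesis unfolding step'_def[abs_def] by (intro continuous_intros) auto
qed

lemma step_sequence: "s > 0 \<Longrightarrow> (\<lambda>n. step (real n * s - 1)) \<longlonglongrightarrow> 1"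
proof -
  assume s: "s > 0"
  have "filterlim (\<lambda>n. real n * s - 1) at_top sequentially"
    using filterlim_tendsto_add_at_top[OF tendsto_const
        filterlim_tendsto_pos_mult_at_top[OF tendsto_const s filterlim_real_sequentially], of "-1"]
    by (simp add: mult.commute)
  moreover have "(step \<longlongrightarrow> 1) at_top"
  proof -
    have "((\<lambda>t::real. 1 - 1 / (1 + t\<^sup>2)) \<longlongrightarrow> 1 - 0) at_top"
    proof (intro tendsto_intros tendsto_divide_0[OF tendsto_const])
      have "filterlim (\<lambda>t::real. 1 + t\<^sup>2) at_top at_top"
        by (intro filterlim_tendsto_add_at_top[OF tendsto_const] filterlim_pow_at_top filterlim_ident) auto
      then show "filterlim (\<lambda>t::real. 1 + t\<^sup>2) at_infinity at_top" by (rule filterlim_at_top_imp_at_infinity)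
    qed
    moreover have "\<forall>\<^sub>F t in at_top. 1 - 1 / (1 + t\<^sup>2) = step t"
      using eventually_gt_at_top[of 0]
    proof (rule eventually_mono)
      fix t :: real assume "0 < t"
      then show "1 - 1 / (1 + t\<^sup>2) = step t"
        using one_plus_square_pos[of t] by (simp add: step_def field_simps)
    qed
    ultimately show ?thesis using Lim_transform_eventually by fastforce
  qed
  ultimately show ?thesis using filterlim_compose by blast
qed

subsection \<open>Removing the interface from the weak formulation\<close>

lemma bump_ge_on_ball:
  assumes "r > 0"
  obtains m where "m > 0" "\<And>x::'a::euclidean_space. norm x \<le> r \<Longrightarrow> bump (2 * r) x \<ge> m"
proof -
  have "compact (cball (0::'a) r)" "cball (0::'a) r \<noteq> {}" using assms by auto
  then obtain y where y: "y \<in> cball (0::'a) r" "\<And>x::'a. x \<in> cball 0 r \<Longrightarrow> bump (2 * r) y \<le> bump (2 * r) x"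
    using continuous_attains_inf[OF _ _ continuous_bump] by metis
  have "bump (2 * r) y > 0" using y(1) assms by (intro bump_pos) simp
  then show ?thesis using that y(2) by simp
qed

lemma C1c_shifted_bump:
  assumes "r > 0" "cball p r \<subseteq> S"
  shows "C1c S (\<lambda>x::'a::euclidean_space. bump r (x - p))"
proof -
  have sm: "Ck_on 1 UNIV (bump r :: 'a \<Rightarrow> real)" by (rule smooth_bump)
  have "Ck_on 1 UNIV (\<lambda>x::'a. bump r (x - p))"
  proof (rule Ck_on_1I)
    fix x
    have "(bump r has_derivative frechet_derivative (bump r) (at (x - p))) (at (x - p))"
      using sm unfolding Ck_on_1 by (auto intro!: has_derivative_frechet)
    then show "((\<lambda>x. bump r (x - p)) has_derivative frechet_derivative (bump r) (at (x - p))) (at x)"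
      by (intro has_derivative_compose[of "\<lambda>x. x - p" "\<lambda>v. v" _ _ "bump r"])
         (auto intro!: derivative_eq_intros)
  next
    fix i :: 'a
    show "continuous_on UNIV (\<lambda>x. frechet_derivative (bump r) (at (x - p)) i)"
      by (rule continuous_on_compose2[OF Ck_on_1_continuous_frechet[OF sm]]) (auto intro!: continuous_intros)
  qed
  moreover have "bump r (x - p) = 0" if "x \<notin> cball p r" for x
    using that assms(1) by (intro bump_zero) (auto simp: dist_norm norm_minus_commute)
  ultimately show ?thesis unfolding C1c_def using assms(2) compact_cball by blast
qed

lemma step_compose:
  fixes \<rho> :: "'a::euclidean_space \<Rightarrow> real"
  assumes "Ck_on 1 S \<rho>"
  shows "Ck_on 1 S (\<lambda>x. step (c * \<rho> x - 1))"
    and "x \<in> S \<Longrightarrow> frechet_derivative (\<lambda>x. step (c * \<rho> x - 1)) (at x) =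
          (\<lambda>v. step' (c * \<rho> x - 1) * (c * frechet_derivative \<rho> (at x) v))"
proof -
  have d: "((\<lambda>x. step (c * \<rho> x - 1)) has_derivative (\<lambda>v. step' (c * \<rho> x - 1) * (c * frechet_derivative \<rho> (at x) v))) (at x)"
    if "x \<in> S" for x
  proof -
    have "(\<rho> has_derivative frechet_derivative \<rho> (at x)) (at x)"
      using assms that unfolding Ck_on_1 by (auto intro!: has_derivative_frechet)
    then have "((\<lambda>x. c * \<rho> x - 1) has_derivative (\<lambda>v. c * frechet_derivative \<rho> (at x) v)) (at x)"
      by (auto intro!: derivative_eq_intros)
    from has_derivative_compose[OF this step_has_derivative[THEN has_field_derivative_imp_has_derivative]]
    show ?thesis .
  qed
  then show "x \<in> S \<Longrightarrow> frechet_derivative (\<lambda>x. step (c * \<rho> x - 1)) (at x) =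
          (\<lambda>v. step' (c * \<rho> x - 1) * (c * frechet_derivative \<rho> (at x) v))"
    by (rule frechet_derivative_eq)
  show "Ck_on 1 S (\<lambda>x. step (c * \<rho> x - 1))"
  proof (rule Ck_on_1I[OF d])
    fix i :: 'a
    show "continuous_on S (\<lambda>x. step' (c * \<rho> x - 1) * (c * frechet_derivative \<rho> (at x) i))"
      by (intro continuous_intros continuous_on_compose2[OF continuous_step'[of UNIV]]
          Ck_on_1_continuous[OF assms] Ck_on_1_continuous_frechet[OF assms]) auto
  qed
qed

text \<open>The test function is multiplied by a cutoff \<open>\<sigma> n\<close> that vanishes near \<open>\<Gamma>\<close>. The derivative of
  \<open>\<sigma> n\<close> is of order \<open>n\<close> but bounded in \<open>L\<^sup>1\<close>, so its coefficient \<open>Q\<close> may be replaced by a compactly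
  supported \<open>C\<^sup>1\<close> function \<open>\<kappa>\<close>. Integrating by parts and using \<open>\<sigma> n \<longlonglongrightarrow> 1\<close> almost everywhere, the
  contribution tends to minus the integral of a derivative of \<open>\<kappa>\<close>, which is zero.\<close>
lemma weak_form_near_interface:
  fixes g h :: "'a::euclidean_space \<Rightarrow> complex" and \<rho> :: "'a \<Rightarrow> real"
  assumes r: "r > 0" and B': "ball p (3 * r) \<subseteq> S" "open S" and g: "Ck_on 1 S g" and h: "continuous_on S h"
    and \<rho>: "Ck_on 1 (ball p (3 * r)) \<rho>" "\<And>x. x \<in> ball p (3 * r) \<Longrightarrow> frechet_derivative \<rho> (at x) v > 0"
    and \<Gamma>: "\<Gamma> \<inter> ball p (3 * r) = {x \<in> ball p (3 * r). \<rho> x = 0}" "negligible \<Gamma>"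
    and off: "\<And>\<phi>. C1c (S - \<Gamma>) \<phi> \<Longrightarrow> weak_form g h \<phi> = 0"
    and \<psi>: "C1c (ball p r) \<psi>"
  shows "weak_form g h \<psi> = 0"
proof -
  let ?B = "ball p r" and ?B3 = "ball p (3 * r)"
  have BB: "?B \<subseteq> ?B3" using r by auto
  have BS: "?B \<subseteq> S" using BB B' by blast
  obtain K where K: "compact K" "K \<subseteq> ?B" "\<And>x. x \<notin> K \<Longrightarrow> \<psi> x = 0"
    "\<And>x. x \<notin> K \<Longrightarrow> frechet_derivative \<psi> (at x) = (\<lambda>v. 0)"
    using C1cE[OF \<psi>] by metis
  have K3: "K \<subseteq> ?B3" and KS: "K \<subseteq> S" using K(2) BB BS by blast+
  let ?D\<rho> = "\<lambda>x. frechet_derivative \<rho> (at x)"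
  \<comment> \<open>\<open>sp\<close> and \<open>sm\<close> are cutoffs for the two sides of the
    level set; at each point at least one of them vanishes, and both vanish where |\<rho>| n \<le>
    1.\<close>
  define sp where "sp n x = step (real n * \<rho> x - 1)" for n x
  define sm where "sm n x = step (- real n * \<rho> x - 1)" for n x
  define \<sigma> where "\<sigma> n x = complex_of_real (sp n x + sm n x)" for n x
  have sp: "Ck_on 1 ?B3 (sp n)" "Ck_on 1 ?B3 (sm n)" for n
    unfolding sp_def[abs_def] sm_def[abs_def] by (rule step_compose(1)[OF \<rho>(1)])+
  have dsp: "frechet_derivative (sp n) (at x) = (\<lambda>w. step' (real n * \<rho> x - 1) * (real n * ?D\<rho> x w))"
     "frechet_derivative (sm n) (at x) = (\<lambda>w. step' (- real n * \<rho> x - 1) * (- real n * ?D\<rho> x w))"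
    if "x \<in> ?B3" for n x
    unfolding sp_def[abs_def] sm_def[abs_def] by (rule step_compose(2)[OF \<rho>(1) that])+
  have spd: "sp n differentiable (at x)" "sm n differentiable (at x)" if "x \<in> ?B3" for n x
    using sp that unfolding Ck_on_1 by blast+
  have \<sigma>C: "Ck_on 1 ?B3 (\<sigma> n)" for n
    unfolding \<sigma>_def[abs_def]
    by (rule Ck_on_bounded_linear_comp[OF bounded_linear_of_real open_ball Ck_on_add[OF open_ball sp]])
  define W where "W n x = real n * (step' (real n * \<rho> x - 1) - step' (- real n * \<rho> x - 1))" for n x
  have d\<sigma>: "frechet_derivative (\<sigma> n) (at x) = (\<lambda>w. complex_of_real (W n x * ?D\<rho> x w))" if "x \<in> ?B3" for n x
  proof (rule frechet_derivative_eq)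
    have "((\<lambda>x. sp n x + sm n x) has_derivative (\<lambda>w. step' (real n * \<rho> x - 1) * (real n * ?D\<rho> x w) + step' (- real n * \<rho> x - 1) * (- real n * ?D\<rho> x w))) (at x)"
      using has_derivative_add[OF has_derivative_frechet[OF spd(1)[OF that]] has_derivative_frechet[OF spd(2)[OF that]], of n n]
      by (simp only: dsp[OF that])
    then have "((\<lambda>x. sp n x + sm n x) has_derivative (\<lambda>w. W n x * ?D\<rho> x w)) (at x)"
      by (simp add: W_def algebra_simps)
    then show "(\<sigma> n has_derivative (\<lambda>w. complex_of_real (W n x * ?D\<rho> x w))) (at x)"
      unfolding \<sigma>_def[abs_def] by (rule bounded_linear.has_derivative[OF bounded_linear_of_real])
  qed
  have \<sigma>0: "\<sigma> n x = 0" if "\<bar>\<rho> x\<bar> * real n \<le> 1" for n x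
  proof -
    have "real n * \<rho> x - 1 \<le> 0" "- real n * \<rho> x - 1 \<le> 0"
      using that by (auto simp: abs_if mult.commute split: if_splits) (smt (verit) mult_nonneg_nonneg mult_le_0_iff of_nat_0_le_iff mult.commute)+
    then show ?thesis by (simp add: \<sigma>_def sp_def sm_def step_zero)
  qed
  have \<sigma>b: "cmod (\<sigma> n x) \<le> 2" for n x
  proof -
    have "0 \<le> sp n x" "sp n x \<le> 1" "0 \<le> sm n x" "sm n x \<le> 1" by (auto simp: sp_def sm_def step_bounds)
    then show ?thesis unfolding \<sigma>_def norm_of_real by linarith
  qed
  have \<sigma>lim: "(\<lambda>n. \<sigma> n x) \<longlonglongrightarrow> 1" if "\<rho> x \<noteq> 0" for x
  proof -
    have "(\<lambda>n. sp n x + sm n x) \<longlonglongrightarrow> 1"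
    proof (cases "\<rho> x > 0")
      case True
      have "sm n x = 0" for n
      proof -
        have "real n * \<rho> x \<ge> 0" using True by simp
        then show ?thesis unfolding sm_def by (intro step_zero(1)) simp
      qed
      then show ?thesis using step_sequence[OF True] by (simp add: sp_def)
    next
      case False
      then have neg: "- \<rho> x > 0" using that by simp
      then have "sp n x = 0" for n
      proof -
        have "real n * \<rho> x \<le> 0" using neg by (simp add: mult_nonneg_nonpos)
        then show ?thesis unfolding sp_def by (intro step_zero(1)) simp
      qed
      then show ?thesis using step_sequence[OF neg] by (simp add: sm_def)
    qed
    from tendsto_of_real[OF this] show ?thesis by (simp add: \<sigma>_def)
  qed
  define \<psi>n where "\<psi>n n x = \<psi> x * \<sigma> n x" for n x
  have clG: "closed {x \<in> K. 1 \<le> \<bar>\<rho> x\<bar> * real n}" for n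
  proof -
    have "continuous_on K \<rho>" using Ck_on_1_continuous[OF \<rho>(1)] K3 continuous_on_subset by blast
    then have "continuous_on K (\<lambda>x. \<bar>\<rho> x\<bar> * real n)" by (intro continuous_intros)
    then have "closed (K \<inter> (\<lambda>x. \<bar>\<rho> x\<bar> * real n) -` {1..})"
      by (rule continuous_closed_preimage[OF _ compact_imp_closed[OF K(1)] closed_atLeast])
    moreover have "K \<inter> (\<lambda>x. \<bar>\<rho> x\<bar> * real n) -` {1..} = {x \<in> K. 1 \<le> \<bar>\<rho> x\<bar> * real n}" by auto
    ultimately show ?thesis by simp
  qed
  have \<psi>nC3: "C1c ?B (\<psi>n n)" for n
    unfolding \<psi>n_def[abs_def] by (rule C1c_mult[OF \<psi> open_ball Ck_on_subset[OF \<sigma>C BB]])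
  \<comment> \<open>The support lies in the compact set where |\<rho>| n \<ge> 1, which avoids
    \<open>\<Gamma>\<close>; so the equation off \<open>\<Gamma>\<close> may be tested with this
    function.\<close>
  have \<psi>nC: "C1c (S - \<Gamma>) (\<psi>n n)" for n
    unfolding C1c_def
  proof (intro conjI exI)
    show "Ck_on 1 UNIV (\<psi>n n)" by (rule C1c_Ck[OF \<psi>nC3])
    show "compact {x \<in> K. 1 \<le> \<bar>\<rho> x\<bar> * real n}"
    proof -
      have "K \<inter> {x \<in> K. 1 \<le> \<bar>\<rho> x\<bar> * real n} = {x \<in> K. 1 \<le> \<bar>\<rho> x\<bar> * real n}" by blast
      then show ?thesis using compact_Int_closed[OF K(1) clG[of n]] by metis
    qed
    show "{x \<in> K. 1 \<le> \<bar>\<rho> x\<bar> * real n} \<subseteq> S - \<Gamma>"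
    proof
      fix x assume x: "x \<in> {x \<in> K. 1 \<le> \<bar>\<rho> x\<bar> * real n}"
      then have "\<rho> x \<noteq> 0" by auto
      moreover have "x \<in> ?B3" "x \<in> S" using x K3 KS by blast+
      ultimately show "x \<in> S - \<Gamma>" using \<Gamma>(1) by blast
    qed
    show "\<forall>x. x \<notin> {x \<in> K. 1 \<le> \<bar>\<rho> x\<bar> * real n} \<longrightarrow> \<psi>n n x = 0"
      using K(3) \<sigma>0 by (auto simp: \<psi>n_def not_le intro: less_imp_le)
  qed
  define T where "T x = (\<Sum>i\<in>Basis. partial_deriv i g x * partial_deriv i \<psi> x) - h x * \<psi> x" for x
  \<comment> \<open>Every partial derivative of the cutoff is \<open>W n x\<close> times that of
    \<open>\<rho>\<close>, and the derivative of \<open>\<rho>\<close> along \<open>v\<close> is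
    nonzero. With this coefficient the terms carrying derivatives of the cutoff combine to
    \<open>Q\<close> times its derivative in the single direction \<open>v\<close>.\<close>
  define Q where "Q x = (if x \<in> K then \<psi> x * (\<Sum>i\<in>Basis. partial_deriv i g x * complex_of_real (?D\<rho> x i)) / complex_of_real (?D\<rho> x v) else 0)" for x
  have pz: "partial_deriv i \<psi> x = 0" if "x \<notin> K" for i x using K(4)[OF that] by (simp add: partial_deriv_def)
  have intT: "integrable lebesgue T" unfolding T_def[abs_def]
    by (rule weak_form_integrable[OF g h C1c_mono[OF \<psi> BS]])
  have split: "(\<Sum>i\<in>Basis. partial_deriv i g x * partial_deriv i (\<psi>n n) x) - h x * \<psi>n n x
      = \<sigma> n x * T x + Q x * frechet_derivative (\<sigma> n) (at x) v" for n x
  proof (cases "x \<in> K")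
    case True
    then have x3: "x \<in> ?B3" using K3 by blast
    have Dv: "?D\<rho> x v \<noteq> 0" using \<rho>(2)[OF x3] by simp
    have sd: "\<sigma> n differentiable (at x)" using \<sigma>C x3 unfolding Ck_on_1 by blast
    have pd: "partial_deriv i (\<psi>n n) x = \<psi> x * complex_of_real (W n x * ?D\<rho> x i) + partial_deriv i \<psi> x * \<sigma> n x" for i
      unfolding \<psi>n_def[abs_def] partial_deriv_mult[OF C1c_differentiable[OF \<psi>] sd]
      by (simp add: partial_deriv_def[of i "\<sigma> n"] d\<sigma>[OF x3])
    have "Q x * frechet_derivative (\<sigma> n) (at x) v = \<psi> x * (\<Sum>i\<in>Basis. partial_deriv i g x * complex_of_real (?D\<rho> x i)) * of_real (W n x)"
      using Dv True by (simp add: Q_def d\<sigma>[OF x3])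
    then show ?thesis
      by (simp add: pd T_def \<psi>n_def algebra_simps sum.distrib sum_distrib_left)
  next
    case False
    have "frechet_derivative (\<psi>n n) (at x) = (\<lambda>v. 0)"
    proof (rule frechet_derivative_eq, rule has_derivative_transform_within_open[of "\<lambda>x. 0" _ _ _ "- K"])
      show "open (- K)" using K(1) by (simp add: compact_imp_closed open_Compl)
    qed (use False K(3) in \<open>auto simp: \<psi>n_def\<close>)
    then have "partial_deriv i (\<psi>n n) x = 0" for i by (simp add: partial_deriv_def)
    then show ?thesis using False K(3) pz by (simp add: T_def Q_def \<psi>n_def)
  qed
  have contQ: "continuous_on UNIV Q"
  proof -
    define Q1 where "Q1 x = \<psi> x * ((\<Sum>i\<in>Basis. partial_deriv i g x * complex_of_real (?D\<rho> x i)) / complex_of_real (?D\<rho> x v))" for x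
    have "continuous_on ?B Q1" unfolding Q1_def
    proof (intro continuous_intros)
      show "continuous_on ?B \<psi>" by (rule C1c_continuous[OF \<psi>])
      show "continuous_on ?B (partial_deriv i g)" if "i \<in> Basis" for i
        using g that BS continuous_on_subset unfolding Ck_on_1 by blast
      show "continuous_on ?B (\<lambda>x. ?D\<rho> x i)" for i
        using Ck_on_1_continuous_frechet[OF \<rho>(1)] BB continuous_on_subset by blast
      show "continuous_on ?B (\<lambda>x. ?D\<rho> x v)"
        using Ck_on_1_continuous_frechet[OF \<rho>(1)] BB continuous_on_subset by blast
      show "\<forall>x\<in>?B. complex_of_real (?D\<rho> x v) \<noteq> 0" using \<rho>(2) BB by force
    qed
    then have c1: "continuous_on ?B Q" by (rule continuous_on_eq) (use K(3) in \<open>auto simp: Q_def Q1_def\<close>)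
    have opK: "open (- K)" using K(1) by (simp add: compact_imp_closed open_Compl)
    have c2: "continuous_on (- K) Q" by (rule continuous_on_eq[of _ "\<lambda>x. 0"]) (auto simp: Q_def)
    have "continuous_on (?B \<union> - K) Q" by (rule continuous_on_open_Un[OF open_ball opK c1 c2])
    moreover have "?B \<union> - K = UNIV" using K(2) by blast
    ultimately show ?thesis by simp
  qed
  have Q0: "Q x = 0" if "x \<notin> K" for x using that by (simp add: Q_def)
  obtain L where L: "compact L" "L \<subseteq> ?B" "K \<subseteq> L"
    and app: "\<And>e. e > 0 \<Longrightarrow> \<exists>\<kappa>. C1c ?B \<kappa> \<and> (\<forall>x. x \<notin> L \<longrightarrow> \<kappa> x = 0) \<and> (\<forall>x. cmod (\<kappa> x - Q x) \<le> e)"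
    using mollify_continuous[OF contQ K(1,2) Q0 open_ball] by metis
  obtain m where m: "m > 0" "\<And>x::'a. norm x \<le> r \<Longrightarrow> bump (2 * r) x \<ge> m" using bump_ge_on_ball[OF r] by blast
  \<comment> \<open>A C^1 majorant of the indicator of \<open>L\<close> with compact support, used
    as weight in the variation estimate.\<close>
  define \<zeta> where "\<zeta> x = bump (2 * r) (x - p) / m" for x
  have \<zeta>: "C1c ?B3 \<zeta>"
  proof -
    have "C1c ?B3 (\<lambda>x. bump (2 * r) (x - p))" by (rule C1c_shifted_bump) (use r in auto)
    from C1c_bounded_linear[OF this bounded_linear_mult_left[of "inverse m"]]
    show ?thesis by (simp add: \<zeta>_def[abs_def] divide_inverse)
  qed
  have \<zeta>0: "\<zeta> x \<ge> 0" for x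
    unfolding \<zeta>_def using m(1) bump_nonneg[of "2 * r" "x - p"] by (intro divide_nonneg_pos)
  have \<zeta>1: "\<zeta> x \<ge> 1" if "x \<in> L" for x
  proof -
    have "x \<in> ?B" using L(2) that by blast
    then have "m \<le> bump (2 * r) (x - p)" by (intro m(2)) (simp add: dist_norm norm_minus_commute)
    then show ?thesis using m(1) by (simp add: \<zeta>_def)
  qed
  define C where "C = (LINT x|lebesgue. \<bar>frechet_derivative \<zeta> (at x) v\<bar>)"
  have intD\<zeta>: "integrable lebesgue (\<lambda>x. frechet_derivative \<zeta> (at x) v)"
  proof -
    obtain K' where "compact K'" "\<And>x. x \<notin> K' \<Longrightarrow> frechet_derivative \<zeta> (at x) = (\<lambda>v. 0)"
      using C1cE[OF \<zeta>] by metis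
    then show ?thesis using integrable_compact_support(2)[of K' "\<lambda>x. frechet_derivative \<zeta> (at x) v"]
      C1c_continuous_frechet[OF \<zeta>] by simp
  qed
  \<comment> \<open>Bounded variation of the cutoffs: the derivative of \<open>sp n - sm n\<close>
    along \<open>v\<close> is nonnegative and dominates that of \<open>\<sigma> n\<close> in
    modulus. Integration by parts moves it onto \<open>\<zeta>\<close>, and |sp - sm| \<le> 1 gives
    a bound independent of \<open>n\<close>.\<close>
  have var: "integrable lebesgue (\<lambda>x. \<zeta> x * cmod (frechet_derivative (\<sigma> n) (at x) v)) \<and>
     (LINT x|lebesgue. \<zeta> x * cmod (frechet_derivative (\<sigma> n) (at x) v)) \<le> C" for n
  proof -
    have z3: "\<zeta> x = 0" if "x \<notin> ?B3" for x
      using \<zeta> that unfolding C1c_def by blast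
    let ?sd = "\<lambda>x. sp n x - sm n x"
    have sd: "Ck_on 1 ?B3 ?sd"
      using Ck_on_add[OF open_ball sp(1)[of n] Ck_on_bounded_linear_comp[OF bounded_linear_minus[OF bounded_linear_ident] open_ball sp(2)[of n]]]
      by simp
    have Dsd: "frechet_derivative ?sd (at x) v = real n * (step' (real n * \<rho> x - 1) + step' (- real n * \<rho> x - 1)) * ?D\<rho> x v"
      if "x \<in> ?B3" for x
    proof -
      have "(?sd has_derivative (\<lambda>w. step' (real n * \<rho> x - 1) * (real n * ?D\<rho> x w) - step' (- real n * \<rho> x - 1) * (- real n * ?D\<rho> x w))) (at x)"
        using has_derivative_diff[OF has_derivative_frechet[OF spd(1)[OF that, of n]] has_derivative_frechet[OF spd(2)[OF that, of n]]]
        by (simp only: dsp[OF that])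
      from frechet_derivative_eq[OF this] show ?thesis by (simp add: algebra_simps)
    qed
    have le: "cmod (frechet_derivative (\<sigma> n) (at x) v) \<le> frechet_derivative ?sd (at x) v" if "x \<in> ?B3" for x
    proof -
      have "\<bar>W n x\<bar> \<le> real n * (step' (real n * \<rho> x - 1) + step' (- real n * \<rho> x - 1))"
        unfolding W_def abs_mult using step_bounds(3)[of "real n * \<rho> x - 1"] step_bounds(3)[of "- real n * \<rho> x - 1"]
        by (intro mult_mono) auto
      then have "\<bar>W n x\<bar> * ?D\<rho> x v \<le> real n * (step' (real n * \<rho> x - 1) + step' (- real n * \<rho> x - 1)) * ?D\<rho> x v"
        using \<rho>(2)[OF that] by (intro mult_right_mono) auto
      then show ?thesis using \<rho>(2)[OF that] unfolding d\<sigma>[OF that] Dsd[OF that] norm_of_real abs_mult by simp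
    qed
    note ibp = integration_by_parts[OF \<zeta> open_ball sd, of v]
    have le2: "\<zeta> x * cmod (frechet_derivative (\<sigma> n) (at x) v) \<le> \<zeta> x * frechet_derivative ?sd (at x) v" for x
      using le[of x] \<zeta>0[of x] z3[of x] by (cases "x \<in> ?B3") (auto intro: mult_left_mono)
    have meas: "integrable lebesgue (\<lambda>x. \<zeta> x * cmod (frechet_derivative (\<sigma> n) (at x) v))"
    proof -
      obtain K' where K': "compact K'" "K' \<subseteq> ?B3" "\<And>x. x \<notin> K' \<Longrightarrow> \<zeta> x = 0"
        using \<zeta> unfolding C1c_def by blast
      show ?thesis
        by (rule integrable_compact_support(2)[OF K'(1)])
           (use K'(3) C1c_continuous[OF \<zeta>] continuous_on_subset[OF Ck_on_1_continuous_frechet[OF \<sigma>C] K'(2)] in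
             \<open>auto intro!: continuous_intros\<close>)
    qed
    have "(LINT x|lebesgue. \<zeta> x * cmod (frechet_derivative (\<sigma> n) (at x) v)) \<le> (LINT x|lebesgue. \<zeta> x * frechet_derivative ?sd (at x) v)"
      using meas ibp(1) le2 by (intro Bochner_Integration.integral_mono)
    also have "\<dots> = - (LINT x|lebesgue. frechet_derivative \<zeta> (at x) v * ?sd x)" by (rule ibp(3))
    also have "\<dots> \<le> norm (LINT x|lebesgue. frechet_derivative \<zeta> (at x) v * ?sd x)" by simp
    also have "\<dots> \<le> C" unfolding C_def
    proof (rule Bochner_Integration.integral_norm_bound_integral[OF ibp(2)])
      show "integrable lebesgue (\<lambda>x. \<bar>frechet_derivative \<zeta> (at x) v\<bar>)" using intD\<zeta> by simp
      fix x
      have "0 \<le> sp n x" "sp n x \<le> 1" "0 \<le> sm n x" "sm n x \<le> 1" by (auto simp: sp_def sm_def step_bounds)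
      then have "\<bar>?sd x\<bar> \<le> 1" by linarith
      then show "norm (frechet_derivative \<zeta> (at x) v * ?sd x) \<le> \<bar>frechet_derivative \<zeta> (at x) v\<bar>"
        by (simp add: abs_mult mult_left_le)
    qed
    finally show ?thesis using meas by blast
  qed
  have n\<Gamma>: "AE x in lebesgue. x \<notin> \<Gamma>"
    using \<Gamma>(2) unfolding negligible_iff_null_sets by (rule AE_not_in)
  \<comment> \<open>Off \<open>\<Gamma>\<close> the cutoffs tend to 1, and their modulus never
    exceeds 2; as \<open>F\<close> vanishes outside the ball, only points where
    \<open>\<rho>\<close> describes \<open>\<Gamma>\<close> matter.\<close>
  have Alim: "(\<lambda>n. LINT x|lebesgue. \<sigma> n x * F x) \<longlonglongrightarrow> integral\<^sup>L lebesgue F"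
    if F: "integrable lebesgue F" "\<And>x. x \<notin> ?B \<Longrightarrow> F x = 0" "\<And>n. integrable lebesgue (\<lambda>x. \<sigma> n x * F x)" for F
  proof (rule integral_dominated_convergence)
    show "integrable lebesgue (\<lambda>x. 2 * cmod (F x))" using F(1) by simp
    show "AE x in lebesgue. (\<lambda>n. \<sigma> n x * F x) \<longlonglongrightarrow> F x"
      using n\<Gamma>
    proof (rule AE_mp, intro AE_I2 impI)
      fix x assume "x \<notin> \<Gamma>"
      show "(\<lambda>n. \<sigma> n x * F x) \<longlonglongrightarrow> F x"
      proof (cases "x \<in> ?B")
        case True
        then have "\<rho> x \<noteq> 0" using \<Gamma>(1) BB \<open>x \<notin> \<Gamma>\<close> by blast
        then show ?thesis using tendsto_mult[OF \<sigma>lim tendsto_const, of x "F x"] by simp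
      qed (use F(2) in simp)
    qed
    show "AE x in lebesgue. norm (\<sigma> n x * F x) \<le> 2 * cmod (F x)" for n
      using \<sigma>b by (intro AE_I2) (simp add: norm_mult mult_right_mono)
  qed (use F in auto)
  have T0: "T x = 0" if "x \<notin> K" for x using K(3) pz that by (simp add: T_def)
  have intA: "integrable lebesgue (\<lambda>x. \<sigma> n x * T x)" for n
  proof (rule Bochner_Integration.integrable_bound)
    show "integrable lebesgue (\<lambda>x. 2 * T x)" using intT by simp
    have "(\<lambda>x. indicator ?B x *\<^sub>R \<sigma> n x) \<in> borel_measurable lebesgue"
    proof -
      have "continuous_on ?B (\<sigma> n)" using Ck_on_1_continuous[OF \<sigma>C] BB continuous_on_subset by blast
      then have "(\<lambda>x. indicator ?B x *\<^sub>R \<sigma> n x) \<in> borel_measurable lborel"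
        using borel_measurable_continuous_on_indicator[of ?B "\<sigma> n"] by simp
      then show ?thesis by (rule measurable_completion)
    qed
    from borel_measurable_times[OF this borel_measurable_integrable[OF intT]]
    have "(\<lambda>x. (indicator ?B x *\<^sub>R \<sigma> n x) * T x) \<in> borel_measurable lebesgue" .
    moreover have "(\<lambda>x. (indicator ?B x *\<^sub>R \<sigma> n x) * T x) = (\<lambda>x. \<sigma> n x * T x)"
    proof
      fix x show "(indicator ?B x *\<^sub>R \<sigma> n x) * T x = \<sigma> n x * T x"
      proof (cases "x \<in> ?B")
        case False
        then have "T x = 0" using T0 K(2) by blast
        then show ?thesis by simp
      qed simp
    qed
    ultimately show "(\<lambda>x. \<sigma> n x * T x) \<in> borel_measurable lebesgue" by simp
    show "AE x in lebesgue. norm (\<sigma> n x * T x) \<le> norm (2 * T x)"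
      using \<sigma>b by (intro AE_I2) (simp add: norm_mult mult_right_mono)
  qed
  have intQ: "integrable lebesgue (\<lambda>x. Q x * frechet_derivative (\<sigma> n) (at x) v)" for n
    by (rule integrable_compact_support(2)[OF K(1)])
       (use Q0 continuous_on_subset[OF contQ] continuous_on_subset[OF Ck_on_1_continuous_frechet[OF \<sigma>C] K3] in
          \<open>auto intro!: continuous_intros\<close>)
  have bound: "cmod (integral\<^sup>L lebesgue T) \<le> e * C" if e: "e > 0" for e
  proof -
    obtain \<kappa> where \<kappa>: "C1c ?B \<kappa>" "\<And>x. x \<notin> L \<Longrightarrow> \<kappa> x = 0" "\<And>x. cmod (\<kappa> x - Q x) \<le> e"
      using app[OF e] by blast
    have \<kappa>3: "C1c ?B3 \<kappa>" by (rule C1c_mono[OF \<kappa>(1) BB])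
    note ibp = integration_by_parts[OF \<kappa>3 open_ball \<sigma>C, where v=v]
    define J where "J n = (LINT x|lebesgue. \<sigma> n x * frechet_derivative \<kappa> (at x) v)" for n
    have \<kappa>B: "frechet_derivative \<kappa> (at x) v = 0" if "x \<notin> ?B" for x
      using C1cE[OF \<kappa>(1)] that by (metis subsetD)
    have J0: "J \<longlonglongrightarrow> 0"
    proof -
      have i: "integrable lebesgue (\<lambda>x. frechet_derivative \<kappa> (at x) v)"
      proof -
        obtain K' where "compact K'" "\<And>x. x \<notin> K' \<Longrightarrow> frechet_derivative \<kappa> (at x) = (\<lambda>v. 0)"
          using C1cE[OF \<kappa>(1)] by metis
        then show ?thesis using integrable_compact_support(2)[of K' "\<lambda>x. frechet_derivative \<kappa> (at x) v"]
          C1c_continuous_frechet[OF \<kappa>(1)] by simp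
      qed
      have "J \<longlonglongrightarrow> (LINT x|lebesgue. frechet_derivative \<kappa> (at x) v)" unfolding J_def
        by (rule Alim[OF i \<kappa>B]) (use ibp(2) in \<open>simp_all add: mult.commute\<close>)
      then show ?thesis using integral_frechet_C1c_zero[OF \<kappa>(1)] by simp
    qed
    \<comment> \<open>Replacing \<open>Q\<close> by \<open>\<kappa>\<close> costs at most
      \<open>e\<close> times the variation bound; the term that remains is \<open>J n\<close> up to
      sign.\<close>
    have "cmod (LINT x|lebesgue. \<sigma> n x * T x) \<le> e * C + cmod (J n)" for n
    proof -
      note ibpn = integration_by_parts[OF \<kappa>3 open_ball \<sigma>C[of n], where v=v]
      have "0 = weak_form g h (\<psi>n n)" using off[OF \<psi>nC] by simp
      also have "\<dots> = (LINT x|lebesgue. \<sigma> n x * T x) + (LINT x|lebesgue. Q x * frechet_derivative (\<sigma> n) (at x) v)"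
        unfolding weak_form_def split by (rule Bochner_Integration.integral_add[OF intA intQ])
      finally have 1: "(LINT x|lebesgue. \<sigma> n x * T x) = - (LINT x|lebesgue. Q x * frechet_derivative (\<sigma> n) (at x) v)"
        by (simp add: eq_neg_iff_add_eq_0)
      have 2: "(LINT x|lebesgue. Q x * frechet_derivative (\<sigma> n) (at x) v) =
         (LINT x|lebesgue. (Q x - \<kappa> x) * frechet_derivative (\<sigma> n) (at x) v) + (LINT x|lebesgue. \<kappa> x * frechet_derivative (\<sigma> n) (at x) v)"
        using Bochner_Integration.integral_add[OF Bochner_Integration.integrable_diff[OF intQ[of n] ibpn(1)] ibpn(1)]
        by (simp add: algebra_simps)
      have 3: "cmod (LINT x|lebesgue. (Q x - \<kappa> x) * frechet_derivative (\<sigma> n) (at x) v)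
         \<le> (LINT x|lebesgue. e * (\<zeta> x * cmod (frechet_derivative (\<sigma> n) (at x) v)))"
      proof (rule Bochner_Integration.integral_norm_bound_integral)
        show "integrable lebesgue (\<lambda>x. (Q x - \<kappa> x) * frechet_derivative (\<sigma> n) (at x) v)"
          using Bochner_Integration.integrable_diff[OF intQ[of n] ibpn(1)] by (simp add: algebra_simps)
        show "integrable lebesgue (\<lambda>x. e * (\<zeta> x * cmod (frechet_derivative (\<sigma> n) (at x) v)))"
          using var[of n] by simp
        fix x
        have "cmod (Q x - \<kappa> x) \<le> e * \<zeta> x"
        proof (cases "x \<in> L")
          case True
          have "e * 1 \<le> e * \<zeta> x" using \<zeta>1[OF True] e by (intro mult_left_mono) auto
          then show ?thesis using \<kappa>(3)[of x] by (simp add: norm_minus_commute)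
        next
          case False
          then have "Q x = 0" "\<kappa> x = 0" using Q0 L(3) \<kappa>(2) by blast+
          then show ?thesis using e \<zeta>0 by simp
        qed
        then have "cmod (Q x - \<kappa> x) * cmod (frechet_derivative (\<sigma> n) (at x) v) \<le> (e * \<zeta> x) * cmod (frechet_derivative (\<sigma> n) (at x) v)"
          by (rule mult_right_mono) simp
        then show "cmod ((Q x - \<kappa> x) * frechet_derivative (\<sigma> n) (at x) v) \<le> e * (\<zeta> x * cmod (frechet_derivative (\<sigma> n) (at x) v))"
          by (simp add: norm_mult mult.assoc)
      qed
      have "(LINT x|lebesgue. e * (\<zeta> x * cmod (frechet_derivative (\<sigma> n) (at x) v))) \<le> e * C"
        using var[of n] e by (simp add: mult_left_mono)
      with 3 have 4: "cmod (LINT x|lebesgue. (Q x - \<kappa> x) * frechet_derivative (\<sigma> n) (at x) v) \<le> e * C" by linarith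
      have 5: "(LINT x|lebesgue. \<kappa> x * frechet_derivative (\<sigma> n) (at x) v) = - J n"
        unfolding J_def using ibpn(3) by (simp add: mult.commute)
      have "cmod (LINT x|lebesgue. \<sigma> n x * T x) = cmod ((LINT x|lebesgue. (Q x - \<kappa> x) * frechet_derivative (\<sigma> n) (at x) v) + - J n)"
        unfolding 1 2 5 norm_minus_cancel ..
      also have "\<dots> \<le> cmod (LINT x|lebesgue. (Q x - \<kappa> x) * frechet_derivative (\<sigma> n) (at x) v) + cmod (- J n)"
        by (rule norm_triangle_ineq)
      finally show ?thesis using 4 by simp
    qed
    moreover have "(\<lambda>n. cmod (LINT x|lebesgue. \<sigma> n x * T x)) \<longlonglongrightarrow> cmod (integral\<^sup>L lebesgue T)"
      by (intro tendsto_norm Alim intT intA) (use T0 K(2) in blast)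
    moreover have "(\<lambda>n. e * C + cmod (J n)) \<longlonglongrightarrow> e * C + cmod 0"
      by (intro tendsto_intros J0)
    ultimately show ?thesis using LIMSEQ_le by fastforce
  qed
  have C0: "C \<ge> 0" unfolding C_def by simp
  have "cmod (integral\<^sup>L lebesgue T) \<le> 0"
  proof (rule field_le_epsilon)
    fix e :: real assume "e > 0"
    then have "cmod (integral\<^sup>L lebesgue T) \<le> e / (C + 1) * C" using C0 by (intro bound) simp
    also have "\<dots> \<le> 0 + e" using C0 \<open>e > 0\<close> by (simp add: field_simps)
    finally show "cmod (integral\<^sup>L lebesgue T) \<le> 0 + e" .
  qed
  then show ?thesis by (simp add: weak_form_def T_def[abs_def])
qed

section \<open>Localisation by partitions of unity\<close>

lemma Ck_on_1_inverse:
  fixes f :: "'a::euclidean_space \<Rightarrow> 'b::real_normed_field"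
  assumes "Ck_on 1 S f" "\<And>x. x \<in> S \<Longrightarrow> f x \<noteq> 0"
  shows "Ck_on 1 S (\<lambda>x. inverse (f x))"
proof (rule Ck_on_1I)
  fix x assume "x \<in> S"
  then have "(f has_derivative frechet_derivative f (at x)) (at x)" "f x \<noteq> 0"
    using assms unfolding Ck_on_1 by (auto intro!: has_derivative_frechet)
  then show "((\<lambda>x. inverse (f x)) has_derivative
      (\<lambda>v. - (inverse (f x) * frechet_derivative f (at x) v * inverse (f x)))) (at x)"
    by (rule Deriv.has_derivative_inverse[rotated])
next
  fix i :: 'a
  show "continuous_on S (\<lambda>x. - (inverse (f x) * frechet_derivative f (at x) i * inverse (f x)))"
    using assms(2) by (intro continuous_intros Ck_on_1_continuous[OF assms(1)] Ck_on_1_continuous_frechet[OF assms(1)]) auto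
qed

text \<open>Partition of unity: bumps centred at finitely many points of the support are divided by
  their sum, which is nonzero near the support of \<open>\<psi>\<close> though not
  everywhere.\<close>

lemma weak_form_local_to_global:
  fixes g h \<psi> :: "'a::euclidean_space \<Rightarrow> complex"
  assumes "open S" "Ck_on 1 S g" "continuous_on S h"
    and loc: "\<And>p. p \<in> S \<Longrightarrow> \<exists>r>0. ball p r \<subseteq> S \<and> (\<forall>\<phi>. C1c (ball p r) \<phi> \<longrightarrow> weak_form g h \<phi> = 0)"
    and \<psi>: "C1c S \<psi>"
  shows "weak_form g h \<psi> = 0"
proof -
  obtain K where K: "compact K" "K \<subseteq> S" "\<And>x. x \<notin> K \<Longrightarrow> \<psi> x = 0"
    using \<psi> unfolding C1c_def by blast
  obtain r where r: "\<And>p. p \<in> S \<Longrightarrow> r p > 0" "\<And>p. p \<in> S \<Longrightarrow> ball p (r p) \<subseteq> S"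
    "\<And>p \<phi>. p \<in> S \<Longrightarrow> C1c (ball p (r p)) \<phi> \<Longrightarrow> weak_form g h \<phi> = 0"
    using loc by metis
  have "K \<subseteq> (\<Union>p\<in>K. ball p (r p / 2))" using r(1) K(2) by fastforce
  then obtain I where I: "I \<subseteq> K" "finite I" "K \<subseteq> (\<Union>p\<in>I. ball p (r p / 2))"
    using compactE_image[OF K(1), of K "\<lambda>p. ball p (r p / 2)"] by auto
  have IS: "p \<in> S" if "p \<in> I" for p using that I(1) K(2) by blast
  \<comment> \<open>Half the radius, so that the closed ball carrying the bump lies in the open ball
    on which the weak equation is known.\<close>
  define \<beta> where "\<beta> p x = complex_of_real (bump (r p / 2) (x - p))" for p x :: 'a
  define \<Sigma> where "\<Sigma> x = (\<Sum>p\<in>I. \<beta> p x)" for x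
  have \<beta>C: "C1c (ball p (r p)) (\<beta> p)" if "p \<in> I" for p
  proof -
    have "C1c (ball p (r p)) (\<lambda>x. bump (r p / 2) (x - p))"
      using r(1)[OF IS[OF that]] by (intro C1c_shifted_bump) auto
    from C1c_bounded_linear[OF this bounded_linear_of_real] show ?thesis by (simp add: \<beta>_def[abs_def])
  qed
  have \<Sigma>C: "Ck_on 1 UNIV \<Sigma>" unfolding \<Sigma>_def[abs_def]
    by (intro Ck_on_sum open_UNIV C1c_Ck[OF \<beta>C])
  define O' where "O' = {x. \<Sigma> x \<noteq> 0}"
  have "continuous_on UNIV \<Sigma>" by (rule Ck_on_1_continuous[OF \<Sigma>C])
  then have opO: "open O'" unfolding O'_def by (rule open_Collect_neq) (rule continuous_on_const)
  have KO: "K \<subseteq> O'"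
  proof
    fix x assume "x \<in> K"
    then obtain p where p: "p \<in> I" "x \<in> ball p (r p / 2)" using I(3) by blast
    have "bump (r p / 2) (x - p) > 0" using p(2) by (intro bump_pos) (simp add: dist_norm norm_minus_commute)
    then have "(\<Sum>p\<in>I. bump (r p / 2) (x - p)) > 0"
      by (intro sum_pos2[OF I(2) p(1)]) (auto intro: bump_nonneg)
    then have "\<Sigma> x \<noteq> 0" unfolding \<Sigma>_def \<beta>_def of_real_sum[symmetric] by (metis less_irrefl of_real_eq_0_iff)
    then show "x \<in> O'" by (simp add: O'_def)
  qed
  \<comment> \<open>Off \<open>O'\<close> the default value \<open>inverse 0 = 0\<close> is
    harmless, because \<open>\<psi>\<close> vanishes there.\<close>
  define \<phi> where "\<phi> p x = \<psi> x * (\<beta> p x * inverse (\<Sigma> x))" for p x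
  have \<phi>C: "C1c (ball p (r p)) (\<phi> p)" if p: "p \<in> I" for p
  proof -
    obtain K' where K': "compact K'" "K' \<subseteq> ball p (r p)" "\<And>x. x \<notin> K' \<Longrightarrow> \<beta> p x = 0"
      using \<beta>C[OF p] unfolding C1c_def by blast
    have "C1c (O' \<inter> ball p (r p)) (\<phi> p)"
    proof (rule C1cI)
      show "open (O' \<inter> ball p (r p))" using opO by auto
      show "compact (K \<inter> K')" using K(1) K'(1) by (rule compact_Int)
      show "K \<inter> K' \<subseteq> O' \<inter> ball p (r p)" using KO K'(2) by blast
      show "\<phi> p x = 0" if "x \<notin> K \<inter> K'" for x using that K(3) K'(3) by (auto simp: \<phi>_def)
      have "Ck_on 1 (O' \<inter> ball p (r p)) (\<lambda>x. inverse (\<Sigma> x))"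
        by (rule Ck_on_1_inverse[OF Ck_on_subset[OF \<Sigma>C]]) (auto simp: O'_def)
      then show "Ck_on 1 (O' \<inter> ball p (r p)) (\<phi> p)" unfolding \<phi>_def[abs_def]
        by (intro Ck_on_mult \<open>open (O' \<inter> ball p (r p))\<close> Ck_on_subset[OF C1c_Ck[OF \<psi>]] Ck_on_subset[OF C1c_Ck[OF \<beta>C[OF p]]]) auto
    qed
    then show ?thesis by (rule C1c_mono) simp
  qed
  have "\<psi> = (\<lambda>x. \<Sum>p\<in>I. \<phi> p x)"
  proof
    fix x
    have "(\<Sum>p\<in>I. \<phi> p x) = \<psi> x * (\<Sigma> x * inverse (\<Sigma> x))"
      by (simp add: \<phi>_def \<Sigma>_def sum_distrib_left sum_distrib_right)
    also have "\<dots> = \<psi> x" using K(3)[of x] KO by (cases "x \<in> K") (auto simp: O'_def)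
    finally show "\<psi> x = (\<Sum>p\<in>I. \<phi> p x)" by simp
  qed
  then have "weak_form g h \<psi> = weak_form g h (\<lambda>x. \<Sum>p\<in>I. \<phi> p x)" by simp
  also have "\<dots> = (\<Sum>p\<in>I. weak_form g h (\<phi> p))"
    by (rule weak_form_sum[OF assms(2,3) I(2)]) (rule C1c_mono[OF \<phi>C r(2)[OF IS]])
  also have "\<dots> = 0" using r(3)[OF IS \<phi>C] by simp
  finally show ?thesis .
qed

text \<open>Away from \<open>\<Gamma>\<close> the weak equation is the distributional one integrated
  by parts, near \<open>\<Gamma>\<close> it comes from the cutoff argument; localisation joins the
  two.\<close>

lemma interface_weak_form:
  fixes u :: "'a::euclidean_space \<Rightarrow> complex"
  assumes \<Omega>: "open \<Omega>" and \<Gamma>: "compact \<Gamma>" "\<Gamma> \<subseteq> \<Omega>" "\<forall>p\<in>\<Gamma>. outward_unit_normal \<Gamma> p (\<nu> p)"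
    and f: "continuous_on \<Omega> f"
    and sol: "interface_solution b \<Gamma> \<nu> f \<Omega> u"
  obtains g where "Ck_on 1 \<Omega> g" "\<And>x. x \<notin> \<Gamma> \<Longrightarrow> g x = u x"
    "\<And>\<psi>. C1c \<Omega> \<psi> \<Longrightarrow> weak_form g (\<lambda>x. b\<^sup>2 * g x - f x) \<psi> = 0"
proof -
  obtain g where g: "Ck_on 1 \<Omega> g" "\<And>x. x \<notin> \<Gamma> \<Longrightarrow> g x = u x" using interface_C1[OF \<Omega> \<Gamma> sol] by blast
  let ?h = "\<lambda>x. b\<^sup>2 * g x - f x"
  have h: "continuous_on \<Omega> ?h" using Ck_on_1_continuous[OF g(1)] f by (intro continuous_intros)
  have cl: "closed \<Gamma>" using \<Gamma>(1) by (rule compact_imp_closed)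
  have op: "open (\<Omega> - \<Gamma>)" using \<Omega> cl by (rule open_Diff)
  have u: "Ck_on 1 (\<Omega> - \<Gamma>) u" "helmholtz_on b (\<Omega> - \<Gamma>) f u"
    using sol unfolding interface_solution_def by auto
  have f': "continuous_on (\<Omega> - \<Gamma>) f" using f continuous_on_subset by blast
  have off: "weak_form g ?h \<phi> = 0" if \<phi>: "C1c (\<Omega> - \<Gamma>) \<phi>" for \<phi>
  proof -
    obtain K where K: "compact K" "K \<subseteq> \<Omega> - \<Gamma>" "\<And>x. x \<notin> K \<Longrightarrow> \<phi> x = 0"
      "\<And>x. x \<notin> K \<Longrightarrow> frechet_derivative \<phi> (at x) = (\<lambda>v. 0)"
      using C1cE[OF \<phi>] by metis
    have "weak_form u (\<lambda>x. b\<^sup>2 * u x - f x) \<phi> = 0"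
    proof (rule weak_form_C1c_of_smooth[OF op u(1) _ _ \<phi>])
      show "continuous_on (\<Omega> - \<Gamma>) (\<lambda>x. b\<^sup>2 * u x - f x)"
        using Ck_on_1_continuous[OF u(1)] f' by (intro continuous_intros)
    qed (rule weak_form_smooth[OF op u(2,1) f'])
    moreover have "(\<Sum>i\<in>Basis. partial_deriv i g x * partial_deriv i \<phi> x) - ?h x * \<phi> x =
       (\<Sum>i\<in>Basis. partial_deriv i u x * partial_deriv i \<phi> x) - (b\<^sup>2 * u x - f x) * \<phi> x" for x
    proof (cases "x \<in> K")
      case True
      then have x: "x \<in> \<Omega> - \<Gamma>" using K(2) by blast
      have "partial_deriv i g x = partial_deriv i u x" for i
        by (rule partial_deriv_cong_open[OF op x]) (use g(2) in blast)
      then show ?thesis using g(2)[of x] x by simp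
    qed (use K in \<open>simp add: partial_deriv_def\<close>)
    ultimately show ?thesis unfolding weak_form_def by simp
  qed
  have neg: "negligible \<Gamma>" by (rule negligible_interface[OF \<Gamma>(3)])
  have "weak_form g ?h \<psi> = 0" if \<psi>: "C1c \<Omega> \<psi>" for \<psi>
  proof (rule weak_form_local_to_global[OF \<Omega> g(1) h _ \<psi>])
    fix p assume p: "p \<in> \<Omega>"
    show "\<exists>r>0. ball p r \<subseteq> \<Omega> \<and> (\<forall>\<phi>. C1c (ball p r) \<phi> \<longrightarrow> weak_form g ?h \<phi> = 0)"
    proof (cases "p \<in> \<Gamma>")
      case False
      then obtain r where r: "r > 0" "ball p r \<subseteq> \<Omega> - \<Gamma>" using op p open_contains_ball by blast
      then have "ball p r \<subseteq> \<Omega>" by blast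
      with r off C1c_mono show ?thesis by blast
    next
      case True
      then have nu: "outward_unit_normal \<Gamma> p (\<nu> p)" using \<Gamma>(3) by blast
      obtain U and \<rho> :: "'a \<Rightarrow> real" where U: "open U" "p \<in> U" "Ck_on 1 U \<rho>"
        "\<Gamma> \<inter> U = {x \<in> U. \<rho> x = 0}" "frechet_derivative \<rho> (at p) (\<nu> p) > 0"
        by (rule outward_unit_normalE[OF nu])
      have "continuous_on U (\<lambda>x. frechet_derivative \<rho> (at x) (\<nu> p))" by (rule Ck_on_1_continuous_frechet[OF U(3)])
      then have "open (U \<inter> (\<lambda>x. frechet_derivative \<rho> (at x) (\<nu> p)) -` {0<..})"
        using U(1) by (intro continuous_open_preimage) auto
      then have "open (\<Omega> \<inter> (U \<inter> (\<lambda>x. frechet_derivative \<rho> (at x) (\<nu> p)) -` {0<..}))" using \<Omega> by blast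
      moreover have "p \<in> \<Omega> \<inter> (U \<inter> (\<lambda>x. frechet_derivative \<rho> (at x) (\<nu> p)) -` {0<..})" using p U by simp
      ultimately obtain R where R: "R > 0" "ball p R \<subseteq> \<Omega> \<inter> (U \<inter> (\<lambda>x. frechet_derivative \<rho> (at x) (\<nu> p)) -` {0<..})"
        using open_contains_ball by blast
      \<comment> \<open>Test functions supported in \<open>ball p r\<close> are treated inside the
        ball of triple radius, on which the derivative of \<open>\<rho>\<close> along
        \<open>\<nu> p\<close> stays positive.\<close>
      define r where "r = R / 3"
      have r: "r > 0" "3 * r = R" using R(1) by (auto simp: r_def)
      have sub: "ball p (3 * r) \<subseteq> \<Omega>" "ball p (3 * r) \<subseteq> U"
        "\<And>x. x \<in> ball p (3 * r) \<Longrightarrow> frechet_derivative \<rho> (at x) (\<nu> p) > 0" using R(2) r(2) by auto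
      have "weak_form g ?h \<phi> = 0" if "C1c (ball p r) \<phi>" for \<phi>
      proof (rule weak_form_near_interface[OF r(1) sub(1) \<Omega> g(1) h _ sub(3) _ neg off that])
        show "Ck_on 1 (ball p (3 * r)) \<rho>" using U(3) sub(2) by (rule Ck_on_subset)
        show "\<Gamma> \<inter> ball p (3 * r) = {x \<in> ball p (3 * r). \<rho> x = 0}" using U(4) sub(2) by blast
      qed
      moreover have "ball p r \<subseteq> \<Omega>" using sub(1) r(1) by auto
      ultimately show ?thesis using r(1) by blast
    qed
  qed
  with g that show ?thesis by blast
qed

section \<open>Square integrable functions on the whole space\<close>

text \<open>Functions are not identified almost everywhere, so \<open>L2norm\<close> is a seminorm.
  Domains enter through extension by zero, which keeps all integrals on the whole space.\<close>

definition L2 :: "('a::euclidean_space \<Rightarrow> complex) \<Rightarrow> bool" where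
  "L2 f \<longleftrightarrow> f \<in> borel_measurable lebesgue \<and> integrable lebesgue (\<lambda>x. (cmod (f x))\<^sup>2)"

definition L2norm :: "('a::euclidean_space \<Rightarrow> complex) \<Rightarrow> real" where
  "L2norm f = sqrt (LINT x|lebesgue. (cmod (f x))\<^sup>2)"

lemma L2norm_nonneg: "L2norm f \<ge> 0"
  by (simp add: L2norm_def)

lemma L2norm_square: "(L2norm f)\<^sup>2 = (LINT x|lebesgue. (cmod (f x))\<^sup>2)"
  by (simp add: L2norm_def)

lemma two_mult_le_squares: "2 * (a * b) \<le> a\<^sup>2 + (b::real)\<^sup>2"
  using zero_le_power2[of "a - b"] by (simp add: power2_diff)

lemma L2_integrable_cmod_mult:
  assumes "L2 f" "L2 g"
  shows "integrable lebesgue (\<lambda>x. cmod (f x) * cmod (g x))"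
proof (rule Bochner_Integration.integrable_bound)
  show "integrable lebesgue (\<lambda>x. (cmod (f x))\<^sup>2 + (cmod (g x))\<^sup>2)" using assms by (simp add: L2_def)
  show "(\<lambda>x. cmod (f x) * cmod (g x)) \<in> borel_measurable lebesgue" using assms by (auto simp: L2_def)
  have "cmod (f x) * cmod (g x) \<le> (cmod (f x))\<^sup>2 + (cmod (g x))\<^sup>2" for x
    using two_mult_le_squares[of "cmod (f x)" "cmod (g x)"] by (smt (verit) zero_le_power2 mult_nonneg_nonneg norm_ge_zero)
  then show "AE x in lebesgue. norm (cmod (f x) * cmod (g x)) \<le> norm ((cmod (f x))\<^sup>2 + (cmod (g x))\<^sup>2)"
    by (intro AE_I2) simp
qed

lemma L2_integrable_mult:
  assumes "L2 f" "L2 g"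
  shows "integrable lebesgue (\<lambda>x. f x * g x)"
proof (rule Bochner_Integration.integrable_bound[OF L2_integrable_cmod_mult[OF assms]])
  show "(\<lambda>x. f x * g x) \<in> borel_measurable lebesgue" using assms by (auto simp: L2_def)
qed (simp add: norm_mult)

lemma L2_Cauchy_Schwarz_norm:
  assumes "L2 f" "L2 g"
  shows "(LINT x|lebesgue. cmod (f x) * cmod (g x)) \<le> L2norm f * L2norm g"
proof -
  let ?I = "LINT x|lebesgue. cmod (f x) * cmod (g x)"
  let ?A = "L2norm f" and ?B = "L2norm g"
  have iA: "integrable lebesgue (\<lambda>x. (cmod (f x))\<^sup>2)" and iB: "integrable lebesgue (\<lambda>x. (cmod (g x))\<^sup>2)"
    using assms by (auto simp: L2_def)
  \<comment> \<open>Weighted Young inequality. The weights s = \<open>L2norm g\<close> and t =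
    \<open>L2norm f\<close> give the claim when both norms are positive; when one norm is zero, a
    large weight on its function excludes a positive integral.\<close>
  have key: "2 * (s * t) * ?I \<le> s\<^sup>2 * ?A\<^sup>2 + t\<^sup>2 * ?B\<^sup>2" for s t
  proof -
    have "2 * (s * t) * ?I = (LINT x|lebesgue. 2 * (s * t) * (cmod (f x) * cmod (g x)))" by simp
    also have "\<dots> \<le> (LINT x|lebesgue. s\<^sup>2 * (cmod (f x))\<^sup>2 + t\<^sup>2 * (cmod (g x))\<^sup>2)"
    proof (rule Bochner_Integration.integral_mono)
      show "integrable lebesgue (\<lambda>x. 2 * (s * t) * (cmod (f x) * cmod (g x)))"
        using L2_integrable_cmod_mult[OF assms] by simp
      show "integrable lebesgue (\<lambda>x. s\<^sup>2 * (cmod (f x))\<^sup>2 + t\<^sup>2 * (cmod (g x))\<^sup>2)" using iA iB by simp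
      show "2 * (s * t) * (cmod (f x) * cmod (g x)) \<le> s\<^sup>2 * (cmod (f x))\<^sup>2 + t\<^sup>2 * (cmod (g x))\<^sup>2" for x
        using two_mult_le_squares[of "s * cmod (f x)" "t * cmod (g x)"] by (simp add: power_mult_distrib algebra_simps)
    qed
    also have "\<dots> = s\<^sup>2 * ?A\<^sup>2 + t\<^sup>2 * ?B\<^sup>2" using iA iB by (simp add: L2norm_square)
    finally show ?thesis .
  qed
  have I0: "?I \<ge> 0" by simp
  have nn: "?A \<ge> 0" "?B \<ge> 0" by (auto intro: L2norm_nonneg)
  show ?thesis
  proof (cases "?A * ?B = 0")
    case False
    then have pos: "?A * ?B > 0" using nn by (simp add: less_le)
    have "2 * (?B * ?A) * ?I \<le> 2 * (?A * ?B) * (?A * ?B)"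
      using key[of ?B ?A] by (simp add: power2_eq_square algebra_simps)
    then have "(?A * ?B) * ?I \<le> (?A * ?B) * (?A * ?B)" by (simp add: mult_ac)
    then show ?thesis using pos by (rule mult_left_le_imp_le)
  next
    case True
    have "?I \<le> 0"
    proof (rule ccontr)
      assume "\<not> ?I \<le> 0"
      then have I: "?I > 0" by simp
      from True consider "?A = 0" | "?B = 0" by auto
      then show False
      proof cases
        case 1
        have "2 * ((?B\<^sup>2 + 1) / ?I * 1) * ?I \<le> ?B\<^sup>2" using key[of "(?B\<^sup>2 + 1) / ?I" 1] 1 by simp
        moreover have "2 * ((?B\<^sup>2 + 1) / ?I * 1) * ?I = 2 * (?B\<^sup>2 + 1)" using I by simp
        ultimately show False by (smt (verit) zero_le_power2)
      next
        case 2
        have "2 * (1 * ((?A\<^sup>2 + 1) / ?I)) * ?I \<le> ?A\<^sup>2" using key[of 1 "(?A\<^sup>2 + 1) / ?I"] 2 by simp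
        moreover have "2 * (1 * ((?A\<^sup>2 + 1) / ?I)) * ?I = 2 * (?A\<^sup>2 + 1)" using I by simp
        ultimately show False by (smt (verit) zero_le_power2)
      qed
    qed
    then show ?thesis unfolding True .
  qed
qed

lemma L2_Cauchy_Schwarz:
  assumes "L2 f" "L2 g"
  shows "cmod (LINT x|lebesgue. f x * g x) \<le> L2norm f * L2norm g"
proof -
  have "cmod (LINT x|lebesgue. f x * g x) \<le> (LINT x|lebesgue. cmod (f x) * cmod (g x))"
    by (rule Bochner_Integration.integral_norm_bound_integral[OF L2_integrable_mult[OF assms] L2_integrable_cmod_mult[OF assms]])
       (simp add: norm_mult)
  also have "\<dots> \<le> L2norm f * L2norm g" by (rule L2_Cauchy_Schwarz_norm[OF assms])
  finally show ?thesis .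
qed

lemma cmod_add_square_le: "(cmod (a + b))\<^sup>2 \<le> (cmod a)\<^sup>2 + 2 * (cmod a * cmod b) + (cmod b)\<^sup>2"
proof -
  have "(cmod (a + b))\<^sup>2 \<le> (cmod a + cmod b)\<^sup>2" by (intro power_mono norm_triangle_ineq) simp
  then show ?thesis by (simp add: power2_sum algebra_simps)
qed

lemma L2_add:
  assumes "L2 f" "L2 g"
  shows "L2 (\<lambda>x. f x + g x)"
  unfolding L2_def
proof
  show m: "(\<lambda>x. f x + g x) \<in> borel_measurable lebesgue" using assms by (auto simp: L2_def)
  show "integrable lebesgue (\<lambda>x. (cmod (f x + g x))\<^sup>2)"
  proof (rule Bochner_Integration.integrable_bound)
    show "integrable lebesgue (\<lambda>x. (cmod (f x))\<^sup>2 + 2 * (cmod (f x) * cmod (g x)) + (cmod (g x))\<^sup>2)"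
      using assms L2_integrable_cmod_mult[OF assms] by (simp add: L2_def)
    show "(\<lambda>x. (cmod (f x + g x))\<^sup>2) \<in> borel_measurable lebesgue" using m by measurable
    show "AE x in lebesgue. norm ((cmod (f x + g x))\<^sup>2) \<le> norm ((cmod (f x))\<^sup>2 + 2 * (cmod (f x) * cmod (g x)) + (cmod (g x))\<^sup>2)"
      using cmod_add_square_le by (intro AE_I2) simp
  qed
qed

lemma L2norm_triangle:
  assumes "L2 f" "L2 g"
  shows "L2norm (\<lambda>x. f x + g x) \<le> L2norm f + L2norm g"
proof -
  have "(L2norm (\<lambda>x. f x + g x))\<^sup>2 = (LINT x|lebesgue. (cmod (f x + g x))\<^sup>2)" by (rule L2norm_square)
  also have "\<dots> \<le> (LINT x|lebesgue. (cmod (f x))\<^sup>2 + 2 * (cmod (f x) * cmod (g x)) + (cmod (g x))\<^sup>2)"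
    using assms L2_add[OF assms] L2_integrable_cmod_mult[OF assms] cmod_add_square_le
    by (intro Bochner_Integration.integral_mono) (auto simp: L2_def)
  also have "\<dots> = (L2norm f)\<^sup>2 + 2 * (LINT x|lebesgue. cmod (f x) * cmod (g x)) + (L2norm g)\<^sup>2"
    using assms L2_integrable_cmod_mult[OF assms] by (simp add: L2_def L2norm_square)
  also have "\<dots> \<le> (L2norm f + L2norm g)\<^sup>2"
    using L2_Cauchy_Schwarz_norm[OF assms] by (simp add: power2_sum algebra_simps)
  finally show ?thesis by (rule power2_le_imp_le) (simp add: L2norm_nonneg)
qed

lemma L2_mono:
  assumes "L2 g" "f \<in> borel_measurable lebesgue" "\<And>x. cmod (f x) \<le> c * cmod (g x)"
  shows "L2 f"
  unfolding L2_def
proof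
  show "integrable lebesgue (\<lambda>x. (cmod (f x))\<^sup>2)"
  proof (rule Bochner_Integration.integrable_bound)
    show "integrable lebesgue (\<lambda>x. c\<^sup>2 * (cmod (g x))\<^sup>2)" using assms by (simp add: L2_def)
    show "(\<lambda>x. (cmod (f x))\<^sup>2) \<in> borel_measurable lebesgue" using assms(2) by measurable
    have "(cmod (f x))\<^sup>2 \<le> c\<^sup>2 * (cmod (g x))\<^sup>2" for x
      using power_mono[OF assms(3)[of x], of 2] by (simp add: power_mult_distrib)
    then show "AE x in lebesgue. norm ((cmod (f x))\<^sup>2) \<le> norm (c\<^sup>2 * (cmod (g x))\<^sup>2)"
      by (intro AE_I2) simp
  qed
qed (rule assms(2))

lemma L2norm_mono:
  assumes "L2 g" "f \<in> borel_measurable lebesgue" "\<And>x. cmod (f x) \<le> c * cmod (g x)" "c \<ge> 0"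
  shows "L2norm f \<le> c * L2norm g"
proof -
  have "(L2norm f)\<^sup>2 \<le> (c * L2norm g)\<^sup>2"
    unfolding L2norm_square power_mult_distrib
  proof -
    have "(LINT x|lebesgue. (cmod (f x))\<^sup>2) \<le> (LINT x|lebesgue. c\<^sup>2 * (cmod (g x))\<^sup>2)"
    proof (rule Bochner_Integration.integral_mono)
      show "integrable lebesgue (\<lambda>x. (cmod (f x))\<^sup>2)" using L2_mono[OF assms(1-3)] by (simp add: L2_def)
      show "integrable lebesgue (\<lambda>x. c\<^sup>2 * (cmod (g x))\<^sup>2)" using assms(1) by (simp add: L2_def)
      show "(cmod (f x))\<^sup>2 \<le> c\<^sup>2 * (cmod (g x))\<^sup>2" for x
        using power_mono[OF assms(3)[of x], of 2] by (simp add: power_mult_distrib)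
    qed
    then show "(LINT x|lebesgue. (cmod (f x))\<^sup>2) \<le> c\<^sup>2 * (LINT x|lebesgue. (cmod (g x))\<^sup>2)" by simp
  qed
  then show ?thesis by (rule power2_le_imp_le) (simp add: L2norm_nonneg assms(4))
qed

lemma L2_scale: "L2 f \<Longrightarrow> L2 (\<lambda>x. c * f x)"
  by (rule L2_mono[where c="cmod c"]) (auto simp: norm_mult L2_def)

lemma L2_diff: "L2 f \<Longrightarrow> L2 g \<Longrightarrow> L2 (\<lambda>x. f x - g x)"
  using L2_add[of f "\<lambda>x. -1 * g x"] L2_scale[of g "-1"] by simp

lemma L2norm_minus_commute: "L2norm (\<lambda>x. f x - g x) = L2norm (\<lambda>x. g x - f x)"
  by (simp add: L2norm_def norm_minus_commute)

lemma L2_compact_support: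
  fixes f :: "'a::euclidean_space \<Rightarrow> complex"
  assumes "compact K" "continuous_on K f" "\<And>x. x \<notin> K \<Longrightarrow> f x = 0"
  shows "L2 f"
  unfolding L2_def
proof
  show "f \<in> borel_measurable lebesgue" using integrable_compact_support(2)[OF assms] by auto
  show "integrable lebesgue (\<lambda>x. (cmod (f x))\<^sup>2)"
    by (rule integrable_compact_support(2)[OF assms(1)]) (use assms in \<open>auto intro!: continuous_intros\<close>)
qed

lemma C1c_L2:
  assumes "C1c S \<phi>"
  shows "L2 \<phi>" "L2 (partial_deriv i \<phi>)"
proof -
  obtain K where K: "compact K" "\<And>x. x \<notin> K \<Longrightarrow> \<phi> x = 0"
    "\<And>x. x \<notin> K \<Longrightarrow> frechet_derivative \<phi> (at x) = (\<lambda>v. 0)"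
    using C1cE[OF assms] by metis
  show "L2 \<phi>" by (rule L2_compact_support[OF K(1)]) (use C1c_continuous[OF assms] K in auto)
  show "L2 (partial_deriv i \<phi>)"
    by (rule L2_compact_support[OF K(1)]) (use C1c_continuous_partial[OF assms] K in \<open>auto simp: partial_deriv_def\<close>)
qed

text \<open>A sum of seminorms in place of the root of the sum of squares: equivalent, and
  subadditive term by term.\<close>

definition H1norm :: "('a::euclidean_space \<Rightarrow> complex) \<Rightarrow> real" where
  "H1norm \<phi> = (\<Sum>i\<in>Basis. L2norm (partial_deriv i \<phi>)) + L2norm \<phi>"

lemma H1norm_ge:
  "H1norm \<phi> \<ge> 0" "L2norm \<phi> \<le> H1norm \<phi>" "i \<in> Basis \<Longrightarrow> L2norm (partial_deriv i \<phi>) \<le> H1norm \<phi>"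
proof -
  have s: "(\<Sum>i\<in>Basis. L2norm (partial_deriv i \<phi>)) \<ge> 0" by (intro sum_nonneg L2norm_nonneg)
  show "H1norm \<phi> \<ge> 0" "L2norm \<phi> \<le> H1norm \<phi>" using s L2norm_nonneg[of \<phi>] by (simp_all add: H1norm_def)
  show "L2norm (partial_deriv i \<phi>) \<le> H1norm \<phi>" if "i \<in> Basis"
  proof -
    have "L2norm (partial_deriv i \<phi>) \<le> (\<Sum>i\<in>Basis. L2norm (partial_deriv i \<phi>))"
      using that by (intro member_le_sum L2norm_nonneg) auto
    then show ?thesis using L2norm_nonneg[of \<phi>] by (simp add: H1norm_def)
  qed
qed

section \<open>Energy estimate and approximation of the solution\<close>

lemma step_mono: "s \<le> t \<Longrightarrow> step s \<le> step t"
  by (rule DERIV_nonneg_imp_nondecreasing[of s t step]) (use step_has_derivative step_bounds(3) in blast)+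

text \<open>The bound on \<open>step'\<close> dominates the sequence by 3 (1 - step (n s - 1)), and
  the steps tend to 1.\<close>

lemma step'_sequence:
  assumes "s > 0"
  shows "(\<lambda>n. s * (real n * step' (real n * s - 1))) \<longlonglongrightarrow> 0"
proof (rule tendsto_sandwich)
  have t: "real n * s * step' (real n * s - 1) \<le> 3 / (1 + (max 0 (real n * s - 1))\<^sup>2)" for n
    using step'_bound[of "real n * s - 1"] by simp
  show "\<forall>\<^sub>F n in sequentially. 0 \<le> s * (real n * step' (real n * s - 1))"
    using assms step_bounds(3) by (intro always_eventually allI mult_nonneg_nonneg) auto
  show "\<forall>\<^sub>F n in sequentially. s * (real n * step' (real n * s - 1)) \<le> 3 / (1 + (max 0 (real n * s - 1))\<^sup>2)"
    using t by (intro always_eventually) (simp add: mult_ac)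
  show "(\<lambda>n. 3 / (1 + (max 0 (real n * s - 1))\<^sup>2)) \<longlonglongrightarrow> 0"
  proof -
    have "(\<lambda>n. 3 * (1 - step (real n * s - 1))) \<longlonglongrightarrow> 3 * (1 - 1)"
      using step_sequence[OF assms] by (intro tendsto_intros)
    moreover have "3 * (1 - step t) = 3 / (1 + (max 0 t)\<^sup>2)" for t
      using one_plus_square_pos[of "max 0 t"] by (simp add: step_def field_simps)
    ultimately show ?thesis by simp
  qed
qed simp

text \<open>If g = 0 and Dg is nonzero at a point, then the real or the imaginary part has a regular
  zero there. This justifies replacing the gradient of \<open>g\<close> by 0 on the zero set of
  \<open>g\<close>.\<close>

lemma negligible_zero_gradient:
  fixes g :: "'a::euclidean_space \<Rightarrow> complex"
  assumes "open S" "Ck_on 1 S g"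
  shows "negligible {x \<in> S. g x = 0 \<and> (\<exists>i. partial_deriv i g x \<noteq> 0)}"
proof -
  have gd: "(g has_derivative frechet_derivative g (at x)) (at x)" if "x \<in> S" for x
    using assms(2) that unfolding Ck_on_1 by (auto intro!: has_derivative_frechet)
  have re: "frechet_derivative (\<lambda>x. Re (g x)) (at x) v = Re (frechet_derivative g (at x) v)"
    "frechet_derivative (\<lambda>x. Im (g x)) (at x) v = Im (frechet_derivative g (at x) v)" if "x \<in> S" for x v
    using frechet_derivative_eq[OF bounded_linear.has_derivative[OF bounded_linear_Re gd[OF that]]]
      frechet_derivative_eq[OF bounded_linear.has_derivative[OF bounded_linear_Im gd[OF that]]] by simp_all
  let ?R = "{x \<in> S. Re (g x) = 0 \<and> (\<exists>v. frechet_derivative (\<lambda>x. Re (g x)) (at x) v \<noteq> 0)}"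
  let ?I = "{x \<in> S. Im (g x) = 0 \<and> (\<exists>v. frechet_derivative (\<lambda>x. Im (g x)) (at x) v \<noteq> 0)}"
  have "negligible ?R"
    by (rule negligible_regular_level[OF assms(1) Ck_on_bounded_linear_comp[OF bounded_linear_Re assms]])
  moreover have "negligible ?I"
    by (rule negligible_regular_level[OF assms(1) Ck_on_bounded_linear_comp[OF bounded_linear_Im assms]])
  ultimately have "negligible (?R \<union> ?I)" by (rule negligible_Un)
  moreover have "{x \<in> S. g x = 0 \<and> (\<exists>i. partial_deriv i g x \<noteq> 0)} \<subseteq> ?R \<union> ?I"
  proof
    fix x assume "x \<in> {x \<in> S. g x = 0 \<and> (\<exists>i. partial_deriv i g x \<noteq> 0)}"
    then obtain i where x: "x \<in> S" "g x = 0" "frechet_derivative g (at x) i \<noteq> 0"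
      unfolding partial_deriv_def by blast
    then have "Re (frechet_derivative g (at x) i) \<noteq> 0 \<or> Im (frechet_derivative g (at x) i) \<noteq> 0"
      by (simp add: complex_eq_iff)
    then show "x \<in> ?R \<union> ?I" using x(1,2) re[OF x(1)] by auto
  qed
  ultimately show ?thesis using negligible_subset by blast
qed

lemma continuous_zero_extension:
  fixes g :: "'a::euclidean_space \<Rightarrow> complex"
  assumes "open \<Omega>" "continuous_on \<Omega> g" "\<And>p. p \<in> frontier \<Omega> \<Longrightarrow> (g \<longlongrightarrow> 0) (at p within \<Omega>)"
  shows "continuous_on UNIV (zero_extension \<Omega> g)"
  unfolding continuous_on_eq_continuous_at[OF open_UNIV]
proof
  fix p :: 'a
  consider "p \<in> \<Omega>" | "p \<in> frontier \<Omega>" | "p \<notin> closure \<Omega>"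
    using assms(1) by (auto simp: frontier_def interior_open)
  then show "isCont (zero_extension \<Omega> g) p"
  proof cases
    case 1
    have "continuous_on \<Omega> (zero_extension \<Omega> g)"
      by (rule continuous_on_eq[OF assms(2)]) (simp add: zero_extension_def)
    then show ?thesis using 1 assms(1) continuous_on_eq_continuous_at by blast
  next
    case 2
    then have np: "p \<notin> \<Omega>" using assms(1) by (simp add: frontier_def interior_open)
    show ?thesis unfolding continuous_at_eps_delta
    proof (intro allI impI)
      fix e :: real assume "e > 0"
      then obtain d where d: "d > 0" "\<And>x. x \<in> \<Omega> \<Longrightarrow> 0 < dist x p \<Longrightarrow> dist x p < d \<Longrightarrow> dist (g x) 0 < e"
        using assms(3)[OF 2] unfolding Lim_within by blast
      show "\<exists>d>0. \<forall>x'. dist x' p < d \<longrightarrow> dist (zero_extension \<Omega> g x') (zero_extension \<Omega> g p) < e"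
      proof (intro exI[of _ d] conjI allI impI d(1))
        fix x assume x: "dist x p < d"
        show "dist (zero_extension \<Omega> g x) (zero_extension \<Omega> g p) < e"
        proof (cases "x \<in> \<Omega>")
          case True
          then have "0 < dist x p" using np by auto
          then show ?thesis using d(2)[OF True] x np True by (simp add: zero_extension_def)
        qed (use np \<open>e > 0\<close> in \<open>simp add: zero_extension_def\<close>)
      qed
    qed
  next
    case 3
    have "continuous_on (- closure \<Omega>) (zero_extension \<Omega> g)"
      by (rule continuous_on_eq[of _ "\<lambda>x. 0"]) (use closure_subset in \<open>auto simp: zero_extension_def\<close>)
    then show ?thesis using 3 continuous_on_eq_continuous_at[of "- closure \<Omega>" "zero_extension \<Omega> g"] by auto
  qed
qed

lemma partial_deriv_C1c_outside:
  assumes "C1c S \<phi>" "x \<notin> S"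
  shows "partial_deriv i \<phi> x = 0"
proof -
  obtain K where "K \<subseteq> S" "\<And>x. x \<notin> K \<Longrightarrow> frechet_derivative \<phi> (at x) = (\<lambda>v. 0)"
    using C1cE[OF assms(1)] by metis
  then show ?thesis using assms(2) by (metis partial_deriv_def subsetD)
qed

lemma L2norm_tendsto_0:
  fixes F :: "nat \<Rightarrow> 'a::euclidean_space \<Rightarrow> complex"
  assumes "integrable lebesgue B" "\<And>n. F n \<in> borel_measurable lebesgue"
    and "\<And>x. (\<lambda>n. F n x) \<longlonglongrightarrow> 0" "\<And>n x. (cmod (F n x))\<^sup>2 \<le> B x"
  shows "\<And>n. L2 (F n)" "(\<lambda>n. L2norm (F n)) \<longlonglongrightarrow> 0"
proof -
  have B0: "B x \<ge> 0" for x using assms(4)[of 0 x] by (smt (verit) zero_le_power2)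
  show "L2 (F n)" for n unfolding L2_def
  proof
    show "integrable lebesgue (\<lambda>x. (cmod (F n x))\<^sup>2)"
    proof (rule Bochner_Integration.integrable_bound[OF assms(1)])
      show "(\<lambda>x. (cmod (F n x))\<^sup>2) \<in> borel_measurable lebesgue" using assms(2)[of n] by measurable
      show "AE x in lebesgue. norm ((cmod (F n x))\<^sup>2) \<le> norm (B x)" using assms(4) B0 by (intro AE_I2) simp
    qed
  qed (rule assms(2))
  have "(\<lambda>n. LINT x|lebesgue. (cmod (F n x))\<^sup>2) \<longlonglongrightarrow> integral\<^sup>L lebesgue (\<lambda>x::'a. 0::real)"
  proof (rule integral_dominated_convergence)
    show "integrable lebesgue B" by (rule assms(1))
    show "(\<lambda>x. (cmod (F n x))\<^sup>2) \<in> borel_measurable lebesgue" for n using assms(2)[of n] by measurable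
    show "AE x in lebesgue. (\<lambda>n. (cmod (F n x))\<^sup>2) \<longlonglongrightarrow> 0"
    proof (rule AE_I2)
      fix x
      have "(\<lambda>n. (cmod (F n x))\<^sup>2) \<longlonglongrightarrow> (cmod 0)\<^sup>2" by (intro tendsto_intros assms(3))
      then show "(\<lambda>n. (cmod (F n x))\<^sup>2) \<longlonglongrightarrow> 0" by simp
    qed
    show "AE x in lebesgue. norm ((cmod (F n x))\<^sup>2) \<le> B x" for n using assms(4) by (intro AE_I2) simp
  qed (use assms(1) in simp_all)
  then have "(\<lambda>n. sqrt (LINT x|lebesgue. (cmod (F n x))\<^sup>2)) \<longlonglongrightarrow> sqrt 0" by (intro tendsto_real_sqrt) simp
  then show "(\<lambda>n. L2norm (F n)) \<longlonglongrightarrow> 0" by (simp add: L2norm_def)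
qed

text \<open>The approximations are \<open>g\<close> times a cutoff of \<open>n * (cmod g)\<^sup>2\<close>; they have compact support because
  \<open>g\<close> vanishes at the boundary, whatever its regularity. Testing with \<open>cnj g\<close> times the same cutoff bounds
  the energy of \<open>g\<close>, since the derivative of the cutoff contributes with the good sign.\<close>
lemma solution_approximation:
  fixes g f :: "'a::euclidean_space \<Rightarrow> complex"
  assumes \<Omega>: "open \<Omega>" "bounded \<Omega>" and g: "Ck_on 1 \<Omega> g"
    and bd: "\<And>p. p \<in> frontier \<Omega> \<Longrightarrow> (g \<longlongrightarrow> 0) (at p within \<Omega>)"
    and f: "continuous_on \<Omega> f" "L2 (zero_extension \<Omega> f)"
    and weak: "\<And>\<psi>. C1c \<Omega> \<psi> \<Longrightarrow> weak_form g (\<lambda>x. b\<^sup>2 * g x - f x) \<psi> = 0"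
    and \<eta>: "\<eta> > 0"
  obtains \<phi> where "C1c \<Omega> \<phi>" "L2 (zero_extension \<Omega> g)" "L2norm (\<lambda>x. zero_extension \<Omega> g x - \<phi> x) \<le> \<eta>"
    "\<And>\<psi>. C1c \<Omega> \<psi> \<Longrightarrow> cmod (weak_form \<phi> (\<lambda>x. b\<^sup>2 * \<phi> x - zero_extension \<Omega> f x) \<psi>) \<le> \<eta> * H1norm \<psi>"
proof -
  define G where "G = zero_extension \<Omega> g"
  define F where "F = zero_extension \<Omega> f"
  have G: "G x = g x" "F x = f x" if "x \<in> \<Omega>" for x using that by (simp_all add: G_def F_def zero_extension_def)
  have G0: "G x = 0" "F x = 0" if "x \<notin> \<Omega>" for x using that by (simp_all add: G_def F_def zero_extension_def)
  have contg: "continuous_on \<Omega> g" by (rule Ck_on_1_continuous[OF g])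
  have contG: "continuous_on UNIV G" unfolding G_def by (rule continuous_zero_extension[OF \<Omega>(1) contg bd])
  have cc: "compact (closure \<Omega>)" using \<Omega>(2) by simp
  have cG: "continuous_on T G" for T using contG continuous_on_subset by blast
  have L2G: "L2 G" by (rule L2_compact_support[OF cc cG]) (use G0 closure_subset in blast)
  have L2F: "L2 F" using f(2) by (simp add: F_def)
  have gd: "g differentiable (at x)" if "x \<in> \<Omega>" for x using g that unfolding Ck_on_1 by blast
  define a where "a i x = partial_deriv i g x" for i x
  have conta: "continuous_on \<Omega> (a i)" if "i \<in> Basis" for i using g that unfolding Ck_on_1 a_def[abs_def] by blast
  define s where "s n x = step (real n * (cmod (G x))\<^sup>2 - 1)" for n x
  define s' where "s' n x = real n * step' (real n * (cmod (G x))\<^sup>2 - 1)" for n x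
  \<comment> \<open>Partial derivative of |g|^2, so that the cutoff \<open>s n\<close> has the
    partial derivatives \<open>s' n x * m i x\<close>.\<close>
  define m where "m i x = 2 * Re (cnj (g x) * a i x)" for i x
  have s01: "0 \<le> s n x" "s n x \<le> 1" "0 \<le> s' n x" for n x by (auto simp: s_def s'_def step_bounds)
  have sq: "Ck_on 1 \<Omega> (\<lambda>x. (cmod (g x))\<^sup>2)"
    "\<And>x v. x \<in> \<Omega> \<Longrightarrow> frechet_derivative (\<lambda>x. (cmod (g x))\<^sup>2) (at x) v = 2 * Re (cnj (g x) * frechet_derivative g (at x) v)"
  proof -
    have d: "((\<lambda>x. (cmod (g x))\<^sup>2) has_derivative (\<lambda>v. 2 * Re (cnj (g x) * frechet_derivative g (at x) v))) (at x)" if "x \<in> \<Omega>" for x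
    proof -
      have gx: "(g has_derivative frechet_derivative g (at x)) (at x)" using gd[OF that] by (rule has_derivative_frechet)
      have "((\<lambda>x. g x \<bullet> g x) has_derivative (\<lambda>v. g x \<bullet> frechet_derivative g (at x) v + frechet_derivative g (at x) v \<bullet> g x)) (at x)"
        by (rule has_derivative_inner[OF gx gx])
      moreover have "g x \<bullet> w + w \<bullet> g x = 2 * Re (cnj (g x) * w)" for x w by (simp add: inner_complex_def algebra_simps)
      ultimately show ?thesis by (simp add: power2_norm_eq_inner)
    qed
    show "Ck_on 1 \<Omega> (\<lambda>x. (cmod (g x))\<^sup>2)"
    proof (rule Ck_on_1I[OF d])
      show "continuous_on \<Omega> (\<lambda>x. 2 * Re (cnj (g x) * frechet_derivative g (at x) i))" for i
        by (intro continuous_intros contg Ck_on_1_continuous_frechet[OF g])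
    qed
    show "\<And>x v. x \<in> \<Omega> \<Longrightarrow> frechet_derivative (\<lambda>x. (cmod (g x))\<^sup>2) (at x) v = 2 * Re (cnj (g x) * frechet_derivative g (at x) v)"
      using frechet_derivative_eq[OF d] by simp
  qed
  have sC: "Ck_on 1 \<Omega> (s n)" for n
    using step_compose(1)[OF sq(1), of "real n"] Ck_on_cong_open[OF \<Omega>(1), of "s n" "\<lambda>x. step (real n * (cmod (g x))\<^sup>2 - 1)" 1] G
    by (simp add: s_def)
  have sd: "s n differentiable (at x)" if "x \<in> \<Omega>" for n x using sC that unfolding Ck_on_1 by blast
  have ps: "partial_deriv i (s n) x = s' n x * m i x" if "x \<in> \<Omega>" for i n x
  proof -
    have "partial_deriv i (s n) x = partial_deriv i (\<lambda>x. step (real n * (cmod (g x))\<^sup>2 - 1)) x"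
      by (rule partial_deriv_cong_open[OF \<Omega>(1) that]) (use G in \<open>simp add: s_def\<close>)
    also have "\<dots> = s' n x * m i x"
      using step_compose(2)[OF sq(1) that, of "real n"] G[OF that]
      by (simp add: partial_deriv_def sq(2)[OF that] s'_def m_def a_def)
    finally show ?thesis .
  qed
  have csC: "Ck_on 1 \<Omega> (\<lambda>x. complex_of_real (s n x))" for n
    by (rule Ck_on_bounded_linear_comp[OF bounded_linear_of_real \<Omega>(1) sC])
  have pcs: "partial_deriv i (\<lambda>x. complex_of_real (s n x)) x = complex_of_real (s' n x * m i x)" if "x \<in> \<Omega>" for i n x
  proof -
    have "((\<lambda>x. complex_of_real (s n x)) has_derivative (\<lambda>v. complex_of_real (frechet_derivative (s n) (at x) v))) (at x)"
      by (rule bounded_linear.has_derivative[OF bounded_linear_of_real has_derivative_frechet[OF sd[OF that]]])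
    from partial_deriv_eq[OF this, of i] show ?thesis using ps[OF that] by (simp add: partial_deriv_def)
  qed
  \<comment> \<open>Closed because the zero extension \<open>G\<close> is continuous on the whole
    space, and contained in the bounded domain because \<open>G\<close> vanishes outside; hence
    compact.\<close>
  define Kn where "Kn n = {x. 1 \<le> real n * (cmod (G x))\<^sup>2}" for n
  have Kn\<Omega>: "Kn n \<subseteq> \<Omega>" for n using G0 by (force simp: Kn_def)
  have Knc: "compact (Kn n)" for n
  proof -
    have "closed (Kn n)" unfolding Kn_def
      by (intro closed_Collect_le continuous_intros contG)
    moreover have "bounded (Kn n)" using Kn\<Omega> \<Omega>(2) bounded_subset by blast
    ultimately show ?thesis using compact_eq_bounded_closed by blast
  qed
  have sz: "s n x = 0" if "x \<notin> Kn n" for n x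
    using that unfolding s_def Kn_def by (intro step_zero(1)) simp
  have s'z: "s' n x = 0" if "x \<notin> Kn n" for n x
  proof -
    have "step' (real n * (cmod (G x))\<^sup>2 - 1) = 0" using that unfolding Kn_def by (intro step_zero(2)) simp
    then show ?thesis by (simp add: s'_def)
  qed
  have C1: "C1c \<Omega> (\<lambda>x. H x * complex_of_real (s n x))" if "Ck_on 1 \<Omega> H" for H n
    by (rule C1cI[OF \<Omega>(1) Knc[of n] Kn\<Omega> Ck_on_mult[OF \<Omega>(1) that csC]]) (simp add: sz)
  define \<phi> where "\<phi> n x = G x * complex_of_real (s n x)" for n x
  have GC: "Ck_on 1 \<Omega> G" using Ck_on_cong_open[OF \<Omega>(1), of G g 1] G g by blast
  have Ga: "partial_deriv i G x = a i x" if "x \<in> \<Omega>" for i x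
    unfolding a_def by (rule partial_deriv_cong_open[OF \<Omega>(1) that]) (rule G)
  have Gd: "G differentiable (at x)" if "x \<in> \<Omega>" for x using GC that unfolding Ck_on_1 by blast
  have \<phi>C: "C1c \<Omega> (\<phi> n)" for n unfolding \<phi>_def[abs_def] by (rule C1[OF GC])
  have csd: "(\<lambda>x. complex_of_real (s n x)) differentiable (at x)" if "x \<in> \<Omega>" for n x
    using csC that unfolding Ck_on_1 by blast
  have p\<phi>: "partial_deriv i (\<phi> n) x = G x * complex_of_real (s' n x * m i x) + a i x * complex_of_real (s n x)" if "x \<in> \<Omega>" for i n x
    unfolding \<phi>_def[abs_def] partial_deriv_mult[OF Gd[OF that] csd[OF that]] pcs[OF that] Ga[OF that] ..
  have p\<phi>0: "partial_deriv i (\<phi> n) x = 0" if "x \<notin> \<Omega>" for i n x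
    by (rule partial_deriv_C1c_outside[OF \<phi>C that])
  have cGC: "Ck_on 1 \<Omega> (\<lambda>x. cnj (G x))" by (rule Ck_on_bounded_linear_comp[OF bounded_linear_cnj \<Omega>(1) GC])
  have pcG: "partial_deriv i (\<lambda>x. cnj (G x)) x = cnj (a i x)" "(\<lambda>x. cnj (G x)) differentiable (at x)" if "x \<in> \<Omega>" for i x
  proof -
    have "((\<lambda>x. cnj (G x)) has_derivative (\<lambda>v. cnj (frechet_derivative G (at x) v))) (at x)"
      by (rule bounded_linear.has_derivative[OF bounded_linear_cnj has_derivative_frechet[OF Gd[OF that]]])
    from partial_deriv_eq[OF this, of i] differentiableI[OF this]
    show "partial_deriv i (\<lambda>x. cnj (G x)) x = cnj (a i x)" "(\<lambda>x. cnj (G x)) differentiable (at x)"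
      using Ga[OF that] by (simp_all add: partial_deriv_def)
  qed
  define \<psi> where "\<psi> n x = cnj (G x) * complex_of_real (s n x)" for n x
  have \<psi>C: "C1c \<Omega> (\<psi> n)" for n unfolding \<psi>_def[abs_def] by (rule C1[OF cGC])
  have p\<psi>: "partial_deriv i (\<psi> n) x = cnj (G x) * complex_of_real (s' n x * m i x) + cnj (a i x) * complex_of_real (s n x)" if "x \<in> \<Omega>" for i n x
    unfolding \<psi>_def[abs_def] partial_deriv_mult[OF pcG(2)[OF that] csd[OF that]] pcs[OF that] pcG(1)[OF that] ..
  have p\<psi>0: "partial_deriv i (\<psi> n) x = 0" if "x \<notin> \<Omega>" for i n x
    by (rule partial_deriv_C1c_outside[OF \<psi>C that])
  define P where "P = {x \<in> \<Omega>. g x \<noteq> 0}"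
  have opP: "open P"
  proof -
    have "P = \<Omega> \<inter> g -` (- {0})" by (auto simp: P_def)
    then show ?thesis using continuous_open_preimage[OF contg \<Omega>(1), of "- {0}"] by (simp add: open_Compl)
  qed
  \<comment> \<open>The gradient restricted to the set where \<open>g\<close> is nonzero. The
    cutoffs tend to 1 only there, so this is the part that the energy bound reaches; inside the
    domain it differs from the gradient on a negligible set.\<close>
  define D where "D i x = (if x \<in> P then a i x else 0)" for i x
  have measD: "D i \<in> borel_measurable lebesgue" if "i \<in> Basis" for i
  proof -
    have "P \<subseteq> \<Omega>" by (auto simp: P_def)
    then have "continuous_on P (a i)" using conta[OF that] continuous_on_subset by blast
    then have "(\<lambda>x. indicator P x *\<^sub>R a i x) \<in> borel_measurable lborel"
      using borel_measurable_continuous_on_indicator[of P "a i"] opP by simp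
    then have "(\<lambda>x. indicator P x *\<^sub>R a i x) \<in> borel_measurable lebesgue" by (rule measurable_completion)
    moreover have "(\<lambda>x. indicator P x *\<^sub>R a i x) = D i" by (auto simp: D_def fun_eq_iff indicator_def)
    ultimately show ?thesis by simp
  qed
  define E where "E x = (\<Sum>i\<in>(Basis::'a set). (cmod (D i x))\<^sup>2)" for x
  have E0: "E x \<ge> 0" for x by (simp add: E_def sum_nonneg)
  have measE: "E \<in> borel_measurable lebesgue" unfolding E_def[abs_def]
    using measD by (intro borel_measurable_sum borel_measurable_power) (auto intro: measurable_compose[OF _ borel_measurable_norm])
  have PK: "x \<in> P" if "x \<in> Kn n" for n x
  proof -
    have "x \<in> \<Omega>" using that Kn\<Omega> by blast
    moreover have "G x \<noteq> 0" using that by (auto simp: Kn_def)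
    ultimately show ?thesis using G by (simp add: P_def)
  qed
  have slim: "(\<lambda>n. s n x) \<longlonglongrightarrow> 1" if "x \<in> P" for x
    unfolding s_def using that G by (intro step_sequence) (simp add: P_def)
  have s'lim: "(\<lambda>n. (cmod (G x))\<^sup>2 * s' n x) \<longlonglongrightarrow> 0" if "x \<in> P" for x
    unfolding s'_def using that G by (intro step'_sequence) (simp add: P_def)
  have s'b: "(cmod (G x))\<^sup>2 * s' n x \<le> 3" for n x
  proof -
    let ?t = "real n * (cmod (G x))\<^sup>2 - 1"
    have "(?t + 1) * step' ?t \<le> 3 / (1 + (max 0 ?t)\<^sup>2)" by (rule step'_bound)
    also have "\<dots> \<le> 3" using one_plus_square_pos[of "max 0 ?t"] by (simp add: field_simps)
    finally show ?thesis by (simp add: s'_def mult_ac)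
  qed
  have mb: "\<bar>m i x\<bar> \<le> 2 * (cmod (G x) * cmod (a i x))" if "x \<in> \<Omega>" for i x
    unfolding m_def G(1)[OF that] using abs_Re_le_cmod[of "cnj (g x) * a i x"] by (simp add: norm_mult)
  \<comment> \<open>Bound for the terms of order zero in the energy identity, integrable because
    \<open>G\<close> and \<open>F\<close> are square integrable.\<close>
  define Bd where "Bd x = (cmod b)\<^sup>2 * (cmod (G x))\<^sup>2 + cmod (F x) * cmod (G x)" for x
  have intBd: "integrable lebesgue Bd" unfolding Bd_def[abs_def]
    using L2G L2_integrable_cmod_mult[OF L2F L2G] by (simp add: L2_def)
  have conth: "continuous_on \<Omega> (\<lambda>x. b\<^sup>2 * g x - f x)" using contg f(1) by (intro continuous_intros)
  have energy: "integrable lebesgue (\<lambda>x. s n x * E x) \<and> (LINT x|lebesgue. s n x * E x) \<le> integral\<^sup>L lebesgue Bd" for n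
  proof -
    let ?W = "\<lambda>x. (\<Sum>i\<in>Basis. partial_deriv i g x * partial_deriv i (\<psi> n) x) - (b\<^sup>2 * g x - f x) * \<psi> n x"
    have iW: "integrable lebesgue ?W" by (rule weak_form_integrable[OF g conth \<psi>C])
    have W0: "integral\<^sup>L lebesgue ?W = 0" using weak[OF \<psi>C[of n]] by (simp add: weak_form_def)
    have bound: "s n x * E x \<le> Re (?W x) + Bd x" for x
    proof (cases "x \<in> \<Omega>")
      case False
      have "\<psi> n x = 0" using False G0 by (simp add: \<psi>_def)
      moreover have "E x = 0" using False by (simp add: E_def D_def P_def)
      ultimately show ?thesis using False p\<psi>0 G0 by (simp add: Bd_def)
    next
      case True
      have t: "Re (a i x * partial_deriv i (\<psi> n) x) \<ge> s n x * (cmod (D i x))\<^sup>2" for i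
      proof -
        have "Re (a i x * partial_deriv i (\<psi> n) x) = s' n x * m i x * Re (a i x * cnj (g x)) + s n x * Re (a i x * cnj (a i x))"
          unfolding p\<psi>[OF True] G(1)[OF True] by (simp add: algebra_simps)
        also have "Re (a i x * cnj (g x)) = m i x / 2" by (simp add: m_def mult.commute)
        also have "Re (a i x * cnj (a i x)) = (cmod (a i x))\<^sup>2" by (simp add: complex_mult_cnj cmod_power2)
        finally have "Re (a i x * partial_deriv i (\<psi> n) x) = s' n x * (m i x)\<^sup>2 / 2 + s n x * (cmod (a i x))\<^sup>2"
          by (simp add: power2_eq_square)
        moreover have "s n x * (cmod (D i x))\<^sup>2 \<le> s n x * (cmod (a i x))\<^sup>2"
          using s01 by (intro mult_left_mono) (auto simp: D_def)
        moreover have "0 \<le> s' n x * (m i x)\<^sup>2 / 2" using s01(3)[of n x] by simp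
        ultimately show ?thesis by linarith
      qed
      have "s n x * E x \<le> Re (\<Sum>i\<in>Basis. partial_deriv i g x * partial_deriv i (\<psi> n) x)"
        unfolding E_def sum_distrib_left Re_sum using t by (intro sum_mono) (simp add: a_def)
      moreover have "Re ((b\<^sup>2 * g x - f x) * \<psi> n x) \<le> Bd x"
      proof -
        have "Re ((b\<^sup>2 * g x - f x) * \<psi> n x) \<le> cmod ((b\<^sup>2 * g x - f x) * \<psi> n x)" by (rule complex_Re_le_cmod)
        also have "\<dots> = cmod (b\<^sup>2 * g x - f x) * (cmod (g x) * s n x)"
          using G(1)[OF True] s01 by (simp add: norm_mult \<psi>_def)
        also have "\<dots> \<le> (cmod (b\<^sup>2 * g x) + cmod (f x)) * (cmod (g x) * 1)"
          using s01 by (intro mult_mono norm_triangle_ineq4 order_refl) auto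
        also have "\<dots> = Bd x" using G[OF True] by (simp add: Bd_def norm_mult norm_power power2_eq_square algebra_simps)
        finally show ?thesis .
      qed
      ultimately show ?thesis by simp
    qed
    have meas: "(\<lambda>x. s n x * E x) \<in> borel_measurable lebesgue"
    proof -
      have "continuous_on UNIV (s n)" unfolding s_def[abs_def]
      proof (rule continuous_on_compose2[of UNIV step])
        show "continuous_on UNIV step"
          by (meson DERIV_isCont continuous_at_imp_continuous_on step_has_derivative)
      qed (auto intro!: continuous_intros contG)
      then have "s n \<in> borel_measurable lborel" by (simp add: borel_measurable_continuous_onI)
      then have "s n \<in> borel_measurable lebesgue" by (rule measurable_completion)
      then show ?thesis using measE by simp
    qed
    have iRe: "integrable lebesgue (\<lambda>x. Re (?W x))" by (rule integrable_bounded_linear[OF bounded_linear_Re iW])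
    have iR: "integrable lebesgue (\<lambda>x. Re (?W x) + Bd x)" by (rule Bochner_Integration.integrable_add[OF iRe intBd])
    have i: "integrable lebesgue (\<lambda>x. s n x * E x)"
    proof (rule Bochner_Integration.integrable_bound[OF iR meas])
      show "AE x in lebesgue. norm (s n x * E x) \<le> norm (Re (?W x) + Bd x)"
      proof (rule AE_I2)
        fix x
        have "0 \<le> s n x * E x" using s01 E0 by simp
        then show "norm (s n x * E x) \<le> norm (Re (?W x) + Bd x)" using bound[of x] by simp
      qed
    qed
    have "(LINT x|lebesgue. s n x * E x) \<le> (LINT x|lebesgue. Re (?W x) + Bd x)"
      by (rule Bochner_Integration.integral_mono[OF i iR bound])
    also have "\<dots> = integral\<^sup>L lebesgue Bd"
      unfolding Bochner_Integration.integral_add[OF iRe intBd] integral_bounded_linear[OF bounded_linear_Re iW] W0 by simp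
    finally show ?thesis using i by blast
  qed
  \<comment> \<open>Monotone convergence: the cutoffs increase with \<open>n\<close> to the
    indicator of \<open>P\<close>, and the energies are bounded by the integral of
    \<open>Bd\<close>. This makes the gradient square integrable up to the boundary.\<close>
  have intE: "integrable lebesgue E"
  proof -
    let ?I = "\<lambda>n. LINT x|lebesgue. s n x * E x"
    have smono: "s k x \<le> s n x" if "k \<le> n" for k n x
      unfolding s_def using that by (intro step_mono) (simp add: mult_right_mono)
    have "incseq ?I"
    proof (rule monoI)
      fix k n :: nat assume "k \<le> n"
      then show "?I k \<le> ?I n"
        using energy smono E0 by (intro Bochner_Integration.integral_mono mult_right_mono) blast+
    qed
    moreover have "bdd_above (range ?I)" using energy by (auto intro!: bdd_aboveI)
    ultimately have lim: "?I \<longlonglongrightarrow> (SUP n. ?I n)" by (rule LIMSEQ_incseq_SUP[rotated])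
    show ?thesis
    proof (rule integrable_monotone_convergence[where f="\<lambda>n x. s n x * E x", OF _ _ _ lim measE])
      show "integrable lebesgue (\<lambda>x. s n x * E x)" for n using energy by blast
      show "AE x in lebesgue. mono (\<lambda>n. s n x * E x)"
        using smono E0 by (intro AE_I2 monoI mult_right_mono)
      show "AE x in lebesgue. (\<lambda>n. s n x * E x) \<longlonglongrightarrow> E x"
      proof (rule AE_I2)
        fix x
        show "(\<lambda>n. s n x * E x) \<longlonglongrightarrow> E x"
        proof (cases "x \<in> P")
          case True
          show ?thesis using tendsto_mult[OF slim[OF True] tendsto_const, of "E x"] by simp
        qed (simp add: E_def D_def)
      qed
    qed
  qed
  have DE: "(cmod (D i x))\<^sup>2 \<le> E x" if "i \<in> Basis" for i x
    unfolding E_def using that by (intro member_le_sum) auto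
  have L2D: "L2 (D i)" if "i \<in> Basis" for i
    unfolding L2_def
  proof
    show "integrable lebesgue (\<lambda>x. (cmod (D i x))\<^sup>2)"
    proof (rule Bochner_Integration.integrable_bound[OF intE])
      show "(\<lambda>x. (cmod (D i x))\<^sup>2) \<in> borel_measurable lebesgue" using measD[OF that] by measurable
    qed (use DE[OF that] E0 in simp)
  qed (rule measD[OF that])
  \<comment> \<open>The second summand in the bracket stems from the derivative of the cutoff,
    through |m| \<le> 2 |G| |a|; it tends to 0 pointwise and never exceeds 6.\<close>
  have diffb: "cmod (partial_deriv i (\<phi> n) x - D i x) \<le> cmod (D i x) * (\<bar>s n x - 1\<bar> + 2 * ((cmod (G x))\<^sup>2 * s' n x))" if "i \<in> Basis" for i n x
  proof (cases "x \<in> P")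
    case True
    then have x: "x \<in> \<Omega>" "D i x = a i x" by (auto simp: P_def D_def)
    have "partial_deriv i (\<phi> n) x - D i x = G x * complex_of_real (s' n x * m i x) + a i x * complex_of_real (s n x - 1)"
      unfolding p\<phi>[OF x(1)] x(2) by (simp add: algebra_simps)
    then have "cmod (partial_deriv i (\<phi> n) x - D i x) \<le> cmod (G x * complex_of_real (s' n x * m i x)) + cmod (a i x * complex_of_real (s n x - 1))"
      by (metis norm_triangle_ineq)
    also have "\<dots> = cmod (G x) * (s' n x * \<bar>m i x\<bar>) + cmod (a i x) * \<bar>s n x - 1\<bar>"
      unfolding norm_mult norm_of_real abs_mult using s01(3)[of n x] by simp
    also have "\<dots> \<le> cmod (G x) * (s' n x * (2 * (cmod (G x) * cmod (a i x)))) + cmod (a i x) * \<bar>s n x - 1\<bar>"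
      using mb[OF x(1), of i] s01(3)[of n x] by (intro add_mono mult_left_mono) auto
    also have "\<dots> = cmod (D i x) * (\<bar>s n x - 1\<bar> + 2 * ((cmod (G x))\<^sup>2 * s' n x))"
      unfolding x(2) by (simp add: power2_eq_square algebra_simps)
    finally show ?thesis .
  next
    case False
    have "partial_deriv i (\<phi> n) x = 0"
    proof (cases "x \<in> \<Omega>")
      case True
      have "x \<notin> Kn n" using PK False by blast
      then show ?thesis using p\<phi>[OF True] sz s'z by simp
    qed (rule p\<phi>0)
    then show ?thesis using False by (simp add: D_def)
  qed
  have lim1: "(\<lambda>n. L2norm (\<lambda>x. partial_deriv i (\<phi> n) x - D i x)) \<longlonglongrightarrow> 0" and
    L2d: "\<And>n. L2 (\<lambda>x. partial_deriv i (\<phi> n) x - D i x)" if i: "i \<in> Basis" for i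
  proof -
    have meas: "(\<lambda>x. partial_deriv i (\<phi> n) x - D i x) \<in> borel_measurable lebesgue" for n
      using C1c_L2(2)[OF \<phi>C[of n], of i] measD[OF i] by (auto simp: L2_def)
    have ptw: "(\<lambda>n. partial_deriv i (\<phi> n) x - D i x) \<longlonglongrightarrow> 0" for x
    proof (rule Lim_null_comparison)
      show "\<forall>\<^sub>F n in sequentially. norm (partial_deriv i (\<phi> n) x - D i x) \<le> cmod (D i x) * (\<bar>s n x - 1\<bar> + 2 * ((cmod (G x))\<^sup>2 * s' n x))"
        using diffb[OF i] by (intro always_eventually) simp
      show "(\<lambda>n. cmod (D i x) * (\<bar>s n x - 1\<bar> + 2 * ((cmod (G x))\<^sup>2 * s' n x))) \<longlonglongrightarrow> 0"
      proof (cases "x \<in> P")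
        case True
        have "(\<lambda>n. cmod (D i x) * (\<bar>s n x - 1\<bar> + 2 * ((cmod (G x))\<^sup>2 * s' n x))) \<longlonglongrightarrow> cmod (D i x) * (\<bar>1 - 1\<bar> + 2 * 0)"
          by (intro tendsto_intros slim[OF True] s'lim[OF True])
        then show ?thesis by simp
      qed (simp add: D_def)
    qed
    \<comment> \<open>Here 49 is the square of 7 = 1 + 2 * 3, with 3 the bound of |G|^2 s'.\<close>
    have bnd: "(cmod (partial_deriv i (\<phi> n) x - D i x))\<^sup>2 \<le> 49 * E x" for n x
    proof -
      have "\<bar>s n x - 1\<bar> + 2 * ((cmod (G x))\<^sup>2 * s' n x) \<le> 7" using s01[of n x] s'b[of x n] by linarith
      then have "cmod (partial_deriv i (\<phi> n) x - D i x) \<le> cmod (D i x) * 7"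
        using diffb[OF i, of n x] by (meson mult_left_mono norm_ge_zero order_trans)
      then have "(cmod (partial_deriv i (\<phi> n) x - D i x))\<^sup>2 \<le> (cmod (D i x) * 7)\<^sup>2" by (rule power_mono) simp
      then show ?thesis using DE[OF i, of x] by (simp add: power_mult_distrib)
    qed
    have int49: "integrable lebesgue (\<lambda>x. 49 * E x)" using intE by simp
    show "(\<lambda>n. L2norm (\<lambda>x. partial_deriv i (\<phi> n) x - D i x)) \<longlonglongrightarrow> 0"
      by (rule L2norm_tendsto_0(2)[OF int49 meas ptw bnd])
    show "L2 (\<lambda>x. partial_deriv i (\<phi> n) x - D i x)" for n
      by (rule L2norm_tendsto_0(1)[OF int49 meas ptw bnd])
  qed
  have lim0: "(\<lambda>n. L2norm (\<lambda>x. \<phi> n x - G x)) \<longlonglongrightarrow> 0"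
  proof (rule L2norm_tendsto_0(2)[where B="\<lambda>x. (cmod (G x))\<^sup>2"])
    show "integrable lebesgue (\<lambda>x. (cmod (G x))\<^sup>2)" using L2G by (simp add: L2_def)
    show "(\<lambda>x. \<phi> n x - G x) \<in> borel_measurable lebesgue" for n
      using C1c_L2(1)[OF \<phi>C[of n]] L2G by (auto simp: L2_def)
    have eq: "\<phi> n x - G x = G x * complex_of_real (s n x - 1)" for n x by (simp add: \<phi>_def algebra_simps)
    show "(\<lambda>n. \<phi> n x - G x) \<longlonglongrightarrow> 0" for x
    proof (cases "x \<in> P")
      case True
      have "(\<lambda>n. G x * complex_of_real (s n x - 1)) \<longlonglongrightarrow> G x * complex_of_real (1 - 1)"
        by (intro tendsto_intros slim[OF True])
      then show ?thesis by (simp add: eq)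
    next
      case False
      then have "G x = 0" using G G0 by (cases "x \<in> \<Omega>") (auto simp: P_def)
      then show ?thesis by (simp add: \<phi>_def)
    qed
    show "(cmod (\<phi> n x - G x))\<^sup>2 \<le> (cmod (G x))\<^sup>2" for n x
    proof (rule power_mono)
      have "\<bar>s n x - 1\<bar> \<le> 1" using s01[of n x] by linarith
      then show "cmod (\<phi> n x - G x) \<le> cmod (G x)"
        unfolding eq norm_mult norm_of_real by (intro mult_left_le) auto
    qed simp
  qed
  have L20: "L2 (\<lambda>x. \<phi> n x - G x)" for n by (rule L2_diff[OF C1c_L2(1)[OF \<phi>C] L2G])
  \<comment> \<open>Coefficient of the H^1 norm of the test function in the error; the summand 1 in
    \<open>(cmod b)\<^sup>2 + 1\<close> makes it bound the L^2 distance of \<open>\<phi> n\<close>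
    from \<open>G\<close> as well.\<close>
  define err where "err n = (\<Sum>i\<in>(Basis::'a set). L2norm (\<lambda>x. partial_deriv i (\<phi> n) x - D i x))
     + ((cmod b)\<^sup>2 + 1) * L2norm (\<lambda>x. \<phi> n x - G x)" for n
  have "err \<longlonglongrightarrow> (\<Sum>i\<in>(Basis::'a set). 0) + ((cmod b)\<^sup>2 + 1) * 0"
    unfolding err_def by (intro tendsto_intros lim1 lim0)
  then have "err \<longlonglongrightarrow> 0" by simp
  then have "\<forall>\<^sub>F n in sequentially. err n < \<eta>" using \<eta> by (rule order_tendstoD(2))
  then obtain n where n: "err n < \<eta>" unfolding eventually_sequentially by blast
  have sumpos: "(\<Sum>i\<in>(Basis::'a set). L2norm (\<lambda>x. partial_deriv i (\<phi> n) x - D i x)) \<ge> 0"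
    by (intro sum_nonneg L2norm_nonneg)
  show ?thesis
  proof (rule that[OF \<phi>C[of n]])
    show "L2 (zero_extension \<Omega> g)" using L2G by (simp add: G_def)
    have "L2norm (\<lambda>x. \<phi> n x - G x) \<le> ((cmod b)\<^sup>2 + 1) * L2norm (\<lambda>x. \<phi> n x - G x)"
      using L2norm_nonneg[of "\<lambda>x. \<phi> n x - G x"] by (simp add: algebra_simps)
    then have "L2norm (\<lambda>x. \<phi> n x - G x) \<le> \<eta>" using n sumpos by (simp add: err_def)
    then show "L2norm (\<lambda>x. zero_extension \<Omega> g x - \<phi> n x) \<le> \<eta>"
      using L2norm_minus_commute[of "\<phi> n" G] by (simp add: G_def)
    fix \<psi> :: "'a \<Rightarrow> complex" assume \<psi>: "C1c \<Omega> \<psi>"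
    let ?W1 = "\<lambda>x. (\<Sum>i\<in>Basis. partial_deriv i (\<phi> n) x * partial_deriv i \<psi> x) - (b\<^sup>2 * \<phi> n x - F x) * \<psi> x"
    let ?W2 = "\<lambda>x. (\<Sum>i\<in>Basis. partial_deriv i g x * partial_deriv i \<psi> x) - (b\<^sup>2 * g x - f x) * \<psi> x"
    let ?V = "\<lambda>x. (\<Sum>i\<in>Basis. (partial_deriv i (\<phi> n) x - D i x) * partial_deriv i \<psi> x) - b\<^sup>2 * ((\<phi> n x - G x) * \<psi> x)"
    obtain K where K: "compact K" "K \<subseteq> \<Omega>" "\<And>x. x \<notin> K \<Longrightarrow> \<psi> x = 0"
      "\<And>x. x \<notin> K \<Longrightarrow> frechet_derivative \<psi> (at x) = (\<lambda>v. 0)"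
      using C1cE[OF \<psi>] by metis
    note L2\<psi> = C1c_L2[OF \<psi>]
    have iV: "integrable lebesgue ?V"
      using L2_integrable_mult[OF L2d L2\<psi>(2)] L2_integrable_mult[OF L20 L2\<psi>(1)]
      by (intro Bochner_Integration.integrable_diff Bochner_Integration.integrable_sum integrable_mult_right) auto
    have iW2: "integrable lebesgue ?W2" by (rule weak_form_integrable[OF g conth \<psi>])
    define Z where "Z = {x \<in> \<Omega>. g x = 0 \<and> (\<exists>i. partial_deriv i g x \<noteq> 0)}"
    have "negligible Z" unfolding Z_def by (rule negligible_zero_gradient[OF \<Omega>(1) g])
    then have AEZ: "AE x in lebesgue. x \<notin> Z" unfolding negligible_iff_null_sets by (rule AE_not_in)
    \<comment> \<open>The weak equation of \<open>g\<close> contains its gradient, the error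
      estimate contains \<open>D\<close>; the two agree outside the negligible set
      \<open>Z\<close>.\<close>
    have eqV: "?W1 x - ?W2 x = ?V x" if "x \<notin> Z" for x
    proof (cases "x \<in> K")
      case True
      then have x: "x \<in> \<Omega>" using K(2) by blast
      have "D i x = partial_deriv i g x" for i using that x by (auto simp: D_def P_def Z_def a_def)
      then show ?thesis using G[OF x] by (simp add: sum_subtractf algebra_simps)
    next
      case False
      then show ?thesis using K(3,4) by (simp add: partial_deriv_def)
    qed
    have "integral\<^sup>L lebesgue ?W1 = integral\<^sup>L lebesgue (\<lambda>x. ?V x + ?W2 x)"
    proof (rule Bochner_Integration.integral_cong_AE)
      have "integrable lebesgue (\<lambda>x. F x * \<psi> x)" by (rule L2_integrable_mult[OF L2F L2\<psi>(1)])
      moreover have "integrable lebesgue (\<lambda>x. partial_deriv i (\<phi> n) x * partial_deriv i \<psi> x)" for i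
        by (rule L2_integrable_mult[OF C1c_L2(2)[OF \<phi>C] L2\<psi>(2)])
      moreover have "integrable lebesgue (\<lambda>x. \<phi> n x * \<psi> x)"
        by (rule L2_integrable_mult[OF C1c_L2(1)[OF \<phi>C] L2\<psi>(1)])
      ultimately have "integrable lebesgue (\<lambda>x. (\<Sum>i\<in>Basis. partial_deriv i (\<phi> n) x * partial_deriv i \<psi> x) - (b\<^sup>2 * (\<phi> n x * \<psi> x) - F x * \<psi> x))"
        by (intro Bochner_Integration.integrable_diff Bochner_Integration.integrable_sum integrable_mult_right) auto
      then have "integrable lebesgue ?W1" by (simp add: algebra_simps)
      then show "?W1 \<in> borel_measurable lebesgue" by auto
      show "(\<lambda>x. ?V x + ?W2 x) \<in> borel_measurable lebesgue"
        using Bochner_Integration.integrable_add[OF iV iW2] by (rule borel_measurable_integrable)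
      show "AE x in lebesgue. ?W1 x = ?V x + ?W2 x"
        using AEZ by (rule AE_mp) (intro AE_I2 impI, use eqV in \<open>simp add: diff_eq_eq\<close>)
    qed
    also have "\<dots> = integral\<^sup>L lebesgue ?V + integral\<^sup>L lebesgue ?W2" by (rule Bochner_Integration.integral_add[OF iV iW2])
    also have "integral\<^sup>L lebesgue ?W2 = 0" using weak[OF \<psi>] by (simp add: weak_form_def)
    finally have "weak_form (\<phi> n) (\<lambda>x. b\<^sup>2 * \<phi> n x - zero_extension \<Omega> f x) \<psi> = integral\<^sup>L lebesgue ?V"
      by (simp add: weak_form_def F_def)
    also have "integral\<^sup>L lebesgue ?V = (\<Sum>i\<in>Basis. LINT x|lebesgue. (partial_deriv i (\<phi> n) x - D i x) * partial_deriv i \<psi> x)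
       - b\<^sup>2 * (LINT x|lebesgue. (\<phi> n x - G x) * \<psi> x)"
      using L2_integrable_mult[OF L2d L2\<psi>(2)] L2_integrable_mult[OF L20 L2\<psi>(1)]
      by (subst Bochner_Integration.integral_diff)
         (auto intro!: Bochner_Integration.integrable_sum integrable_mult_right simp: Bochner_Integration.integral_sum)
    also have "cmod \<dots> \<le> (\<Sum>i\<in>Basis. cmod (LINT x|lebesgue. (partial_deriv i (\<phi> n) x - D i x) * partial_deriv i \<psi> x))
       + (cmod b)\<^sup>2 * cmod (LINT x|lebesgue. (\<phi> n x - G x) * \<psi> x)"
      by (rule order_trans[OF norm_triangle_ineq4]) (intro add_mono norm_sum, simp add: norm_mult norm_power)
    also have "\<dots> \<le> (\<Sum>i\<in>(Basis::'a set). L2norm (\<lambda>x. partial_deriv i (\<phi> n) x - D i x) * H1norm \<psi>)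
       + (cmod b)\<^sup>2 * (L2norm (\<lambda>x. \<phi> n x - G x) * H1norm \<psi>)"
    proof (intro add_mono sum_mono mult_left_mono)
      fix i :: 'a assume i: "i \<in> Basis"
      have "cmod (LINT x|lebesgue. (partial_deriv i (\<phi> n) x - D i x) * partial_deriv i \<psi> x)
         \<le> L2norm (\<lambda>x. partial_deriv i (\<phi> n) x - D i x) * L2norm (partial_deriv i \<psi>)"
        by (rule L2_Cauchy_Schwarz[OF L2d[OF i] L2\<psi>(2)])
      also have "\<dots> \<le> L2norm (\<lambda>x. partial_deriv i (\<phi> n) x - D i x) * H1norm \<psi>"
        by (intro mult_left_mono H1norm_ge(3)[OF i] L2norm_nonneg)
      finally show "cmod (LINT x|lebesgue. (partial_deriv i (\<phi> n) x - D i x) * partial_deriv i \<psi> x)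
         \<le> L2norm (\<lambda>x. partial_deriv i (\<phi> n) x - D i x) * H1norm \<psi>" .
    next
      have "cmod (LINT x|lebesgue. (\<phi> n x - G x) * \<psi> x) \<le> L2norm (\<lambda>x. \<phi> n x - G x) * L2norm \<psi>"
        by (rule L2_Cauchy_Schwarz[OF L20 L2\<psi>(1)])
      also have "\<dots> \<le> L2norm (\<lambda>x. \<phi> n x - G x) * H1norm \<psi>"
        by (intro mult_left_mono H1norm_ge(2) L2norm_nonneg)
      finally show "cmod (LINT x|lebesgue. (\<phi> n x - G x) * \<psi> x) \<le> L2norm (\<lambda>x. \<phi> n x - G x) * H1norm \<psi>" .
    qed simp
    also have "\<dots> \<le> err n * H1norm \<psi>"
    proof -
      have "0 \<le> L2norm (\<lambda>x. \<phi> n x - G x) * H1norm \<psi>"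
        using L2norm_nonneg H1norm_ge(1) by (rule mult_nonneg_nonneg)
      then show ?thesis
        unfolding err_def sum_distrib_right[symmetric] by (simp add: distrib_right mult.assoc)
    qed
    also have "\<dots> \<le> \<eta> * H1norm \<psi>" using n H1norm_ge(1)[of \<psi>] by (intro mult_right_mono) auto
    finally show "cmod (weak_form (\<phi> n) (\<lambda>x. b\<^sup>2 * \<phi> n x - zero_extension \<Omega> f x) \<psi>) \<le> \<eta> * H1norm \<psi>" .
  qed
qed

section \<open>Change of variables near the identity\<close>

text \<open>The change of variables theorem of the library needs a well-ordered index type, which a bare
  finite type does not have; hence coordinates are relabelled along a bijection from the
  numeral types 2 and 3.\<close>

definition relabel :: "('m \<Rightarrow> 'n) \<Rightarrow> real ^ 'n \<Rightarrow> real ^ 'm" where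
  "relabel \<pi> x = (\<chi> i. x $ \<pi> i)"

lemma bounded_linear_relabel: "bounded_linear (relabel \<pi> :: real ^ 'n \<Rightarrow> real ^ 'm)"
  unfolding linear_conv_bounded_linear[symmetric]
  by (rule linearI) (simp_all add: relabel_def vec_eq_iff)

lemma relabel_relabel:
  assumes "bij \<pi>"
  shows "relabel \<pi> (relabel (inv \<pi>) y) = y" "relabel (inv \<pi>) (relabel \<pi> x) = x"
  using assms by (simp_all add: relabel_def vec_eq_iff bij_is_inj bij_is_surj surj_f_inv_f)

lemma relabel_axis:
  assumes "bij \<pi>"
  shows "relabel (inv \<pi>) (axis i 1) = axis (\<pi> i) 1"
  using assms by (auto simp: relabel_def vec_eq_iff axis_def bij_is_inj bij_is_surj surj_f_inv_f)

lemma prod_Basis_cart: "(\<Prod>b\<in>Basis. (x::real^'n) \<bullet> b) = (\<Prod>i\<in>UNIV. x $ i)"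
proof -
  have B: "(Basis :: (real^'n) set) = (\<lambda>i. axis i 1) ` UNIV" by (auto simp: Basis_vec_def)
  have "inj (\<lambda>i::'n. axis i (1::real))" by (auto simp: inj_on_def axis_eq_axis)
  then show ?thesis unfolding B by (simp add: prod.reindex inner_axis)
qed

text \<open>Lebesgue measure is determined by its values on boxes, and relabelling coordinates
  carries boxes to boxes with the same side lengths.\<close>

lemma distr_relabel_lborel:
  fixes \<pi> :: "'m::finite \<Rightarrow> 'n::finite"
  assumes \<pi>: "bij \<pi>"
  shows "distr lborel borel (relabel (inv \<pi>)) = (lborel :: (real ^ 'n) measure)"
proof (rule lborel_eqI[symmetric])
  let ?T = "relabel (inv \<pi>) :: real ^ 'm \<Rightarrow> real ^ 'n"
  have m: "?T \<in> borel_measurable borel"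
    by (intro borel_measurable_continuous_onI linear_continuous_on bounded_linear_relabel)
  fix l u :: "real ^ 'n"
  assume le: "\<And>b. b \<in> Basis \<Longrightarrow> l \<bullet> b \<le> u \<bullet> b"
  have le': "l $ i \<le> u $ i" for i using le[of "axis i 1"] by (simp add: inner_axis)
  have comp: "?T y $ j = y $ inv \<pi> j" for y j by (simp add: relabel_def)
  have pre: "?T -` box l u = box (relabel \<pi> l) (relabel \<pi> u)"
  proof -
    have "(\<forall>j. l $ j < y $ inv \<pi> j \<and> y $ inv \<pi> j < u $ j) \<longleftrightarrow> (\<forall>i. l $ \<pi> i < y $ i \<and> y $ i < u $ \<pi> i)" for y
      using \<pi> by (metis bij_inv_eq_iff)
    then show ?thesis by (auto simp: mem_box_cart comp relabel_def)
  qed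
  have "emeasure (distr lborel borel ?T) (box l u) = emeasure lborel (?T -` box l u)"
    using m by (subst emeasure_distr) auto
  also have "\<dots> = (\<Prod>b\<in>Basis. (relabel \<pi> u - relabel \<pi> l) \<bullet> b)"
    unfolding pre
  proof (rule emeasure_lborel_box)
    fix b :: "real ^ 'm" assume "b \<in> Basis"
    then obtain i where "b = axis i 1" by (auto simp: Basis_vec_def)
    then show "relabel \<pi> l \<bullet> b \<le> relabel \<pi> u \<bullet> b" using le' by (simp add: inner_axis relabel_def)
  qed
  also have "(\<Prod>b\<in>Basis. (relabel \<pi> u - relabel \<pi> l) \<bullet> b) = (\<Prod>i\<in>UNIV. (u - l) $ \<pi> i)"
    unfolding prod_Basis_cart by (simp add: relabel_def)
  also have "\<dots> = (\<Prod>j\<in>UNIV. (u - l) $ j)"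
    using prod.reindex_bij_betw[OF \<pi>, of "\<lambda>j. (u - l) $ j"] by simp
  also have "\<dots> = (\<Prod>b\<in>Basis. (u - l) \<bullet> b)" by (rule prod_Basis_cart[symmetric])
  finally show "emeasure (distr lborel borel ?T) (box l u) = ennreal (\<Prod>b\<in>Basis. (u - l) \<bullet> b)" .
qed simp

text \<open>Openness of \<open>A\<close> and continuity of \<open>k\<close> make the integrand Borel
  measurable, which allows passing from the completed measure to the Borel one, for which image
  measures are formed.\<close>

lemma set_integral_relabel:
  fixes \<pi> :: "'m::finite \<Rightarrow> 'n::finite" and k :: "real ^ 'n \<Rightarrow> real"
  assumes \<pi>: "bij \<pi>" and A: "open A" "continuous_on A k"
  shows "set_integrable lebesgue (relabel (inv \<pi>) -` A) (\<lambda>y. k (relabel (inv \<pi>) y)) \<longleftrightarrow> set_integrable lebesgue A k"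
    and "(LINT y:relabel (inv \<pi>) -` A|lebesgue. k (relabel (inv \<pi>) y)) = (LINT x:A|lebesgue. k x)"
proof -
  let ?T = "relabel (inv \<pi>) :: real ^ 'm \<Rightarrow> real ^ 'n"
  define F where "F x = indicator A x *\<^sub>R k x" for x
  have Fm: "F \<in> borel_measurable borel" unfolding F_def[abs_def]
    by (rule borel_measurable_continuous_on_indicator) (use A in auto)
  have m: "?T \<in> borel_measurable borel"
    by (intro borel_measurable_continuous_onI linear_continuous_on bounded_linear_relabel)
  have FT: "(\<lambda>y. F (?T y)) \<in> borel_measurable borel" using Fm m by (rule measurable_compose[rotated])
  have eq: "(\<lambda>y. indicator (?T -` A) y *\<^sub>R k (?T y)) = (\<lambda>y. F (?T y))"
    by (auto simp: F_def indicator_def fun_eq_iff)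
  have "set_integrable lebesgue (?T -` A) (\<lambda>y. k (?T y)) \<longleftrightarrow> integrable lborel (\<lambda>y. F (?T y))"
    unfolding set_integrable_def eq using FT by (intro integrable_completion) simp
  also have "\<dots> \<longleftrightarrow> integrable (distr lborel borel ?T) F"
    using m Fm by (intro integrable_distr_eq[symmetric]) auto
  also have "\<dots> \<longleftrightarrow> integrable lborel F" by (simp add: distr_relabel_lborel[OF \<pi>])
  also have "\<dots> \<longleftrightarrow> set_integrable lebesgue A k"
    unfolding set_integrable_def F_def[symmetric] using Fm by (intro integrable_completion[symmetric]) simp
  finally show "set_integrable lebesgue (?T -` A) (\<lambda>y. k (?T y)) \<longleftrightarrow> set_integrable lebesgue A k" .
  have "(LINT y:?T -` A|lebesgue. k (?T y)) = integral\<^sup>L lborel (\<lambda>y. F (?T y))"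
    unfolding set_lebesgue_integral_def eq using FT by (intro integral_completion) simp
  also have "\<dots> = integral\<^sup>L (distr lborel borel ?T) F"
    using m Fm by (intro integral_distr[symmetric]) auto
  also have "\<dots> = integral\<^sup>L lborel F" by (simp add: distr_relabel_lborel[OF \<pi>])
  also have "\<dots> = (LINT x:A|lebesgue. k x)"
    unfolding set_lebesgue_integral_def F_def[symmetric] using Fm by (intro integral_completion[symmetric]) simp
  finally show "(LINT y:?T -` A|lebesgue. k (?T y)) = (LINT x:A|lebesgue. k x)" .
qed

lemma bounded_linear_vec1: "bounded_linear (vec :: real \<Rightarrow> real ^ 1)"
  unfolding linear_conv_bounded_linear[symmetric] by (rule linearI) (simp_all add: vec_eq_iff)

lemma set_integrable_vec1:
  "set_integrable M S (\<lambda>y. vec (k y) :: real ^ 1) \<longleftrightarrow> set_integrable M S k"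
proof
  assume "set_integrable M S (\<lambda>y. vec (k y) :: real ^ 1)"
  from integrable_bounded_linear[OF bounded_linear_vec_nth[of 1] this[unfolded set_integrable_def]]
  show "set_integrable M S k" by (simp add: set_integrable_def)
next
  assume "set_integrable M S k"
  from integrable_bounded_linear[OF bounded_linear_vec1 this[unfolded set_integrable_def]]
  show "set_integrable M S (\<lambda>y. vec (k y) :: real ^ 1)"
    by (simp add: set_integrable_def linear_scale[OF bounded_linear.linear[OF bounded_linear_vec1], of "indicator S _" "k _", simplified])
qed

text \<open>Scalars are read as vectors of length one, the form in which the change of variables
  theorem takes its integrands.\<close>

lemma change_of_variables_real_valued:
  fixes g :: "real ^ 'm::{finite,wellorder} \<Rightarrow> real ^ 'm::_" and k :: "real ^ 'm::_ \<Rightarrow> real"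
  assumes S: "S \<in> sets lebesgue" "\<And>x. x \<in> S \<Longrightarrow> (g has_derivative g' x) (at x within S)" "inj_on g S"
  shows "set_integrable lebesgue (g ` S) k \<longleftrightarrow> set_integrable lebesgue S (\<lambda>x. \<bar>det (matrix (g' x))\<bar> * k (g x))"
    and "set_integrable lebesgue (g ` S) k \<Longrightarrow>
      (LINT x:g ` S|lebesgue. k x) = (LINT x:S|lebesgue. \<bar>det (matrix (g' x))\<bar> * k (g x))"
proof -
  let ?f = "\<lambda>x. vec (k x) :: real ^ 1"
  have sc: "c *\<^sub>R (vec a :: real ^ 1) = vec (c * a)" for c a by (simp add: vec_eq_iff)
  show iff: "set_integrable lebesgue (g ` S) k \<longleftrightarrow> set_integrable lebesgue S (\<lambda>x. \<bar>det (matrix (g' x))\<bar> * k (g x))"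
    using absolutely_integrable_change_of_variables[OF S, of ?f] unfolding sc set_integrable_vec1 .
  assume i: "set_integrable lebesgue (g ` S) k"
  then have i2: "set_integrable lebesgue S (\<lambda>x. \<bar>det (matrix (g' x))\<bar> * k (g x))" using iff by blast
  have v: "integral A (\<lambda>x. vec (l x) :: real ^ 1) $ 1 = (LINT x:A|lebesgue. l x)" if "set_integrable lebesgue A l" for A l
  proof -
    have iv: "set_integrable lebesgue A (\<lambda>x. vec (l x) :: real ^ 1)" using that by (simp add: set_integrable_vec1)
    then have "integral A (\<lambda>x. vec (l x) :: real ^ 1) = (LINT x:A|lebesgue. vec (l x))"
      by (rule set_lebesgue_integral_eq_integral(2)[symmetric])
    then show ?thesis
      using integral_bounded_linear[OF bounded_linear_vec_nth[of 1] iv[unfolded set_integrable_def]]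
      by (simp add: set_lebesgue_integral_def)
  qed
  have "integral (g ` S) ?f = integral S (\<lambda>x. \<bar>det (matrix (g' x))\<bar> *\<^sub>R ?f (g x))"
  proof (rule integral_change_of_variables[OF S])
    show "?f absolutely_integrable_on g ` S \<or>
      (\<lambda>x. \<bar>det (matrix (g' x))\<bar> *\<^sub>R ?f (g x)) absolutely_integrable_on S"
      using i unfolding set_integrable_vec1 by blast
  qed
  then show "(LINT x:g ` S|lebesgue. k x) = (LINT x:S|lebesgue. \<bar>det (matrix (g' x))\<bar> * k (g x))"
    unfolding sc using v[OF i] v[OF i2] by simp
qed

text \<open>Continuity of the determinant at the identity. Closeness is phrased entrywise because
  the partial derivatives are what is controlled.\<close>

lemma det_near_identity:
  assumes "\<kappa> > 0"
  obtains \<delta> where "\<delta> > 0"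
    "\<And>A :: real ^ 'm::finite ^ 'm. (\<And>i j. \<bar>A $ i $ j - mat 1 $ i $ j\<bar> \<le> \<delta>) \<Longrightarrow> \<bar>\<bar>det A\<bar> - 1\<bar> \<le> \<kappa>"
proof -
  have "continuous_on UNIV (det :: real ^ 'm ^ 'm \<Rightarrow> real)"
    unfolding det_def[abs_def] by (intro continuous_intros)
  then have "isCont (det :: real ^ 'm ^ 'm \<Rightarrow> real) (mat 1)" using continuous_on_eq_continuous_at by blast
  then obtain d where d: "d > 0" "\<And>A :: real ^ 'm ^ 'm. dist A (mat 1) < d \<Longrightarrow> dist (det A) (det (mat 1 :: real ^ 'm ^ 'm)) < \<kappa>"
    using assms unfolding continuous_at_eps_delta by metis
  define n where "n = real CARD('m)"
  have n: "n > 0" by (simp add: n_def)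
  \<comment> \<open>An n by n matrix with entries of modulus at most \<open>\<delta>\<close> has
    norm at most n^2 \<delta>, here d/2.\<close>
  define \<delta> where "\<delta> = d / (2 * n * n)"
  show ?thesis
  proof (rule that)
    show "\<delta> > 0" using d n by (simp add: \<delta>_def)
    fix A :: "real ^ 'm ^ 'm"
    assume A: "\<And>i j. \<bar>A $ i $ j - mat 1 $ i $ j\<bar> \<le> \<delta>"
    have r: "norm ((A - mat 1) $ i) \<le> n * \<delta>" for i
    proof -
      have "norm ((A - mat 1) $ i) \<le> (\<Sum>j\<in>UNIV. \<bar>(A - mat 1) $ i $ j\<bar>)" by (rule norm_le_l1_cart)
      also have "\<dots> \<le> (\<Sum>j\<in>(UNIV :: 'm set). \<delta>)" using A by (intro sum_mono) simp
      finally show ?thesis by (simp add: n_def)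
    qed
    have "norm (A - mat 1) \<le> (\<Sum>i\<in>UNIV. norm ((A - mat 1) $ i))"
      unfolding norm_vec_def by (rule L2_set_le_sum) simp
    also have "\<dots> \<le> (\<Sum>i\<in>(UNIV :: 'm set). n * \<delta>)" using r by (intro sum_mono)
    also have "\<dots> = d / 2" using n by (simp add: \<delta>_def n_def)
    finally have "dist A (mat 1) < d" using d(1) by (simp add: dist_norm)
    then have "\<bar>det A - 1\<bar> < \<kappa>" using d(2) by (simp add: dist_real_def)
    then show "\<bar>\<bar>det A\<bar> - 1\<bar> \<le> \<kappa>" by linarith
  qed
qed

text \<open>\<open>J\<close> plays the role of the modulus of the Jacobian determinant of
  \<open>\<tau>\<close>, known only through its closeness to 1 and the change of variables formula
  for continuous integrands; matrices and coordinates stay out of the later estimates.\<close>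

definition cv_density :: "(real ^ 'n) set \<Rightarrow> (real ^ 'n \<Rightarrow> real ^ 'n) \<Rightarrow> real \<Rightarrow> (real ^ 'n \<Rightarrow> real) \<Rightarrow> bool" where
  "cv_density \<Omega> \<tau> \<kappa> J \<longleftrightarrow> continuous_on \<Omega> J \<and> (\<forall>x\<in>\<Omega>. \<bar>J x - 1\<bar> \<le> \<kappa>) \<and>
     (\<forall>h :: real ^ 'n \<Rightarrow> real. continuous_on (\<tau> ` \<Omega>) h \<longrightarrow>
        (set_integrable lebesgue (\<tau> ` \<Omega>) h \<longleftrightarrow> set_integrable lebesgue \<Omega> (\<lambda>x. J x * h (\<tau> x))) \<and>
        (set_integrable lebesgue (\<tau> ` \<Omega>) h \<longrightarrow>
          (LINT x:\<tau> ` \<Omega>|lebesgue. h x) = (LINT x:\<Omega>|lebesgue. J x * h (\<tau> x))))"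

text \<open>The map is conjugated by the relabelling of coordinates, the formula is applied over the
  index type \<open>'m\<close>, and both integrals are transported back. The threshold
  \<open>\<delta>\<close> precedes the domain and the map.\<close>

lemma cv_density_of_bij:
  fixes \<pi> :: "'m::{finite,wellorder} \<Rightarrow> 'n::finite"
  assumes \<pi>: "bij \<pi>" and "\<kappa> > 0"
  obtains \<delta> where "\<delta> > 0"
    "\<And>\<Omega> (\<tau> :: real ^ 'n \<Rightarrow> real ^ 'n). open \<Omega> \<Longrightarrow> open (\<tau> ` \<Omega>) \<Longrightarrow> Ck_on 1 \<Omega> \<tau> \<Longrightarrow> inj_on \<tau> \<Omega> \<Longrightarrow>
       (\<And>x i. x \<in> \<Omega> \<Longrightarrow> i \<in> Basis \<Longrightarrow> norm (partial_deriv i \<tau> x - i) \<le> \<delta>) \<Longrightarrow> \<exists>J. cv_density \<Omega> \<tau> \<kappa> J"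
proof -
  obtain \<delta> where \<delta>: "\<delta> > 0"
    "\<And>A :: real ^ 'm::_ ^ 'm::_. (\<And>i j. \<bar>A $ i $ j - mat 1 $ i $ j\<bar> \<le> \<delta>) \<Longrightarrow> \<bar>\<bar>det A\<bar> - 1\<bar> \<le> \<kappa>"
    using det_near_identity[OF \<open>\<kappa> > 0\<close>] by blast
  let ?T = "relabel (inv \<pi>)" and ?R = "relabel \<pi>"
  note blT = bounded_linear_relabel[of "inv \<pi>"] and blR = bounded_linear_relabel[of \<pi>]
  note TR = relabel_relabel[OF \<pi>]
  show ?thesis
  proof (rule that[OF \<delta>(1)])
    fix \<Omega> and \<tau> :: "real ^ 'n \<Rightarrow> real ^ 'n"
    assume \<Omega>: "open \<Omega>" "open (\<tau> ` \<Omega>)" and \<tau>: "Ck_on 1 \<Omega> \<tau>" "inj_on \<tau> \<Omega>"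
      and near: "\<And>x i. x \<in> \<Omega> \<Longrightarrow> i \<in> Basis \<Longrightarrow> norm (partial_deriv i \<tau> x - i) \<le> \<delta>"
    let ?D = "\<lambda>x. frechet_derivative \<tau> (at x)"
    \<comment> \<open>Jacobian matrix in the relabelled coordinates. Its entries are components of
      partial derivatives of \<open>\<tau>\<close>, so \<open>near\<close> provides the entrywise
      closeness to the identity.\<close>
    define A where "A x = matrix (\<lambda>w. ?R (?D x (?T w)))" for x
    define J where "J x = \<bar>det (A x)\<bar>" for x
    have Aent: "A x $ i $ j = partial_deriv (axis (\<pi> j) 1) \<tau> x $ \<pi> i" for x i j
      by (simp add: A_def matrix_def relabel_axis[OF \<pi>] partial_deriv_def) (simp add: relabel_def)
    define S where "S = ?T -` \<Omega>"
    have opS: "open S" unfolding S_def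
      using \<Omega>(1) linear_continuous_on[OF blT] continuous_open_preimage[of UNIV ?T \<Omega>] by simp
    define g where "g y = ?R (\<tau> (?T y))" for y
    define g' where "g' y w = ?R (?D (?T y) (?T w))" for y w
    have der: "(g has_derivative g' y) (at y within S)" if "y \<in> S" for y
    proof -
      have "\<tau> differentiable (at (?T y))" using \<tau>(1) that unfolding Ck_on_1 S_def by blast
      then have d: "(\<tau> has_derivative ?D (?T y)) (at (?T y))" by (rule has_derivative_frechet)
      have "((\<lambda>y. \<tau> (?T y)) has_derivative (\<lambda>w. ?D (?T y) (?T w))) (at y)"
        by (rule has_derivative_compose[OF bounded_linear_imp_has_derivative[OF blT] d])
      from bounded_linear.has_derivative[OF blR this]
      show ?thesis unfolding g_def[abs_def] g'_def[abs_def] by (rule has_derivative_at_withinI)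
    qed
    have inj: "inj_on g S"
    proof (rule inj_onI)
      fix y z assume yz: "y \<in> S" "z \<in> S" "g y = g z"
      then have "\<tau> (?T y) = \<tau> (?T z)" unfolding g_def using TR(2) by metis
      then have "?T y = ?T z" using \<tau>(2) yz unfolding S_def inj_on_def by blast
      then show "y = z" using TR(1) by metis
    qed
    have gS: "g ` S = ?T -` (\<tau> ` \<Omega>)"
    proof (intro set_eqI iffI)
      fix z assume "z \<in> g ` S"
      then show "z \<in> ?T -` (\<tau> ` \<Omega>)" by (auto simp: g_def S_def TR)
    next
      fix z assume "z \<in> ?T -` (\<tau> ` \<Omega>)"
      then obtain x where x: "x \<in> \<Omega>" "?T z = \<tau> x" by auto
      then have "z = g (?R x)" unfolding g_def TR using TR(1) by metis
      moreover have "?R x \<in> S" using x by (simp add: S_def TR)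
      ultimately show "z \<in> g ` S" by blast
    qed
    have Sm: "S \<in> sets lebesgue" using opS by (simp add: lmeasurable_open borel_open)
    have J1: "\<bar>det (matrix (g' y))\<bar> = J (?T y)" for y
      unfolding J_def A_def g'_def[abs_def] ..
    have contJ: "continuous_on \<Omega> J"
      unfolding J_def det_def Aent
      using \<tau>(1) unfolding Ck_on_1 by (intro continuous_intros) auto
    have Jb: "\<bar>J x - 1\<bar> \<le> \<kappa>" if "x \<in> \<Omega>" for x
      unfolding J_def
    proof (rule \<delta>(2))
      fix i j
      have "A x $ i $ j - mat 1 $ i $ j = (partial_deriv (axis (\<pi> j) 1) \<tau> x - axis (\<pi> j) 1) $ \<pi> i"
        using \<pi> by (auto simp: Aent mat_def axis_def bij_def inj_eq)
      also have "\<bar>\<dots>\<bar> \<le> norm (partial_deriv (axis (\<pi> j) 1) \<tau> x - axis (\<pi> j) 1)" by (rule component_le_norm_cart)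
      also have "\<dots> \<le> \<delta>" using that by (intro near) simp_all
      finally show "\<bar>A x $ i $ j - mat 1 $ i $ j\<bar> \<le> \<delta>" .
    qed
    have cont\<tau>: "continuous_on \<Omega> \<tau>" by (rule Ck_on_1_continuous[OF \<tau>(1)])
    have main: "(set_integrable lebesgue (\<tau> ` \<Omega>) h \<longleftrightarrow> set_integrable lebesgue \<Omega> (\<lambda>x. J x * h (\<tau> x))) \<and>
        (set_integrable lebesgue (\<tau> ` \<Omega>) h \<longrightarrow>
          (LINT x:\<tau> ` \<Omega>|lebesgue. h x) = (LINT x:\<Omega>|lebesgue. J x * h (\<tau> x)))"
      if h: "continuous_on (\<tau> ` \<Omega>) h" for h :: "real ^ 'n \<Rightarrow> real"
    proof -
      have ch: "continuous_on \<Omega> (\<lambda>x. J x * h (\<tau> x))"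
        by (intro continuous_intros contJ continuous_on_compose2[OF h cont\<tau>]) auto
      have cv1: "set_integrable lebesgue (g ` S) (\<lambda>z. h (?T z)) \<longleftrightarrow>
          set_integrable lebesgue S (\<lambda>y. \<bar>det (matrix (g' y))\<bar> * h (?T (g y)))"
        by (rule change_of_variables_real_valued(1)[OF Sm _ inj]) (rule der)
      have cv2: "(LINT z:g ` S|lebesgue. h (?T z)) = (LINT y:S|lebesgue. \<bar>det (matrix (g' y))\<bar> * h (?T (g y)))"
        if "set_integrable lebesgue (g ` S) (\<lambda>z. h (?T z))"
        by (rule change_of_variables_real_valued(2)[OF Sm _ inj that]) (rule der)
      have e: "(\<lambda>y. \<bar>det (matrix (g' y))\<bar> * h (?T (g y))) = (\<lambda>y. J (?T y) * h (\<tau> (?T y)))"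
        by (simp add: J1 g_def TR)
      note t1 = set_integral_relabel[OF \<pi> \<Omega>(2) h] and t2 = set_integral_relabel[OF \<pi> \<Omega>(1) ch]
      have iff: "set_integrable lebesgue (\<tau> ` \<Omega>) h \<longleftrightarrow> set_integrable lebesgue \<Omega> (\<lambda>x. J x * h (\<tau> x))"
        using cv1[unfolded e gS, unfolded S_def] t1(1) t2(1) by blast
      moreover have "(LINT x:\<tau> ` \<Omega>|lebesgue. h x) = (LINT x:\<Omega>|lebesgue. J x * h (\<tau> x))"
        if "set_integrable lebesgue (\<tau> ` \<Omega>) h"
        using cv2[unfolded e gS, unfolded S_def] t1 t2(2) that by simp
      ultimately show ?thesis by blast
    qed
    show "\<exists>J. cv_density \<Omega> \<tau> \<kappa> J" unfolding cv_density_def using contJ Jb main by blast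
  qed
qed

lemma cv_density_exists:
  assumes "CARD('n::finite) = 2 \<or> CARD('n) = 3" and "\<kappa> > 0"
  obtains \<delta> where "\<delta> > 0"
    "\<And>\<Omega> (\<tau> :: real ^ 'n \<Rightarrow> real ^ 'n). open \<Omega> \<Longrightarrow> open (\<tau> ` \<Omega>) \<Longrightarrow> Ck_on 1 \<Omega> \<tau> \<Longrightarrow> inj_on \<tau> \<Omega> \<Longrightarrow>
       (\<And>x i. x \<in> \<Omega> \<Longrightarrow> i \<in> Basis \<Longrightarrow> norm (partial_deriv i \<tau> x - i) \<le> \<delta>) \<Longrightarrow> \<exists>J. cv_density \<Omega> \<tau> \<kappa> J"
  using assms(1)
proof
  assume "CARD('n) = 2"
  then obtain \<pi> :: "2 \<Rightarrow> 'n" where "bij \<pi>" using finite_same_card_bij[of "UNIV :: 2 set" "UNIV :: 'n set"] by auto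
  from cv_density_of_bij[OF this assms(2)] that show ?thesis by blast
next
  assume "CARD('n) = 3"
  then obtain \<pi> :: "3 \<Rightarrow> 'n" where "bij \<pi>" using finite_same_card_bij[of "UNIV :: 3 set" "UNIV :: 'n set"] by auto
  from cv_density_of_bij[OF this assms(2)] that show ?thesis by blast
qed

section \<open>Comparison of two nearby domains\<close>

lemma Ck_on_1_compose:
  fixes \<tau> :: "'a::euclidean_space \<Rightarrow> 'b::euclidean_space" and h :: "'b \<Rightarrow> 'c::real_normed_vector"
  assumes "Ck_on 1 S \<tau>" "Ck_on 1 T h" "\<tau> ` S \<subseteq> T"
  shows "Ck_on 1 S (\<lambda>x. h (\<tau> x))"
    and "x \<in> S \<Longrightarrow> frechet_derivative (\<lambda>x. h (\<tau> x)) (at x) v =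
      frechet_derivative h (at (\<tau> x)) (frechet_derivative \<tau> (at x) v)"
proof -
  have hd: "h differentiable (at y)" if "y \<in> T" for y using assms(2) that unfolding Ck_on_1 by blast
  have d: "((\<lambda>x. h (\<tau> x)) has_derivative (\<lambda>v. frechet_derivative h (at (\<tau> x)) (frechet_derivative \<tau> (at x) v))) (at x)"
    if "x \<in> S" for x
  proof (rule has_derivative_compose[of \<tau> "frechet_derivative \<tau> (at x)" x UNIV h])
    show "(\<tau> has_derivative frechet_derivative \<tau> (at x)) (at x)"
      using assms(1) that unfolding Ck_on_1 by (auto intro!: has_derivative_frechet)
    show "(h has_derivative frechet_derivative h (at (\<tau> x))) (at (\<tau> x))"
      using assms(3) that by (intro has_derivative_frechet hd) blast
  qed
  show "x \<in> S \<Longrightarrow> frechet_derivative (\<lambda>x. h (\<tau> x)) (at x) v =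
      frechet_derivative h (at (\<tau> x)) (frechet_derivative \<tau> (at x) v)"
    using frechet_derivative_eq[OF d] by simp
  show "Ck_on 1 S (\<lambda>x. h (\<tau> x))"
  proof (rule Ck_on_1I[OF d])
    fix i :: 'a
    have "continuous_on S (\<lambda>x. \<Sum>j\<in>Basis. (frechet_derivative \<tau> (at x) i \<bullet> j) *\<^sub>R partial_deriv j h (\<tau> x))"
    proof (intro continuous_intros)
      show "continuous_on S (\<lambda>x. frechet_derivative \<tau> (at x) i)" by (rule Ck_on_1_continuous_frechet[OF assms(1)])
      fix j :: 'b assume "j \<in> Basis"
      then have "continuous_on T (partial_deriv j h)" using assms(2) unfolding Ck_on_1 by blast
      then show "continuous_on S (\<lambda>x. partial_deriv j h (\<tau> x))"
        by (rule continuous_on_compose2[OF _ Ck_on_1_continuous[OF assms(1)] assms(3)])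
    qed
    then show "continuous_on S (\<lambda>x. frechet_derivative h (at (\<tau> x)) (frechet_derivative \<tau> (at x) i))"
    proof (rule continuous_on_eq)
      fix x assume "x \<in> S"
      then have "h differentiable (at (\<tau> x))" using assms(3) by (intro hd) blast
      then show "(\<Sum>j\<in>Basis. (frechet_derivative \<tau> (at x) i \<bullet> j) *\<^sub>R partial_deriv j h (\<tau> x)) =
          frechet_derivative h (at (\<tau> x)) (frechet_derivative \<tau> (at x) i)"
        by (simp only: frechet_derivative_sum_partial)
    qed
  qed
qed

lemma zero_extension_measurable:
  fixes h :: "'a::euclidean_space \<Rightarrow> complex"
  assumes "open S" "continuous_on S h"
  shows "zero_extension S h \<in> borel_measurable lebesgue"
proof -
  have "(\<lambda>x. indicator S x *\<^sub>R h x) \<in> borel_measurable lborel"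
    using borel_measurable_continuous_on_indicator[of S h] assms by simp
  then have "(\<lambda>x. indicator S x *\<^sub>R h x) \<in> borel_measurable lebesgue" by (rule measurable_completion)
  moreover have "(\<lambda>x. indicator S x *\<^sub>R h x) = zero_extension S h"
    by (auto simp: zero_extension_def indicator_def fun_eq_iff)
  ultimately show ?thesis by simp
qed

lemma zero_extension_square:
  "(\<lambda>x. (cmod (zero_extension S h x))\<^sup>2) = (\<lambda>x. indicator S x *\<^sub>R (cmod (h x))\<^sup>2)"
  by (auto simp: zero_extension_def indicator_def fun_eq_iff)

lemma L2_zero_extension_iff:
  fixes h :: "'a::euclidean_space \<Rightarrow> complex"
  assumes "open S" "continuous_on S h"
  shows "L2 (zero_extension S h) \<longleftrightarrow> set_integrable lebesgue S (\<lambda>x. (cmod (h x))\<^sup>2)"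
  using zero_extension_measurable[OF assms] by (simp add: L2_def zero_extension_square set_integrable_def)

lemma L2norm_zero_extension:
  "(L2norm (zero_extension S h))\<^sup>2 = (LINT x:S|lebesgue. (cmod (h x))\<^sup>2)"
  by (simp add: L2norm_square zero_extension_square set_lebesgue_integral_def)

section \<open>Pulling back and pushing forward along the map\<close>

text \<open>\<open>\<delta>\<close> bounds the C^1 size of \<open>r\<close> and
  \<open>\<kappa>\<close> the deviation of the Jacobian from 1. The bound on the dimension times
  \<open>\<delta>\<close> keeps the derivative of the map within 1/2 of the identity, and \<kappa>
  \<le> 1/2 keeps \<open>J\<close> between 1/2 and 3/2.\<close>

locale near_identity =
  fixes \<Omega> \<Omega>r :: "(real ^ 'n::finite) set" and r :: "real ^ 'n \<Rightarrow> real ^ 'n" and \<delta> \<kappa> :: real and J :: "real ^ 'n \<Rightarrow> real"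
  assumes opens: "open \<Omega>" "open \<Omega>r"
    and C1r: "Ck_on 1 \<Omega> r"
    and bij: "bij_betw (\<lambda>x. x + r x) \<Omega> \<Omega>r"
    and r_small: "\<And>x. x \<in> \<Omega> \<Longrightarrow> norm (r x) \<le> \<delta>"
    and dr_small: "\<And>x i. x \<in> \<Omega> \<Longrightarrow> i \<in> Basis \<Longrightarrow> norm (partial_deriv i r x) \<le> \<delta>"
    and \<delta>: "0 \<le> \<delta>" "\<delta> \<le> \<kappa>" "real DIM(real ^ 'n) * \<delta> \<le> 1 / 2"
    and \<kappa>: "\<kappa> \<le> 1 / 2"
    and density: "cv_density \<Omega> (\<lambda>x. x + r x) \<kappa> J"
begin

definition "\<tau> x = x + r x"
definition "\<sigma> = inv_into \<Omega> \<tau>"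
text \<open>Transport between the domains, extended by zero so that test functions go to test
  functions.\<close>

definition "pull \<theta> = zero_extension \<Omega> (\<lambda>x. \<theta> (\<tau> x))"
definition "push \<psi> = zero_extension \<Omega>r (\<lambda>y. \<psi> (\<sigma> y))"

lemma \<tau>_image: "\<tau> ` \<Omega> = \<Omega>r" and \<tau>_inj: "inj_on \<tau> \<Omega>"
  using bij unfolding bij_betw_def \<tau>_def[abs_def] by auto

lemma \<tau>_in: "x \<in> \<Omega> \<Longrightarrow> \<tau> x \<in> \<Omega>r"
  using \<tau>_image by blast

lemma \<sigma>\<tau>: "x \<in> \<Omega> \<Longrightarrow> \<sigma> (\<tau> x) = x"
  unfolding \<sigma>_def using \<tau>_inj by (rule inv_into_f_f)

lemma \<tau>\<sigma>: "y \<in> \<Omega>r \<Longrightarrow> \<tau> (\<sigma> y) = y" and \<sigma>_in: "y \<in> \<Omega>r \<Longrightarrow> \<sigma> y \<in> \<Omega>"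
  unfolding \<sigma>_def using \<tau>_image f_inv_into_f[of y \<tau> \<Omega>] inv_into_into[of y \<tau> \<Omega>] by auto

lemma \<tau>_C1: "Ck_on 1 \<Omega> \<tau>"
  unfolding \<tau>_def[abs_def]
  by (rule Ck_on_add[OF opens(1) Ck_on_bounded_linear[OF bounded_linear_ident] C1r])

lemma \<tau>_differentiable: "x \<in> \<Omega> \<Longrightarrow> \<tau> differentiable (at x)"
  using \<tau>_C1 unfolding Ck_on_1 by blast

lemma \<tau>_deriv: "x \<in> \<Omega> \<Longrightarrow> frechet_derivative \<tau> (at x) v = v + frechet_derivative r (at x) v"
proof -
  assume "x \<in> \<Omega>"
  then have "(r has_derivative frechet_derivative r (at x)) (at x)"
    using C1r unfolding Ck_on_1 by (auto intro!: has_derivative_frechet)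
  then have "(\<tau> has_derivative (\<lambda>v. v + frechet_derivative r (at x) v)) (at x)"
    unfolding \<tau>_def[abs_def] by (rule has_derivative_add[OF has_derivative_ident])
  then show ?thesis using frechet_derivative_eq by metis
qed

lemma \<tau>_deriv_near:
  assumes "x \<in> \<Omega>"
  shows "norm (frechet_derivative \<tau> (at x) v - v) \<le> norm v / 2"
proof -
  have rd: "r differentiable (at x)" using C1r assms unfolding Ck_on_1 by blast
  have "norm (frechet_derivative r (at x) v) \<le> (\<Sum>i\<in>Basis. norm ((v \<bullet> i) *\<^sub>R partial_deriv i r x))"
    unfolding frechet_derivative_sum_partial[OF rd] by (rule norm_sum)
  also have "\<dots> \<le> (\<Sum>i\<in>(Basis :: (real ^ 'n) set). norm v * \<delta>)"
    unfolding norm_scaleR by (intro sum_mono mult_mono) (auto simp: Basis_le_norm assms dr_small)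
  also have "\<dots> = norm v * (real DIM(real ^ 'n) * \<delta>)" by simp
  also have "\<dots> \<le> norm v * (1 / 2)" using \<delta>(3) by (intro mult_left_mono) auto
  finally show ?thesis by (simp add: \<tau>_deriv[OF assms])
qed

lemma \<tau>_deriv_lower:
  assumes "x \<in> \<Omega>"
  shows "norm v \<le> 2 * norm (frechet_derivative \<tau> (at x) v)"
proof -
  have "norm v \<le> norm (frechet_derivative \<tau> (at x) v) + norm (frechet_derivative \<tau> (at x) v - v)"
    using norm_triangle_ineq4[of "frechet_derivative \<tau> (at x) v" "frechet_derivative \<tau> (at x) v - v"] by simp
  then show ?thesis using \<tau>_deriv_near[OF assms, of v] by linarith
qed

text \<open>Inverse function theorem at each point, with invertibility from |v| \<le> 2 |D\<tau> v|.
  The same inequality gives continuity of the inverse derivative \<open>B\<close>: the difference of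
  B(\<sigma> z) i and its value at y is at most twice its image under the derivative of
  \<open>\<tau>\<close> at \<sigma> z, and this image tends to 0.\<close>

lemma \<sigma>_C1: "Ck_on 1 \<Omega>r \<sigma>"
proof -
  let ?A = "\<lambda>x. frechet_derivative \<tau> (at x)"
  have "\<exists>B. linear B \<and> (\<forall>v. ?A x (B v) = v)" if "x \<in> \<Omega>" for x
  proof -
    have lin: "linear (?A x)" using \<tau>_differentiable[OF that] by (rule linear_frechet_derivative)
    have "v = 0" if "?A x v = 0" for v using \<tau>_deriv_lower[OF \<open>x \<in> \<Omega>\<close>, of v] that by simp
    then have "inj (?A x)" using linear_injective_0[OF lin] by blast
    then obtain B where "linear B" "?A x \<circ> B = id"
      using linear_injective_isomorphism[OF lin] by (auto simp: fun_eq_iff o_def)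
    then show ?thesis by (metis comp_apply id_apply)
  qed
  then obtain B where B: "\<And>x. x \<in> \<Omega> \<Longrightarrow> linear (B x)" "\<And>x v. x \<in> \<Omega> \<Longrightarrow> ?A x (B x v) = v" by metis
  have der: "(\<sigma> has_derivative B (\<sigma> y)) (at y)" if y: "y \<in> \<Omega>r" for y
  proof (rule has_derivative_inverse_strong_x[OF opens(1), where f=\<tau>])
    show "\<sigma> y \<in> \<Omega>" "\<tau> (\<sigma> y) = y" using \<sigma>_in \<tau>\<sigma> y by blast+
    show "continuous_on \<Omega> \<tau>" by (rule Ck_on_1_continuous[OF \<tau>_C1])
    show "(\<tau> has_derivative ?A (\<sigma> y)) (at (\<sigma> y))"
      by (rule has_derivative_frechet[OF \<tau>_differentiable[OF \<sigma>_in[OF y]]])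
    show "?A (\<sigma> y) \<circ> B (\<sigma> y) = id" using B(2)[OF \<sigma>_in[OF y]] by (simp add: fun_eq_iff)
  qed (rule \<sigma>\<tau>)
  have cont\<sigma>: "continuous_on \<Omega>r \<sigma>"
    using der has_derivative_continuous continuous_at_imp_continuous_on by blast
  show ?thesis
  proof (rule Ck_on_1I[OF der])
    fix i :: "real ^ 'n"
    show "continuous_on \<Omega>r (\<lambda>y. B (\<sigma> y) i)"
      unfolding continuous_on_def
    proof
      fix y assume y: "y \<in> \<Omega>r"
      define w where "w = B (\<sigma> y) i"
      have Ai: "?A (\<sigma> y) w = i" unfolding w_def using B(2)[OF \<sigma>_in[OF y]] by simp
      have "continuous_on \<Omega>r (\<lambda>z. ?A (\<sigma> z) w)"
        by (rule continuous_on_compose2[OF Ck_on_1_continuous_frechet[OF \<tau>_C1] cont\<sigma>]) (use \<sigma>_in in blast)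
      then have "((\<lambda>z. ?A (\<sigma> z) w) \<longlongrightarrow> ?A (\<sigma> y) w) (at y within \<Omega>r)" using y unfolding continuous_on_def by blast
      then have l: "((\<lambda>z. 2 * norm (?A (\<sigma> z) w - ?A (\<sigma> y) w)) \<longlongrightarrow> 0) (at y within \<Omega>r)"
        by (auto intro!: tendsto_eq_intros simp: LIM_zero)
      have "\<forall>\<^sub>F z in at y within \<Omega>r. norm (B (\<sigma> z) i - w) \<le> 2 * norm (?A (\<sigma> z) w - ?A (\<sigma> y) w)"
        unfolding eventually_at_filter
      proof (intro always_eventually allI impI)
        fix z assume z: "z \<in> \<Omega>r"
        have lin: "linear (?A (\<sigma> z))" using \<tau>_differentiable[OF \<sigma>_in[OF z]] by (rule linear_frechet_derivative)
        have "norm (B (\<sigma> z) i - w) \<le> 2 * norm (?A (\<sigma> z) (B (\<sigma> z) i - w))" by (rule \<tau>_deriv_lower[OF \<sigma>_in[OF z]])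
        also have "?A (\<sigma> z) (B (\<sigma> z) i - w) = i - ?A (\<sigma> z) w"
          using B(2)[OF \<sigma>_in[OF z]] by (simp add: linear_diff[OF lin])
        finally show "norm (B (\<sigma> z) i - w) \<le> 2 * norm (?A (\<sigma> z) w - ?A (\<sigma> y) w)"
          using Ai by (simp add: norm_minus_commute)
      qed
      then have "((\<lambda>z. B (\<sigma> z) i - w) \<longlongrightarrow> 0) (at y within \<Omega>r)" using l by (rule Lim_null_comparison)
      then show "((\<lambda>z. B (\<sigma> z) i) \<longlongrightarrow> B (\<sigma> y) i) (at y within \<Omega>r)" by (simp add: w_def LIM_zero_iff)
    qed
  qed
qed

lemma pull_C1c:
  assumes "C1c \<Omega>r \<theta>"
  shows "C1c \<Omega> (pull \<theta>)"
proof -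
  obtain K where K: "compact K" "K \<subseteq> \<Omega>r" "\<And>y. y \<notin> K \<Longrightarrow> \<theta> y = 0" using assms unfolding C1c_def by blast
  show ?thesis
  proof (rule C1cI[OF opens(1)])
    have "continuous_on K \<sigma>" using Ck_on_1_continuous[OF \<sigma>_C1] K(2) continuous_on_subset by blast
    then show "compact (\<sigma> ` K)" using K(1) by (rule compact_continuous_image)
    show "\<sigma> ` K \<subseteq> \<Omega>" using K(2) \<sigma>_in by blast
    have "Ck_on 1 \<Omega> (\<lambda>x. \<theta> (\<tau> x))" by (rule Ck_on_1_compose(1)[OF \<tau>_C1 C1c_Ck[OF assms]]) simp
    then show "Ck_on 1 \<Omega> (pull \<theta>)"
      using Ck_on_cong_open[OF opens(1), of "pull \<theta>" "\<lambda>x. \<theta> (\<tau> x)" 1] by (simp add: pull_def zero_extension_def)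
    fix x assume "x \<notin> \<sigma> ` K"
    then have "\<tau> x \<notin> K" if "x \<in> \<Omega>" using \<sigma>\<tau>[OF that] by (metis image_eqI)
    then show "pull \<theta> x = 0" using K(3) by (simp add: pull_def zero_extension_def)
  qed
qed

lemma push_C1c:
  assumes "C1c \<Omega> \<psi>"
  shows "C1c \<Omega>r (push \<psi>)"
proof -
  obtain K where K: "compact K" "K \<subseteq> \<Omega>" "\<And>y. y \<notin> K \<Longrightarrow> \<psi> y = 0" using assms unfolding C1c_def by blast
  show ?thesis
  proof (rule C1cI[OF opens(2)])
    have "continuous_on K \<tau>" using Ck_on_1_continuous[OF \<tau>_C1] K(2) continuous_on_subset by blast
    then show "compact (\<tau> ` K)" using K(1) by (rule compact_continuous_image)
    show "\<tau> ` K \<subseteq> \<Omega>r" using K(2) \<tau>_in by blast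
    have "Ck_on 1 \<Omega>r (\<lambda>x. \<psi> (\<sigma> x))" by (rule Ck_on_1_compose(1)[OF \<sigma>_C1 C1c_Ck[OF assms]]) simp
    then show "Ck_on 1 \<Omega>r (push \<psi>)"
      using Ck_on_cong_open[OF opens(2), of "push \<psi>" "\<lambda>x. \<psi> (\<sigma> x)" 1] by (simp add: push_def zero_extension_def)
    fix y assume "y \<notin> \<tau> ` K"
    then have "\<sigma> y \<notin> K" if "y \<in> \<Omega>r" using \<tau>\<sigma>[OF that] by (metis image_eqI)
    then show "push \<psi> y = 0" using K(3) by (simp add: push_def zero_extension_def)
  qed
qed

lemma pull_push:
  assumes "C1c \<Omega> \<psi>"
  shows "pull (push \<psi>) = \<psi>"
proof
  fix x
  have "\<psi> x = 0" if "x \<notin> \<Omega>" using assms that unfolding C1c_def by blast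
  then show "pull (push \<psi>) x = \<psi> x"
    by (cases "x \<in> \<Omega>") (simp_all add: pull_def push_def zero_extension_def \<tau>_in \<sigma>\<tau>)
qed

lemma J_bounds: "x \<in> \<Omega> \<Longrightarrow> \<bar>J x - 1\<bar> \<le> \<kappa>" "x \<in> \<Omega> \<Longrightarrow> J x \<ge> 1 / 2" "x \<in> \<Omega> \<Longrightarrow> J x \<le> 3 / 2"
proof -
  show 1: "x \<in> \<Omega> \<Longrightarrow> \<bar>J x - 1\<bar> \<le> \<kappa>" using density unfolding cv_density_def by blast
  then show "x \<in> \<Omega> \<Longrightarrow> J x \<ge> 1 / 2" "x \<in> \<Omega> \<Longrightarrow> J x \<le> 3 / 2" using \<kappa> by linarith+
qed

lemma J_continuous: "continuous_on \<Omega> J"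
  using density unfolding cv_density_def by blast

lemma cv_real:
  fixes h :: "real ^ 'n \<Rightarrow> real"
  assumes "continuous_on \<Omega>r h"
  shows "set_integrable lebesgue \<Omega>r h \<longleftrightarrow> set_integrable lebesgue \<Omega> (\<lambda>x. J x * h (\<tau> x))"
    and "set_integrable lebesgue \<Omega>r h \<Longrightarrow> (LINT y:\<Omega>r|lebesgue. h y) = (LINT x:\<Omega>|lebesgue. J x * h (\<tau> x))"
proof -
  have \<tau>': "(\<lambda>x. x + r x) = \<tau>" by (simp add: \<tau>_def fun_eq_iff)
  show "set_integrable lebesgue \<Omega>r h \<longleftrightarrow> set_integrable lebesgue \<Omega> (\<lambda>x. J x * h (\<tau> x))"
    "set_integrable lebesgue \<Omega>r h \<Longrightarrow> (LINT y:\<Omega>r|lebesgue. h y) = (LINT x:\<Omega>|lebesgue. J x * h (\<tau> x))"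
    using density assms unfolding cv_density_def \<tau>' \<tau>_image by blast+
qed

lemma cv_complex:
  fixes h :: "real ^ 'n \<Rightarrow> complex"
  assumes c: "continuous_on \<Omega>r h" and i: "set_integrable lebesgue \<Omega>r h"
  shows "set_integrable lebesgue \<Omega> (\<lambda>x. complex_of_real (J x) * h (\<tau> x))"
    and "(LINT y:\<Omega>r|lebesgue. h y) = (LINT x:\<Omega>|lebesgue. complex_of_real (J x) * h (\<tau> x))"
proof -
  have sRe: "set_integrable lebesgue S (\<lambda>x. Re (k x))" "set_integrable lebesgue S (\<lambda>x. Im (k x))"
    "Re (LINT x:S|lebesgue. k x) = (LINT x:S|lebesgue. Re (k x))"
    "Im (LINT x:S|lebesgue. k x) = (LINT x:S|lebesgue. Im (k x))"
    if "set_integrable lebesgue S k" for S and k :: "real ^ 'n \<Rightarrow> complex"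
    using integrable_bounded_linear[OF bounded_linear_Re that[unfolded set_integrable_def]]
      integrable_bounded_linear[OF bounded_linear_Im that[unfolded set_integrable_def]]
      integral_bounded_linear[OF bounded_linear_Re that[unfolded set_integrable_def]]
      integral_bounded_linear[OF bounded_linear_Im that[unfolded set_integrable_def]]
    by (simp_all add: set_integrable_def set_lebesgue_integral_def)
  have cR: "continuous_on \<Omega>r (\<lambda>y. Re (h y))" "continuous_on \<Omega>r (\<lambda>y. Im (h y))"
    using c by (auto intro: continuous_intros)
  have iJ: "set_integrable lebesgue \<Omega> (\<lambda>x. J x * Re (h (\<tau> x)))" "set_integrable lebesgue \<Omega> (\<lambda>x. J x * Im (h (\<tau> x)))"
    using cv_real(1)[OF cR(1)] cv_real(1)[OF cR(2)] sRe(1,2)[OF i] by simp_all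
  have "set_integrable lebesgue \<Omega> (\<lambda>x. complex_of_real (J x * Re (h (\<tau> x))) + \<i> * complex_of_real (J x * Im (h (\<tau> x))))"
  proof -
    have "set_integrable lebesgue \<Omega> (\<lambda>x. complex_of_real (k x))" if "set_integrable lebesgue \<Omega> k" for k
      using integrable_bounded_linear[OF bounded_linear_of_real that[unfolded set_integrable_def]]
      by (simp add: set_integrable_def scaleR_conv_of_real)
    then show ?thesis using iJ by (intro set_integral_add set_integrable_mult_right)
  qed
  moreover have e: "complex_of_real (J x * Re (h (\<tau> x))) + \<i> * complex_of_real (J x * Im (h (\<tau> x))) = complex_of_real (J x) * h (\<tau> x)" for x
    by (simp add: complex_eq_iff)
  ultimately show k: "set_integrable lebesgue \<Omega> (\<lambda>x. complex_of_real (J x) * h (\<tau> x))" by simp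
  show "(LINT y:\<Omega>r|lebesgue. h y) = (LINT x:\<Omega>|lebesgue. complex_of_real (J x) * h (\<tau> x))"
    unfolding complex_eq_iff sRe(3,4)[OF i] sRe(3,4)[OF k]
    using cv_real(2)[OF cR(1) sRe(1)[OF i]] cv_real(2)[OF cR(2) sRe(2)[OF i]] by simp
qed

text \<open>\<open>J\<close> lies between 1/2 and 3/2, so the squared norms on the two domains are
  comparable with factors 2 and 3/2; for the norms themselves the factor 2 covers both.\<close>

lemma pull_L2:
  fixes h :: "real ^ 'n \<Rightarrow> complex"
  assumes c: "continuous_on \<Omega>r h"
  shows "L2 (zero_extension \<Omega> (\<lambda>x. h (\<tau> x))) \<longleftrightarrow> L2 (zero_extension \<Omega>r h)"
    and "L2 (zero_extension \<Omega>r h) \<Longrightarrow> L2norm (zero_extension \<Omega> (\<lambda>x. h (\<tau> x))) \<le> 2 * L2norm (zero_extension \<Omega>r h)"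
    and "L2 (zero_extension \<Omega>r h) \<Longrightarrow> L2norm (zero_extension \<Omega>r h) \<le> 2 * L2norm (zero_extension \<Omega> (\<lambda>x. h (\<tau> x)))"
proof -
  let ?q = "\<lambda>y. (cmod (h y))\<^sup>2"
  have c\<tau>: "continuous_on \<Omega> (\<lambda>x. h (\<tau> x))"
    using \<tau>_in by (intro continuous_on_compose2[OF c Ck_on_1_continuous[OF \<tau>_C1]]) blast
  have cq: "continuous_on \<Omega>r ?q" using c by (intro continuous_intros)
  have mJ: "set_borel_measurable lebesgue \<Omega> (\<lambda>x. J x * ?q (\<tau> x))" "set_borel_measurable lebesgue \<Omega> (\<lambda>x. ?q (\<tau> x))"
  proof -
    have bm: "set_borel_measurable lebesgue \<Omega> k" if "continuous_on \<Omega> k" for k :: "real ^ 'n \<Rightarrow> real"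
    proof -
      have "(\<lambda>x. indicator \<Omega> x *\<^sub>R k x) \<in> borel_measurable lborel"
        using borel_measurable_continuous_on_indicator[of \<Omega> k] opens that by simp
      then show ?thesis unfolding set_borel_measurable_def by (rule measurable_completion)
    qed
    have "continuous_on \<Omega> (\<lambda>x. ?q (\<tau> x))" using c\<tau> by (intro continuous_intros)
    from bm[OF continuous_on_mult[OF J_continuous this]] bm[OF this]
    show "set_borel_measurable lebesgue \<Omega> (\<lambda>x. J x * ?q (\<tau> x))" "set_borel_measurable lebesgue \<Omega> (\<lambda>x. ?q (\<tau> x))" .
  qed
  have jq: "J x * ?q (\<tau> x) \<le> 3 / 2 * ?q (\<tau> x)" "?q (\<tau> x) \<le> 2 * (J x * ?q (\<tau> x))" "0 \<le> J x * ?q (\<tau> x)" if "x \<in> \<Omega>" for x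
  proof -
    show "J x * ?q (\<tau> x) \<le> 3 / 2 * ?q (\<tau> x)" using J_bounds(3)[OF that] by (rule mult_right_mono) simp
    have "1 / 2 * ?q (\<tau> x) \<le> J x * ?q (\<tau> x)" using J_bounds(2)[OF that] by (rule mult_right_mono) simp
    then show "?q (\<tau> x) \<le> 2 * (J x * ?q (\<tau> x))" by simp
    show "0 \<le> J x * ?q (\<tau> x)" using J_bounds(2)[OF that] by (intro mult_nonneg_nonneg) auto
  qed
  have iff1: "set_integrable lebesgue \<Omega> (\<lambda>x. ?q (\<tau> x)) \<longleftrightarrow> set_integrable lebesgue \<Omega> (\<lambda>x. J x * ?q (\<tau> x))"
  proof
    assume a: "set_integrable lebesgue \<Omega> (\<lambda>x. ?q (\<tau> x))"
    have "set_integrable lebesgue \<Omega> (\<lambda>x. 3 / 2 * ?q (\<tau> x))" using a by (rule set_integrable_mult_right)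
    then show "set_integrable lebesgue \<Omega> (\<lambda>x. J x * ?q (\<tau> x))"
      by (rule set_integrable_bound[OF _ mJ(1)]) (use jq in \<open>auto intro!: AE_I2\<close>)
  next
    assume a: "set_integrable lebesgue \<Omega> (\<lambda>x. J x * ?q (\<tau> x))"
    have "set_integrable lebesgue \<Omega> (\<lambda>x. 2 * (J x * ?q (\<tau> x)))" using a by (rule set_integrable_mult_right)
    then show "set_integrable lebesgue \<Omega> (\<lambda>x. ?q (\<tau> x))"
      by (rule set_integrable_bound[OF _ mJ(2)]) (use jq in \<open>auto intro!: AE_I2\<close>)
  qed
  show iff: "L2 (zero_extension \<Omega> (\<lambda>x. h (\<tau> x))) \<longleftrightarrow> L2 (zero_extension \<Omega>r h)"
    unfolding L2_zero_extension_iff[OF opens(1) c\<tau>] L2_zero_extension_iff[OF opens(2) c] iff1 cv_real(1)[OF cq] ..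
  assume L: "L2 (zero_extension \<Omega>r h)"
  then have i: "set_integrable lebesgue \<Omega>r ?q" unfolding L2_zero_extension_iff[OF opens(2) c] .
  then have iJ: "set_integrable lebesgue \<Omega> (\<lambda>x. J x * ?q (\<tau> x))" using cv_real(1)[OF cq] by simp
  then have i\<tau>: "set_integrable lebesgue \<Omega> (\<lambda>x. ?q (\<tau> x))" using iff1 by simp
  have eq: "(L2norm (zero_extension \<Omega>r h))\<^sup>2 = (LINT x:\<Omega>|lebesgue. J x * ?q (\<tau> x))"
    unfolding L2norm_zero_extension by (rule cv_real(2)[OF cq i])
  have "(L2norm (zero_extension \<Omega> (\<lambda>x. h (\<tau> x))))\<^sup>2 \<le> (LINT x:\<Omega>|lebesgue. 2 * (J x * ?q (\<tau> x)))"
    unfolding L2norm_zero_extension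
    by (rule set_integral_mono[OF i\<tau> set_integrable_mult_right[OF iJ] jq(2)])
  also have "\<dots> = 2 * (L2norm (zero_extension \<Omega>r h))\<^sup>2" unfolding eq by simp
  also have "\<dots> \<le> (2 * L2norm (zero_extension \<Omega>r h))\<^sup>2" by (simp add: power_mult_distrib)
  finally show "L2norm (zero_extension \<Omega> (\<lambda>x. h (\<tau> x))) \<le> 2 * L2norm (zero_extension \<Omega>r h)"
    by (rule power2_le_imp_le) (simp add: L2norm_nonneg)
  have "(L2norm (zero_extension \<Omega>r h))\<^sup>2 \<le> (LINT x:\<Omega>|lebesgue. 3 / 2 * ?q (\<tau> x))"
    unfolding eq by (rule set_integral_mono[OF iJ set_integrable_mult_right[OF i\<tau>] jq(1)])
  also have "\<dots> = 3 / 2 * (L2norm (zero_extension \<Omega> (\<lambda>x. h (\<tau> x))))\<^sup>2" unfolding L2norm_zero_extension by simp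
  also have "\<dots> \<le> (2 * L2norm (zero_extension \<Omega> (\<lambda>x. h (\<tau> x))))\<^sup>2" by (simp add: power_mult_distrib)
  finally show "L2norm (zero_extension \<Omega>r h) \<le> 2 * L2norm (zero_extension \<Omega> (\<lambda>x. h (\<tau> x)))"
    by (rule power2_le_imp_le) (simp add: L2norm_nonneg)
qed

text \<open>The l^1 length of the gradient: it dominates each partial derivative and is a plain sum,
  without square roots.\<close>

definition "grad1 \<phi> x = (\<Sum>i\<in>(Basis :: (real ^ 'n) set). cmod (partial_deriv i \<phi> x))"

lemma grad1_nonneg: "grad1 \<phi> x \<ge> 0"
  by (simp add: grad1_def sum_nonneg)

lemma grad1_ge: "i \<in> Basis \<Longrightarrow> cmod (partial_deriv i \<phi> x) \<le> grad1 \<phi> x"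
  unfolding grad1_def by (rule member_le_sum) auto

text \<open>By the chain rule the difference is the derivative of \<open>\<theta>\<close> applied to
  a partial derivative of \<open>r\<close>, whose components are at most
  \<open>\<delta>\<close>.\<close>

lemma pull_partial_near:
  assumes \<theta>: "C1c \<Omega>r \<theta>" and x: "x \<in> \<Omega>" and i: "i \<in> Basis"
  shows "cmod (partial_deriv i (pull \<theta>) x - partial_deriv i \<theta> (\<tau> x)) \<le> \<delta> * grad1 \<theta> (\<tau> x)"
proof -
  have \<theta>d: "\<theta> differentiable (at (\<tau> x))" by (rule C1c_differentiable[OF \<theta>])
  have lin: "linear (frechet_derivative \<theta> (at (\<tau> x)))" using \<theta>d by (rule linear_frechet_derivative)
  have "partial_deriv i (pull \<theta>) x = partial_deriv i (\<lambda>x. \<theta> (\<tau> x)) x"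
    by (rule partial_deriv_cong_open[OF opens(1) x]) (simp add: pull_def zero_extension_def)
  also have "\<dots> = frechet_derivative \<theta> (at (\<tau> x)) (i + partial_deriv i r x)"
    using Ck_on_1_compose(2)[OF \<tau>_C1 C1c_Ck[OF \<theta>] _ x, of i]
    by (simp add: partial_deriv_def \<tau>_deriv[OF x])
  finally have "partial_deriv i (pull \<theta>) x - partial_deriv i \<theta> (\<tau> x) = frechet_derivative \<theta> (at (\<tau> x)) (partial_deriv i r x)"
    by (simp add: linear_add[OF lin] partial_deriv_def)
  also have "\<dots> = (\<Sum>j\<in>Basis. (partial_deriv i r x \<bullet> j) *\<^sub>R partial_deriv j \<theta> (\<tau> x))"
    by (rule frechet_derivative_sum_partial[OF \<theta>d])
  also have "cmod \<dots> \<le> (\<Sum>j\<in>Basis. cmod ((partial_deriv i r x \<bullet> j) *\<^sub>R partial_deriv j \<theta> (\<tau> x)))" by (rule norm_sum)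
  also have "\<dots> \<le> (\<Sum>j\<in>(Basis :: (real ^ 'n) set). \<delta> * cmod (partial_deriv j \<theta> (\<tau> x)))"
    unfolding norm_scaleR
  proof (intro sum_mono mult_right_mono)
    fix j :: "real ^ 'n" assume "j \<in> Basis"
    then have "norm (partial_deriv i r x \<bullet> j) \<le> norm (partial_deriv i r x)" by (rule Basis_le_norm[unfolded real_norm_def[symmetric]])
    then show "\<bar>partial_deriv i r x \<bullet> j\<bar> \<le> \<delta>" using dr_small[OF x i] by simp
  qed simp
  also have "\<dots> = \<delta> * grad1 \<theta> (\<tau> x)" by (simp add: grad1_def sum_distrib_left)
  finally show ?thesis .
qed

text \<open>Summing the preceding estimate over the coordinates brings back the left-hand side with
  the factor dimension times \<open>\<delta>\<close>, at most one half, and it is absorbed.\<close>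

lemma grad1_pull:
  assumes \<theta>: "C1c \<Omega>r \<theta>" and x: "x \<in> \<Omega>"
  shows "grad1 \<theta> (\<tau> x) \<le> 2 * grad1 (pull \<theta>) x"
proof -
  have "grad1 \<theta> (\<tau> x) \<le> (\<Sum>i\<in>(Basis :: (real ^ 'n) set). cmod (partial_deriv i (pull \<theta>) x) + \<delta> * grad1 \<theta> (\<tau> x))"
    unfolding grad1_def[of \<theta> "\<tau> x"]
  proof (rule sum_mono)
    fix i :: "real ^ 'n" assume "i \<in> Basis"
    from pull_partial_near[OF \<theta> x this]
    show "cmod (partial_deriv i \<theta> (\<tau> x)) \<le> cmod (partial_deriv i (pull \<theta>) x) + \<delta> * (\<Sum>i\<in>Basis. cmod (partial_deriv i \<theta> (\<tau> x)))"
      unfolding grad1_def using norm_triangle_ineq2[of "partial_deriv i \<theta> (\<tau> x)" "partial_deriv i (pull \<theta>) x"]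
      by (simp add: norm_minus_commute)
  qed
  also have "\<dots> = grad1 (pull \<theta>) x + (real DIM(real ^ 'n) * \<delta>) * grad1 \<theta> (\<tau> x)"
    by (simp add: sum.distrib grad1_def[of "pull \<theta>"])
  also have "\<dots> \<le> grad1 (pull \<theta>) x + 1 / 2 * grad1 \<theta> (\<tau> x)"
    using \<delta>(3) grad1_nonneg by (intro add_left_mono mult_right_mono) auto
  finally show ?thesis by linarith
qed

lemma grad1_L2:
  assumes \<psi>: "C1c S \<psi>"
  shows "L2 (\<lambda>x. complex_of_real (grad1 \<psi> x))" "L2norm (\<lambda>x. complex_of_real (grad1 \<psi> x)) \<le> H1norm \<psi>"
proof -
  have L: "L2 (\<lambda>x. complex_of_real (cmod (partial_deriv j \<psi> x)))" "L2norm (\<lambda>x. complex_of_real (cmod (partial_deriv j \<psi> x))) = L2norm (partial_deriv j \<psi>)" for j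
    using C1c_L2(2)[OF \<psi>, of j] by (auto simp: L2_def L2norm_def)
  have fin: "L2 (\<lambda>x. \<Sum>j\<in>F. complex_of_real (cmod (partial_deriv j \<psi> x))) \<and>
    L2norm (\<lambda>x. \<Sum>j\<in>F. complex_of_real (cmod (partial_deriv j \<psi> x))) \<le> (\<Sum>j\<in>F. L2norm (partial_deriv j \<psi>))"
    if "finite F" for F :: "(real ^ 'n) set"
    using that
  proof (induction F)
    case empty
    show ?case by (simp add: L2_def L2norm_def)
  next
    case (insert j F)
    then show ?case using L2_add[OF L(1)[of j]] L2norm_triangle[OF L(1)[of j]] L(2)[of j] by fastforce
  qed
  show "L2 (\<lambda>x. complex_of_real (grad1 \<psi> x))"
    unfolding grad1_def of_real_sum using fin[OF finite_Basis] by blast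
  have "L2norm (\<lambda>x. complex_of_real (grad1 \<psi> x)) \<le> (\<Sum>j\<in>(Basis :: (real ^ 'n) set). L2norm (partial_deriv j \<psi>))"
    unfolding grad1_def of_real_sum using fin[OF finite_Basis] by blast
  then show "L2norm (\<lambda>x. complex_of_real (grad1 \<psi> x)) \<le> H1norm \<psi>"
    using L2norm_nonneg[of \<psi>] by (simp add: H1norm_def)
qed

text \<open>\<open>pull\<close> inverts \<open>push\<close>, so the estimates for
  \<open>pull\<close>, applied to \<open>push \<psi>\<close>, bound the latter by
  \<open>\<psi>\<close>. The factor 4 for each coordinate is 2 from the change of variables times 2
  from the gradients.\<close>

lemma push_H1norm:
  assumes \<psi>: "C1c \<Omega> \<psi>"
  shows "H1norm (push \<psi>) \<le> (4 * real DIM(real ^ 'n) + 2) * H1norm \<psi>"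
proof -
  have \<psi>r: "C1c \<Omega>r (push \<psi>)" by (rule push_C1c[OF \<psi>])
  have zr: "zero_extension \<Omega>r k = k" if "\<And>y. y \<notin> \<Omega>r \<Longrightarrow> k y = 0" for k :: "real ^ 'n \<Rightarrow> complex"
    using that by (auto simp: zero_extension_def fun_eq_iff)
  have push0: "push \<psi> y = 0" if "y \<notin> \<Omega>r" for y using that by (simp add: push_def zero_extension_def)
  have ppush0: "partial_deriv i (push \<psi>) y = 0" if "y \<notin> \<Omega>r" for i y
    by (rule partial_deriv_C1c_outside[OF \<psi>r that])
  have n0: "L2norm (push \<psi>) \<le> 2 * L2norm \<psi>"
  proof -
    have "L2norm (zero_extension \<Omega>r (push \<psi>)) \<le> 2 * L2norm (zero_extension \<Omega> (\<lambda>x. push \<psi> (\<tau> x)))"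
      by (rule pull_L2(3)[OF C1c_continuous[OF \<psi>r]]) (simp add: zr[OF push0] C1c_L2(1)[OF \<psi>r])
    then show ?thesis using pull_push[OF \<psi>] by (simp add: zr[OF push0] pull_def)
  qed
  have n1: "L2norm (partial_deriv i (push \<psi>)) \<le> 4 * H1norm \<psi>" if i: "i \<in> Basis" for i
  proof -
    let ?k = "partial_deriv i (push \<psi>)"
    have ck: "continuous_on \<Omega>r ?k" by (rule C1c_continuous_partial[OF \<psi>r])
    have zk: "zero_extension \<Omega>r ?k = ?k" by (rule zr) (rule ppush0)
    have Lk: "L2 (zero_extension \<Omega>r ?k)" unfolding zk by (rule C1c_L2(2)[OF \<psi>r])
    have "L2norm ?k \<le> 2 * L2norm (zero_extension \<Omega> (\<lambda>x. ?k (\<tau> x)))"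
      using pull_L2(3)[OF ck Lk] unfolding zk .
    also have "L2norm (zero_extension \<Omega> (\<lambda>x. ?k (\<tau> x))) \<le> 2 * L2norm (\<lambda>x. complex_of_real (grad1 \<psi> x))"
    proof (rule L2norm_mono)
      show "L2 (\<lambda>x. complex_of_real (grad1 \<psi> x))" by (rule grad1_L2(1)[OF \<psi>])
      show "zero_extension \<Omega> (\<lambda>x. ?k (\<tau> x)) \<in> borel_measurable lebesgue"
        using pull_L2(1)[OF ck] Lk by (simp add: L2_def)
      show "cmod (zero_extension \<Omega> (\<lambda>x. ?k (\<tau> x)) x) \<le> 2 * cmod (complex_of_real (grad1 \<psi> x))" for x
      proof (cases "x \<in> \<Omega>")
        case True
        have "cmod (?k (\<tau> x)) \<le> grad1 (push \<psi>) (\<tau> x)" by (rule grad1_ge[OF i])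
        also have "\<dots> \<le> 2 * grad1 \<psi> x" using grad1_pull[OF \<psi>r True] by (simp add: pull_push[OF \<psi>])
        finally show ?thesis using True grad1_nonneg by (simp add: zero_extension_def)
      qed (simp add: zero_extension_def)
    qed simp
    also have "L2norm (\<lambda>x. complex_of_real (grad1 \<psi> x)) \<le> H1norm \<psi>" by (rule grad1_L2(2)[OF \<psi>])
    finally show ?thesis by simp
  qed
  have "H1norm (push \<psi>) \<le> (\<Sum>i\<in>(Basis :: (real ^ 'n) set). 4 * H1norm \<psi>) + 2 * H1norm \<psi>"
    unfolding H1norm_def[of "push \<psi>"]
  proof (intro add_mono sum_mono n1)
    show "L2norm (push \<psi>) \<le> 2 * H1norm \<psi>" using n0 H1norm_ge(2)[of \<psi>] by linarith
  qed
  also have "\<dots> = (4 * real DIM(real ^ 'n) + 2) * H1norm \<psi>" by (simp add: algebra_simps)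
  finally show ?thesis .
qed

end

lemma norm_add_le3: "norm (a + b + c) \<le> norm a + norm b + norm (c :: 'a::real_normed_vector)"
  using norm_triangle_ineq[of "a + b" c] norm_triangle_ineq[of a b] by linarith

lemma norm_diff_le3: "norm (a - b - c) \<le> norm a + norm b + norm (c :: 'a::real_normed_vector)"
  using norm_triangle_ineq4[of "a - b" c] norm_triangle_ineq4[of a b] by linarith

context near_identity
begin

text \<open>The form on \<open>\<Omega>r\<close> is transported to \<open>\<Omega>\<close> and the
  integrands are compared pointwise. They differ through the derivative of \<open>r\<close> and
  through 1 - J, both of order \<open>\<kappa>\<close>, and through the displacement of the data,
  which is kept as a separate norm.\<close>

lemma weak_form_pull:
  fixes f :: "real ^ 'n \<Rightarrow> complex"
  assumes f: "continuous_on \<Omega> f" "continuous_on \<Omega>r f" "L2 (zero_extension \<Omega> f)" "L2 (zero_extension \<Omega>r f)"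
    and \<theta>: "C1c \<Omega>r \<theta>" and \<psi>: "C1c \<Omega> \<psi>"
  shows "cmod (weak_form (pull \<theta>) (\<lambda>x. b\<^sup>2 * pull \<theta> x - zero_extension \<Omega> f x) \<psi>
            - weak_form \<theta> (\<lambda>x. b\<^sup>2 * \<theta> x - zero_extension \<Omega>r f x) (push \<psi>))
      \<le> ((10 * real DIM(real ^ 'n) + (cmod b)\<^sup>2) * \<kappa> * H1norm (pull \<theta>)
          + L2norm (zero_extension \<Omega> (\<lambda>x. of_real (J x) * f (\<tau> x) - f x))) * H1norm \<psi>"
proof -
  let ?P = "pull \<theta>" and ?q = "push \<psi>"
  have q: "C1c \<Omega>r ?q" by (rule push_C1c[OF \<psi>])
  have P: "C1c \<Omega> ?P" by (rule pull_C1c[OF \<theta>])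
  define I where "I y = (\<Sum>i\<in>Basis. partial_deriv i \<theta> y * partial_deriv i ?q y) - (b\<^sup>2 * \<theta> y - f y) * ?q y" for y
  define I' where "I' x = (\<Sum>i\<in>Basis. partial_deriv i ?P x * partial_deriv i \<psi> x) - (b\<^sup>2 * ?P x - f x) * \<psi> x" for x
  have q0: "?q y = 0" "partial_deriv i ?q y = 0" if "y \<notin> \<Omega>r" for y i
    using that partial_deriv_C1c_outside[OF q that] by (simp_all add: push_def zero_extension_def)
  have \<psi>0: "\<psi> x = 0" "partial_deriv i \<psi> x = 0" if "x \<notin> \<Omega>" for x i
    using \<psi> that partial_deriv_C1c_outside[OF \<psi> that] unfolding C1c_def by blast+
  have I0: "I y = 0" if "y \<notin> \<Omega>r" for y using q0[OF that] by (simp add: I_def)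
  have I'0: "I' x = 0" if "x \<notin> \<Omega>" for x using \<psi>0[OF that] by (simp add: I'_def)
  have wI: "weak_form \<theta> (\<lambda>x. b\<^sup>2 * \<theta> x - zero_extension \<Omega>r f x) ?q = integral\<^sup>L lebesgue I"
    unfolding weak_form_def
    by (rule arg_cong[where f="integral\<^sup>L lebesgue"]) (use q0 in \<open>auto simp: I_def zero_extension_def fun_eq_iff\<close>)
  have wI': "weak_form ?P (\<lambda>x. b\<^sup>2 * ?P x - zero_extension \<Omega> f x) \<psi> = integral\<^sup>L lebesgue I'"
    unfolding weak_form_def
    by (rule arg_cong[where f="integral\<^sup>L lebesgue"]) (use \<psi>0 in \<open>auto simp: I'_def zero_extension_def fun_eq_iff\<close>)
  have intI: "integrable lebesgue I" unfolding I_def[abs_def]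
    by (rule weak_form_integrable[OF Ck_on_subset[OF C1c_Ck[OF \<theta>]] _ q])
       (auto intro!: continuous_intros C1c_continuous[OF \<theta>] f(2))
  have intI': "integrable lebesgue I'" unfolding I'_def[abs_def]
    by (rule weak_form_integrable[OF Ck_on_subset[OF C1c_Ck[OF P]] _ \<psi>])
       (auto intro!: continuous_intros C1c_continuous[OF P] f(1))
  have indI: "(\<lambda>y. indicator \<Omega>r y *\<^sub>R I y) = I" using I0 by (auto simp: indicator_def fun_eq_iff)
  have sI: "set_integrable lebesgue \<Omega>r I" unfolding set_integrable_def indI by (rule intI)
  have cI: "continuous_on \<Omega>r I" unfolding I_def[abs_def]
    by (intro continuous_intros C1c_continuous[OF \<theta>] C1c_continuous[OF q] C1c_continuous_partial[OF \<theta>]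
        C1c_continuous_partial[OF q] f(2))
  define IJ where "IJ = zero_extension \<Omega> (\<lambda>x. complex_of_real (J x) * I (\<tau> x))"
  have IJ_ind: "(\<lambda>x. indicator \<Omega> x *\<^sub>R (complex_of_real (J x) * I (\<tau> x))) = IJ"
    by (auto simp: IJ_def zero_extension_def indicator_def fun_eq_iff)
  have intIJ: "integrable lebesgue IJ"
    using cv_complex(1)[OF cI sI] unfolding set_integrable_def IJ_ind .
  have IJ: "integral\<^sup>L lebesgue I = integral\<^sup>L lebesgue IJ"
    using cv_complex(2)[OF cI sI] unfolding set_lebesgue_integral_def IJ_ind indI .
  define k where "k x = of_real (J x) * f (\<tau> x) - f x" for x
  define \<rho> where "\<rho> = zero_extension \<Omega> k"
  have \<tau>c: "continuous_on \<Omega> \<tau>" by (rule Ck_on_1_continuous[OF \<tau>_C1])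
  have f\<tau>: "continuous_on \<Omega> (\<lambda>x. f (\<tau> x))" using \<tau>_in by (intro continuous_on_compose2[OF f(2) \<tau>c]) blast
  have kc: "continuous_on \<Omega> k" unfolding k_def[abs_def] by (intro continuous_intros J_continuous f\<tau> f(1))
  have L2\<rho>: "L2 \<rho>"
  proof -
    have "L2 (zero_extension \<Omega> (\<lambda>x. f (\<tau> x)))" using pull_L2(1)[OF f(2)] f(4) by simp
    then have a: "L2 (zero_extension \<Omega> (\<lambda>x. of_real (J x) * f (\<tau> x)))"
    proof (rule L2_mono[where c="3/2"])
      show "zero_extension \<Omega> (\<lambda>x. of_real (J x) * f (\<tau> x)) \<in> borel_measurable lebesgue"
        by (rule zero_extension_measurable[OF opens(1)]) (intro continuous_intros J_continuous f\<tau>)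
      show "cmod (zero_extension \<Omega> (\<lambda>x. of_real (J x) * f (\<tau> x)) x) \<le> 3/2 * cmod (zero_extension \<Omega> (\<lambda>x. f (\<tau> x)) x)" for x
      proof (cases "x \<in> \<Omega>")
        case True
        have "\<bar>J x\<bar> * cmod (f (\<tau> x)) \<le> 3/2 * cmod (f (\<tau> x))"
          using J_bounds(2,3)[OF True] by (intro mult_right_mono) auto
        then show ?thesis using True by (simp add: zero_extension_def norm_mult)
      qed (simp add: zero_extension_def)
    qed
    have "\<rho> = (\<lambda>x. zero_extension \<Omega> (\<lambda>x. of_real (J x) * f (\<tau> x)) x - zero_extension \<Omega> f x)"
      by (auto simp: \<rho>_def k_def zero_extension_def fun_eq_iff)
    then show ?thesis using L2_diff[OF a f(3)] by simp
  qed
  define n where "n = real DIM(real ^ 'n)"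
  let ?g = "\<lambda>\<phi> x. grad1 \<phi> x"
  define Bd where "Bd x = 10 * n * \<kappa> * (?g ?P x * ?g \<psi> x) + (cmod b)\<^sup>2 * \<kappa> * (cmod (?P x) * cmod (\<psi> x)) + cmod (\<rho> x) * cmod (\<psi> x)" for x
  have \<kappa>0: "0 \<le> \<kappa>" using \<delta>(1,2) by linarith
  have gP: "L2 (\<lambda>x. complex_of_real (?g ?P x))" "L2 (\<lambda>x. complex_of_real (?g \<psi> x))"
    by (rule grad1_L2(1)[OF P], rule grad1_L2(1)[OF \<psi>])
  have gg: "(\<lambda>x. cmod (complex_of_real (?g ?P x)) * cmod (complex_of_real (?g \<psi> x))) = (\<lambda>x. ?g ?P x * ?g \<psi> x)"
    using grad1_nonneg by (simp add: fun_eq_iff)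
  have i1: "integrable lebesgue (\<lambda>x. ?g ?P x * ?g \<psi> x)" using L2_integrable_cmod_mult[OF gP] unfolding gg .
  have i2: "integrable lebesgue (\<lambda>x. cmod (?P x) * cmod (\<psi> x))"
    by (rule L2_integrable_cmod_mult[OF C1c_L2(1)[OF P] C1c_L2(1)[OF \<psi>]])
  have i3: "integrable lebesgue (\<lambda>x. cmod (\<rho> x) * cmod (\<psi> x))"
    by (rule L2_integrable_cmod_mult[OF L2\<rho> C1c_L2(1)[OF \<psi>]])
  have intBd: "integrable lebesgue Bd" unfolding Bd_def[abs_def] using i1 i2 i3 by simp
  have pw: "cmod (I' x - IJ x) \<le> Bd x" for x
  proof (cases "x \<in> \<Omega>")
    case False
    then show ?thesis using I'0 grad1_nonneg \<kappa>0 by (simp add: IJ_def zero_extension_def Bd_def n_def)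
  next
    case True
    have qx: "?q (\<tau> x) = \<psi> x" using True by (simp add: push_def zero_extension_def \<tau>_in \<sigma>\<tau>)
    have Px: "?P x = \<theta> (\<tau> x)" using True by (simp add: pull_def zero_extension_def)
    let ?p = "\<lambda>i. partial_deriv i \<theta> (\<tau> x)" and ?qq = "\<lambda>i. partial_deriv i ?q (\<tau> x)"
    let ?PP = "\<lambda>i. partial_deriv i ?P x" and ?QQ = "\<lambda>i. partial_deriv i \<psi> x"
    have g1: "grad1 \<theta> (\<tau> x) \<le> 2 * ?g ?P x" by (rule grad1_pull[OF \<theta> True])
    have g2: "grad1 ?q (\<tau> x) \<le> 2 * ?g \<psi> x" using grad1_pull[OF q True] by (simp add: pull_push[OF \<psi>])
    let ?G = "?g ?P x * ?g \<psi> x"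
    have tm: "cmod (?PP i * ?QQ i - of_real (J x) * (?p i * ?qq i)) \<le> 10 * \<kappa> * ?G" if i: "i \<in> Basis" for i
    proof -
      have a1: "cmod (?p i) \<le> 2 * ?g ?P x" using grad1_ge[OF i, of \<theta> "\<tau> x"] g1 by linarith
      have a2: "cmod (?qq i) \<le> 2 * ?g \<psi> x" using grad1_ge[OF i, of ?q "\<tau> x"] g2 by linarith
      have "cmod (?PP i - ?p i) \<le> \<delta> * grad1 \<theta> (\<tau> x)" by (rule pull_partial_near[OF \<theta> True i])
      also have "\<dots> \<le> \<kappa> * (2 * ?g ?P x)" using g1 \<delta> grad1_nonneg by (intro mult_mono) auto
      finally have a3: "cmod (?PP i - ?p i) \<le> \<kappa> * (2 * ?g ?P x)" .
      have "cmod (?QQ i - ?qq i) \<le> \<delta> * grad1 ?q (\<tau> x)"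
        using pull_partial_near[OF q True i] by (simp add: pull_push[OF \<psi>])
      also have "\<dots> \<le> \<kappa> * (2 * ?g \<psi> x)" using g2 \<delta> grad1_nonneg by (intro mult_mono) auto
      finally have a4: "cmod (?QQ i - ?qq i) \<le> \<kappa> * (2 * ?g \<psi> x)" .
      have a5: "cmod (of_real (1 - J x)) \<le> \<kappa>"
        unfolding norm_of_real using J_bounds(1)[OF True] by (simp add: abs_minus_commute)
      have tri: "cmod (P * Q - z * (p * q)) \<le> cmod (1 - z) * (cmod p * cmod q) + cmod (P - p) * cmod q + cmod P * cmod (Q - q)"
        for P Q z p q :: complex
      proof -
        have "P * Q - z * (p * q) = (1 - z) * (p * q) + (P - p) * q + P * (Q - q)" by (simp add: algebra_simps)
        then show ?thesis using norm_add_le3[of "(1 - z) * (p * q)" "(P - p) * q" "P * (Q - q)"]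
          by (simp only: norm_mult)
      qed
      have "cmod (?PP i * ?QQ i - of_real (J x) * (?p i * ?qq i)) \<le> cmod (of_real (1 - J x)) * (cmod (?p i) * cmod (?qq i)) + cmod (?PP i - ?p i) * cmod (?qq i) + cmod (?PP i) * cmod (?QQ i - ?qq i)"
        using tri[of "?PP i" "?QQ i" "of_real (J x)" "?p i" "?qq i"] by (simp only: of_real_diff of_real_1)
      \<comment> \<open>The three terms contribute 4, 4 and 2, which is the origin of the factor
        10.\<close>
      also have "\<dots> \<le> \<kappa> * ((2 * ?g ?P x) * (2 * ?g \<psi> x)) + (\<kappa> * (2 * ?g ?P x)) * (2 * ?g \<psi> x) + ?g ?P x * (\<kappa> * (2 * ?g \<psi> x))"
      proof (intro add_mono)
        have gn: "0 \<le> ?g ?P x" "0 \<le> ?g \<psi> x" by (rule grad1_nonneg)+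
        have t0: "cmod (?p i) * cmod (?qq i) \<le> (2 * ?g ?P x) * (2 * ?g \<psi> x)"
          by (rule mult_mono[OF a1 a2]) (use gn in simp_all)
        show "cmod (of_real (1 - J x)) * (cmod (?p i) * cmod (?qq i)) \<le> \<kappa> * ((2 * ?g ?P x) * (2 * ?g \<psi> x))"
          by (rule mult_mono[OF a5 t0]) (use \<kappa>0 in simp_all)
        show "cmod (?PP i - ?p i) * cmod (?qq i) \<le> (\<kappa> * (2 * ?g ?P x)) * (2 * ?g \<psi> x)"
          by (rule mult_mono[OF a3 a2]) (use \<kappa>0 gn in simp_all)
        show "cmod (?PP i) * cmod (?QQ i - ?qq i) \<le> ?g ?P x * (\<kappa> * (2 * ?g \<psi> x))"
          by (rule mult_mono[OF grad1_ge[OF i] a4]) (use gn in simp_all)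
      qed
      also have "\<dots> = 10 * \<kappa> * ?G" by (simp add: algebra_simps)
      finally show ?thesis .
    qed
    have split: "I' x - IJ x = (\<Sum>i\<in>Basis. ?PP i * ?QQ i - of_real (J x) * (?p i * ?qq i))
        - b\<^sup>2 * (of_real (1 - J x) * (?P x * \<psi> x)) - k x * \<psi> x"
    proof -
      have IJx: "IJ x = of_real (J x) * I (\<tau> x)" using True by (simp add: IJ_def zero_extension_def)
      show ?thesis unfolding IJx I'_def I_def k_def qx Px sum_subtractf sum_distrib_left[symmetric]
        by (simp add: algebra_simps)
    qed
    have "cmod (I' x - IJ x) \<le> cmod (\<Sum>i\<in>Basis. ?PP i * ?QQ i - of_real (J x) * (?p i * ?qq i))
        + cmod (b\<^sup>2 * (of_real (1 - J x) * (?P x * \<psi> x))) + cmod (k x * \<psi> x)"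
      unfolding split by (rule norm_diff_le3)
    also have "\<dots> \<le> (\<Sum>i\<in>(Basis :: (real ^ 'n) set). 10 * \<kappa> * ?G) + (cmod b)\<^sup>2 * (\<kappa> * (cmod (?P x) * cmod (\<psi> x))) + cmod (\<rho> x) * cmod (\<psi> x)"
    proof (intro add_mono)
      show "cmod (\<Sum>i\<in>Basis. ?PP i * ?QQ i - of_real (J x) * (?p i * ?qq i)) \<le> (\<Sum>i\<in>(Basis :: (real ^ 'n) set). 10 * \<kappa> * ?G)"
        by (rule order_trans[OF norm_sum sum_mono[OF tm]])
      have "\<bar>1 - J x\<bar> \<le> \<kappa>" using J_bounds(1)[OF True] by (simp add: abs_minus_commute)
      then show "cmod (b\<^sup>2 * (of_real (1 - J x) * (?P x * \<psi> x))) \<le> (cmod b)\<^sup>2 * (\<kappa> * (cmod (?P x) * cmod (\<psi> x)))"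
        unfolding norm_mult norm_power norm_of_real by (intro mult_left_mono mult_right_mono) auto
      show "cmod (k x * \<psi> x) \<le> cmod (\<rho> x) * cmod (\<psi> x)" using True by (simp add: \<rho>_def zero_extension_def norm_mult)
    qed
    also have "\<dots> = Bd x" by (simp add: Bd_def n_def)
    finally show ?thesis .
  qed
  have "weak_form ?P (\<lambda>x. b\<^sup>2 * ?P x - zero_extension \<Omega> f x) \<psi>
            - weak_form \<theta> (\<lambda>x. b\<^sup>2 * \<theta> x - zero_extension \<Omega>r f x) ?q = (LINT x|lebesgue. I' x - IJ x)"
    unfolding wI wI' IJ by (rule Bochner_Integration.integral_diff[symmetric, OF intI' intIJ])
  also have "cmod \<dots> \<le> integral\<^sup>L lebesgue Bd"
    by (rule Bochner_Integration.integral_norm_bound_integral[OF Bochner_Integration.integrable_diff[OF intI' intIJ] intBd pw])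
  also have "\<dots> = 10 * n * \<kappa> * (LINT x|lebesgue. ?g ?P x * ?g \<psi> x)
      + (cmod b)\<^sup>2 * \<kappa> * (LINT x|lebesgue. cmod (?P x) * cmod (\<psi> x)) + (LINT x|lebesgue. cmod (\<rho> x) * cmod (\<psi> x))"
    unfolding Bd_def[abs_def] using i1 i2 i3 by simp
  also have "\<dots> \<le> 10 * n * \<kappa> * (H1norm ?P * H1norm \<psi>) + (cmod b)\<^sup>2 * \<kappa> * (H1norm ?P * H1norm \<psi>) + L2norm \<rho> * H1norm \<psi>"
  proof (intro add_mono mult_left_mono)
    have "(LINT x|lebesgue. ?g ?P x * ?g \<psi> x) \<le> L2norm (\<lambda>x. complex_of_real (?g ?P x)) * L2norm (\<lambda>x. complex_of_real (?g \<psi> x))"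
      using L2_Cauchy_Schwarz_norm[OF gP] unfolding gg .
    also have "\<dots> \<le> H1norm ?P * H1norm \<psi>"
      by (intro mult_mono grad1_L2(2)[OF P] grad1_L2(2)[OF \<psi>] H1norm_ge(1) L2norm_nonneg)
    finally show "(LINT x|lebesgue. ?g ?P x * ?g \<psi> x) \<le> H1norm ?P * H1norm \<psi>" .
    have "(LINT x|lebesgue. cmod (?P x) * cmod (\<psi> x)) \<le> L2norm ?P * L2norm \<psi>"
      by (rule L2_Cauchy_Schwarz_norm[OF C1c_L2(1)[OF P] C1c_L2(1)[OF \<psi>]])
    also have "\<dots> \<le> H1norm ?P * H1norm \<psi>" by (intro mult_mono H1norm_ge L2norm_nonneg)
    finally show "(LINT x|lebesgue. cmod (?P x) * cmod (\<psi> x)) \<le> H1norm ?P * H1norm \<psi>" .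
    have "(LINT x|lebesgue. cmod (\<rho> x) * cmod (\<psi> x)) \<le> L2norm \<rho> * L2norm \<psi>"
      by (rule L2_Cauchy_Schwarz_norm[OF L2\<rho> C1c_L2(1)[OF \<psi>]])
    also have "\<dots> \<le> L2norm \<rho> * H1norm \<psi>" by (intro mult_left_mono H1norm_ge L2norm_nonneg)
    finally show "(LINT x|lebesgue. cmod (\<rho> x) * cmod (\<psi> x)) \<le> L2norm \<rho> * H1norm \<psi>" .
  qed (use \<kappa>0 in \<open>simp_all add: n_def\<close>)
  also have "\<dots> = ((10 * n + (cmod b)\<^sup>2) * \<kappa> * H1norm ?P + L2norm \<rho>) * H1norm \<psi>" by (simp add: algebra_simps)
  finally show ?thesis unfolding \<rho>_def k_def[abs_def] n_def .
qed

text \<open>A fixed point of x \<mapsto> y - r x, supplied by Brouwer on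
  \<open>cball y \<delta>\<close>, is a preimage of \<open>y\<close>. Points deep inside
  \<open>\<Omega>\<close> thus belong to \<open>\<Omega>r\<close> as well.\<close>

lemma cball_in_image:
  assumes "cball y \<delta> \<subseteq> \<Omega>"
  shows "y \<in> \<Omega>r"
proof -
  have "continuous_on (cball y \<delta>) (\<lambda>x. y - r x)"
    using continuous_on_subset[OF Ck_on_1_continuous[OF C1r] assms] by (intro continuous_intros)
  moreover have "(\<lambda>x. y - r x) \<in> cball y \<delta> \<rightarrow> cball y \<delta>"
    using r_small assms by (auto simp: dist_norm)
  moreover have "cball y \<delta> \<noteq> {}" using \<delta>(1) by simp
  ultimately obtain x where x: "x \<in> cball y \<delta>" "y - r x = x"
    using brouwer[OF compact_cball convex_cball, of y \<delta> "\<lambda>x. y - r x"] by blast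
  then have "y = \<tau> x" by (metis \<tau>_def add.commute diff_add_cancel)
  then show ?thesis using \<tau>_in x(1) assms by blast
qed

end

section \<open>Coercivity\<close>

text \<open>With x = A/B \<ge> 0 the difference x - b^2 factors as (sqrt x - b)(sqrt x + b), and
  both factors have imaginary part of modulus |Im b|.\<close>

lemma norm_diff_square_ge:
  assumes "A \<ge> 0" "B \<ge> 0"
  shows "(Im b)\<^sup>2 * B \<le> cmod (of_real A - b\<^sup>2 * of_real B)"
proof (cases "B = 0")
  case False
  define x where "x = A / B"
  have x: "x \<ge> 0" "A = x * B" using assms False by (auto simp: x_def)
  have "(Im b)\<^sup>2 \<le> cmod (of_real (sqrt x) - b) * cmod (of_real (sqrt x) + b)"
  proof -
    have "\<bar>Im b\<bar> \<le> cmod (of_real (sqrt x) - b)" "\<bar>Im b\<bar> \<le> cmod (of_real (sqrt x) + b)"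
      using abs_Im_le_cmod[of "of_real (sqrt x) - b"] abs_Im_le_cmod[of "of_real (sqrt x) + b"] by simp_all
    then have "\<bar>Im b\<bar> * \<bar>Im b\<bar> \<le> cmod (of_real (sqrt x) - b) * cmod (of_real (sqrt x) + b)"
      by (intro mult_mono) auto
    then show ?thesis by (simp add: power2_eq_square)
  qed
  also have "\<dots> = cmod ((of_real (sqrt x))\<^sup>2 - b\<^sup>2)"
    unfolding norm_mult[symmetric] by (simp add: power2_eq_square algebra_simps)
  also have "(complex_of_real (sqrt x))\<^sup>2 = of_real x" using x(1) by (simp flip: of_real_power)
  finally have "(Im b)\<^sup>2 * B \<le> cmod (of_real x - b\<^sup>2) * B" using assms(2) by (rule mult_right_mono)
  also have "\<dots> = cmod ((of_real x - b\<^sup>2) * of_real B)" using assms(2) by (simp add: norm_mult)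
  also have "(of_real x - b\<^sup>2) * of_real B = of_real A - b\<^sup>2 * of_real B" by (simp add: x(2) algebra_simps)
  finally show ?thesis .
qed simp

text \<open>Testing with the conjugate of \<open>E\<close> gives A - b^2 B, where A and B are the
  squared norms of the gradient and of \<open>E\<close>. Its modulus controls B first and then A
  \<le> |A - b^2 B| + |b|^2 B. The constant precedes \<open>S\<close>, so it serves every
  domain.\<close>

lemma coercivity:
  fixes b :: complex
  assumes "Im b > 0"
  obtains c where "c > 0"
    "\<And>(S :: 'a::euclidean_space set) E K. C1c S E \<Longrightarrow> K \<ge> 0 \<Longrightarrow>
       (\<And>\<psi>. C1c S \<psi> \<Longrightarrow> cmod (weak_form E (\<lambda>x. b\<^sup>2 * E x) \<psi>) \<le> K * H1norm \<psi>) \<Longrightarrow> c * H1norm E \<le> K"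
proof -
  define n where "n = real DIM('a)"
  define m where "m = (Im b)\<^sup>2"
  have m: "m > 0" using assms by (simp add: m_def)
  \<comment> \<open>The last factor bounds A + B by the modulus of the form;
    \<open>2 * (n + 1)\<close> passes from sums of squares to the square of a sum of norms.\<close>
  define Cc where "Cc = 2 * (n + 1) * (1 + ((cmod b)\<^sup>2 + 1) / m)"
  have n0: "n \<ge> 0" by (simp add: n_def)
  have "1 + ((cmod b)\<^sup>2 + 1) / m \<ge> 1" using m by simp
  then have Cc: "Cc > 0" using n0 by (simp add: Cc_def)
  show ?thesis
  proof (rule that)
    show "1 / Cc > 0" using Cc by simp
    fix S :: "'a set" and E K
    assume E: "C1c S E" and K: "K \<ge> 0" and bound: "\<And>\<psi>. C1c S \<psi> \<Longrightarrow> cmod (weak_form E (\<lambda>x. b\<^sup>2 * E x) \<psi>) \<le> K * H1norm \<psi>"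
    define \<psi> where "\<psi> x = cnj (E x)" for x
    have \<psi>: "C1c S \<psi>" unfolding \<psi>_def[abs_def] by (rule C1c_bounded_linear[OF E bounded_linear_cnj])
    have p: "partial_deriv i \<psi> x = cnj (partial_deriv i E x)" for i x
      unfolding \<psi>_def[abs_def] partial_deriv_def[of i E]
      by (rule partial_deriv_eq) (rule bounded_linear.has_derivative[OF bounded_linear_cnj has_derivative_frechet[OF C1c_differentiable[OF E]]])
    have Ns: "L2norm (partial_deriv i \<psi>) = L2norm (partial_deriv i E)" "L2norm \<psi> = L2norm E" for i
      by (simp_all add: L2norm_def p) (simp add: \<psi>_def)
    have H: "H1norm \<psi> = H1norm E" by (simp add: H1norm_def Ns)
    define A where "A = (\<Sum>i\<in>(Basis :: 'a set). (L2norm (partial_deriv i E))\<^sup>2)"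
    define B where "B = (L2norm E)\<^sup>2"
    have AB: "A \<ge> 0" "B \<ge> 0" by (simp_all add: A_def B_def sum_nonneg)
    have i1: "integrable lebesgue (\<lambda>x. (cmod (partial_deriv i E x))\<^sup>2)" "integrable lebesgue (\<lambda>x. (cmod (E x))\<^sup>2)" for i
      using C1c_L2(1)[OF E] C1c_L2(2)[OF E, of i] by (auto simp: L2_def)
    have "weak_form E (\<lambda>x. b\<^sup>2 * E x) \<psi> = (LINT x|lebesgue.
        (\<Sum>i\<in>Basis. complex_of_real ((cmod (partial_deriv i E x))\<^sup>2)) - b\<^sup>2 * complex_of_real ((cmod (E x))\<^sup>2))"
      unfolding weak_form_def p complex_norm_square by (simp add: \<psi>_def mult.assoc)
    also have "\<dots> = (\<Sum>i\<in>Basis. LINT x|lebesgue. complex_of_real ((cmod (partial_deriv i E x))\<^sup>2)) - b\<^sup>2 * (LINT x|lebesgue. complex_of_real ((cmod (E x))\<^sup>2))"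
      using i1 by (subst Bochner_Integration.integral_diff) (auto simp: Bochner_Integration.integral_sum simp del: of_real_power)
    also have "\<dots> = of_real A - b\<^sup>2 * of_real B"
      unfolding integral_complex_of_real L2norm_square[symmetric] A_def B_def by simp
    finally have wf: "weak_form E (\<lambda>x. b\<^sup>2 * E x) \<psi> = of_real A - b\<^sup>2 * of_real B" .
    define q where "q = cmod (of_real A - b\<^sup>2 * of_real B)"
    have qB: "m * B \<le> q" unfolding q_def m_def by (rule norm_diff_square_ge[OF AB])
    have "B \<le> q / m" using qB m by (simp add: field_simps)
    have "A = cmod ((of_real A - b\<^sup>2 * of_real B) + b\<^sup>2 * of_real B)" using AB by simp
    also have "\<dots> \<le> q + (cmod b)\<^sup>2 * B"
      unfolding q_def by (rule order_trans[OF norm_triangle_ineq]) (use AB in \<open>simp add: norm_mult norm_power\<close>)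
    also have "\<dots> \<le> q + (cmod b)\<^sup>2 * (q / m)" using \<open>B \<le> q / m\<close> by (intro add_left_mono mult_left_mono) auto
    finally have "A + B \<le> q + (cmod b)\<^sup>2 * (q / m) + q / m" using \<open>B \<le> q / m\<close> by linarith
    also have "\<dots> = (1 + ((cmod b)\<^sup>2 + 1) / m) * q" using m by (simp add: field_simps)
    finally have ABq: "A + B \<le> (1 + ((cmod b)\<^sup>2 + 1) / m) * q" .
    have "(H1norm E)\<^sup>2 \<le> 2 * ((\<Sum>i\<in>(Basis :: 'a set). L2norm (partial_deriv i E))\<^sup>2 + (L2norm E)\<^sup>2)"
      unfolding H1norm_def power2_sum using two_mult_le_squares[of "\<Sum>i\<in>(Basis :: 'a set). L2norm (partial_deriv i E)" "L2norm E"]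
      by (simp add: algebra_simps)
    also have "\<dots> \<le> 2 * (n * A + B)"
      using sum_squared_le_sum_of_squares[where f="\<lambda>i. L2norm (partial_deriv i E)" and I="Basis :: 'a set"]
      by (simp add: A_def B_def n_def mult.commute)
    also have "\<dots> \<le> 2 * (n + 1) * (A + B)" using AB n0 by (simp add: algebra_simps)
    also have "\<dots> \<le> 2 * (n + 1) * ((1 + ((cmod b)\<^sup>2 + 1) / m) * q)" using ABq n0 by (intro mult_left_mono) auto
    also have "\<dots> = Cc * q" by (simp add: Cc_def)
    also have "\<dots> \<le> Cc * (K * H1norm E)"
      using bound[OF \<psi>] Cc unfolding wf H q_def by (intro mult_left_mono) auto
    finally have sq: "H1norm E * H1norm E \<le> (Cc * K) * H1norm E" by (simp add: power2_eq_square algebra_simps)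
    show "1 / Cc * H1norm E \<le> K"
    proof (cases "H1norm E = 0")
      case False
      then have "H1norm E > 0" using H1norm_ge(1)[of E] by simp
      then have "H1norm E \<le> Cc * K" using sq mult_right_le_imp_le by blast
      then show ?thesis using Cc by (simp add: field_simps)
    next
      case True
      then show ?thesis using K by simp
    qed
  qed
qed

section \<open>Continuity of the data under the change of variables\<close>

text \<open>Dominated convergence as the level grows. Applied to |f|^2 over the cube, it controls
  the large values of \<open>f\<close> on all domains in the cube at once.\<close>

lemma integral_tail_small:
  fixes B :: "'a::euclidean_space \<Rightarrow> real"
  assumes "integrable lebesgue B" "\<And>x. B x \<ge> 0" "e > 0"
  obtains M where "M \<ge> 0" "integrable lebesgue (\<lambda>x. max 0 (B x - M))" "(LINT x|lebesgue. max 0 (B x - M)) \<le> e"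
proof -
  have m: "(\<lambda>x. max 0 (B x - M)) \<in> borel_measurable lebesgue" for M using assms(1) by auto
  have i: "integrable lebesgue (\<lambda>x. max 0 (B x - real n))" for n
    by (rule Bochner_Integration.integrable_bound[OF assms(1) m]) (use assms(2) in \<open>auto intro!: AE_I2\<close>)
  have "(\<lambda>n. LINT x|lebesgue. max 0 (B x - real n)) \<longlonglongrightarrow> integral\<^sup>L lebesgue (\<lambda>x::'a. 0::real)"
  proof (rule integral_dominated_convergence)
    show "integrable lebesgue B" by (rule assms(1))
    show "AE x in lebesgue. (\<lambda>n. max 0 (B x - real n)) \<longlonglongrightarrow> 0"
    proof (rule AE_I2)
      fix x
      obtain N where N: "B x \<le> real N" using real_arch_simple by blast
      have "\<forall>\<^sub>F n in sequentially. max 0 (B x - real n) = 0"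
        using eventually_ge_at_top[of N]
      proof (rule eventually_mono)
        fix n assume "N \<le> n"
        then have "real N \<le> real n" by simp
        then show "max 0 (B x - real n) = 0" using N by simp
      qed
      then show "(\<lambda>n. max 0 (B x - real n)) \<longlonglongrightarrow> 0" by (rule tendsto_eventually)
    qed
    show "AE x in lebesgue. norm (max 0 (B x - real n)) \<le> B x" for n
      using assms(2) by (intro AE_I2) auto
  qed (use m in auto)
  then have "\<forall>\<^sub>F n in sequentially. (LINT x|lebesgue. max 0 (B x - real n)) < e"
    using assms(3) by (intro order_tendstoD(2)) auto
  then obtain n where "(LINT x|lebesgue. max 0 (B x - real n)) < e" unfolding eventually_sequentially by blast
  then show ?thesis using that[of "real n"] i by simp
qed

text \<open>The difference splits into (J - 1) f(\<tau> x), of order \<open>\<kappa>\<close>, and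
  f(\<tau> x) - f(x). The latter is at most \<open>\<omega>\<close> on \<open>K\<close>; off
  \<open>K\<close>, |f|^2 is at most \<open>M\<close> plus its excess over \<open>M\<close>. The
  constant is paid by the small measure of \<Omega> - K, the excess by the tail integral, directly
  on \<open>\<Omega>\<close> and by change of variables on \<open>\<Omega>r\<close>.\<close>

lemma (in near_identity) data_shift:
  fixes f :: "real ^ 'n \<Rightarrow> complex"
  assumes f: "continuous_on \<Omega> f" "continuous_on \<Omega>r f"
    and Q: "\<Omega> \<subseteq> Q" "\<Omega>r \<subseteq> Q" "L2 (zero_extension Q f)"
    and \<Omega>m: "\<Omega> \<in> lmeasurable"
    and M: "M \<ge> 0" "integrable lebesgue (\<lambda>x. max 0 ((cmod (zero_extension Q f x))\<^sup>2 - M))"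
      "(LINT x|lebesgue. max 0 ((cmod (zero_extension Q f x))\<^sup>2 - M)) \<le> e"
    and K: "closed K" "K \<subseteq> \<Omega>" "4 * M * measure lebesgue (\<Omega> - K) \<le> e" "\<Omega> - K \<in> lmeasurable"
    and unif: "\<And>x y. x \<in> K \<Longrightarrow> dist y x \<le> \<delta> \<Longrightarrow> cmod (f y - f x) \<le> \<omega>"
      "\<omega>\<^sup>2 * measure lebesgue \<Omega> \<le> e"
    and e: "e \<ge> 0"
  shows "L2norm (zero_extension \<Omega> (\<lambda>x. of_real (J x) * f (\<tau> x) - f x))
      \<le> 2 * \<kappa> * L2norm (zero_extension Q f) + sqrt (8 * e)"
proof -
  let ?F = "zero_extension Q f"
  define Bq where "Bq y = (cmod (f y))\<^sup>2" for y
  \<comment> \<open>Excess of |f|^2 over the level \<open>M\<close>; its integral over either domain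
    is at most the tail integral over the cube.\<close>
  define rest where "rest y = max 0 (Bq y - M)" for y
  have rest0: "rest y \<ge> 0" for y by (simp add: rest_def)
  have restle: "Bq y \<le> M + rest y" for y by (simp add: rest_def)
  have \<tau>c: "continuous_on \<Omega> \<tau>" by (rule Ck_on_1_continuous[OF \<tau>_C1])
  have f\<tau>: "continuous_on \<Omega> (\<lambda>x. f (\<tau> x))" using \<tau>_in by (intro continuous_on_compose2[OF f(2) \<tau>c]) blast
  have bm: "set_borel_measurable lebesgue \<Omega> k" if "continuous_on \<Omega> k" for k :: "real ^ 'n \<Rightarrow> real"
  proof -
    have "(\<lambda>x. indicator \<Omega> x *\<^sub>R k x) \<in> borel_measurable lborel"
      using borel_measurable_continuous_on_indicator[of \<Omega> k] opens that by simp
    then show ?thesis unfolding set_borel_measurable_def by (rule measurable_completion)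
  qed
  have meas_ind: "zero_extension S f \<in> borel_measurable lebesgue" if "S = \<Omega> \<or> S = \<Omega>r" for S
    using that zero_extension_measurable[OF opens(1) f(1)] zero_extension_measurable[OF opens(2) f(2)] by blast
  have L2S: "L2 (zero_extension S f)" "L2norm (zero_extension S f) \<le> L2norm ?F" if "S = \<Omega> \<or> S = \<Omega>r" for S
  proof -
    have le: "cmod (zero_extension S f x) \<le> 1 * cmod (?F x)" for x
      using that Q by (auto simp: zero_extension_def)
    show "L2 (zero_extension S f)" by (rule L2_mono[OF Q(3) meas_ind[OF that] le])
    show "L2norm (zero_extension S f) \<le> L2norm ?F" using L2norm_mono[OF Q(3) meas_ind[OF that] le] by simp
  qed
  have restint: "set_integrable lebesgue S rest \<and> (LINT x:S|lebesgue. rest x) \<le> e" if "S = \<Omega> \<or> S = \<Omega>r" for S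
  proof -
    let ?R = "\<lambda>x. max 0 ((cmod (?F x))\<^sup>2 - M)"
    have S: "open S" "continuous_on S rest" "S \<subseteq> Q"
      using that opens f Q unfolding rest_def Bq_def by (auto intro!: continuous_intros)
    have "(\<lambda>x. indicator S x *\<^sub>R rest x) \<in> borel_measurable lborel"
      using borel_measurable_continuous_on_indicator[of S rest] S by simp
    then have m: "(\<lambda>x. indicator S x *\<^sub>R rest x) \<in> borel_measurable lebesgue" by (rule measurable_completion)
    have le: "indicator S x *\<^sub>R rest x \<le> ?R x" for x
      using S(3) by (auto simp: indicator_def rest_def Bq_def zero_extension_def)
    have i: "integrable lebesgue (\<lambda>x. indicator S x *\<^sub>R rest x)"
    proof (rule Bochner_Integration.integrable_bound[OF M(2) m])
      show "AE x in lebesgue. norm (indicator S x *\<^sub>R rest x) \<le> norm (?R x)"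
      proof (rule AE_I2)
        fix x
        have "0 \<le> indicat_real S x *\<^sub>R rest x" using rest0 by simp
        then show "norm (indicator S x *\<^sub>R rest x) \<le> norm (?R x)" using le[of x] by simp
      qed
    qed
    have "(LINT x|lebesgue. indicator S x *\<^sub>R rest x) \<le> (LINT x|lebesgue. ?R x)"
      by (rule Bochner_Integration.integral_mono[OF i M(2) le])
    then show ?thesis using i M(3) by (simp add: set_integrable_def set_lebesgue_integral_def)
  qed
  have crest: "continuous_on \<Omega>r rest" unfolding rest_def Bq_def using f(2) by (auto intro!: continuous_intros)
  have crest\<tau>: "continuous_on \<Omega> (\<lambda>x. rest (\<tau> x))" using \<tau>_in by (intro continuous_on_compose2[OF crest \<tau>c]) blast
  have iJr: "set_integrable lebesgue \<Omega> (\<lambda>x. J x * rest (\<tau> x))" "(LINT x:\<Omega>|lebesgue. J x * rest (\<tau> x)) \<le> e"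
    using cv_real[OF crest] restint[of \<Omega>r] by auto
  have i2Jr: "set_integrable lebesgue \<Omega> (\<lambda>x. 2 * (J x * rest (\<tau> x)))" by (rule set_integrable_mult_right[OF iJr(1)])
  have r2J: "rest (\<tau> x) \<le> 2 * (J x * rest (\<tau> x))" if "x \<in> \<Omega>" for x
    using mult_right_mono[OF J_bounds(2)[OF that] rest0, of "\<tau> x"] by simp
  have ir\<tau>: "set_integrable lebesgue \<Omega> (\<lambda>x. rest (\<tau> x))"
    by (rule set_integrable_bound[OF i2Jr bm[OF crest\<tau>]])
       (use r2J rest0 in \<open>auto intro!: AE_I2 intro: order_trans[OF _ abs_ge_self]\<close>)
  have r\<tau>: "(LINT x:\<Omega>|lebesgue. rest (\<tau> x)) \<le> 2 * e"
  proof -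
    have "(LINT x:\<Omega>|lebesgue. rest (\<tau> x)) \<le> (LINT x:\<Omega>|lebesgue. 2 * (J x * rest (\<tau> x)))"
      by (rule set_integral_mono[OF ir\<tau> i2Jr r2J])
    also have "\<dots> \<le> 2 * e" using iJr(2) by simp
    finally show ?thesis .
  qed
  have diff2: "(cmod (f (\<tau> x) - f x))\<^sup>2 \<le> \<omega>\<^sup>2 + 4 * M * indicator (\<Omega> - K) x + 2 * rest (\<tau> x) + 2 * rest x" if x: "x \<in> \<Omega>" for x
  proof (cases "x \<in> K")
    case True
    have "dist (\<tau> x) x \<le> \<delta>" using r_small[OF x] by (simp add: \<tau>_def dist_norm)
    then have "(cmod (f (\<tau> x) - f x))\<^sup>2 \<le> \<omega>\<^sup>2" using unif(1)[OF True] by (intro power_mono) auto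
    then show ?thesis using rest0[of x] rest0[of "\<tau> x"] M(1) by (simp add: indicator_def)
  next
    case False
    have "(cmod (f (\<tau> x) - f x))\<^sup>2 \<le> (cmod (f (\<tau> x)) + cmod (f x))\<^sup>2" by (intro power_mono norm_triangle_ineq4) simp
    also have "\<dots> \<le> 2 * Bq (\<tau> x) + 2 * Bq x"
      using two_mult_le_squares[of "cmod (f (\<tau> x))" "cmod (f x)"] by (simp add: power2_sum Bq_def algebra_simps)
    also have "\<dots> \<le> 4 * M + 2 * rest (\<tau> x) + 2 * rest x" using restle[of x] restle[of "\<tau> x"] by linarith
    finally have "(cmod (f (\<tau> x) - f x))\<^sup>2 \<le> 4 * M + 2 * rest (\<tau> x) + 2 * rest x" .
    moreover have "indicat_real (\<Omega> - K) x = 1" using False x by simp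
    moreover have "0 \<le> \<omega>\<^sup>2" by (rule zero_le_power2)
    ultimately show ?thesis by (simp only: mult_1_right)
  qed
  define d where "d x = f (\<tau> x) - f x" for x
  have L2\<tau>: "L2 (zero_extension \<Omega> (\<lambda>x. f (\<tau> x)))" "L2norm (zero_extension \<Omega> (\<lambda>x. f (\<tau> x))) \<le> 2 * L2norm ?F"
    using pull_L2(1,2)[OF f(2)] L2S[of \<Omega>r] by auto
  have dz: "zero_extension \<Omega> d = (\<lambda>x. zero_extension \<Omega> (\<lambda>x. f (\<tau> x)) x - zero_extension \<Omega> f x)"
    by (auto simp: d_def zero_extension_def fun_eq_iff)
  have L2d: "L2 (zero_extension \<Omega> d)" unfolding dz by (rule L2_diff[OF L2\<tau>(1) L2S(1)]) simp
  have cd: "continuous_on \<Omega> d" unfolding d_def[abs_def] by (intro continuous_intros f\<tau> f(1))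
  have id: "set_integrable lebesgue \<Omega> (\<lambda>x. (cmod (d x))\<^sup>2)" using L2d L2_zero_extension_iff[OF opens(1) cd] by simp
  have ic: "set_integrable lebesgue \<Omega> (\<lambda>x. c)" for c :: real
    unfolding set_integrable_def using \<Omega>m by (simp add: lmeasurable_iff_integrable)
  have iK: "set_integrable lebesgue \<Omega> (\<lambda>x. 4 * M * indicator (\<Omega> - K) x)"
  proof -
    have "integrable lebesgue (\<lambda>x. 4 * M * indicat_real (\<Omega> - K) x)" using K(4) by (simp add: lmeasurable_iff_integrable)
    moreover have "(\<lambda>x. indicat_real \<Omega> x *\<^sub>R (4 * M * indicator (\<Omega> - K) x)) = (\<lambda>x. 4 * M * indicat_real (\<Omega> - K) x)"
      by (auto simp: indicator_def fun_eq_iff)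
    ultimately show ?thesis unfolding set_integrable_def by simp
  qed
  have sK: "(LINT x:\<Omega>|lebesgue. 4 * M * indicator (\<Omega> - K) x) = 4 * M * measure lebesgue (\<Omega> - K)"
  proof -
    have "(\<lambda>x. indicat_real \<Omega> x *\<^sub>R (4 * M * indicator (\<Omega> - K) x)) = (\<lambda>x. 4 * M * indicat_real (\<Omega> - K) x)"
      by (auto simp: indicator_def fun_eq_iff)
    then show ?thesis unfolding set_lebesgue_integral_def using K(4) by simp
  qed
  have sc: "(LINT x:\<Omega>|lebesgue. \<omega>\<^sup>2) = \<omega>\<^sup>2 * measure lebesgue \<Omega>"
    unfolding set_lebesgue_integral_def using \<Omega>m by simp
  have ir: "set_integrable lebesgue \<Omega> rest" "(LINT x:\<Omega>|lebesgue. rest x) \<le> e" using restint[of \<Omega>] by auto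
  note j1 = set_integral_add[OF ic iK, of "\<omega>\<^sup>2"]
  note j2 = set_integral_add[OF j1(1) set_integrable_mult_right[OF ir\<tau>, of 2]]
  note j3 = set_integral_add[OF j2(1) set_integrable_mult_right[OF ir(1), of 2]]
  have "(L2norm (zero_extension \<Omega> d))\<^sup>2 = (LINT x:\<Omega>|lebesgue. (cmod (d x))\<^sup>2)" by (rule L2norm_zero_extension)
  also have "\<dots> \<le> (LINT x:\<Omega>|lebesgue. \<omega>\<^sup>2 + 4 * M * indicator (\<Omega> - K) x + 2 * rest (\<tau> x) + 2 * rest x)"
    by (rule set_integral_mono[OF id j3(1)]) (simp add: d_def diff2)
  also have "\<dots> = \<omega>\<^sup>2 * measure lebesgue \<Omega> + 4 * M * measure lebesgue (\<Omega> - K)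
       + 2 * (LINT x:\<Omega>|lebesgue. rest (\<tau> x)) + 2 * (LINT x:\<Omega>|lebesgue. rest x)"
    unfolding j3(2) j2(2) j1(2) sK sc by simp
  \<comment> \<open>The four terms are at most e, e, 4e and 2e; the transported excess costs another
    factor 2 because J \<ge> 1/2.\<close>
  also have "\<dots> \<le> 8 * e" using unif(2) K(3) r\<tau> ir(2) by linarith
  finally have dle: "L2norm (zero_extension \<Omega> d) \<le> sqrt (8 * e)" by (rule real_le_rsqrt)
  define jf where "jf x = of_real (J x - 1) * f (\<tau> x)" for x
  have cjf: "continuous_on \<Omega> jf" unfolding jf_def[abs_def] by (intro continuous_intros J_continuous f\<tau>)
  have jfle: "cmod (zero_extension \<Omega> jf x) \<le> \<kappa> * cmod (zero_extension \<Omega> (\<lambda>x. f (\<tau> x)) x)" for x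
  proof (cases "x \<in> \<Omega>")
    case True
    have "\<bar>J x - 1\<bar> * cmod (f (\<tau> x)) \<le> \<kappa> * cmod (f (\<tau> x))" using J_bounds(1)[OF True] by (rule mult_right_mono) simp
    then show ?thesis using True by (simp only: zero_extension_def jf_def norm_mult norm_of_real if_True)
  qed (simp add: zero_extension_def)
  have \<kappa>0: "0 \<le> \<kappa>" using \<delta> by linarith
  have mjf: "zero_extension \<Omega> jf \<in> borel_measurable lebesgue" by (rule zero_extension_measurable[OF opens(1) cjf])
  have L2jf: "L2 (zero_extension \<Omega> jf)" by (rule L2_mono[OF L2\<tau>(1) mjf jfle])
  have "L2norm (zero_extension \<Omega> jf) \<le> \<kappa> * L2norm (zero_extension \<Omega> (\<lambda>x. f (\<tau> x)))"
    by (rule L2norm_mono[OF L2\<tau>(1) mjf jfle \<kappa>0])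
  also have "\<dots> \<le> \<kappa> * (2 * L2norm ?F)" using L2\<tau>(2) \<kappa>0 by (rule mult_left_mono)
  finally have jfn: "L2norm (zero_extension \<Omega> jf) \<le> 2 * \<kappa> * L2norm ?F" by (simp add: mult.commute mult.left_commute)
  have "zero_extension \<Omega> (\<lambda>x. of_real (J x) * f (\<tau> x) - f x) = (\<lambda>x. zero_extension \<Omega> jf x + zero_extension \<Omega> d x)"
    by (auto simp: zero_extension_def jf_def d_def fun_eq_iff algebra_simps)
  then have "L2norm (zero_extension \<Omega> (\<lambda>x. of_real (J x) * f (\<tau> x) - f x))
      \<le> L2norm (zero_extension \<Omega> jf) + L2norm (zero_extension \<Omega> d)"
    using L2norm_triangle[OF L2jf L2d] by simp
  then show ?thesis using jfn dle by linarith
qed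

text \<open>\<open>M\<close> comes from the tail of \<open>f\<close>, \<open>K\<close> from
  \<open>M\<close>, and the modulus of continuity from \<open>K\<close>. These choices involve only
  \<open>\<Omega>\<close> and the cube, so the thresholds precede \<open>\<Omega>r\<close>.\<close>

lemma data_shift_parameters:
  fixes f :: "real ^ 'n::finite \<Rightarrow> complex"
  assumes \<Omega>: "open \<Omega>" "bounded \<Omega>" and f: "continuous_on \<Omega> f"
    and Q: "\<Omega> \<subseteq> Q" "L2 (zero_extension Q f)" and \<rho>: "\<rho> > 0"
  obtains \<delta>0 \<kappa>0 where "\<delta>0 > 0" "\<kappa>0 > 0"
    "\<And>\<Omega>r r \<delta> \<kappa> J. near_identity \<Omega> \<Omega>r r \<delta> \<kappa> J \<Longrightarrow> \<Omega>r \<subseteq> Q \<Longrightarrow> continuous_on \<Omega>r f \<Longrightarrow> \<delta> \<le> \<delta>0 \<Longrightarrow> \<kappa> \<le> \<kappa>0 \<Longrightarrow>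
       L2norm (zero_extension \<Omega> (\<lambda>x. of_real (J x) * f (x + r x) - f x)) \<le> \<rho>"
proof -
  let ?F = "zero_extension Q f"
  \<comment> \<open>Makes \<open>sqrt (8 * e)\<close> half of the target; the other half is left for
    the Jacobian term.\<close>
  define e where "e = (\<rho> / 2)\<^sup>2 / 8"
  have e: "e > 0" "sqrt (8 * e) = \<rho> / 2" using \<rho> by (auto simp: e_def)
  have iF: "integrable lebesgue (\<lambda>x. (cmod (?F x))\<^sup>2)" using Q(2) by (simp add: L2_def)
  obtain M where M: "M \<ge> 0" "integrable lebesgue (\<lambda>x. max 0 ((cmod (?F x))\<^sup>2 - M))"
     "(LINT x|lebesgue. max 0 ((cmod (?F x))\<^sup>2 - M)) \<le> e"
    using integral_tail_small[OF iF _ e(1)] by auto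
  have \<Omega>m: "\<Omega> \<in> lmeasurable" using \<Omega> by (simp add: lmeasurable_open)
  have epos: "e / (4 * M + 1) > 0" using e M by simp
  obtain K where K: "closed K" "K \<subseteq> \<Omega>" "\<Omega> - K \<in> lmeasurable" "emeasure lebesgue (\<Omega> - K) < ennreal (e / (4 * M + 1))"
    by (rule sets_lebesgue_inner_closed[OF fmeasurableD[OF \<Omega>m] epos])
  have "measure lebesgue (\<Omega> - K) \<le> e / (4 * M + 1)"
  proof -
    have "emeasure lebesgue (\<Omega> - K) = ennreal (measure lebesgue (\<Omega> - K))" using K(3) by (rule emeasure_eq_measure2)
    then have "ennreal (measure lebesgue (\<Omega> - K)) < ennreal (e / (4 * M + 1))" using K(4) by simp
    then show ?thesis by (simp add: ennreal_less_iff)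
  qed
  then have "4 * M * measure lebesgue (\<Omega> - K) \<le> 4 * M * (e / (4 * M + 1))" using M(1) by (intro mult_left_mono) auto
  also have "\<dots> \<le> e" using M(1) e(1) by (simp add: field_simps)
  finally have K3: "4 * M * measure lebesgue (\<Omega> - K) \<le> e" .
  have cK: "compact K" using K(1,2) \<Omega>(2) bounded_subset compact_eq_bounded_closed by blast
  define \<omega> where "\<omega> = sqrt (e / (measure lebesgue \<Omega> + 1))"
  have mp: "measure lebesgue \<Omega> + 1 > 0" by (smt (verit) measure_nonneg)
  have \<omega>: "\<omega> > 0" "\<omega>\<^sup>2 * measure lebesgue \<Omega> \<le> e"
  proof -
    show "\<omega> > 0" using e mp by (simp add: \<omega>_def)
    have "\<omega>\<^sup>2 = e / (measure lebesgue \<Omega> + 1)" using e mp by (simp add: \<omega>_def)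
    then have "\<omega>\<^sup>2 * measure lebesgue \<Omega> + \<omega>\<^sup>2 = e" using mp by (simp add: field_simps)
    then show "\<omega>\<^sup>2 * measure lebesgue \<Omega> \<le> e" using zero_le_power2[of \<omega>] by linarith
  qed
  obtain d0 where d0: "d0 > 0" "(\<Union>x\<in>K. ball x d0) \<subseteq> \<Omega>"
    using compact_subset_open_imp_ball_epsilon_subset[OF cK \<Omega>(1) K(2)] by blast
  \<comment> \<open>A compact neighbourhood of \<open>K\<close> inside \<open>\<Omega>\<close>:
    points of \<open>K\<close> displaced by at most d0/2 stay in it, so uniform continuity of
    \<open>f\<close> on \<open>L\<close> covers the displaced points.\<close>
  define L where "L = {x + y |x y. x \<in> K \<and> y \<in> cball 0 (d0/2)}"
  have "compact L" unfolding L_def by (intro compact_sums cK compact_cball)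
  have L\<Omega>: "L \<subseteq> \<Omega>"
  proof
    fix z assume "z \<in> L"
    then obtain x y where "z = x + y" "x \<in> K" "norm y \<le> d0/2" unfolding L_def by auto
    then have "z \<in> ball x d0" using d0(1) by (simp add: dist_norm)
    with \<open>x \<in> K\<close> d0(2) show "z \<in> \<Omega>" by blast
  qed
  have "uniformly_continuous_on L f"
    using compact_uniformly_continuous[OF continuous_on_subset[OF f L\<Omega>] \<open>compact L\<close>] .
  then obtain d1 where d1: "d1 > 0" "\<And>x y. x \<in> L \<Longrightarrow> y \<in> L \<Longrightarrow> dist y x < d1 \<Longrightarrow> dist (f y) (f x) < \<omega>"
    unfolding uniformly_continuous_on_def using \<omega>(1) by metis
  define \<delta>0 where "\<delta>0 = min (d0/2) (d1/2)"
  have \<delta>0: "\<delta>0 > 0" using d0 d1 by (simp add: \<delta>0_def)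
  have unif: "cmod (f y - f x) \<le> \<omega>" if "x \<in> K" "dist y x \<le> \<delta>0" for x y
  proof -
    have "y = x + (y - x)" "y - x \<in> cball 0 (d0/2)" "x = x + 0" "0 \<in> cball (0 :: real ^ 'n) (d0/2)"
      using that(2) d0(1) by (auto simp: \<delta>0_def dist_norm norm_minus_commute)
    then have "x \<in> L" "y \<in> L" unfolding L_def using that(1) by blast+
    moreover have "dist y x < d1" using that(2) d1(1) by (simp add: \<delta>0_def)
    ultimately show ?thesis using d1(2)[of x y] by (simp add: dist_norm)
  qed
  define m where "m = L2norm ?F + 1"
  define \<kappa>0 where "\<kappa>0 = \<rho> / (4 * m)"
  have Fp: "m > 0" using L2norm_nonneg[of ?F] by (simp add: m_def)
  have \<kappa>0: "\<kappa>0 > 0" "2 * \<kappa>0 * L2norm ?F \<le> \<rho> / 2"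
  proof -
    show "\<kappa>0 > 0" using \<rho> Fp by (simp add: \<kappa>0_def)
    have "2 * \<kappa>0 * L2norm ?F \<le> 2 * \<kappa>0 * m" using \<open>\<kappa>0 > 0\<close> by (simp add: m_def)
    also have "\<dots> = \<rho> / 2" using Fp by (simp add: \<kappa>0_def)
    finally show "2 * \<kappa>0 * L2norm ?F \<le> \<rho> / 2" .
  qed
  show ?thesis
  proof (rule that[OF \<delta>0 \<kappa>0(1)])
    fix \<Omega>r r \<delta> \<kappa> J
    assume ni: "near_identity \<Omega> \<Omega>r r \<delta> \<kappa> J" and r: "\<Omega>r \<subseteq> Q" "continuous_on \<Omega>r f" "\<delta> \<le> \<delta>0" "\<kappa> \<le> \<kappa>0"
    interpret near_identity \<Omega> \<Omega>r r \<delta> \<kappa> J by (rule ni)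
    have u: "cmod (f y - f x) \<le> \<omega>" if "x \<in> K" "dist y x \<le> \<delta>" for x y
      by (rule unif[OF that(1)]) (use that(2) r(3) in linarith)
    have "L2norm (zero_extension \<Omega> (\<lambda>x. of_real (J x) * f (\<tau> x) - f x)) \<le> 2 * \<kappa> * L2norm ?F + sqrt (8 * e)"
      by (rule data_shift[OF f r(2) Q(1) r(1) Q(2) \<Omega>m M K(1,2) K3 K(3) u \<omega>(2)]) (use e in auto)
    also have "\<dots> \<le> 2 * \<kappa>0 * L2norm ?F + \<rho> / 2"
      using r(4) L2norm_nonneg[of ?F] unfolding e(2) by (intro add_mono mult_right_mono) auto
    also have "\<dots> \<le> \<rho>" using \<kappa>0(2) by linarith
    finally show "L2norm (zero_extension \<Omega> (\<lambda>x. of_real (J x) * f (x + r x) - f x)) \<le> \<rho>" by (simp add: \<tau>_def)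
  qed
qed

section \<open>Comparison of the two solutions\<close>

text \<open>Every supremum is a summand of a sum of nonnegative extended reals and hence below the
  whole; the finite bound turns this into an inequality between reals.\<close>

lemma C2_norm_less:
  fixes r :: "'a::euclidean_space \<Rightarrow> 'b::real_normed_vector"
  assumes "C2_norm S r < ennreal \<delta>" "x \<in> S"
  shows "norm (r x) \<le> \<delta>" "i \<in> Basis \<Longrightarrow> norm (partial_deriv i r x) \<le> \<delta>"
proof -
  have \<delta>: "0 \<le> \<delta>"
  proof (rule ccontr)
    assume "\<not> 0 \<le> \<delta>"
    then have "ennreal \<delta> = 0" by (simp add: ennreal_neg)
    then show False using assms(1) by simp
  qed
  have "ennreal (norm (r x)) \<le> (SUP x\<in>S. ennreal (norm (r x)))" using assms(2) by (rule SUP_upper)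
  also have "\<dots> \<le> C2_norm S r" unfolding C2_norm_def add.assoc by (rule add_increasing2) auto
  finally have "ennreal (norm (r x)) \<le> ennreal \<delta>" using assms(1) by simp
  then show "norm (r x) \<le> \<delta>" using \<delta> by simp
  assume i: "i \<in> Basis"
  have "ennreal (norm (partial_deriv i r x)) \<le> (SUP x\<in>S. ennreal (norm (partial_deriv i r x)))"
    using assms(2) by (rule SUP_upper)
  also have "\<dots> \<le> (\<Sum>i\<in>Basis. SUP x\<in>S. ennreal (norm (partial_deriv i r x)))"
    by (rule member_le_sum[OF i]) auto
  also have "\<dots> \<le> C2_norm S r" unfolding C2_norm_def by (intro add_increasing2 add_increasing) auto
  finally have "ennreal (norm (partial_deriv i r x)) \<le> ennreal \<delta>" using assms(1) by simp
  then show "norm (partial_deriv i r x) \<le> \<delta>" using \<delta> by simp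
qed

text \<open>Lebesgue measure is complete, so a change on a negligible set preserves
  measurability.\<close>

lemma L2_cong_negligible:
  fixes f g :: "'a::euclidean_space \<Rightarrow> complex"
  assumes g: "L2 g" and N: "negligible N" and eq: "\<And>x. x \<notin> N \<Longrightarrow> f x = g x"
  shows "L2 f" "L2norm f = L2norm g"
proof -
  have ae: "AE x in lebesgue. x \<notin> N" using N unfolding negligible_iff_null_sets by (rule AE_not_in)
  have gm: "g \<in> borel_measurable lebesgue" using g by (simp add: L2_def)
  have fm: "f \<in> borel_measurable lebesgue"
  proof (rule measurableI)
    fix A :: "complex set" assume "A \<in> sets borel"
    then have "g -` A \<inter> space lebesgue \<in> sets lebesgue" by (rule measurable_sets[OF gm])
    then have s: "g -` A \<in> sets lebesgue" by simp
    have "AE x in lebesgue. x \<in> g -` A \<longleftrightarrow> x \<in> f -` A" using ae by eventually_elim (simp add: eq)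
    from completion.in_sets_AE[OF this s] show "f -` A \<inter> space lebesgue \<in> sets lebesgue" by simp
  qed simp
  have ae2: "AE x in lebesgue. (cmod (g x))\<^sup>2 = (cmod (f x))\<^sup>2" using ae by eventually_elim (simp add: eq)
  have m: "(\<lambda>x. (cmod (g x))\<^sup>2) \<in> borel_measurable lebesgue" "(\<lambda>x. (cmod (f x))\<^sup>2) \<in> borel_measurable lebesgue"
    using gm fm by measurable
  show "L2 f" using g integrable_cong_AE[OF m ae2] fm by (simp add: L2_def)
  show "L2norm f = L2norm g" unfolding L2norm_def using integral_cong_AE[OF m ae2] by simp
qed

text \<open>Transfers the approximation from the C^1 function \<open>g\<close> to \<open>u\<close>:
  they differ only on \<open>\<Gamma>\<close>, which is negligible and, being compact in
  \<open>D\<close>, away from the boundary.\<close>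

lemma interface_solution_approximation:
  fixes u f :: "'a::euclidean_space \<Rightarrow> complex"
  assumes D: "open D" "bounded D" and \<Gamma>: "compact \<Gamma>" "\<Gamma> \<subseteq> D" "\<forall>p\<in>\<Gamma>. outward_unit_normal \<Gamma> p (\<nu> p)"
    and f: "continuous_on D f" "L2 (zero_extension D f)"
    and sol: "interface_solution b \<Gamma> \<nu> f D u"
    and \<eta>: "\<eta> > 0"
  obtains \<phi> where "C1c D \<phi>" "L2 (zero_extension D u)" "L2norm (\<lambda>x. zero_extension D u x - \<phi> x) \<le> \<eta>"
    "\<And>\<psi>. C1c D \<psi> \<Longrightarrow> cmod (weak_form \<phi> (\<lambda>x. b\<^sup>2 * \<phi> x - zero_extension D f x) \<psi>) \<le> \<eta> * H1norm \<psi>"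
proof -
  obtain g where g: "Ck_on 1 D g" "\<And>x. x \<notin> \<Gamma> \<Longrightarrow> g x = u x"
    "\<And>\<psi>. C1c D \<psi> \<Longrightarrow> weak_form g (\<lambda>x. b\<^sup>2 * g x - f x) \<psi> = 0"
    by (rule interface_weak_form[OF D(1) \<Gamma> f(1) sol]) (erule that; blast)
  have bd: "(g \<longlongrightarrow> 0) (at p within D)" if p: "p \<in> frontier D" for p
  proof -
    have u0: "(u \<longlongrightarrow> 0) (at p within D)" using sol p unfolding interface_solution_def by blast
    have "p \<notin> \<Gamma>" using p \<Gamma>(2) D(1) by (auto simp: frontier_def interior_open)
    moreover have "open (- \<Gamma>)" using \<Gamma>(1) by (simp add: compact_imp_closed open_Compl)
    ultimately have "\<forall>\<^sub>F x in at p within D. u x = g x"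
      unfolding eventually_at_topological using g(2) by (intro exI[of _ "- \<Gamma>"]) auto
    then show ?thesis using u0 by (rule Lim_transform_eventually[OF _, rotated])
  qed
  obtain \<phi> where \<phi>: "C1c D \<phi>" "L2 (zero_extension D g)" "L2norm (\<lambda>x. zero_extension D g x - \<phi> x) \<le> \<eta>"
    "\<And>\<psi>. C1c D \<psi> \<Longrightarrow> cmod (weak_form \<phi> (\<lambda>x. b\<^sup>2 * \<phi> x - zero_extension D f x) \<psi>) \<le> \<eta> * H1norm \<psi>"
    by (rule solution_approximation[OF D g(1) bd f g(3) \<eta>]) (assumption | erule that; blast)+
  have N: "negligible \<Gamma>" using \<Gamma>(3) by (rule negligible_interface)
  have ze: "zero_extension D u x = zero_extension D g x" if "x \<notin> \<Gamma>" for x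
    using g(2)[OF that] by (simp add: zero_extension_def)
  show ?thesis
  proof (rule that[OF \<phi>(1)])
    show "L2 (zero_extension D u)" by (rule L2_cong_negligible(1)[OF \<phi>(2) N ze])
    have "L2norm (\<lambda>x. zero_extension D u x - \<phi> x) = L2norm (\<lambda>x. zero_extension D g x - \<phi> x)"
      by (rule L2_cong_negligible(2)[OF L2_diff[OF \<phi>(2) C1c_L2(1)[OF \<phi>(1)]] N]) (simp add: ze)
    then show "L2norm (\<lambda>x. zero_extension D u x - \<phi> x) \<le> \<eta>" using \<phi>(3) by simp
  qed (rule \<phi>(4))
qed

lemma H1norm_add:
  assumes "C1c S \<phi>" "C1c T \<psi>"
  shows "H1norm (\<lambda>x. \<phi> x + \<psi> x) \<le> H1norm \<phi> + H1norm \<psi>"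
proof -
  have p: "partial_deriv i (\<lambda>x. \<phi> x + \<psi> x) = (\<lambda>x. partial_deriv i \<phi> x + partial_deriv i \<psi> x)" for i
    by (rule ext, rule partial_deriv_add) (use assms C1c_differentiable in blast)+
  have "L2norm (partial_deriv i (\<lambda>x. \<phi> x + \<psi> x)) \<le> L2norm (partial_deriv i \<phi>) + L2norm (partial_deriv i \<psi>)" for i
    unfolding p by (rule L2norm_triangle) (use assms C1c_L2(2) in blast)+
  then have "(\<Sum>i\<in>Basis. L2norm (partial_deriv i (\<lambda>x. \<phi> x + \<psi> x)))
      \<le> (\<Sum>i\<in>Basis. L2norm (partial_deriv i \<phi>)) + (\<Sum>i\<in>Basis. L2norm (partial_deriv i \<psi>))"
    unfolding sum.distrib[symmetric] by (rule sum_mono)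
  moreover have "L2norm (\<lambda>x. \<phi> x + \<psi> x) \<le> L2norm \<phi> + L2norm \<psi>"
    by (rule L2norm_triangle) (use assms C1c_L2(1) in blast)+
  ultimately show ?thesis by (simp add: H1norm_def)
qed

text \<open>The data \<open>F\<close> cancel in the difference, leaving the homogeneous form to
  which coercivity applies.\<close>

lemma weak_form_diff_bound:
  fixes \<phi> \<theta> F :: "'a::euclidean_space \<Rightarrow> complex"
  assumes \<phi>: "C1c S \<phi>" and \<theta>: "C1c S \<theta>" and F: "L2 F" and \<psi>: "C1c S \<psi>"
    and "cmod (weak_form \<phi> (\<lambda>x. b\<^sup>2 * \<phi> x - F x) \<psi>) \<le> K * H1norm \<psi>"
    and "cmod (weak_form \<theta> (\<lambda>x. b\<^sup>2 * \<theta> x - F x) \<psi>) \<le> L * H1norm \<psi>"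
  shows "cmod (weak_form (\<lambda>x. \<phi> x - \<theta> x) (\<lambda>x. b\<^sup>2 * (\<phi> x - \<theta> x)) \<psi>) \<le> (K + L) * H1norm \<psi>"
proof -
  let ?w = "\<lambda>g x. (\<Sum>i\<in>Basis. partial_deriv i g x * partial_deriv i \<psi> x) - (b\<^sup>2 * g x - F x) * \<psi> x"
  have i: "integrable lebesgue (?w g)" if "C1c S g" for g
  proof (rule Bochner_Integration.integrable_diff)
    show "integrable lebesgue (\<lambda>x. \<Sum>i\<in>Basis. partial_deriv i g x * partial_deriv i \<psi> x)"
      by (intro Bochner_Integration.integrable_sum L2_integrable_mult C1c_L2(2)[OF that] C1c_L2(2)[OF \<psi>])
    show "integrable lebesgue (\<lambda>x. (b\<^sup>2 * g x - F x) * \<psi> x)"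
      by (intro L2_integrable_mult L2_diff L2_scale C1c_L2(1)[OF that] C1c_L2(1)[OF \<psi>] F)
  qed
  have p: "partial_deriv i (\<lambda>x. \<phi> x - \<theta> x) x = partial_deriv i \<phi> x - partial_deriv i \<theta> x" for i x
    unfolding partial_deriv_def[of i \<phi>] partial_deriv_def[of i \<theta>]
    by (rule partial_deriv_eq)
       (intro has_derivative_diff has_derivative_frechet C1c_differentiable[OF \<phi>] C1c_differentiable[OF \<theta>])
  have "weak_form (\<lambda>x. \<phi> x - \<theta> x) (\<lambda>x. b\<^sup>2 * (\<phi> x - \<theta> x)) \<psi> = (LINT x|lebesgue. ?w \<phi> x - ?w \<theta> x)"
    unfolding weak_form_def p
    by (rule Bochner_Integration.integral_cong) (simp_all add: algebra_simps sum_subtractf)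
  also have "\<dots> = weak_form \<phi> (\<lambda>x. b\<^sup>2 * \<phi> x - F x) \<psi> - weak_form \<theta> (\<lambda>x. b\<^sup>2 * \<theta> x - F x) \<psi>"
    unfolding weak_form_def by (rule Bochner_Integration.integral_diff[OF i[OF \<phi>] i[OF \<theta>]])
  also have "cmod \<dots> \<le> K * H1norm \<psi> + L * H1norm \<psi>" by (rule order_trans[OF norm_triangle_ineq4 add_mono[OF assms(5,6)]])
  finally show ?thesis by (simp add: algebra_simps)
qed

context near_identity
begin

text \<open>The H^1 norm of \<open>pull \<theta>\<close> appears in the transport error; it is split
  into the norm of the difference, which half of the coercive term absorbs because C \<kappa> \<le>
  c/2, and that of \<open>\<phi>\<close>. In \<open>4 * n + 3\<close> the part 4 n + 2 bounds
  \<open>push\<close> in H^1 and the 1 is the error of \<open>\<phi>\<close>.\<close>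

lemma pull_near:
  fixes f :: "real ^ 'n \<Rightarrow> complex" and b :: complex
  defines "n \<equiv> real DIM(real ^ 'n)" and "C \<equiv> 10 * real DIM(real ^ 'n) + (cmod b)\<^sup>2"
  assumes f: "continuous_on \<Omega> f" "continuous_on \<Omega>r f" "L2 (zero_extension \<Omega> f)" "L2 (zero_extension \<Omega>r f)"
    and \<phi>: "C1c \<Omega> \<phi>" "\<And>\<psi>. C1c \<Omega> \<psi> \<Longrightarrow> cmod (weak_form \<phi> (\<lambda>x. b\<^sup>2 * \<phi> x - zero_extension \<Omega> f x) \<psi>) \<le> \<eta> * H1norm \<psi>"
    and \<theta>: "C1c \<Omega>r \<theta>" "\<And>\<psi>. C1c \<Omega>r \<psi> \<Longrightarrow> cmod (weak_form \<theta> (\<lambda>x. b\<^sup>2 * \<theta> x - zero_extension \<Omega>r f x) \<psi>) \<le> \<eta> * H1norm \<psi>"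
    and \<eta>: "\<eta> \<ge> 0"
    and \<rho>: "L2norm (zero_extension \<Omega> (\<lambda>x. of_real (J x) * f (\<tau> x) - f x)) \<le> \<rho>"
    and coer: "\<And>E K. C1c \<Omega> E \<Longrightarrow> K \<ge> 0 \<Longrightarrow>
       (\<And>\<psi>. C1c \<Omega> \<psi> \<Longrightarrow> cmod (weak_form E (\<lambda>x. b\<^sup>2 * E x) \<psi>) \<le> K * H1norm \<psi>) \<Longrightarrow> c * H1norm E \<le> K"
    and c: "C * \<kappa> \<le> c / 2"
  shows "c / 2 * H1norm (\<lambda>x. pull \<theta> x - \<phi> x) \<le> \<eta> * (4 * n + 3) + C * \<kappa> * H1norm \<phi> + \<rho>"
proof -
  let ?P = "pull \<theta>"
  let ?E = "\<lambda>x. ?P x - \<phi> x"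
  have P: "C1c \<Omega> ?P" by (rule pull_C1c[OF \<theta>(1)])
  have E: "C1c \<Omega> ?E" by (rule C1c_diff[OF P \<phi>(1)])
  have C0: "C \<ge> 0" "n \<ge> 0" by (simp_all add: C_def n_def)
  have \<kappa>0: "\<kappa> \<ge> 0" using \<delta> by linarith
  have \<rho>0: "\<rho> \<ge> 0" using \<rho> L2norm_nonneg order_trans by blast
  define L where "L = \<eta> * (4 * n + 2) + C * \<kappa> * H1norm ?P + \<rho>"
  have L0: "L \<ge> 0" using C0 \<kappa>0 \<rho>0 \<eta> H1norm_ge(1)[of ?P] by (simp add: L_def)
  have Lb: "cmod (weak_form ?P (\<lambda>x. b\<^sup>2 * ?P x - zero_extension \<Omega> f x) \<psi>) \<le> L * H1norm \<psi>" if \<psi>: "C1c \<Omega> \<psi>" for \<psi>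
  proof -
    let ?a = "weak_form ?P (\<lambda>x. b\<^sup>2 * ?P x - zero_extension \<Omega> f x) \<psi>"
      and ?b = "weak_form \<theta> (\<lambda>x. b\<^sup>2 * \<theta> x - zero_extension \<Omega>r f x) (push \<psi>)"
    have "cmod ?b \<le> \<eta> * H1norm (push \<psi>)" by (rule \<theta>(2)[OF push_C1c[OF \<psi>]])
    also have "\<dots> \<le> \<eta> * ((4 * n + 2) * H1norm \<psi>)" using push_H1norm[OF \<psi>] \<eta> unfolding n_def by (rule mult_left_mono)
    finally have 1: "cmod ?b \<le> \<eta> * ((4 * n + 2) * H1norm \<psi>)" .
    have "cmod (?a - ?b) \<le> (C * \<kappa> * H1norm ?P + L2norm (zero_extension \<Omega> (\<lambda>x. of_real (J x) * f (\<tau> x) - f x))) * H1norm \<psi>"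
      unfolding C_def by (rule weak_form_pull[OF f \<theta>(1) \<psi>])
    also have "\<dots> \<le> (C * \<kappa> * H1norm ?P + \<rho>) * H1norm \<psi>" using \<rho> H1norm_ge(1) by (intro mult_right_mono) auto
    finally have 2: "cmod (?a - ?b) \<le> (C * \<kappa> * H1norm ?P + \<rho>) * H1norm \<psi>" .
    have "cmod ?a \<le> cmod (?a - ?b) + cmod ?b" using norm_triangle_ineq[of "?a - ?b" ?b] by simp
    then show ?thesis using 1 2 by (simp add: L_def algebra_simps)
  qed
  have "c * H1norm ?E \<le> L + \<eta>"
    using weak_form_diff_bound[OF P \<phi>(1) f(3) _ Lb \<phi>(2)] L0 \<eta> by (intro coer[OF E]) auto
  moreover have "H1norm ?P \<le> H1norm ?E + H1norm \<phi>" using H1norm_add[OF E \<phi>(1)] by simp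
  then have "C * \<kappa> * H1norm ?P \<le> C * \<kappa> * (H1norm ?E + H1norm \<phi>)" using C0 \<kappa>0 by (intro mult_left_mono) auto
  moreover have "C * \<kappa> * H1norm ?E \<le> c / 2 * H1norm ?E" using c H1norm_ge(1) by (rule mult_right_mono)
  ultimately show ?thesis by (simp add: L_def algebra_simps)
qed

text \<open>Transport to \<open>\<Omega>\<close> turns \<open>push \<phi>\<close> into
  \<open>\<phi>\<close> and \<open>\<theta>\<close> into \<open>pull \<theta>\<close>; the factor 2
  compares the norms on the two domains.\<close>

lemma push_near:
  assumes \<phi>: "C1c \<Omega> \<phi>" and \<theta>: "C1c \<Omega>r \<theta>"
  shows "L2norm (\<lambda>y. push \<phi> y - \<theta> y) \<le> 2 * L2norm (\<lambda>x. pull \<theta> x - \<phi> x)"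
proof -
  let ?h = "\<lambda>y. push \<phi> y - \<theta> y"
  have h: "C1c \<Omega>r ?h" by (rule C1c_diff[OF push_C1c[OF \<phi>] \<theta>])
  have z: "zero_extension \<Omega>r ?h = ?h"
  proof
    fix y
    have "?h y = 0" if "y \<notin> \<Omega>r" using h that unfolding C1c_def by blast
    then show "zero_extension \<Omega>r ?h y = ?h y" by (auto simp: zero_extension_def)
  qed
  have "zero_extension \<Omega> (\<lambda>x. ?h (\<tau> x)) = (\<lambda>x. pull (push \<phi>) x - pull \<theta> x)"
    by (auto simp: pull_def zero_extension_def fun_eq_iff)
  then have "zero_extension \<Omega> (\<lambda>x. ?h (\<tau> x)) = (\<lambda>x. \<phi> x - pull \<theta> x)" by (simp add: pull_push[OF \<phi>])
  then show ?thesis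
    using pull_L2(3)[OF C1c_continuous[OF h]] C1c_L2(1)[OF h] z L2norm_minus_commute[of \<phi> "pull \<theta>"] by simp
qed

text \<open>On \<open>\<Omega>r\<close> the function \<open>\<phi>\<close> is compared with itself
  at a point at distance at most \<open>\<delta>\<close>. Off \<open>\<Omega>r\<close>, where
  \<open>push \<phi>\<close> is zero, \<open>\<phi>\<close> vanishes too, because its support lies
  deep inside \<open>\<Omega>\<close> and is covered by the image.\<close>

lemma push_close:
  assumes \<phi>: "C1c \<Omega> \<phi>" and K: "\<And>x. x \<notin> K \<Longrightarrow> \<phi> x = 0" "\<And>y. y \<in> K \<Longrightarrow> cball y \<delta> \<subseteq> \<Omega>"
    and unif: "\<And>x y. dist x y \<le> \<delta> \<Longrightarrow> cmod (\<phi> y - \<phi> x) \<le> \<omega>"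
    and Q: "compact Q" "\<Omega> \<subseteq> Q" "\<Omega>r \<subseteq> Q"
  shows "L2norm (\<lambda>x. \<phi> x - push \<phi> x) \<le> \<omega> * L2norm (zero_extension Q (\<lambda>x. 1))"
proof (rule L2norm_mono)
  show "L2 (zero_extension Q (\<lambda>x. 1))"
    by (rule L2_compact_support[OF Q(1)]) (auto simp: zero_extension_def cong: continuous_on_cong)
  show "(\<lambda>x. \<phi> x - push \<phi> x) \<in> borel_measurable lebesgue"
    using L2_diff[OF C1c_L2(1)[OF \<phi>] C1c_L2(1)[OF push_C1c[OF \<phi>]]] by (simp add: L2_def)
  show \<omega>: "\<omega> \<ge> 0" using unif[of 0 0] \<delta>(1) by simp
  fix y
  show "cmod (\<phi> y - push \<phi> y) \<le> \<omega> * cmod (zero_extension Q (\<lambda>x. 1) y)"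
  proof (cases "y \<in> \<Omega>r")
    case True
    have "dist (\<sigma> y) y \<le> \<delta>"
      using \<tau>\<sigma>[OF True] r_small[OF \<sigma>_in[OF True]] unfolding \<tau>_def dist_norm
      by (metis add_diff_cancel_left' norm_minus_commute)
    then show ?thesis using unif[of "\<sigma> y" y] True Q(3) by (auto simp: push_def zero_extension_def)
  next
    case False
    then have "y \<notin> K" using cball_in_image K(2) by blast
    then show ?thesis using K(1) False \<omega> by (simp add: push_def zero_extension_def)
  qed
qed

end

text \<open>Chain of comparisons U, \<phi>1, \<phi>, push \<phi>, \<theta>, V. In the application
  \<phi> belongs to a solution selected before \<open>\<delta>\<close>, while \<phi>1 belongs to the
  given solution on \<open>\<Omega>\<close>; coercivity compares these two as well.\<close>

lemma (in near_identity) solution_distance: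
  fixes f U V :: "real ^ 'n \<Rightarrow> complex" and b :: complex
  defines "n \<equiv> real DIM(real ^ 'n)" and "C \<equiv> 10 * real DIM(real ^ 'n) + (cmod b)\<^sup>2"
  assumes f: "continuous_on \<Omega> f" "continuous_on \<Omega>r f" "L2 (zero_extension \<Omega> f)" "L2 (zero_extension \<Omega>r f)"
    and \<phi>: "C1c \<Omega> \<phi>" "\<And>\<psi>. C1c \<Omega> \<psi> \<Longrightarrow> cmod (weak_form \<phi> (\<lambda>x. b\<^sup>2 * \<phi> x - zero_extension \<Omega> f x) \<psi>) \<le> \<eta> * H1norm \<psi>"
    and \<phi>1: "C1c \<Omega> \<phi>1" "\<And>\<psi>. C1c \<Omega> \<psi> \<Longrightarrow> cmod (weak_form \<phi>1 (\<lambda>x. b\<^sup>2 * \<phi>1 x - zero_extension \<Omega> f x) \<psi>) \<le> \<eta> * H1norm \<psi>"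
    and \<theta>: "C1c \<Omega>r \<theta>" "\<And>\<psi>. C1c \<Omega>r \<psi> \<Longrightarrow> cmod (weak_form \<theta> (\<lambda>x. b\<^sup>2 * \<theta> x - zero_extension \<Omega>r f x) \<psi>) \<le> \<eta> * H1norm \<psi>"
    and UV: "L2 U" "L2norm (\<lambda>x. U x - \<phi>1 x) \<le> \<eta>" "L2 V" "L2norm (\<lambda>x. V x - \<theta> x) \<le> \<eta>"
    and \<eta>: "\<eta> \<ge> 0"
    and \<rho>: "L2norm (zero_extension \<Omega> (\<lambda>x. of_real (J x) * f (\<tau> x) - f x)) \<le> \<rho>"
    and coer: "\<And>E K. C1c \<Omega> E \<Longrightarrow> K \<ge> 0 \<Longrightarrow>
       (\<And>\<psi>. C1c \<Omega> \<psi> \<Longrightarrow> cmod (weak_form E (\<lambda>x. b\<^sup>2 * E x) \<psi>) \<le> K * H1norm \<psi>) \<Longrightarrow> c * H1norm E \<le> K"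
    and c: "c > 0" "C * \<kappa> \<le> c / 2"
    and K: "\<And>x. x \<notin> K \<Longrightarrow> \<phi> x = 0" "\<And>y. y \<in> K \<Longrightarrow> cball y \<delta> \<subseteq> \<Omega>"
    and unif: "\<And>x y. dist x y \<le> \<delta> \<Longrightarrow> cmod (\<phi> y - \<phi> x) \<le> \<omega>"
    and Q: "compact Q" "\<Omega> \<subseteq> Q" "\<Omega>r \<subseteq> Q"
  shows "L2norm (\<lambda>x. U x - V x) \<le> 2 * \<eta> + 2 * \<eta> / c + \<omega> * L2norm (zero_extension Q (\<lambda>x. 1))
           + 4 / c * (\<eta> * (4 * n + 3) + C * \<kappa> * H1norm \<phi> + \<rho>)"
proof -
  let ?E = "\<lambda>x. pull \<theta> x - \<phi> x"
  have L2s: "L2 \<phi>" "L2 \<phi>1" "L2 \<theta>" "L2 (push \<phi>)"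
    using \<phi>(1) \<phi>1(1) \<theta>(1) push_C1c[OF \<phi>(1)] by (auto intro: C1c_L2(1))
  have 1: "L2norm (\<lambda>x. \<phi>1 x - \<phi> x) \<le> 2 * \<eta> / c"
  proof -
    have "c * H1norm (\<lambda>x. \<phi>1 x - \<phi> x) \<le> \<eta> + \<eta>"
      using weak_form_diff_bound[OF \<phi>1(1) \<phi>(1) f(3) _ \<phi>1(2) \<phi>(2)] \<eta>
      by (intro coer[OF C1c_diff[OF \<phi>1(1) \<phi>(1)]]) auto
    then have "H1norm (\<lambda>x. \<phi>1 x - \<phi> x) \<le> 2 * \<eta> / c" using c(1) by (simp add: field_simps)
    then show ?thesis using H1norm_ge(2) order_trans by blast
  qed
  have 2: "L2norm (\<lambda>y. push \<phi> y - \<theta> y) \<le> 4 / c * (\<eta> * (4 * n + 3) + C * \<kappa> * H1norm \<phi> + \<rho>)"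
  proof -
    have "c / 2 * H1norm ?E \<le> \<eta> * (4 * n + 3) + C * \<kappa> * H1norm \<phi> + \<rho>"
      unfolding C_def n_def
      by (rule pull_near[OF f \<phi> \<theta> \<eta> \<rho> coer c(2)[unfolded C_def]])
    then have "4 / c * (c / 2 * H1norm ?E) \<le> 4 / c * (\<eta> * (4 * n + 3) + C * \<kappa> * H1norm \<phi> + \<rho>)"
      using c(1) by (intro mult_left_mono) auto
    moreover have "4 / c * (c / 2 * H1norm ?E) = 2 * H1norm ?E" using c(1) by simp
    ultimately show ?thesis using push_near[OF \<phi>(1) \<theta>(1)] H1norm_ge(2)[of ?E] by linarith
  qed
  have 3: "L2norm (\<lambda>x. \<phi> x - push \<phi> x) \<le> \<omega> * L2norm (zero_extension Q (\<lambda>x. 1))"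
    by (rule push_close[OF \<phi>(1) K unif Q])
  have 4: "L2norm (\<lambda>x. \<theta> x - V x) \<le> \<eta>" using UV(4) L2norm_minus_commute[of \<theta> V] by simp
  let ?s = "\<lambda>x. (U x - \<phi>1 x) + ((\<phi>1 x - \<phi> x) + ((\<phi> x - push \<phi> x) + ((push \<phi> x - \<theta> x) + (\<theta> x - V x))))"
  have d: "L2 (\<lambda>x. U x - \<phi>1 x)" "L2 (\<lambda>x. \<phi>1 x - \<phi> x)" "L2 (\<lambda>x. \<phi> x - push \<phi> x)"
    "L2 (\<lambda>x. push \<phi> x - \<theta> x)" "L2 (\<lambda>x. \<theta> x - V x)"
    using L2s UV by (auto intro: L2_diff)
  note s4 = L2_add[OF d(4,5)] note s3 = L2_add[OF d(3) s4] note s2 = L2_add[OF d(2) s3]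
  have "L2norm ?s \<le> L2norm (\<lambda>x. U x - \<phi>1 x) + (L2norm (\<lambda>x. \<phi>1 x - \<phi> x) + (L2norm (\<lambda>x. \<phi> x - push \<phi> x)
      + (L2norm (\<lambda>x. push \<phi> x - \<theta> x) + L2norm (\<lambda>x. \<theta> x - V x))))"
    using L2norm_triangle[OF d(1) s2] L2norm_triangle[OF d(2) s3] L2norm_triangle[OF d(3) s4] L2norm_triangle[OF d(4,5)]
    by linarith
  moreover have "?s = (\<lambda>x. U x - V x)" by (simp add: algebra_simps)
  ultimately show ?thesis using 1 2 3 4 UV(2) by simp
qed

section \<open>Choice of the parameters and continuity with respect to the domain\<close>

lemma L2_zero_extension_square_integrable:
  assumes "square_integrable_on S v"
  shows "L2 (zero_extension S v)"
proof -
  have e: "zero_extension S v = (\<lambda>x. indicator S x *\<^sub>R v x)" by (auto simp: zero_extension_def indicator_def fun_eq_iff)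
  have "zero_extension S v \<in> borel_measurable lebesgue"
    using assms unfolding e by (simp add: square_integrable_on_def set_borel_measurable_def)
  moreover have "integrable lebesgue (\<lambda>x. (cmod (zero_extension S v x))\<^sup>2)"
    using assms unfolding zero_extension_square by (simp add: square_integrable_on_def set_integrable_def)
  ultimately show ?thesis by (simp add: L2_def)
qed

lemma L2_zero_extension_subset:
  assumes "L2 (zero_extension Q f)" "S \<subseteq> Q" "open S" "continuous_on S f"
  shows "L2 (zero_extension S (f :: 'a::euclidean_space \<Rightarrow> complex))"
  by (rule L2_mono[OF assms(1) zero_extension_measurable[OF assms(3,4)], of 1]) (use assms(2) in \<open>auto simp: zero_extension_def\<close>)

lemma L2_norm_on_eq_L2norm:
  assumes "\<And>x. x \<notin> S \<Longrightarrow> v x = 0"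
  shows "L2_norm_on S v = L2norm v"
proof -
  have "(\<lambda>x. indicator S x *\<^sub>R (cmod (v x))\<^sup>2) = (\<lambda>x. (cmod (v x))\<^sup>2)"
    using assms by (auto simp: indicator_def fun_eq_iff)
  then show ?thesis by (simp add: L2_norm_on_def L2norm_def set_lebesgue_integral_def)
qed

theorem theorem4:
  fixes \<Omega> \<Gamma> :: "(real ^ 'n) set"
    and \<nu> :: "real ^ 'n \<Rightarrow> real ^ 'n"
    and f :: "real ^ 'n \<Rightarrow> complex"
    and b :: complex
    and s t \<epsilon> :: real
  assumes "CARD('n) = 2 \<or> CARD('n) = 3"
    and "Im b > 0"
    and "bounded_C2_domain \<Omega>"
    and "smooth_closed_hypersurface \<Gamma>"
    and "\<Gamma> \<subseteq> \<Omega>"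
    and "\<forall>p\<in>\<Gamma>. outward_unit_normal \<Gamma> p (\<nu> p)"
    and "\<Omega> \<subseteq> cbox (vec s) (vec t)"
    and "square_integrable_on (cbox (vec s) (vec t)) f"
    and "\<epsilon> > 0"
  shows "\<exists>\<delta>>0. \<forall>\<Omega>r r u ur.
     bounded_C2_domain \<Omega>r \<longrightarrow>
     \<Gamma> \<subseteq> \<Omega>r \<longrightarrow>
     \<Omega>r \<subseteq> cbox (vec s) (vec t) \<longrightarrow>
     continuous_on (\<Omega> \<union> \<Omega>r) f \<longrightarrow>
     Ck_on 2 \<Omega> r \<longrightarrow>
     bij_betw (\<lambda>x. x + r x) \<Omega> \<Omega>r \<longrightarrow>
     interface_solution b \<Gamma> \<nu> f \<Omega> u \<longrightarrow>
     interface_solution b \<Gamma> \<nu> f \<Omega>r ur \<longrightarrow>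
     C2_norm \<Omega> r < ennreal \<delta> \<longrightarrow>
     L2_norm_on (cbox (vec s) (vec t)) (\<lambda>x. zero_extension \<Omega> u x - zero_extension \<Omega>r ur x) < \<epsilon>"
proof (cases "continuous_on \<Omega> f \<and> (\<exists>u. interface_solution b \<Gamma> \<nu> f \<Omega> u)")
  \<comment> \<open>The premises after \<open>\<delta>\<close> contain the continuity of
    \<open>f\<close> on \<open>\<Omega>\<close> and a solution there, so the claim is vacuous. In
    the other case a solution \<open>u0\<close> is at hand before \<open>\<delta>\<close> is
    chosen.\<close>
  case False
  then show ?thesis by (intro exI[of _ 1]) (auto intro: continuous_on_subset)
next
  case True
  then obtain u0 where fc: "continuous_on \<Omega> f" and u0: "interface_solution b \<Gamma> \<nu> f \<Omega> u0" by blast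
  let ?Q = "cbox (vec s) (vec t) :: (real ^ 'n) set"
  have \<Omega>: "open \<Omega>" "bounded \<Omega>" using assms(3) by (auto simp: bounded_C2_domain_def)
  have \<Gamma>: "compact \<Gamma>" using assms(4) by (simp add: smooth_closed_hypersurface_def)
  have fQ: "L2 (zero_extension ?Q f)" by (rule L2_zero_extension_square_integrable[OF assms(8)])
  have f\<Omega>: "L2 (zero_extension \<Omega> f)" by (rule L2_zero_extension_subset[OF fQ assms(7) \<Omega>(1) fc])
  obtain c where c: "c > 0" and coer: "\<And>(S :: (real ^ 'n) set) E K. C1c S E \<Longrightarrow> K \<ge> 0 \<Longrightarrow>
       (\<And>\<psi>. C1c S \<psi> \<Longrightarrow> cmod (weak_form E (\<lambda>x. b\<^sup>2 * E x) \<psi>) \<le> K * H1norm \<psi>) \<Longrightarrow> c * H1norm E \<le> K"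
    by (rule coercivity[OF assms(2)]) (erule that; blast)
  define n where "n = real DIM(real ^ 'n)"
  define C where "C = 10 * n + (cmod b)\<^sup>2"
  have nC: "n \<ge> 1" "C \<ge> 0" using DIM_positive[where 'a="real ^ 'n"] by (simp_all add: n_def C_def Suc_leI)
  \<comment> \<open>Total coefficient of \<open>\<eta>\<close> in the final estimate, so that all
    terms with \<open>\<eta>\<close> sum to \<epsilon>/4.\<close>
  define A where "A = 2 + 2 / c + 4 / c * (4 * n + 3)"
  have A: "A > 0" using c nC(1) by (simp add: A_def add_pos_nonneg)
  define \<eta> where "\<eta> = \<epsilon> / (4 * A)"
  have \<eta>: "\<eta> > 0" "\<eta> * A = \<epsilon> / 4" using A assms(9) by (simp_all add: \<eta>_def)
  obtain \<phi> where \<phi>: "C1c \<Omega> \<phi>"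
    "\<And>\<psi>. C1c \<Omega> \<psi> \<Longrightarrow> cmod (weak_form \<phi> (\<lambda>x. b\<^sup>2 * \<phi> x - zero_extension \<Omega> f x) \<psi>) \<le> \<eta> * H1norm \<psi>"
    by (rule interface_solution_approximation[OF \<Omega> \<Gamma> assms(5,6) fc f\<Omega> u0 \<eta>(1)]) (erule that; blast)
  obtain K where K: "compact K" "K \<subseteq> \<Omega>" "\<And>x. x \<notin> K \<Longrightarrow> \<phi> x = 0" using \<phi>(1) unfolding C1c_def by blast
  obtain dK where dK: "dK > 0" "(\<Union>x\<in>K. ball x dK) \<subseteq> \<Omega>"
    using compact_subset_open_imp_ball_epsilon_subset[OF K(1) \<Omega>(1) K(2)] by blast
  define V where "V = L2norm (zero_extension ?Q (\<lambda>x. 1))"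
  have V: "V \<ge> 0" by (simp add: V_def L2norm_nonneg)
  \<comment> \<open>\<open>V\<close> is the square root of the volume of the cube; the denominator
    with V + 1 is positive, and the oscillation term stays below \<epsilon>/8.\<close>
  define \<omega> where "\<omega> = \<epsilon> / (8 * (V + 1))"
  have \<omega>: "\<omega> > 0" "\<omega> * V \<le> \<epsilon> / 8"
  proof -
    show "\<omega> > 0" using V assms(9) by (simp add: \<omega>_def)
    then have "\<omega> * V \<le> \<omega> * (V + 1)" by simp
    also have "\<dots> = \<epsilon> / 8"
    proof -
      have "V + 1 \<noteq> 0" using V by simp
      then show ?thesis unfolding \<omega>_def by (metis divide_divide_eq_left' nonzero_eq_divide_eq mult.commute)
    qed
    finally show "\<omega> * V \<le> \<epsilon> / 8" .
  qed
  have "uniformly_continuous_on UNIV \<phi>"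
    by (rule uniformly_continuous_compact_support[OF C1c_continuous[OF \<phi>(1)] K(1,3)])
  then obtain d\<omega> where d\<omega>: "d\<omega> > 0" "\<And>x y. dist x y < d\<omega> \<Longrightarrow> dist (\<phi> x) (\<phi> y) < \<omega>"
    unfolding uniformly_continuous_on_def using \<omega>(1) by (metis UNIV_I)
  \<comment> \<open>Enters the final estimate twice, for the data and as bound of the Jacobian term,
    each time as (4/c) \<rho> = \<epsilon>/4.\<close>
  define \<rho> where "\<rho> = c * \<epsilon> / 16"
  have \<rho>: "\<rho> > 0" "4 / c * \<rho> = \<epsilon> / 4" using c assms(9) by (simp_all add: \<rho>_def)
  obtain \<delta>0 \<kappa>0 where d0: "\<delta>0 > 0" "\<kappa>0 > 0"
    and shift: "\<And>\<Omega>r r \<delta> \<kappa> J. near_identity \<Omega> \<Omega>r r \<delta> \<kappa> J \<Longrightarrow> \<Omega>r \<subseteq> ?Q \<Longrightarrow> continuous_on \<Omega>r f \<Longrightarrow> \<delta> \<le> \<delta>0 \<Longrightarrow> \<kappa> \<le> \<kappa>0 \<Longrightarrow>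
       L2norm (zero_extension \<Omega> (\<lambda>x. of_real (J x) * f (x + r x) - f x)) \<le> \<rho>"
    by (rule data_shift_parameters[OF \<Omega> fc assms(7) fQ \<rho>(1)]) (erule that; assumption?; blast)
  \<comment> \<open>\<open>k1\<close> makes C \<kappa> \<le> c/2, which coercivity absorbs;
    \<open>k2\<close> makes C \<kappa> times \<open>H1norm \<phi>\<close> at most
    \<open>\<rho>\<close>. The summands 1 guard against zero denominators.\<close>
  define k1 where "k1 = c / (2 * (C + 1))"
  define k2 where "k2 = \<rho> / ((C + 1) * (H1norm \<phi> + 1))"
  define \<kappa> where "\<kappa> = min (min (1 / 2) \<kappa>0) (min k1 k2)"
  have H: "H1norm \<phi> + 1 > 0" using H1norm_ge(1)[of \<phi>] by linarith
  have k: "k1 > 0" "k2 > 0" "\<kappa> > 0" using c nC \<rho>(1) H d0 by (auto simp: k1_def k2_def \<kappa>_def)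
  have \<kappa>c: "C * \<kappa> \<le> c / 2"
  proof -
    have "C * \<kappa> \<le> (C + 1) * k1" using nC(2) k by (intro mult_mono) (auto simp: \<kappa>_def)
    also have "\<dots> = c / 2" using nC(2) unfolding k1_def by (simp add: field_simps)
    finally show ?thesis .
  qed
  have \<kappa>\<rho>: "C * \<kappa> * H1norm \<phi> \<le> \<rho>"
  proof -
    have "C * \<kappa> * H1norm \<phi> \<le> ((C + 1) * k2) * (H1norm \<phi> + 1)"
      using nC(2) k H1norm_ge(1)[of \<phi>] by (intro mult_mono) (auto simp: \<kappa>_def)
    also have "\<dots> = k2 * ((C + 1) * (H1norm \<phi> + 1))" by (simp add: algebra_simps)
    also have "\<dots> = \<rho>"
    proof -
      have "(C + 1) * (H1norm \<phi> + 1) \<noteq> 0" using nC(2) H by simp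
      then show ?thesis unfolding k2_def by simp
    qed
    finally show ?thesis .
  qed
  obtain \<delta>c where \<delta>c: "\<delta>c > 0"
    "\<And>\<Omega> (\<tau> :: real ^ 'n \<Rightarrow> real ^ 'n). open \<Omega> \<Longrightarrow> open (\<tau> ` \<Omega>) \<Longrightarrow> Ck_on 1 \<Omega> \<tau> \<Longrightarrow> inj_on \<tau> \<Omega> \<Longrightarrow>
       (\<And>x i. x \<in> \<Omega> \<Longrightarrow> i \<in> Basis \<Longrightarrow> norm (partial_deriv i \<tau> x - i) \<le> \<delta>c) \<Longrightarrow> \<exists>J. cv_density \<Omega> \<tau> \<kappa> J"
    by (rule cv_density_exists[OF assms(1) k(3)]) (erule that; blast)
  \<comment> \<open>One entry for each requirement: the Jacobian (\<open>\<delta>c\<close>),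
    comparison with \<open>\<kappa>\<close>, the shift of the data (\<open>\<delta>0\<close>), balls
    around the support inside \<open>\<Omega>\<close> (\<open>dK\<close>), the oscillation of
    \<open>\<phi>\<close> (\<open>d\<omega>\<close>) and invertibility of the derivative
    (\<open>1 / (2 * n)\<close>).\<close>
  define \<delta> where "\<delta> = min (min (min \<delta>c \<kappa>) (min \<delta>0 (dK / 2))) (min (d\<omega> / 2) (1 / (2 * n)))"
  have dd: "\<delta> > 0" "\<delta> \<le> \<delta>c" "\<delta> \<le> \<kappa>" "\<delta> \<le> \<delta>0" "\<delta> < dK" "\<delta> < d\<omega>" "\<delta> \<le> 1 / (2 * n)"
    using \<delta>c(1) k(3) d0(1) dK(1) d\<omega>(1) nC(1) by (auto simp: \<delta>_def)
  have n\<delta>: "n * \<delta> \<le> 1 / 2" using dd(7) nC(1) by (simp add: field_simps)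
  show ?thesis
  proof (intro exI[of _ \<delta>] conjI allI impI)
    fix \<Omega>r r u ur
    assume \<Omega>r: "bounded_C2_domain \<Omega>r" and \<Gamma>r: "\<Gamma> \<subseteq> \<Omega>r" and Qr: "\<Omega>r \<subseteq> ?Q"
      and fc2: "continuous_on (\<Omega> \<union> \<Omega>r) f" and r: "Ck_on 2 \<Omega> r" and bij: "bij_betw (\<lambda>x. x + r x) \<Omega> \<Omega>r"
      and u: "interface_solution b \<Gamma> \<nu> f \<Omega> u" and ur: "interface_solution b \<Gamma> \<nu> f \<Omega>r ur"
      and rC2: "C2_norm \<Omega> r < ennreal \<delta>"
    have opr: "open \<Omega>r" "bounded \<Omega>r" using \<Omega>r by (auto simp: bounded_C2_domain_def)
    have fr: "continuous_on \<Omega>r f" using fc2 by (rule continuous_on_subset) simp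
    have f\<Omega>r: "L2 (zero_extension \<Omega>r f)" by (rule L2_zero_extension_subset[OF fQ Qr opr(1) fr])
    have r1: "Ck_on 1 \<Omega> r" using r by (rule Ck_on_le) simp
    have im: "(\<lambda>x. x + r x) ` \<Omega> = \<Omega>r" "inj_on (\<lambda>x. x + r x) \<Omega>" using bij by (auto simp: bij_betw_def)
    have id: "Ck_on 1 \<Omega> (\<lambda>x. x)" by (rule Ck_on_bounded_linear[OF bounded_linear_ident])
    have pd: "partial_deriv i (\<lambda>x. x + r x) x - i = partial_deriv i r x" if "x \<in> \<Omega>" for i x
    proof -
      have "r differentiable (at x)" using r1 that unfolding Ck_on_1 by blast
      moreover have "partial_deriv i (\<lambda>x. x) x = i" by (rule partial_deriv_eq) (rule has_derivative_ident)
      ultimately show ?thesis using partial_deriv_add[of "\<lambda>x. x" x r i] by simp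
    qed
    have "\<exists>J. cv_density \<Omega> (\<lambda>x. x + r x) \<kappa> J"
    proof (rule \<delta>c(2)[OF \<Omega>(1) _ Ck_on_add[OF \<Omega>(1) id r1] im(2)])
      show "open ((\<lambda>x. x + r x) ` \<Omega>)" using opr(1) by (simp add: im(1))
      fix x and i :: "real ^ 'n" assume "x \<in> \<Omega>" "i \<in> Basis"
      then show "norm (partial_deriv i (\<lambda>x. x + r x) x - i) \<le> \<delta>c"
        using C2_norm_less(2)[OF rC2] pd dd(2) by (metis order_trans)
    qed
    then obtain J where J: "cv_density \<Omega> (\<lambda>x. x + r x) \<kappa> J" by blast
    interpret near_identity \<Omega> \<Omega>r r \<delta> \<kappa> J
    proof
      show "real DIM(real ^ 'n) * \<delta> \<le> 1 / 2" using n\<delta> by (simp only: n_def)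
      show "\<kappa> \<le> 1 / 2" by (simp add: \<kappa>_def)
    qed (use \<Omega>(1) opr(1) r1 bij C2_norm_less[OF rC2] dd J in auto)
    have \<rho>': "L2norm (zero_extension \<Omega> (\<lambda>x. of_real (J x) * f (\<tau> x) - f x)) \<le> \<rho>"
      unfolding \<tau>_def by (rule shift[OF near_identity_axioms Qr fr dd(4)]) (simp add: \<kappa>_def)
    obtain \<phi>1 where \<phi>1: "C1c \<Omega> \<phi>1" "L2 (zero_extension \<Omega> u)" "L2norm (\<lambda>x. zero_extension \<Omega> u x - \<phi>1 x) \<le> \<eta>"
      "\<And>\<psi>. C1c \<Omega> \<psi> \<Longrightarrow> cmod (weak_form \<phi>1 (\<lambda>x. b\<^sup>2 * \<phi>1 x - zero_extension \<Omega> f x) \<psi>) \<le> \<eta> * H1norm \<psi>"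
      by (rule interface_solution_approximation[OF \<Omega> \<Gamma> assms(5,6) fc f\<Omega> u \<eta>(1)]) (erule that; blast)
    obtain \<theta> where \<theta>: "C1c \<Omega>r \<theta>" "L2 (zero_extension \<Omega>r ur)" "L2norm (\<lambda>x. zero_extension \<Omega>r ur x - \<theta> x) \<le> \<eta>"
      "\<And>\<psi>. C1c \<Omega>r \<psi> \<Longrightarrow> cmod (weak_form \<theta> (\<lambda>x. b\<^sup>2 * \<theta> x - zero_extension \<Omega>r f x) \<psi>) \<le> \<eta> * H1norm \<psi>"
      by (rule interface_solution_approximation[OF opr \<Gamma> \<Gamma>r assms(6) fr f\<Omega>r ur \<eta>(1)]) (erule that; blast)
    have near: "cball y \<delta> \<subseteq> \<Omega>" if "y \<in> K" for y using dK(2) dd(5) that by fastforce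
    have unif: "cmod (\<phi> y - \<phi> x) \<le> \<omega>" if "dist x y \<le> \<delta>" for x y
      using d\<omega>(2)[of x y] that dd(6) by (simp add: dist_norm norm_minus_commute less_imp_le)
    have "L2norm (\<lambda>x. zero_extension \<Omega> u x - zero_extension \<Omega>r ur x) \<le> 2 * \<eta> + 2 * \<eta> / c + \<omega> * V
           + 4 / c * (\<eta> * (4 * n + 3) + C * \<kappa> * H1norm \<phi> + \<rho>)"
      unfolding n_def C_def V_def
    proof (rule solution_distance[OF fc fr f\<Omega> f\<Omega>r \<phi> \<phi>1(1,4) \<theta>(1,4) \<phi>1(2,3) \<theta>(2,3) _ \<rho>' coer c _ K(3) near unif _ assms(7) Qr])
      show "0 \<le> \<eta>" using \<eta>(1) by simp
      show "(10 * real DIM(real ^ 'n) + (cmod b)\<^sup>2) * \<kappa> \<le> c / 2" using \<kappa>c by (simp only: C_def n_def)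
    qed (auto intro: compact_cbox)
    also have "\<dots> \<le> 2 * \<eta> + 2 * \<eta> / c + \<omega> * V + 4 / c * (\<eta> * (4 * n + 3) + \<rho> + \<rho>)"
      using \<kappa>\<rho> c by (intro add_left_mono mult_left_mono) auto
    also have "\<dots> = \<eta> * A + \<omega> * V + 4 / c * \<rho> + 4 / c * \<rho>" by (simp add: A_def algebra_simps add_divide_distrib)
    \<comment> \<open>The four terms are at most \<epsilon>/4, \<epsilon>/8, \<epsilon>/4 and
      \<epsilon>/4.\<close>
    also have "\<dots> < \<epsilon>" unfolding \<rho>(2) \<eta>(2) using \<omega>(2) assms(9) by linarith
    finally have "L2norm (\<lambda>x. zero_extension \<Omega> u x - zero_extension \<Omega>r ur x) < \<epsilon>" .
    moreover have "zero_extension \<Omega> u x - zero_extension \<Omega>r ur x = 0" if "x \<notin> ?Q" for x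
      using that assms(7) Qr by (auto simp: zero_extension_def)
    ultimately show "L2_norm_on ?Q (\<lambda>x. zero_extension \<Omega> u x - zero_extension \<Omega>r ur x) < \<epsilon>"
      by (simp add: L2_norm_on_eq_L2norm)
  qed (rule dd(1))
qed

end
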